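(* Let $A$ be a regular two-dimensional local ring of characteristic $p>0$ with algebraically closed residue field $k$ and fraction field $K$. Let $L/K$ be a cyclic extension of degree $p$ whose branch divisor is (strictly) normal crossing and non-empty, with ramified height-one primes $\mathfrak p_1,\dots,\mathfrak p_d$, $d\in\{1,2\}$. Let $T_r$ and $h_{\mathfrak p}(L/K)$ be as defined in the context. Then for every integer $r\ge 1$ the supremum $$h_r(L/K)=\sup\{h_{\mathfrak p}(L/K) : \mathfrak p\in T_r\}$$ is finite.
   Context: Setting: $A$ is a regular two-dimensional local ring of characteristic $p>0$, $\mathfrak m$ its maximal ideal, $k=A/\mathfrak m$ algebraically closed, $K=\operatorname{Frac}A$. $\operatorname{Spec}_1A$ is the set of primes $\mathfrak p$ of $A$ with $\dim(A/\mathfrak p)=1$; for such $\mathfrak p$, $F_{\mathfrak p}$ denotes the prime divisor $\operatorname{Spec}(A/\mathfrak p)$. The intersection number is $(F_{\mathfrak p}.F_{\mathfrak p'})=\dim_k A/(\mathfrak p+\mathfrak p')$ for distinct $\mathfrak p,\mathfrak p'$. $L/K$ is a cyclic extension of degree $p$ and $B$ is the integral closure of $A$ in $L$. $L/K$ is unramified at $\mathfrak p\in\operatorname{Spec}_1A$ if the ramification index is 1 and the residue field extension is separable at the primes of $B$ over $\mathfrak p$; otherwise it is ramified at $\mathfrak p$. Let $\mathfrak p_1,\dots,\mathfrak p_d$ be the primes in $\operatorname{Spec}_1A$ at which $L/K$ is ramified. Normal crossing and non-empty branch divisor means: $1\le d\le 2$; each $A/\mathfrak p_i$ is regular; and if $d=2$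 then $(F_{\mathfrak p_1}.F_{\mathfrak p_2})=1$. Put $U_A=\{\mathfrak p\in\operatorname{Spec}_1A : A/\mathfrak p \text{ is regular},\ \mathfrak p\ne\mathfrak p_1,\dots,\mathfrak p_d\}$. For $\mathfrak p\in U_A$ let $\mathfrak q$ be a prime of $B$ over $\mathfrak p$, $K(\mathfrak p)=\operatorname{Frac}(A/\mathfrak p)$, $L(\mathfrak q)=\operatorname{Frac}(B/\mathfrak q)$. Since $L/K$ is unramified at $\mathfrak p$, the decomposition group of $\mathfrak q$ is $\operatorname{Gal}(L(\mathfrak q)/K(\mathfrak p))$. The ring $A/\mathfrak p$ is a discrete valuation ring with residue field $k$; let $G_{i,\mathfrak p}$, $i\ge -1$, be the lower ramification subgroups of $\operatorname{Gal}(L(\mathfrak q)/K(\mathfrak p))$ with respect to this discrete valuation. Define $h_{\mathfrak p}(L/K)=\max\{i : |G_{i,\mathfrak p}|=p\}$ if the ramification index $e(L(\mathfrak q)/K(\mathfrak p))$ equals $p$, and $h_{\mathfrak p}(L/K)=0$ otherwise. (This is independent of the choice of $\mathfrak q$.) For $r\ge 1$: $T_r=\{\mathfrak p\in U_A : (F_{\mathfrak p}.F_{\mathfrak p_1})=r\}$ if $d=1$, and $T_r=\{\mathfrak p\in U_A : (F_{\mathfrak p}.F_{\mathfrak p_1})=r,\ (F_{\mathfrak p}.F_{\mathfrak p_2})=1\}$ if $d=2$. *)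

theory Defs
  imports "HOL-Algebra.Algebra" "HOL-Library.Extended_Nat"
begin

section \<open>Local rings, dimension, regularity\<close>

definition has_characteristic :: "('a, 'm) ring_scheme \<Rightarrow> nat \<Rightarrow> bool" where
  "has_characteristic R p \<longleftrightarrow> (\<forall>n::nat. add_pow R n \<one>\<^bsub>R\<^esub> = \<zero>\<^bsub>R\<^esub> \<longleftrightarrow> p dvd n)"

definition krull_dim :: "('a, 'm) ring_scheme \<Rightarrow> enat" where
  "krull_dim R = (SUP n \<in> {n. \<exists>P :: nat \<Rightarrow> 'a set.
       (\<forall>i\<le>n. primeideal (P i) R) \<and> (\<forall>i<n. P i \<subset> P (Suc i))}. enat n)"

definition local_cring :: "('a, 'm) ring_scheme \<Rightarrow> bool" where
  "local_cring R \<longleftrightarrow> cring R \<and> (\<exists>!M. maximalideal M R)"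

definition max_ideal :: "('a, 'm) ring_scheme \<Rightarrow> 'a set" where
  "max_ideal R = (THE M. maximalideal M R)"

definition embedding_dim :: "('a, 'm) ring_scheme \<Rightarrow> nat" where
  "embedding_dim R = (LEAST n. \<exists>S \<subseteq> carrier R. finite S \<and> card S = n \<and> genideal R S = max_ideal R)"

definition regular_local_ring :: "('a, 'm) ring_scheme \<Rightarrow> bool" where
  "regular_local_ring R \<longleftrightarrow>
     local_cring R \<and> noetherian_ring R \<and> enat (embedding_dim R) = krull_dim R"

definition Spec1 :: "('a, 'm) ring_scheme \<Rightarrow> 'a set set" where
  "Spec1 R = {P. primeideal P R \<and> krull_dim (R Quot P) = 1}"

text \<open>
  A coefficient field of a local ring is a subfield mapping bijectively onto the residue field.
  For distinct \<open>P, Q\<close> in \<open>Spec1 R\<close>, where \<open>R\<close> is a noetherian local ring of positive characteristic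
  with algebraically closed residue field \<open>k\<close>, the artinian ring \<open>R/(P + Q)\<close> has exactly one
  coefficient field (its elements are the \<open>p^n\<close>-th powers, for large \<open>n\<close>). It is through this copy
  of \<open>k\<close> that \<open>R/(P + Q)\<close> is a vector space over \<open>k\<close>, even when \<open>R\<close> itself contains no copy of \<open>k\<close>.
\<close>

definition coefficient_field :: "'a set \<Rightarrow> ('a, 'm) ring_scheme \<Rightarrow> bool" where
  "coefficient_field F R \<longleftrightarrow> subfield F R \<and>
     bij_betw (\<lambda>x. max_ideal R +>\<^bsub>R\<^esub> x) F (carrier (R Quot max_ideal R))"

definition residue_field_dim :: "('a, 'm) ring_scheme \<Rightarrow> nat" where
  "residue_field_dim R = ring.dim R (SOME F. coefficient_field F R) (carrier R)"

definition intersection_number :: "('a, 'm) ring_scheme \<Rightarrow> 'a set \<Rightarrow> 'a set \<Rightarrow> nat" where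
  "intersection_number R P Q = residue_field_dim (R Quot (P <+>\<^bsub>R\<^esub> Q))"


section \<open>Fraction fields, localizations, integral closure\<close>

definition frac_class :: "('a, 'm) ring_scheme \<Rightarrow> 'a \<Rightarrow> 'a \<Rightarrow> ('a \<times> 'a) set" where
  "frac_class R a b =
     {(c, d). c \<in> carrier R \<and> d \<in> carrier R - {\<zero>\<^bsub>R\<^esub>} \<and> a \<otimes>\<^bsub>R\<^esub> d = c \<otimes>\<^bsub>R\<^esub> b}"

definition Frac :: "('a, 'm) ring_scheme \<Rightarrow> ('a \<times> 'a) set ring" where
  "Frac R =
     \<lparr> carrier = {frac_class R a b | a b. a \<in> carrier R \<and> b \<in> carrier R - {\<zero>\<^bsub>R\<^esub>}},
       monoid.mult = (\<lambda>U V. \<Union>(a, b) \<in> U. \<Union>(c, d) \<in> V. frac_class R (a \<otimes>\<^bsub>R\<^esub> c) (b \<otimes>\<^bsub>R\<^esub> d)),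
       one = frac_class R \<one>\<^bsub>R\<^esub> \<one>\<^bsub>R\<^esub>,
       ring.zero = frac_class R \<zero>\<^bsub>R\<^esub> \<one>\<^bsub>R\<^esub>,
       add = (\<lambda>U V. \<Union>(a, b) \<in> U. \<Union>(c, d) \<in> V.
                frac_class R (a \<otimes>\<^bsub>R\<^esub> d \<oplus>\<^bsub>R\<^esub> c \<otimes>\<^bsub>R\<^esub> b) (b \<otimes>\<^bsub>R\<^esub> d)) \<rparr>"

text \<open>In the following, \<open>S\<close> is a subring of a field \<open>E\<close>, and everything is formed inside \<open>E\<close>.\<close>

definition localization :: "('a, 'm) ring_scheme \<Rightarrow> 'a set \<Rightarrow> 'a set \<Rightarrow> 'a set" where
  "localization E S P = {a \<otimes>\<^bsub>E\<^esub> inv\<^bsub>E\<^esub> s | a s. a \<in> S \<and> s \<in> S - P}"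

definition fractions_in :: "('a, 'm) ring_scheme \<Rightarrow> 'a set \<Rightarrow> 'a set" where
  "fractions_in E S = localization E S {\<zero>\<^bsub>E\<^esub>}"

definition integral_closure :: "('a, 'm) ring_scheme \<Rightarrow> 'a set \<Rightarrow> 'a set" where
  "integral_closure E S = {x \<in> carrier E. \<exists>f \<in> carrier (univ_poly E S).
      f \<noteq> [] \<and> lead_coeff f = \<one>\<^bsub>E\<^esub> \<and> ring.eval E f x = \<zero>\<^bsub>E\<^esub>}"

definition primes_over :: "('a, 'm) ring_scheme \<Rightarrow> 'a set \<Rightarrow> 'a set \<Rightarrow> 'a set set" where
  "primes_over E S P =
     {Q. primeideal Q (E\<lparr>carrier := integral_closure E S\<rparr>) \<and> Q \<inter> S = P}"

text \<open>
  For \<open>Q\<close> in \<open>primes_over E S P\<close> and \<open>R\<close> the localization at \<open>Q\<close> of the integral closure,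
  the ramification index \<open>e\<close> is given by \<open>P R = (Q R)^e\<close>.
\<close>

definition ramification_index :: "('a, 'm) ring_scheme \<Rightarrow> 'a set \<Rightarrow> 'a set \<Rightarrow> 'a set \<Rightarrow> nat" where
  "ramification_index E S P Q =
     (let R = E\<lparr>carrier := localization E (integral_closure E S) Q\<rparr>
      in THE e. genideal R P = genideal R Q [^]\<^bsub>ideals_set R\<^esub> e)"


section \<open>Field extensions\<close>

text \<open>Here \<open>F\<close> is a subfield of \<open>E\<close>.\<close>

definition separable_poly :: "('a, 'm) ring_scheme \<Rightarrow> 'a list \<Rightarrow> bool" where
  "separable_poly F f \<longleftrightarrow> (\<forall>y \<in> carrier (field.alg_closure F).
      ring.alg_mult (field.alg_closure F) (map (ring.indexed_const F) f) y \<le> 1)"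

definition separable_extension :: "('a, 'm) ring_scheme \<Rightarrow> 'a set \<Rightarrow> bool" where
  "separable_extension E F \<longleftrightarrow> (\<forall>x \<in> carrier E.
      ring.algebraic E F x \<and> separable_poly (E\<lparr>carrier := F\<rparr>) (ring.Irr E F x))"

text \<open>Automorphisms are taken extensional, as in \<^const>\<open>BijGroup\<close>, so that cardinalities are right.\<close>

definition Gal :: "('a, 'm) ring_scheme \<Rightarrow> 'a set \<Rightarrow> ('a \<Rightarrow> 'a) monoid" where
  "Gal E F = BijGroup (carrier E)
     \<lparr>carrier := {\<sigma> \<in> ring_iso E E \<inter> extensional (carrier E). \<forall>x\<in>F. \<sigma> x = x}\<rparr>"

definition galois_extension :: "('a, 'm) ring_scheme \<Rightarrow> 'a set \<Rightarrow> bool" where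
  "galois_extension E F \<longleftrightarrow> subfield F E \<and> ring.finite_dimension E F (carrier E) \<and>
     {x \<in> carrier E. \<forall>\<sigma> \<in> carrier (Gal E F). \<sigma> x = x} = F"

definition cyclic_extension :: "('a, 'm) ring_scheme \<Rightarrow> 'a set \<Rightarrow> nat \<Rightarrow> bool" where
  "cyclic_extension E F n \<longleftrightarrow>
     galois_extension E F \<and> cyclic_group (Gal E F) \<and> ring.dimension E n F (carrier E)"

text \<open>
  Let \<open>S\<close> be a discrete valuation ring with fraction field \<open>F\<close> inside \<open>E\<close>, where \<open>E\<close> is a finite
  Galois extension of \<open>F\<close>, and let \<open>N\<close> be a prime over the maximal ideal in the integral closure
  \<open>C\<close> of \<open>S\<close> in \<open>E\<close>. The group \<open>G_i\<close>, \<open>i \<ge> -1\<close>, consists of the elements of the decomposition group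
  of \<open>N\<close> (which is \<open>G_(-1)\<close>) that act trivially on \<open>C/N^(i+1)\<close>.
\<close>

definition lower_ramification_group ::
    "('a, 'm) ring_scheme \<Rightarrow> 'a set \<Rightarrow> 'a set \<Rightarrow> int \<Rightarrow> ('a \<Rightarrow> 'a) set" where
  "lower_ramification_group E S N i =
     (let C = integral_closure E S
      in {\<sigma> \<in> carrier (Gal E (fractions_in E S)). \<sigma> ` N = N \<and>
           (\<forall>x\<in>C. \<sigma> x \<ominus>\<^bsub>E\<^esub> x \<in> N [^]\<^bsub>ideals_set (E\<lparr>carrier := C\<rparr>)\<^esub> nat (i + 1))})"


section \<open>The branch divisor and the invariants \<open>h\<close>\<close>

text \<open>
  From here on \<open>A\<close> is a subring of the field \<open>L\<close>, \<open>K = fractions_in L A\<close>, and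
  \<open>B = integral_closure L A\<close>. For \<open>Q\<close> in \<open>primes_over L A P\<close>, the residue field \<open>L(Q)\<close> is \<open>Frac (B/Q)\<close>;
  the ring \<open>A/P\<close> embeds into \<open>L(Q)\<close> and \<open>residue_subring L A Q\<close> is its image, so that \<open>K(P)\<close> becomes
  the subfield \<open>residue_subfield L A Q\<close> of \<open>L(Q)\<close>.
\<close>

definition residue_field :: "('a, 'm) ring_scheme \<Rightarrow> 'a set \<Rightarrow> 'a set \<Rightarrow> ('a set \<times> 'a set) set ring" where
  "residue_field L A Q = Frac (L\<lparr>carrier := integral_closure L A\<rparr> Quot Q)"

definition residue_subring :: "('a, 'm) ring_scheme \<Rightarrow> 'a set \<Rightarrow> 'a set \<Rightarrow> ('a set \<times> 'a set) set set" where
  "residue_subring L A Q =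
     (let R = L\<lparr>carrier := integral_closure L A\<rparr> Quot Q
      in (\<lambda>a. frac_class R (Q +>\<^bsub>L\<^esub> a) \<one>\<^bsub>R\<^esub>) ` A)"

definition residue_subfield :: "('a, 'm) ring_scheme \<Rightarrow> 'a set \<Rightarrow> 'a set \<Rightarrow> ('a set \<times> 'a set) set set" where
  "residue_subfield L A Q = fractions_in (residue_field L A Q) (residue_subring L A Q)"

definition unramified_at :: "('a, 'm) ring_scheme \<Rightarrow> 'a set \<Rightarrow> 'a set \<Rightarrow> bool" where
  "unramified_at L A P \<longleftrightarrow> (\<forall>Q \<in> primes_over L A P.
      ramification_index L A P Q = 1 \<and>
      separable_extension (residue_field L A Q) (residue_subfield L A Q))"

definition ramified_primes :: "('a, 'm) ring_scheme \<Rightarrow> 'a set \<Rightarrow> 'a set set" where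
  "ramified_primes L A = {P \<in> Spec1 (L\<lparr>carrier := A\<rparr>). \<not> unramified_at L A P}"

text \<open>The list \<open>ps\<close> enumerates the ramified primes, since \<open>T_set\<close> depends on their order.\<close>

definition normal_crossing_branch :: "('a, 'm) ring_scheme \<Rightarrow> 'a set \<Rightarrow> 'a set list \<Rightarrow> bool" where
  "normal_crossing_branch L A ps \<longleftrightarrow>
     distinct ps \<and> set ps = ramified_primes L A \<and> 1 \<le> length ps \<and> length ps \<le> 2 \<and>
     (\<forall>P \<in> set ps. regular_local_ring (L\<lparr>carrier := A\<rparr> Quot P)) \<and>
     (length ps = 2 \<longrightarrow> intersection_number (L\<lparr>carrier := A\<rparr>) (ps ! 0) (ps ! 1) = 1)"

definition U_set :: "('a, 'm) ring_scheme \<Rightarrow> 'a set \<Rightarrow> 'a set set" where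
  "U_set L A = {P \<in> Spec1 (L\<lparr>carrier := A\<rparr>).
      regular_local_ring (L\<lparr>carrier := A\<rparr> Quot P) \<and> P \<notin> ramified_primes L A}"

definition T_set :: "('a, 'm) ring_scheme \<Rightarrow> 'a set \<Rightarrow> 'a set list \<Rightarrow> nat \<Rightarrow> 'a set set" where
  "T_set L A ps r = {P \<in> U_set L A.
      intersection_number (L\<lparr>carrier := A\<rparr>) P (ps ! 0) = r \<and>
      (length ps = 2 \<longrightarrow> intersection_number (L\<lparr>carrier := A\<rparr>) P (ps ! 1) = 1)}"

text \<open>
  For \<open>P\<close> in \<open>U_set L A\<close> the result does not depend on the choice of the prime \<open>Q\<close> over \<open>P\<close>, nor on
  that of the prime \<open>N\<close> over the maximal ideal of the discrete valuation ring \<open>A/P\<close> in the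
  integral closure of \<open>A/P\<close> in \<open>L(Q)\<close>; if the ramification index is \<open>p\<close>, then \<open>N\<close> is unique.
\<close>

definition h_prime :: "('a, 'm) ring_scheme \<Rightarrow> 'a set \<Rightarrow> nat \<Rightarrow> 'a set \<Rightarrow> nat" where
  "h_prime L A p P =
     (let Q = (SOME Q. Q \<in> primes_over L A P);
          E = residue_field L A Q;
          S = residue_subring L A Q;
          M = max_ideal (E\<lparr>carrier := S\<rparr>);
          N = (SOME N. N \<in> primes_over E S M)
      in if ramification_index E S M N = p
         then nat (Max {i::int. -1 \<le> i \<and> card (lower_ramification_group E S N i) = p})
         else 0)"

definition h_sup :: "('a, 'm) ring_scheme \<Rightarrow> 'a set \<Rightarrow> nat \<Rightarrow> 'a set list \<Rightarrow> nat \<Rightarrow> enat" where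
  "h_sup L A p ps r = (SUP P \<in> T_set L A ps r. enat (h_prime L A p P))"

end

theory Submission
  imports Defs
begin

text \<open>
  Let \<open>\<sigma>\<close> generate the Galois group and let \<open>J\<close> be the ideal of \<open>B\<close> generated by all \<open>\<sigma> b - b\<close>.
  Since \<open>\<sigma>\<close> acts trivially modulo a prime containing \<open>J\<close>, such a prime lies over a ramified prime or
  over the maximal ideal of \<open>A\<close>. Hence some power \<open>t^n\<close> of the product \<open>t\<close> of generators of the ramified primes lies in \<open>J\<close>. For \<open>P\<close> in
  \<open>T_r\<close>, an automorphism of the residue field \<open>L(Q)\<close> is induced by a power of \<open>\<sigma>\<close>; if \<open>G_i\<close> has order
  \<open>p\<close>, then the image of \<open>J\<close> lies in the \<open>(i + 1)\<close>-st power of the prime of the residue field. But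
  \<open>t\<close> has order \<open>r\<close> or \<open>r + 1\<close> along \<open>P\<close>, so \<open>i + 1 \<le> p (r + 1) n\<close>, with \<open>n\<close> independent of \<open>P\<close>.

  No finiteness of \<open>B\<close> over \<open>A\<close> is available; the localization of \<open>B\<close> at a prime above a principal
  prime \<open>f A\<close> is a discrete valuation ring because any \<open>p + 1\<close> elements of \<open>L\<close> satisfy a linear
  relation over \<open>A\<close> with not all coefficients divisible by \<open>f\<close>.
\<close>

section \<open>Integral elements\<close>

text \<open>Primes, ideals and localizations are subsets of one ambient field, described with its
  operations. Regularity of \<open>A\<close> enters through two generators of its maximal ideal:
  with Nakayama's lemma they make every prime of height one principal. One package of facts about a
  principal prime is applied twice, to \<open>A\<close> in \<open>L\<close> and to
  \<open>A/P\<close> in \<open>L(Q)\<close>. The second application bounds the ramification index of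
  \<open>L(Q)\<close> over \<open>K(P)\<close> by \<open>p\<close>, whence the factor
  \<open>p\<close> in the bound. Intersection numbers become valuations in the discrete valuation
  ring \<open>A/P\<close>. The exponent \<open>n\<close> comes from a prime containing a given ideal
  and avoiding \<open>t\<close>; a discriminant or different, which would require a basis of
  \<open>B\<close>, does not occur. For a single element of \<open>B\<close> the matching power of
  \<sigma> may depend on the element; an avoidance argument for submodules makes it uniform. Values
  defined by \<open>SOME\<close>, \<open>THE\<close> or \<open>Max\<close> are arbitrary where no
  prime or index exists, so the bound also absorbs constants that do not depend on
  \<open>P\<close>.\<close>

locale field_subring = field E for E (structure) +
  fixes A :: "'a set"
  assumes subring_A: "subring A E"
begin

lemmas A_carrier = subringE(1)[OF subring_A]
lemmas A_zero [simp, intro] = subringE(2)[OF subring_A]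
lemmas A_one [simp, intro] = subringE(3)[OF subring_A]
lemmas A_neg [simp, intro] = subringE(5)[OF subring_A]
lemmas A_mult [simp, intro] = subringE(6)[OF subring_A]
lemmas A_add [simp, intro] = subringE(7)[OF subring_A]

lemma A_in [simp, intro]: "a \<in> A \<Longrightarrow> a \<in> carrier E"
  using A_carrier by blast

lemma A_minus [simp, intro]: "\<lbrakk>a \<in> A; b \<in> A\<rbrakk> \<Longrightarrow> a \<ominus> b \<in> A"
  by (simp add: a_minus_def)

lemma A_pow [simp, intro]: "a \<in> A \<Longrightarrow> a [^] (n::nat) \<in> A"
  by (induction n) auto

text \<open>The values at \<open>x\<close> of polynomials over \<open>A\<close> of degree less than
  \<open>d\<close>, in Horner form: induction on \<open>d\<close> splits off the constant term and
  one factor \<open>x\<close>.\<close>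

primrec lowdeg :: "'a \<Rightarrow> nat \<Rightarrow> 'a set" where
  "lowdeg x 0 = {\<zero>}"
| "lowdeg x (Suc d) = {a \<oplus> x \<otimes> w | a w. a \<in> A \<and> w \<in> lowdeg x d}"

context
  fixes x assumes x [simp, intro]: "x \<in> carrier E"
begin

lemma lowdeg_in [simp, intro]: "w \<in> lowdeg x d \<Longrightarrow> w \<in> carrier E"
  by (induction d arbitrary: w) (auto simp: A_in)

lemma lowdeg_zero [simp]: "\<zero> \<in> lowdeg x d"
proof (induction d)
  case (Suc d)
  have "\<zero> = \<zero> \<oplus> x \<otimes> \<zero>" by simp
  with Suc show ?case unfolding lowdeg.simps by blast
qed simp

lemma lowdeg_add [simp]: "\<lbrakk>v \<in> lowdeg x d; w \<in> lowdeg x d\<rbrakk> \<Longrightarrow> v \<oplus> w \<in> lowdeg x d"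
proof (induction d arbitrary: v w)
  case (Suc d)
  then obtain a v' b w' where *: "a \<in> A" "v' \<in> lowdeg x d" "v = a \<oplus> x \<otimes> v'"
    "b \<in> A" "w' \<in> lowdeg x d" "w = b \<oplus> x \<otimes> w'" by auto
  then have "a \<in> carrier E" "b \<in> carrier E" "v' \<in> carrier E" "w' \<in> carrier E" by auto
  then have "v \<oplus> w = (a \<oplus> b) \<oplus> x \<otimes> (v' \<oplus> w')"
    unfolding * using x by algebra
  with Suc.IH * show ?case by auto
qed simp

lemma lowdeg_smult [simp]: "\<lbrakk>a \<in> A; w \<in> lowdeg x d\<rbrakk> \<Longrightarrow> a \<otimes> w \<in> lowdeg x d"
proof (induction d arbitrary: w)
  case (Suc d)
  then obtain b w' where *: "b \<in> A" "w' \<in> lowdeg x d" "w = b \<oplus> x \<otimes> w'" by auto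
  then have "a \<in> carrier E" "b \<in> carrier E" "w' \<in> carrier E" using Suc.prems by auto
  then have "a \<otimes> w = (a \<otimes> b) \<oplus> x \<otimes> (a \<otimes> w')"
    unfolding * using x by algebra
  with Suc * show ?case by auto
qed simp

lemma lowdeg_neg [simp]: "w \<in> lowdeg x d \<Longrightarrow> \<ominus> w \<in> lowdeg x d"
  using lowdeg_smult[of "\<ominus> \<one>" w d] by (simp add: l_minus)

lemma lowdeg_minus [simp]: "\<lbrakk>v \<in> lowdeg x d; w \<in> lowdeg x d\<rbrakk> \<Longrightarrow> v \<ominus> w \<in> lowdeg x d"
  by (simp add: a_minus_def)

lemma lowdeg_x: "w \<in> lowdeg x d \<Longrightarrow> x \<otimes> w \<in> lowdeg x (Suc d)"
proof -
  assume "w \<in> lowdeg x d"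
  then have "x \<otimes> w = \<zero> \<oplus> x \<otimes> w" "w \<in> lowdeg x d" by auto
  then show ?thesis unfolding lowdeg.simps by blast
qed

lemma lowdeg_const: "a \<in> A \<Longrightarrow> a \<in> lowdeg x (Suc d)"
proof -
  assume "a \<in> A"
  then have "a = a \<oplus> x \<otimes> \<zero>" "\<zero> \<in> lowdeg x d" by auto
  with \<open>a \<in> A\<close> show ?thesis unfolding lowdeg.simps by blast
qed

lemma lowdeg_Suc: "w \<in> lowdeg x d \<Longrightarrow> w \<in> lowdeg x (Suc d)"
proof (induction d arbitrary: w)
  case 0
  then show ?case using lowdeg_zero[of "Suc 0"] by (simp del: lowdeg.simps(2))
next
  case (Suc d)
  then obtain b w' where *: "b \<in> A" "w' \<in> lowdeg x d" "w = b \<oplus> x \<otimes> w'" by auto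
  with Suc.IH[OF *(2)] show ?case unfolding lowdeg.simps(2)[of x "Suc d"] by blast
qed

lemma lowdeg_mono: "\<lbrakk>w \<in> lowdeg x d; d \<le> e\<rbrakk> \<Longrightarrow> w \<in> lowdeg x e"
proof (induction e)
  case (Suc e) then show ?case using lowdeg_Suc by (cases "d = Suc e") (simp_all del: lowdeg.simps)
qed (simp del: lowdeg.simps)

lemma lowdeg_pow: "i < d \<Longrightarrow> x [^] i \<in> lowdeg x d"
proof (induction i arbitrary: d)
  case 0
  then show ?case using lowdeg_const[of \<one> "d - 1"] by (simp del: lowdeg.simps)
next
  case (Suc i)
  then obtain d' where "d = Suc d'" "i < d'" by (cases d) auto
  with Suc.IH[of d'] show ?case using lowdeg_x[of "x [^] i" d'] 
    by (simp add: m_comm del: lowdeg.simps)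
qed

lemma lowdeg_mult: "\<lbrakk>v \<in> lowdeg x d; w \<in> lowdeg x e\<rbrakk> \<Longrightarrow> v \<otimes> w \<in> lowdeg x (d + e)"
proof (induction d arbitrary: v)
  case (Suc d)
  then obtain b v' where *: "b \<in> A" "v' \<in> lowdeg x d" "v = b \<oplus> x \<otimes> v'" by auto
  then have "b \<in> carrier E" "v' \<in> carrier E" "w \<in> carrier E" using Suc.prems by auto
  then have "v \<otimes> w = b \<otimes> w \<oplus> x \<otimes> (v' \<otimes> w)"
    unfolding * using x by algebra
  moreover have "b \<otimes> w \<in> lowdeg x (Suc d + e)"
    using lowdeg_smult[OF *(1) Suc.prems(2)] lowdeg_mono by (simp del: lowdeg.simps)
  moreover have "x \<otimes> (v' \<otimes> w) \<in> lowdeg x (Suc d + e)"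
    using lowdeg_x[OF Suc.IH[OF *(2) Suc.prems(2)]] by (simp del: lowdeg.simps)
  ultimately show ?case by (simp del: lowdeg.simps)
qed simp

text \<open>One degree sharper than \<open>lowdeg_mult\<close>, because the pure power
  \<open>x [^] d\<close> is in general only in \<open>lowdeg x (Suc d)\<close>. This degree is what
  keeps corrections below a monic leading term.\<close>

lemma lowdeg_pow_mult: "w \<in> lowdeg x e \<Longrightarrow> x [^] d \<otimes> w \<in> lowdeg x (d + e)"
proof (induction d)
  case (Suc d)
  then have "x [^] Suc d \<otimes> w = x \<otimes> (x [^] d \<otimes> w)" by (simp add: m_ac)
  with lowdeg_x Suc show ?case by (simp del: lowdeg.simps)
qed simp

text \<open>The list has length exactly \<open>d\<close>, with leading zeros allowed, so that
  prefixing \<open>\<one>\<close> gives a monic polynomial of degree \<open>d\<close>.\<close>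

lemma lowdeg_eval: "w \<in> lowdeg x d \<Longrightarrow> \<exists>q. set q \<subseteq> A \<and> length q = d \<and> eval q x = w"
proof (induction d arbitrary: w)
  case (Suc d)
  then obtain b v' where *: "b \<in> A" "v' \<in> lowdeg x d" "w = b \<oplus> x \<otimes> v'" by auto
  from Suc.IH[OF *(2)] obtain q where q: "set q \<subseteq> A" "length q = d" "eval q x = v'" by auto
  have "eval (q @ [b]) x = w"
    using q * A_carrier by (subst eval_append_aux) (auto simp: m_comm a_comm)
  with q * show ?case by (intro exI[of _ "q @ [b]"]) auto
qed simp

lemma eval_lowdeg: "set q \<subseteq> A \<Longrightarrow> eval q x \<in> lowdeg x (length q)"
proof (induction q rule: rev_induct)
  case (snoc b q)
  have "eval (q @ [b]) x = b \<oplus> x \<otimes> eval q x"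
    using snoc.prems A_carrier by (subst eval_append_aux) (auto simp: m_comm a_comm eval_in_carrier)
  with snoc show ?case by auto
qed simp

text \<open>Eliminating one unknown after the other replaces the determinant of the Cayley--Hamilton
  argument: a linear system whose diagonal is monic of degree \<open>d\<close> and whose other entries have
  degree less than \<open>d\<close> becomes one of the same shape for degree \<open>2d\<close>.\<close>

lemma monic_annihilator:
  fixes n :: nat
  assumes "\<And>i j. \<lbrakk>i < n; j < n; i \<noteq> j\<rbrakk> \<Longrightarrow> P i j \<in> lowdeg x d"
    and "\<And>i. i < n \<Longrightarrow> \<exists>w \<in> lowdeg x d. P i i = x [^] d \<oplus> w"
    and "\<And>j. j < n \<Longrightarrow> m j \<in> carrier E"
    and "\<And>i. i < n \<Longrightarrow> (\<Oplus>j\<in>{..<n}. P i j \<otimes> m j) = \<zero>"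
  shows "\<exists>D. \<exists>w \<in> lowdeg x D. \<forall>j<n. (x [^] D \<oplus> w) \<otimes> m j = \<zero>"
  using assms
proof (induction n arbitrary: P d)
  case 0
  then show ?case by (intro exI[of _ 0]) auto
next
  case (Suc n)
  note offd = Suc.prems(1) and diag = Suc.prems(2) and m = Suc.prems(3) and eq = Suc.prems(4)
  have Pin: "P i j \<in> carrier E" if "i < Suc n" "j < Suc n" for i j
    using offd[OF that] diag[OF that(1)] by (cases "i = j") auto
  \<comment> \<open>Row \<open>i\<close> times the pivot \<open>P n n\<close> minus
    \<open>P i n\<close> times row \<open>n\<close>: the coefficient of \<open>m n\<close>
    cancels.\<close>
  define Q where "Q i j = P n n \<otimes> P i j \<ominus> P i n \<otimes> P n j" for i j
  obtain u where u: "u \<in> lowdeg x d" "P n n = x [^] d \<oplus> u" using diag[of n] by auto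
  have sumc: "(\<Oplus>j\<in>{..<n}. P i j \<otimes> m j) \<in> carrier E" if "i < Suc n" for i
    using that Pin m by (intro finsum_closed) auto
  have split: "P i n \<otimes> m n \<oplus> (\<Oplus>j\<in>{..<n}. P i j \<otimes> m j) = \<zero>" if "i < Suc n" for i
    using eq[OF that] that Pin m unfolding lessThan_Suc by (subst (asm) finsum_insert) auto
  have "\<exists>D. \<exists>w\<in>lowdeg x D. \<forall>j<n. (x [^] D \<oplus> w) \<otimes> m j = \<zero>"
  proof (rule Suc.IH[of Q "d + d"])
    fix i j assume ij: "i < n" "j < n" "i \<noteq> j"
    have "P n n \<otimes> P i j = x [^] d \<otimes> P i j \<oplus> u \<otimes> P i j"
      using u ij Pin[of i j] by (simp add: l_distr)
    also have "\<dots> \<in> lowdeg x (d + d)"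
      using offd[of i j] ij u by (intro lowdeg_add lowdeg_pow_mult lowdeg_mult) auto
    finally show "Q i j \<in> lowdeg x (d + d)"
      unfolding Q_def using ij offd[of i n] offd[of n j]
      by (intro lowdeg_minus[OF _ lowdeg_mult]) auto
  next
    fix i assume i: "i < n"
    obtain v where v: "v \<in> lowdeg x d" "P i i = x [^] d \<oplus> v" using diag[of i] i by auto
    have "Q i i = x [^] (d + d) \<oplus> (x [^] d \<otimes> v \<oplus> x [^] d \<otimes> u \<oplus> u \<otimes> v \<ominus> P i n \<otimes> P n i)"
    proof -
      have "x [^] d \<in> carrier E" "u \<in> carrier E" "v \<in> carrier E" "P i n \<in> carrier E" "P n i \<in> carrier E"
        using u v Pin i by auto
      then show ?thesis unfolding Q_def u v nat_pow_mult[OF x, symmetric] by algebra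
    qed
    moreover have "x [^] d \<otimes> v \<oplus> x [^] d \<otimes> u \<oplus> u \<otimes> v \<ominus> P i n \<otimes> P n i \<in> lowdeg x (d + d)"
      using u v i offd[of i n] offd[of n i]
      by (intro lowdeg_add lowdeg_minus lowdeg_mult lowdeg_pow_mult) auto
    ultimately show "\<exists>w\<in>lowdeg x (d + d). Q i i = x [^] (d + d) \<oplus> w" by blast
  next
    fix j assume "j < n" then show "m j \<in> carrier E" using m by auto
  next
    fix i assume i: "i < n"
    let ?S = "\<lambda>i. \<Oplus>j\<in>{..<n}. P i j \<otimes> m j"
    have "(\<Oplus>j\<in>{..<n}. Q i j \<otimes> m j)
        = (\<Oplus>j\<in>{..<n}. P n n \<otimes> (P i j \<otimes> m j) \<oplus> (\<ominus> P i n) \<otimes> (P n j \<otimes> m j))"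
    proof (rule finsum_cong')
      fix j assume "j \<in> {..<n}"
      then have "P n n \<in> carrier E" "P i j \<in> carrier E" "P i n \<in> carrier E" "P n j \<in> carrier E"
        "m j \<in> carrier E" using Pin m i by auto
      then show "Q i j \<otimes> m j = P n n \<otimes> (P i j \<otimes> m j) \<oplus> (\<ominus> P i n) \<otimes> (P n j \<otimes> m j)"
        unfolding Q_def by algebra
    qed (use Pin m i in auto)
    also have "\<dots> = P n n \<otimes> ?S i \<oplus> (\<ominus> P i n) \<otimes> ?S n"
      using Pin m i by (subst finsum_addf) (auto simp: finsum_rdistr)
    also have "\<dots> = \<zero>"
    proof -
      have "P i n \<in> carrier E" "P n n \<in> carrier E" "m n \<in> carrier E" "?S i \<in> carrier E" "?S n \<in> carrier E"
        using Pin m i sumc by auto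
      moreover have "?S i = \<ominus> (P i n \<otimes> m n)" "?S n = \<ominus> (P n n \<otimes> m n)"
        using split[of i] split[of n] i calculation
        by (metis (no_types, lifting) less_Suc_eq m_closed minus_equality minus_minus)+
      ultimately show ?thesis by (simp only:) algebra
    qed
    finally show "(\<Oplus>j\<in>{..<n}. Q i j \<otimes> m j) = \<zero>" .
  qed
  then obtain D w where Dw: "w \<in> lowdeg x D" "\<And>j. j < n \<Longrightarrow> (x [^] D \<oplus> w) \<otimes> m j = \<zero>" by auto
  let ?q = "x [^] D \<oplus> w"
  have qin: "?q \<in> carrier E" using Dw by auto
  \<comment> \<open>The element \<open>?q\<close> kills \<open>m j\<close> for \<open>j < n\<close>,
    so in the last equation only the pivot term survives, and \<open>?q \<otimes> P n n\<close>
    kills \<open>m n\<close> as well.\<close>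
  have q0: "?q \<otimes> (\<Oplus>j\<in>{..<n}. P n j \<otimes> m j) = \<zero>"
  proof -
    have "?q \<otimes> (\<Oplus>j\<in>{..<n}. P n j \<otimes> m j) = (\<Oplus>j\<in>{..<n}. ?q \<otimes> (P n j \<otimes> m j))"
      using Pin m qin by (intro finsum_rdistr) auto
    also have "\<dots> = (\<Oplus>j\<in>{..<n}. \<zero>)"
    proof (rule finsum_cong')
      fix j assume j: "j \<in> {..<n}"
      then have "P n j \<in> carrier E" "m j \<in> carrier E" "?q \<otimes> m j = \<zero>" using Pin m Dw by auto
      then show "?q \<otimes> (P n j \<otimes> m j) = \<zero>" using qin m_lcomm[of ?q "P n j" "m j"] by simp
    qed auto
    finally show ?thesis by simp
  qed
  have qn: "(?q \<otimes> P n n) \<otimes> m n = \<zero>"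
  proof -
    let ?S = "\<Oplus>j\<in>{..<n}. P n j \<otimes> m j"
    have c: "P n n \<in> carrier E" "m n \<in> carrier E" "?S \<in> carrier E" using Pin m sumc by auto
    have "?q \<otimes> (P n n \<otimes> m n \<oplus> ?S) = \<zero>" using split[of n] qin by simp
    then show ?thesis using c qin q0 by (simp add: r_distr m_assoc)
  qed
  have "?q \<otimes> P n n = x [^] (D + d) \<oplus> (x [^] D \<otimes> u \<oplus> x [^] d \<otimes> w \<oplus> w \<otimes> u)"
  proof -
    have "x [^] d \<in> carrier E" "x [^] D \<in> carrier E" "u \<in> carrier E" "w \<in> carrier E" using u Dw by auto
    then show ?thesis unfolding u nat_pow_mult[OF x, symmetric] by algebra
  qed
  moreover have "x [^] D \<otimes> u \<oplus> x [^] d \<otimes> w \<oplus> w \<otimes> u \<in> lowdeg x (D + d)"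
    using lowdeg_add[OF lowdeg_add[OF lowdeg_pow_mult[OF u(1), of D] _] lowdeg_mult[OF Dw(1) u(1)]]
      lowdeg_pow_mult[OF Dw(1), of d] by (simp add: add.commute del: lowdeg.simps)
  moreover have "(?q \<otimes> P n n) \<otimes> m j = \<zero>" if "j < Suc n" for j
  proof (cases "j = n")
    case False
    then have "P n n \<in> carrier E" "m j \<in> carrier E" "?q \<otimes> m j = \<zero>" using that Dw Pin m by auto
    then show ?thesis using qin m_assoc[of "P n n" ?q "m j"] by (simp add: m_comm[of ?q])
  qed (use qn in simp)
  ultimately show ?case by metis
qed

lemma integral_closure_iff:
  "x \<in> integral_closure E A \<longleftrightarrow> (\<exists>q. set q \<subseteq> A \<and> eval (\<one> # q) x = \<zero>)"
proof
  assume "x \<in> integral_closure E A"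
  then obtain f where f: "f \<in> carrier (univ_poly E A)" "f \<noteq> []" "lead_coeff f = \<one>" "eval f x = \<zero>"
    unfolding integral_closure_def by auto
  then have "set f \<subseteq> A" "f = \<one> # tl f"
    unfolding univ_poly_carrier[symmetric] polynomial_def by (auto simp: neq_Nil_conv)
  with f show "\<exists>q. set q \<subseteq> A \<and> eval (\<one> # q) x = \<zero>"
    by (metis list.set_intros(2) list.set_sel(2) subset_code(1) f(2))
next
  assume "\<exists>q. set q \<subseteq> A \<and> eval (\<one> # q) x = \<zero>"
  then obtain q where "set q \<subseteq> A" "eval (\<one> # q) x = \<zero>" by auto
  moreover from this have "\<one> # q \<in> carrier (univ_poly E A)"
    unfolding univ_poly_carrier[symmetric] polynomial_def by auto
  ultimately show "x \<in> integral_closure E A" unfolding integral_closure_def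
    by (auto intro!: bexI[of _ "\<one> # q"])
qed

text \<open>The determinant trick: the matrix with \<open>x \<ominus> c i i\<close> on the diagonal
  and \<open>\<ominus> c i j\<close> elsewhere kills the vector \<open>m\<close>, and its diagonal
  is monic of degree one in \<open>x\<close>. The resulting annihilator, monic in \<open>x\<close>,
  kills the nonzero \<open>m j0\<close> and hence vanishes in the field \<open>E\<close>.\<close>

lemma integralI:
  fixes n :: nat
  assumes m: "\<And>j. j < n \<Longrightarrow> m j \<in> carrier E" "j0 < n" "m j0 \<noteq> \<zero>"
    and c: "\<And>i j. \<lbrakk>i < n; j < n\<rbrakk> \<Longrightarrow> c i j \<in> A"
    and eq: "\<And>i. i < n \<Longrightarrow> x \<otimes> m i = (\<Oplus>j\<in>{..<n}. c i j \<otimes> m j)"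
  shows "x \<in> integral_closure E A"
proof -
  define P where "P i j = (if i = j then x else \<zero>) \<ominus> c i j" for i j
  have cin: "c i j \<in> carrier E" if "i < n" "j < n" for i j using c that by auto
  have "\<exists>D. \<exists>w \<in> lowdeg x D. \<forall>j<n. (x [^] D \<oplus> w) \<otimes> m j = \<zero>"
  proof (rule monic_annihilator[of n P 1])
    fix i j assume "i < n" "j < n" "i \<noteq> j"
    then show "P i j \<in> lowdeg x 1" unfolding P_def using lowdeg_const[of "\<ominus> c i j" 0] c cin
      by (simp add: a_minus_def del: lowdeg.simps)
  next
    fix i assume "i < n"
    then show "\<exists>w\<in>lowdeg x 1. P i i = x [^] (1::nat) \<oplus> w"
      unfolding P_def using lowdeg_const[of "\<ominus> c i i" 0] c
      by (intro bexI[of _ "\<ominus> c i i"]) (simp_all add: a_minus_def del: lowdeg.simps)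
  next
    fix i assume i: "i < n"
    have "(\<Oplus>j\<in>{..<n}. P i j \<otimes> m j)
        = (\<Oplus>j\<in>{..<n}. (if i = j then x \<otimes> m j else \<zero>) \<oplus> \<ominus> (c i j \<otimes> m j))"
    proof (rule finsum_cong')
      fix j assume "j \<in> {..<n}"
      then have "c i j \<in> carrier E" "m j \<in> carrier E" using cin m i by auto
      then show "P i j \<otimes> m j = (if i = j then x \<otimes> m j else \<zero>) \<oplus> \<ominus> (c i j \<otimes> m j)"
        unfolding P_def using x by (cases "i = j") (simp_all add: minus_eq l_distr l_minus)
    qed (use m cin i in auto)
    also have "\<dots> = (\<Oplus>j\<in>{..<n}. (if i = j then x \<otimes> m j else \<zero>)) \<oplus> (\<Oplus>j\<in>{..<n}. \<ominus> (c i j \<otimes> m j))"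
      using m cin i by (intro finsum_addf) auto
    also have "(\<Oplus>j\<in>{..<n}. (if i = j then x \<otimes> m j else \<zero>)) = x \<otimes> m i"
      using finsum_singleton[of i "{..<n}" "\<lambda>j. x \<otimes> m j"] m i by simp
    also have "(\<Oplus>j\<in>{..<n}. \<ominus> (c i j \<otimes> m j)) = (\<Oplus>j\<in>{..<n}. (\<ominus> \<one>) \<otimes> (c i j \<otimes> m j))"
      using m cin i by (intro finsum_cong') (auto simp: l_minus)
    also have "\<dots> = (\<ominus> \<one>) \<otimes> (\<Oplus>j\<in>{..<n}. c i j \<otimes> m j)"
      using m cin i by (intro finsum_rdistr[symmetric]) auto
    also have "x \<otimes> m i \<oplus> \<dots> = \<zero>"
      using m i by (simp add: eq[OF i, symmetric] l_minus r_neg)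
    finally show "(\<Oplus>j\<in>{..<n}. P i j \<otimes> m j) = \<zero>" .
  qed (use m in auto)
  then obtain D w where Dw: "w \<in> lowdeg x D" "(x [^] D \<oplus> w) \<otimes> m j0 = \<zero>" using m by auto
  then have "x [^] D \<oplus> w = \<zero>" using m integral[of "x [^] D \<oplus> w" "m j0"] by auto
  moreover obtain q where "set q \<subseteq> A" "length q = D" "eval q x = w" using lowdeg_eval[OF Dw(1)] by auto
  ultimately show ?thesis unfolding integral_closure_iff by (intro exI[of _ q]) auto
qed

end

end

section \<open>Finitely generated submodules and the ring of integral elements\<close>

context field_subring begin

primrec lspan :: "'a list \<Rightarrow> 'a set" where
  "lspan [] = {\<zero>}"
| "lspan (u # us) = {a \<otimes> u \<oplus> w | a w. a \<in> A \<and> w \<in> lspan us}"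

lemma lspan_in: "\<lbrakk>w \<in> lspan us; set us \<subseteq> carrier E\<rbrakk> \<Longrightarrow> w \<in> carrier E"
  by (induction us arbitrary: w) auto

lemma lspan_ConsI: "\<lbrakk>a \<in> A; w \<in> lspan us\<rbrakk> \<Longrightarrow> a \<otimes> u \<oplus> w \<in> lspan (u # us)"
  by auto

lemma lspan_zero [simp]: "set us \<subseteq> carrier E \<Longrightarrow> \<zero> \<in> lspan us"
proof (induction us)
  case (Cons u us)
  then show ?case using lspan_ConsI[of \<zero> \<zero> us u] by simp
qed simp

lemma lspan_add: "\<lbrakk>v \<in> lspan us; w \<in> lspan us; set us \<subseteq> carrier E\<rbrakk> \<Longrightarrow> v \<oplus> w \<in> lspan us"
proof (induction us arbitrary: v w)
  case (Cons u us)
  then obtain a v' b w' where *: "a \<in> A" "v' \<in> lspan us" "v = a \<otimes> u \<oplus> v'"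
    "b \<in> A" "w' \<in> lspan us" "w = b \<otimes> u \<oplus> w'" by auto
  then have "a \<in> carrier E" "b \<in> carrier E" "v' \<in> carrier E" "w' \<in> carrier E" "u \<in> carrier E"
    using Cons.prems lspan_in by auto
  then have "v \<oplus> w = (a \<oplus> b) \<otimes> u \<oplus> (v' \<oplus> w')"
    unfolding * by algebra
  with Cons * show ?case by auto
qed simp

lemma lspan_smult: "\<lbrakk>a \<in> A; w \<in> lspan us; set us \<subseteq> carrier E\<rbrakk> \<Longrightarrow> a \<otimes> w \<in> lspan us"
proof (induction us arbitrary: w)
  case (Cons u us)
  then obtain b w' where *: "b \<in> A" "w' \<in> lspan us" "w = b \<otimes> u \<oplus> w'" by auto
  then have "a \<in> carrier E" "b \<in> carrier E" "w' \<in> carrier E" "u \<in> carrier E"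
    using Cons.prems lspan_in by auto
  then have "a \<otimes> w = (a \<otimes> b) \<otimes> u \<oplus> a \<otimes> w'"
    unfolding * by algebra
  with Cons * show ?case by auto
qed simp

lemma lspan_mem: "\<lbrakk>u \<in> set us; set us \<subseteq> carrier E\<rbrakk> \<Longrightarrow> u \<in> lspan us"
proof (induction us)
  case (Cons v us)
  show ?case
  proof (cases "u = v")
    case True
    with Cons show ?thesis using lspan_ConsI[of \<one> \<zero> us v] by simp
  next
    case False
    with Cons have "u \<in> lspan us" "u \<in> carrier E" "v \<in> carrier E" by auto
    then show ?thesis using lspan_ConsI[of \<zero> u us v] by simp
  qed
qed simp

text \<open>Generators are numbered from the back, so that prefixing one adds a last index and
  leaves the other indices alone.\<close>

lemma lspan_finsum:
  assumes "w \<in> lspan us" "set us \<subseteq> carrier E"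
  shows "\<exists>c. (\<forall>j<length us. c j \<in> A) \<and>
    w = (\<Oplus>j\<in>{..<length us}. c j \<otimes> us ! (length us - 1 - j))"
  using assms
proof (induction us arbitrary: w)
  case (Cons u us)
  then obtain a v where *: "a \<in> A" "v \<in> lspan us" "w = a \<otimes> u \<oplus> v" by auto
  then obtain c where c: "\<forall>j<length us. c j \<in> A"
    "v = (\<Oplus>j\<in>{..<length us}. c j \<otimes> us ! (length us - 1 - j))" using Cons by auto
  define c' where "c' = c(length us := a)"
  have us: "us ! k \<in> carrier E" if "k < length us" for k using Cons.prems that by auto
  have "(\<Oplus>j\<in>{..<length us}. c j \<otimes> us ! (length us - 1 - j))
    = (\<Oplus>j\<in>{..<length us}. c' j \<otimes> (u # us) ! (length us - j))"
    using c us by (intro finsum_cong') (auto simp: c'_def nth_Cons' Suc_diff_le)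
  then have "w = (\<Oplus>j\<in>{..<length (u # us)}. c' j \<otimes> (u # us) ! (length (u # us) - 1 - j))"
    unfolding * c list.size using * c us Cons.prems
    by (simp add: lessThan_Suc, subst finsum_insert) (auto simp: c'_def nth_Cons')
  with * c show ?case by (intro exI[of _ c']) (auto simp: c'_def less_Suc_eq)
qed auto

text \<open>The coefficients of the products \<open>z \<otimes> u\<close> in the generators form the
  matrix needed by \<open>integralI\<close>; \<open>u0\<close> is the nonzero entry of the
  vector.\<close>

lemma integral_if_lspan_stable:
  assumes us: "set us \<subseteq> carrier E" "u0 \<in> set us" "u0 \<noteq> \<zero>" and z: "z \<in> carrier E"
    and stable: "\<And>u. u \<in> set us \<Longrightarrow> z \<otimes> u \<in> lspan us"
  shows "z \<in> integral_closure E A"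
proof -
  let ?n = "length us" let ?m = "\<lambda>j. us ! (?n - 1 - j)"
  have "\<exists>c. (\<forall>j<?n. c j \<in> A) \<and> z \<otimes> ?m i = (\<Oplus>j\<in>{..<?n}. c j \<otimes> ?m j)" if "i < ?n" for i
    using that by (intro lspan_finsum stable us) auto
  then obtain c where c: "\<And>i j. \<lbrakk>i < ?n; j < ?n\<rbrakk> \<Longrightarrow> c i j \<in> A"
    "\<And>i. i < ?n \<Longrightarrow> z \<otimes> ?m i = (\<Oplus>j\<in>{..<?n}. c i j \<otimes> ?m j)" by metis
  obtain k where k: "k < ?n" "us ! k = u0" using us by (auto simp: in_set_conv_nth)
  show ?thesis
  proof (rule integralI[OF z, of ?n ?m "?n - 1 - k" c])
    show "?m j \<in> carrier E" if "j < ?n" for j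
      using us(1) that by (auto intro!: subsetD[OF us(1)] nth_mem)
    show "?m (?n - 1 - k) \<noteq> \<zero>" using k us by simp
  qed (use c k in auto)
qed

lemma lspan_stable:
  assumes "set us \<subseteq> carrier E" "z \<in> carrier E" "\<And>u. u \<in> set us \<Longrightarrow> z \<otimes> u \<in> lspan us"
    and "w \<in> lspan us"
  shows "z \<otimes> w \<in> lspan us"
proof -
  have "z \<otimes> w \<in> lspan us" if "w \<in> lspan vs" "set vs \<subseteq> set us" for vs
    using that
  proof (induction vs arbitrary: w)
    case (Cons v vs)
    then obtain b w' where *: "b \<in> A" "w' \<in> lspan vs" "w = b \<otimes> v \<oplus> w'" by auto
    have c: "b \<in> carrier E" "v \<in> carrier E" "w' \<in> carrier E"
      using * Cons.prems assms(1) lspan_in[OF *(2)] by auto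
    then have "z \<otimes> w = b \<otimes> (z \<otimes> v) \<oplus> z \<otimes> w'" unfolding * using assms(2) by algebra
    moreover have "z \<otimes> w' \<in> lspan us" using Cons * by auto
    moreover have "b \<otimes> (z \<otimes> v) \<in> lspan us"
      using lspan_smult * assms(1,3) Cons.prems by auto
    ultimately show ?case using lspan_add assms(1) by simp
  qed (use assms in simp)
  with assms(4) show ?thesis by blast
qed

text \<open>A factor \<open>x\<close> is moved from \<open>v\<close> into \<open>z\<close>, which is
  why \<open>z\<close> varies in the induction. Applied in two variables one after the other, this
  reduces products of polynomials to products of powers.\<close>

lemma lowdeg_module:
  assumes x: "x \<in> carrier E" and z: "z \<in> carrier E"
    and M: "\<zero> \<in> M" "\<And>u v. \<lbrakk>u \<in> M; v \<in> M\<rbrakk> \<Longrightarrow> u \<oplus> v \<in> M" "\<And>a u. \<lbrakk>a \<in> A; u \<in> M\<rbrakk> \<Longrightarrow> a \<otimes> u \<in> M"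
    and gen: "\<And>i. i < d \<Longrightarrow> z \<otimes> x [^] i \<in> M" and v: "v \<in> lowdeg x d"
  shows "z \<otimes> v \<in> M"
  using z gen v
proof (induction d arbitrary: z v)
  case (Suc d)
  then obtain a w where *: "a \<in> A" "w \<in> lowdeg x d" "v = a \<oplus> x \<otimes> w" by auto
  have "(z \<otimes> x) \<otimes> x [^] i \<in> M" if "i < d" for i
    using Suc.prems(2)[of "Suc i"] that x Suc.prems(1) by (simp add: m_assoc m_comm[of "x [^] i"])
  then have "(z \<otimes> x) \<otimes> w \<in> M" using Suc.IH[of "z \<otimes> x" w] Suc.prems(1) x * by auto
  moreover have "a \<otimes> z \<in> M" using M(3)[OF *(1) Suc.prems(2)[of 0]] Suc.prems(1) by simp
  moreover have "z \<otimes> v = a \<otimes> z \<oplus> (z \<otimes> x) \<otimes> w"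
  proof -
    have "a \<in> carrier E" "w \<in> carrier E" using * lowdeg_in[OF x] by auto
    then show ?thesis unfolding * using x Suc.prems(1) by algebra
  qed
  ultimately show ?case using M by simp
qed (use M in simp)

lemma integral_carrier: "x \<in> integral_closure E A \<Longrightarrow> x \<in> carrier E"
  by (simp add: integral_closure_def)

lemma A_integral: "a \<in> A \<Longrightarrow> a \<in> integral_closure E A"
  by (subst integral_closure_iff) (auto intro!: exI[of _ "[\<ominus> a]"] simp: r_neg)

lemma integral_lowdeg:
  assumes "x \<in> integral_closure E A"
  obtains d where "d > 0" "x [^] d \<in> lowdeg x d"
proof -
  have x: "x \<in> carrier E" using assms by (rule integral_carrier)
  then obtain q where q: "set q \<subseteq> A" "eval (\<one> # q) x = \<zero>"
    using assms integral_closure_iff by auto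
  have qx: "eval q x \<in> carrier E" using q x A_carrier by (intro eval_in_carrier) auto
  then have "x [^] length q = \<ominus> eval q x" using q x by (simp add: sum_zero_eq_neg)
  also have "\<dots> \<in> lowdeg x (length q)" using lowdeg_neg[OF x] eval_lowdeg[OF x q(1)] by blast
  finally have "x [^] length q \<in> lowdeg x (length q)" .
  moreover have "length q \<noteq> 0" using q by auto
  ultimately show thesis using that by blast
qed

text \<open>The products \<open>x^i y^j\<close> with \<open>i < d\<close> and \<open>j < e\<close>
  span a module that is stable under \<open>x\<close> and under \<open>y\<close>, hence under their
  sum and product.\<close>

lemma integral_sum_prod:
  assumes "x \<in> integral_closure E A" "y \<in> integral_closure E A"
  shows "x \<oplus> y \<in> integral_closure E A" "x \<otimes> y \<in> integral_closure E A"
proof -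
  have x: "x \<in> carrier E" and y: "y \<in> carrier E" using assms integral_carrier by auto
  obtain d where d: "d > 0" "x [^] d \<in> lowdeg x d" by (rule integral_lowdeg[OF assms(1)])
  obtain e where e: "e > 0" "y [^] e \<in> lowdeg y e" by (rule integral_lowdeg[OF assms(2)])
  define us where "us = map (\<lambda>(i, j). x [^] i \<otimes> y [^] j) (List.product [0..<d] [0..<e])"
  have us: "set us \<subseteq> carrier E" using x y by (auto simp: us_def)
  have usI: "x [^] i \<otimes> y [^] j \<in> set us" if "i < d" "j < e" for i j
    using that by (force simp: us_def)
  have usE: "\<exists>i j. i < d \<and> j < e \<and> u = x [^] i \<otimes> y [^] j" if "u \<in> set us" for u
    using that unfolding us_def by (auto, blast)
  have prod: "v \<otimes> w \<in> lspan us" if "v \<in> lowdeg x d" "w \<in> lowdeg y e" for v w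
  proof -
    have w: "w \<in> carrier E" and v: "v \<in> carrier E" using that x y by auto
    have "x [^] i \<otimes> w \<in> lspan us" if i: "i < d" for i
    proof (rule lowdeg_module[OF y _ lspan_zero[OF us] lspan_add[OF _ _ us] lspan_smult[OF _ _ us] _ \<open>w \<in> lowdeg y e\<close>])
      show "x [^] i \<in> carrier E" using x by simp
      show "x [^] i \<otimes> y [^] j \<in> lspan us" if "j < e" for j
        using usI[OF i that] us by (rule lspan_mem)
    qed
    then have "w \<otimes> x [^] i \<in> lspan us" if "i < d" for i using that w x by (simp add: m_comm)
    then have "w \<otimes> v \<in> lspan us"
      using lowdeg_module[OF x w lspan_zero[OF us] lspan_add[OF _ _ us] lspan_smult[OF _ _ us] _ \<open>v \<in> lowdeg x d\<close>]
      by blast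
    then show ?thesis using v w by (simp add: m_comm)
  qed
  have powd: "x [^] Suc i \<in> lowdeg x d" if "i < d" for i
    using that d lowdeg_pow[OF x, of "Suc i" d] by (cases "Suc i = d") (simp_all del: lowdeg.simps nat_pow_Suc)
  have powe: "y [^] Suc i \<in> lowdeg y e" if "i < e" for i
    using that e lowdeg_pow[OF y, of "Suc i" e] by (cases "Suc i = e") (simp_all del: lowdeg.simps nat_pow_Suc)
  have sx: "x \<otimes> u \<in> lspan us" if "u \<in> set us" for u
  proof -
    from usE[OF that] obtain i j where ij: "i < d" "j < e" "u = x [^] i \<otimes> y [^] j" by auto
    then have "x \<otimes> u = x [^] Suc i \<otimes> y [^] j" using x y by (simp add: m_ac)
    then show ?thesis using prod[OF powd[OF ij(1)] lowdeg_pow[OF y ij(2)]] by simp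
  qed
  have sy: "y \<otimes> u \<in> lspan us" if "u \<in> set us" for u
  proof -
    from usE[OF that] obtain i j where ij: "i < d" "j < e" "u = x [^] i \<otimes> y [^] j" by auto
    then have "y \<otimes> u = x [^] i \<otimes> y [^] Suc j" using x y by (simp add: m_ac)
    then show ?thesis using prod[OF lowdeg_pow[OF x ij(1)] powe[OF ij(2)]] by simp
  qed
  have one: "\<one> \<in> set us" using usI[of 0 0] d e by simp
  show "x \<oplus> y \<in> integral_closure E A"
  proof (rule integral_if_lspan_stable[OF us one])
    fix u assume u: "u \<in> set us"
    then have "(x \<oplus> y) \<otimes> u = x \<otimes> u \<oplus> y \<otimes> u" using x y us by (auto simp: l_distr)
    then show "(x \<oplus> y) \<otimes> u \<in> lspan us" using sx[OF u] sy[OF u] lspan_add us by simp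
  qed (use x y in auto)
  show "x \<otimes> y \<in> integral_closure E A"
  proof (rule integral_if_lspan_stable[OF us one])
    fix u assume u: "u \<in> set us"
    then have "(x \<otimes> y) \<otimes> u = x \<otimes> (y \<otimes> u)" using x y us by (auto simp: m_assoc)
    then show "(x \<otimes> y) \<otimes> u \<in> lspan us" using lspan_stable[OF us x sx sy[OF u]] by simp
  qed (use x y in auto)
qed

lemma subring_integral_closure: "subring (integral_closure E A) E"
proof (rule subringI)
  show "\<ominus> h \<in> integral_closure E A" if "h \<in> integral_closure E A" for h
  proof -
    have "\<ominus> h = (\<ominus> \<one>) \<otimes> h" using integral_carrier[OF that] by (simp add: l_minus)
    then show ?thesis using integral_sum_prod(2)[OF A_integral that, of "\<ominus> \<one>"] by simp
  qed
qed (use integral_carrier integral_sum_prod A_integral in auto)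

end

text \<open>Primality in the subring \<open>B\<close>, written with the operations of the ambient
  ring. In the record with carrier \<open>B\<close> the additive inverse is a different term, so
  this form avoids translating every computation.\<close>

definition prime_of :: "('a, 'm) ring_scheme \<Rightarrow> 'a set \<Rightarrow> 'a set \<Rightarrow> bool" where
  "prime_of E B Q \<longleftrightarrow> Q \<subseteq> B \<and> \<zero>\<^bsub>E\<^esub> \<in> Q \<and> (\<forall>x\<in>Q. \<forall>y\<in>Q. x \<oplus>\<^bsub>E\<^esub> y \<in> Q) \<and>
    (\<forall>b\<in>B. \<forall>x\<in>Q. b \<otimes>\<^bsub>E\<^esub> x \<in> Q) \<and> \<one>\<^bsub>E\<^esub> \<notin> Q \<and>
    (\<forall>a\<in>B. \<forall>b\<in>B. a \<otimes>\<^bsub>E\<^esub> b \<in> Q \<longrightarrow> a \<in> Q \<or> b \<in> Q)"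

lemma (in cring) additive_subgroup_subringI:
  assumes B: "subring B R" and "I \<subseteq> B" "\<zero> \<in> I" "\<And>x y. \<lbrakk>x \<in> I; y \<in> I\<rbrakk> \<Longrightarrow> x \<oplus> y \<in> I"
    "\<And>b x. \<lbrakk>b \<in> B; x \<in> I\<rbrakk> \<Longrightarrow> b \<otimes> x \<in> I"
  shows "ideal I (R\<lparr>carrier := B\<rparr>)"
proof -
  interpret B: cring "R\<lparr>carrier := B\<rparr>" using B subcringI' subcring_iff subringE(1) by metis
  have Bc: "B \<subseteq> carrier R" using B by (rule subringE)
  have neg: "\<ominus>\<^bsub>R\<lparr>carrier := B\<rparr>\<^esub> x = \<ominus> x" if "x \<in> B" for x
  proof -
    have "\<ominus> x \<in> B" using B that by (auto intro: subringE)
    then show ?thesis using that Bc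
      by (intro B.minus_equality) (auto simp: l_neg)
  qed
  show ?thesis
  proof (rule idealI)
    show "ring (R\<lparr>carrier := B\<rparr>)" by (rule B.ring_axioms)
    show "subgroup I (add_monoid (R\<lparr>carrier := B\<rparr>))"
    proof (rule B.add.subgroupI)
      fix a assume a: "a \<in> I"
      have "\<ominus> a = (\<ominus> \<one>) \<otimes> a" using a assms Bc by (auto simp: l_minus)
      moreover have "\<ominus> \<one> \<in> B" using B by (auto intro: subringE)
      ultimately show "\<ominus>\<^bsub>R\<lparr>carrier := B\<rparr>\<^esub> a \<in> I" using a assms neg by auto
    qed (use assms in auto)
    fix a x assume ax: "a \<in> I" "x \<in> carrier (R\<lparr>carrier := B\<rparr>)"
    then show "x \<otimes>\<^bsub>R\<lparr>carrier := B\<rparr>\<^esub> a \<in> I" using assms by auto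
    have "a \<otimes> x = x \<otimes> a" using ax assms Bc by (intro m_comm) auto
    then show "a \<otimes>\<^bsub>R\<lparr>carrier := B\<rparr>\<^esub> x \<in> I" using ax assms by auto
  qed
qed

lemma (in cring) primeideal_iff_prime_of:
  assumes B: "subring B R"
  shows "primeideal Q (R\<lparr>carrier := B\<rparr>) \<longleftrightarrow> prime_of R B Q"
proof
  assume "primeideal Q (R\<lparr>carrier := B\<rparr>)"
  then interpret Q: primeideal Q "R\<lparr>carrier := B\<rparr>" .
  have "\<one> \<notin> Q" using Q.one_imp_carrier Q.I_notcarr by auto
  moreover have "\<zero> \<in> Q" using additive_subgroup.zero_closed[OF Q.additive_subgroup_axioms] by simp
  moreover have "x \<oplus> y \<in> Q" if "x \<in> Q" "y \<in> Q" for x y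
    using additive_subgroup.a_closed[OF Q.additive_subgroup_axioms that] by simp
  moreover have "b \<otimes> x \<in> Q" if "x \<in> Q" "b \<in> B" for x b using Q.I_l_closed[of x b] that by simp
  moreover have "a \<in> Q \<or> b \<in> Q" if "a \<in> B" "b \<in> B" "a \<otimes> b \<in> Q" for a b
    using Q.I_prime[of a b] that by simp
  moreover have "Q \<subseteq> B" using Q.Icarr by auto
  ultimately show "prime_of R B Q" using \<open>\<one> \<notin> Q\<close> unfolding prime_of_def by (simp (no_asm_simp))
next
  assume p: "prime_of R B Q"
  interpret B: cring "R\<lparr>carrier := B\<rparr>" using B subcringI' subcring_iff subringE(1) by metis
  show "primeideal Q (R\<lparr>carrier := B\<rparr>)"
  proof (rule primeidealI)
    show "ideal Q (R\<lparr>carrier := B\<rparr>)"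
      by (rule additive_subgroup_subringI[OF B]) (use p[unfolded prime_of_def] in blast)+
    show "carrier (R\<lparr>carrier := B\<rparr>) \<noteq> Q" using p subringE(3)[OF B] by (auto simp: prime_of_def)
    show "cring (R\<lparr>carrier := B\<rparr>)" by (rule B.is_cring)
    show "a \<in> Q \<or> b \<in> Q" if "a \<in> carrier (R\<lparr>carrier := B\<rparr>)" "b \<in> carrier (R\<lparr>carrier := B\<rparr>)"
      "a \<otimes>\<^bsub>R\<lparr>carrier := B\<rparr>\<^esub> b \<in> Q" for a b
      using p that unfolding prime_of_def by simp
  qed
qed

context field_subring begin

text \<open>The Horner prefixes of a relation for \<open>y\<close>, and their products with \<open>y\<close>, are integral because
  they map the module spanned by the powers of \<open>y\<close> below the degree into itself. Not all of them can
  lie in \<open>Q\<close>, since every coefficient is a difference of two of them.\<close>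

lemma integral_fraction:
  assumes Q: "prime_of E (integral_closure E A) Q" and y: "y \<in> carrier E"
    and q: "set q \<subseteq> A" "eval q y = \<zero>" and c: "c \<in> set q" "c \<notin> Q"
  shows "\<exists>a\<in>integral_closure E A. \<exists>b\<in>integral_closure E A. a \<otimes> y = b \<and> (a \<notin> Q \<or> b \<notin> Q)"
proof (rule ccontr)
  assume neg: "\<not> ?thesis"
  obtain n where n: "length q = Suc n" using c by (cases q) auto
  let ?b = "\<lambda>k. eval (take k q) y"
  have qc: "set q \<subseteq> carrier E" using q A_carrier by auto
  have bc: "?b k \<in> carrier E" for k using eval_in_carrier[OF subset_trans[OF set_take_subset qc] y] .
  have low: "?b k \<otimes> y [^] j \<in> lowdeg y n" if "k \<le> n" "j \<le> n" for k j
  proof (cases "k + j \<le> n")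
    case True
    have "?b k \<in> lowdeg y k" using eval_lowdeg[OF y subset_trans[OF set_take_subset q(1)], of k] that n
      by (simp del: lowdeg.simps)
    then have "y [^] j \<otimes> ?b k \<in> lowdeg y (j + k)" by (rule lowdeg_pow_mult[OF y])
    then have "?b k \<otimes> y [^] j \<in> lowdeg y (j + k)"
      unfolding m_comm[OF bc nat_pow_closed[OF y], of k j] .
    then show ?thesis using lowdeg_mono[OF y] True by (metis add.commute)
  next
    case False
    \<comment> \<open>Once the degree exceeds \<open>n\<close>, the relation replaces
      \<open>?b k \<otimes> y [^] ?l\<close> by minus the value of the remaining \<open>?l\<close>
      coefficients, which is a polynomial of degree less than \<open>?l\<close>.\<close>
    let ?l = "Suc n - k"
    have l: "length (drop k q) = ?l" "?l \<le> j" using n that False by auto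
    have dq: "set (drop k q) \<subseteq> A" using subset_trans[OF set_drop_subset q(1)] .
    have "\<zero> = ?b k \<otimes> y [^] ?l \<oplus> eval (drop k q) y"
      using eval_append[OF subset_trans[OF set_take_subset qc] subset_trans[OF set_drop_subset qc] y, of k k]
      unfolding append_take_drop_id q(2) l(1) .
    moreover have dc: "eval (drop k q) y \<in> carrier E"
      using eval_in_carrier[OF subset_trans[OF dq A_carrier] y] .
    ultimately have "?b k \<otimes> y [^] ?l = \<ominus> eval (drop k q) y"
      using sum_zero_eq_neg[OF m_closed[OF bc nat_pow_closed[OF y]] dc] by metis
    moreover have "eval (drop k q) y \<in> lowdeg y ?l" using eval_lowdeg[OF y dq] l by simp
    ultimately have "?b k \<otimes> y [^] ?l \<in> lowdeg y ?l"
      by (simp only: lowdeg_neg[OF y])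
    then have "y [^] (j - ?l) \<otimes> (?b k \<otimes> y [^] ?l) \<in> lowdeg y (j - ?l + ?l)"
      by (rule lowdeg_pow_mult[OF y])
    moreover have "y [^] (j - ?l) \<otimes> (?b k \<otimes> y [^] ?l) = ?b k \<otimes> y [^] (j - ?l + ?l)"
      using m_lcomm[OF nat_pow_closed[OF y] bc nat_pow_closed[OF y]] nat_pow_mult[OF y]
      by (simp (no_asm_simp) only:)
    moreover have "j - ?l + ?l = j" using l(2) by (rule le_add_diff_inverse2)
    ultimately have "?b k \<otimes> y [^] j \<in> lowdeg y j" by (simp only:)
    then show ?thesis using lowdeg_mono[OF y _ that(2)] by blast
  qed
  have int: "z \<in> integral_closure E A"
    if "0 < n" "z \<in> carrier E" "\<And>j. j < n \<Longrightarrow> z \<otimes> y [^] j \<in> lowdeg y n" for z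
  proof -
    let ?us = "map (\<lambda>j. y [^] j) [0..<n]"
    have us: "set ?us \<subseteq> carrier E" using y by auto
    have one: "\<one> \<in> set ?us"
      using imageI[of 0 "set [0..<n]" "\<lambda>j. y [^] j"] that(1) by simp
    have mem: "\<one> \<otimes> y [^] i \<in> lspan ?us" if "i < n" for i
      using lspan_mem[OF _ us, of "y [^] i"] that y by simp
    have low': "w \<in> lspan ?us" if w: "w \<in> lowdeg y n" for w
      using lowdeg_module[OF y one_closed lspan_zero[OF us] lspan_add[OF _ _ us] lspan_smult[OF _ _ us] mem w]
        lowdeg_in[OF y w] by (simp only: l_one)
    show ?thesis
    proof (rule integral_if_lspan_stable[OF us one _ that(2)])
      fix u assume "u \<in> set ?us"
      then obtain j where "j < n" "u = y [^] j" by auto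
      then show "z \<otimes> u \<in> lspan ?us" using low'[OF that(3)] by simp
    qed simp
  qed
  have bQ: "?b k \<in> Q" "?b k \<otimes> y \<in> Q" if "k \<le> n" for k
  proof -
    have "?b k \<in> Q \<and> ?b k \<otimes> y \<in> Q"
    proof (cases "n = 0")
      case True
      then have "?b k = \<zero>" using that by simp
      then show ?thesis using Q y by (simp add: prime_of_def)
    next
      case False
      then have "?b k \<in> integral_closure E A" using int[OF _ bc low[OF that]] by simp
      moreover have "?b k \<otimes> y \<in> integral_closure E A"
      proof (rule int)
        show "0 < n" using False by simp
        show "?b k \<otimes> y \<in> carrier E" by (rule m_closed[OF bc y])
        fix j assume "j < n"
        then have "?b k \<otimes> y [^] Suc j \<in> lowdeg y n" by (intro low[OF that]) simp
        then show "?b k \<otimes> y \<otimes> y [^] j \<in> lowdeg y n"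
          using m_assoc[OF bc y nat_pow_closed[OF y], of k j] nat_pow_Suc2[OF y, of j] by (simp only:)
      qed
      ultimately show ?thesis using neg by blast
    qed
    then show "?b k \<in> Q" "?b k \<otimes> y \<in> Q" by auto
  qed
  obtain i where i: "i < length q" "q ! i = c" using c by (auto simp: in_set_conv_nth)
  have cc: "c \<in> carrier E" using c qc by auto
  have "?b (Suc i) = ?b i \<otimes> y \<oplus> c"
    using i cc qc set_take_subset[of i q] y by (simp add: take_Suc_conv_app_nth eval_append_aux)
  then have "c = ?b (Suc i) \<oplus> (\<ominus> \<one>) \<otimes> (?b i \<otimes> y)"
    using cc bc[of i] y by (simp add: l_minus) algebra
  moreover have "?b (Suc i) \<in> Q"
  proof (cases "i = n")
    case True
    then have "?b (Suc i) = \<zero>" using n q by simp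
    then show ?thesis using Q by (simp add: prime_of_def)
  qed (use bQ i n in auto)
  moreover have "(\<ominus> \<one>) \<otimes> (?b i \<otimes> y) \<in> Q" using bQ(2)[of i] i n Q A_integral[OF A_neg[OF A_one]]
    unfolding prime_of_def by auto
  ultimately show False using c Q unfolding prime_of_def by auto
qed

end

section \<open>Primes above a principal prime\<close>

lemma (in domain) pow_nonzero: "\<lbrakk>x \<in> carrier R; x \<noteq> \<zero>\<rbrakk> \<Longrightarrow> x [^] (k::nat) \<noteq> \<zero>"
  by (induction k) (auto simp: integral_iff)

context field_subring begin

lemma integral_eval:
  assumes "set q \<subseteq> integral_closure E A" "b \<in> integral_closure E A"
  shows "eval q b \<in> integral_closure E A"
  using assms(1)
proof (induction q rule: rev_induct)
  case Nil
  then show ?case using A_integral by simp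
next
  case (snoc a q)
  have "eval (q @ [a]) b = eval q b \<otimes> b \<oplus> a"
    using snoc.prems integral_carrier assms(2) by (intro eval_append_aux) auto
  then show ?case using snoc integral_sum_prod assms(2) by auto
qed

text \<open>In a monic relation for \<open>b\<close> with constant term \<open>a\<close>, the other
  terms are \<open>b\<close> times an integral element, so that minus \<open>a\<close> is a multiple
  of \<open>b\<close>. A zero constant term is removed by dividing the relation by \<open>b\<close>,
  which shortens the list.\<close>

lemma integral_nonzero_multiple:
  assumes b: "b \<in> integral_closure E A" "b \<noteq> \<zero>"
  shows "\<exists>c\<in>integral_closure E A. b \<otimes> c \<in> A \<and> b \<otimes> c \<noteq> \<zero>"
proof -
  have bc: "b \<in> carrier E" using b integral_carrier by simp
  obtain q where q: "set q \<subseteq> A" "eval (\<one> # q) b = \<zero>" using b bc integral_closure_iff by auto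
  then show ?thesis
  proof (induction q rule: rev_induct)
    case Nil
    then show ?case by simp
  next
    case (snoc a q)
    let ?c = "eval (\<one> # q) b"
    have c: "?c \<in> integral_closure E A"
      using snoc.prems A_integral by (intro integral_eval b) auto
    have cc: "?c \<in> carrier E" using c by (rule integral_carrier)
    have a: "a \<in> A" "set q \<subseteq> A" using snoc.prems by auto
    have "eval ((\<one> # q) @ [a]) b = ?c \<otimes> b \<oplus> a"
      using snoc.prems A_carrier bc by (intro eval_append_aux) auto
    then have "?c \<otimes> b \<oplus> a = \<zero>" using snoc.prems(2) by simp
    then have eq: "b \<otimes> ?c = \<ominus> a"
      using sum_zero_eq_neg[OF m_closed[OF cc bc] A_in[OF a(1)]] m_comm[OF bc cc] by simp
    show ?case
    proof (cases "a = \<zero>")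
      case True
      then have "?c = \<zero>" using eq integral[OF _ bc cc] b(2) by simp
      then show ?thesis using snoc.IH a by blast
    next
      case False
      then have "\<ominus> a \<noteq> \<zero>" using a(1) by (metis A_in minus_minus minus_zero)
      then show ?thesis using eq a c by (intro bexI[of _ ?c]) simp_all
    qed
  qed
qed

end

text \<open>Serves twice: for \<open>A\<close> in the large field with \<open>f\<close> a generator
  of a height-one prime, and for the image of \<open>A\<close> in a residue field with
  \<open>f\<close> the image of a uniformizer. The assumption \<open>dependent\<close> expresses a
  degree at most \<open>n\<close> over the fractions of \<open>A\<close> by relations with
  coefficients in \<open>A\<close>; \<open>separated\<close> stands for Krull's intersection
  theorem.\<close>

locale prime_over_principal = field_subring +
  fixes f Q and n :: nat
  assumes f: "f \<in> A" "f \<noteq> \<zero>"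
    and prime_f: "prime_of E A {f \<otimes> a | a. a \<in> A}"
    and separated: "\<And>a. \<lbrakk>a \<in> A; a \<noteq> \<zero>\<rbrakk> \<Longrightarrow> \<exists>k::nat. \<forall>b\<in>A. a \<noteq> f [^] k \<otimes> b"
    and dependent: "\<And>ys. \<lbrakk>length ys = Suc n; set ys \<subseteq> carrier E\<rbrakk> \<Longrightarrow>
      \<exists>as. length as = Suc n \<and> set as \<subseteq> A \<and> \<not> set as \<subseteq> {\<zero>} \<and> combine as ys = \<zero>"
    and Q: "prime_of E (integral_closure E A) Q" "Q \<inter> A = {f \<otimes> a | a. a \<in> A}"
begin

abbreviation "B \<equiv> integral_closure E A"
abbreviation "P \<equiv> {f \<otimes> a | a. a \<in> A}"

lemmas B_in = integral_carrier
lemma B_mult: "\<lbrakk>x \<in> B; y \<in> B\<rbrakk> \<Longrightarrow> x \<otimes> y \<in> B" by (rule integral_sum_prod)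
lemma B_add: "\<lbrakk>x \<in> B; y \<in> B\<rbrakk> \<Longrightarrow> x \<oplus> y \<in> B" by (rule integral_sum_prod)
lemma Q_B: "x \<in> Q \<Longrightarrow> x \<in> B" using Q by (auto simp: prime_of_def)
lemma Q_in: "x \<in> Q \<Longrightarrow> x \<in> carrier E" using Q_B B_in by blast
lemma Q_add: "\<lbrakk>x \<in> Q; y \<in> Q\<rbrakk> \<Longrightarrow> x \<oplus> y \<in> Q" using Q by (auto simp: prime_of_def)
lemma Q_mult: "\<lbrakk>b \<in> B; x \<in> Q\<rbrakk> \<Longrightarrow> b \<otimes> x \<in> Q" using Q by (auto simp: prime_of_def)
lemma Q_prime: "\<lbrakk>a \<in> B; b \<in> B; a \<otimes> b \<in> Q\<rbrakk> \<Longrightarrow> a \<in> Q \<or> b \<in> Q" using Q by (auto simp: prime_of_def)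
lemma Q_one: "\<one> \<notin> Q" using Q by (auto simp: prime_of_def)
lemma Q_zero: "\<zero> \<in> Q" using Q by (auto simp: prime_of_def)
lemma P_iff: "a \<in> A \<Longrightarrow> a \<in> P \<longleftrightarrow> a \<in> Q" using Q by blast
lemma f_in: "f \<in> carrier E" using f by simp

text \<open>The localization of \<open>B\<close> at \<open>Q\<close>, described by possible
  denominators, and in \<open>mloc\<close> its maximal ideal in the same form; no representation as
  a fraction has to be chosen.\<close>

definition "loc = {x \<in> carrier E. \<exists>s\<in>B. s \<notin> Q \<and> s \<otimes> x \<in> B}"
definition "mloc = {x \<in> carrier E. \<exists>s\<in>B. s \<notin> Q \<and> s \<otimes> x \<in> Q}"

lemma loc_in: "x \<in> loc \<Longrightarrow> x \<in> carrier E" by (simp add: loc_def)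

lemma mloc_loc: "x \<in> mloc \<Longrightarrow> x \<in> loc" using Q_B by (auto simp: loc_def mloc_def)

lemma mloc_in: "x \<in> mloc \<Longrightarrow> x \<in> carrier E" by (simp add: mloc_def)

lemma nonQ: "s \<in> B \<Longrightarrow> s \<notin> Q \<Longrightarrow> s \<noteq> \<zero>" using Q_zero by auto

lemma localization_eq: "localization E B Q = loc"
proof
  show "localization E B Q \<subseteq> loc"
  proof
    fix x assume "x \<in> localization E B Q"
    then obtain a s where *: "x = a \<otimes> inv s" "a \<in> B" "s \<in> B" "s \<notin> Q" by (auto simp: localization_def)
    then have c: "a \<in> carrier E" "s \<in> carrier E" "s \<noteq> \<zero>" using B_in nonQ by auto
    then have i: "inv s \<in> carrier E" "s \<otimes> inv s = \<one>" by (auto simp: field_Units)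
    then have "s \<otimes> x = a" using c unfolding * by (simp add: m_lcomm)
    then show "x \<in> loc" using * c i by (auto simp: loc_def)
  qed
  show "loc \<subseteq> localization E B Q"
  proof
    fix x assume "x \<in> loc"
    then obtain s where s: "s \<in> B" "s \<notin> Q" "s \<otimes> x \<in> B" and x: "x \<in> carrier E" by (auto simp: loc_def)
    then have c: "s \<in> carrier E" "s \<noteq> \<zero>" using B_in nonQ by auto
    then have i: "inv s \<in> carrier E" "s \<otimes> inv s = \<one>" by (auto simp: field_Units)
    have "(s \<otimes> x) \<otimes> inv s = (s \<otimes> inv s) \<otimes> x" using c i(1) x by (simp add: m_ac)
    then have "x = (s \<otimes> x) \<otimes> inv s" using x i by simp
    then show "x \<in> localization E B Q" using s unfolding localization_def by blast
  qed
qed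

lemma B_loc: "b \<in> B \<Longrightarrow> b \<in> loc"
  using B_in A_integral Q_one by (auto simp: loc_def intro!: bexI[of _ \<one>])

lemma Q_mloc: "b \<in> Q \<Longrightarrow> b \<in> mloc"
  using Q_in A_integral Q_one by (auto simp: mloc_def intro!: bexI[of _ \<one>])

lemma mloc_B: "b \<in> mloc \<Longrightarrow> b \<in> B \<Longrightarrow> b \<in> Q"
  using Q_prime by (auto simp: mloc_def)

lemma loc_ops:
  assumes "x \<in> loc" "y \<in> loc" shows "x \<otimes> y \<in> loc" "x \<oplus> y \<in> loc"
    and "y \<in> mloc \<Longrightarrow> x \<otimes> y \<in> mloc" and "x \<in> mloc \<Longrightarrow> y \<in> mloc \<Longrightarrow> x \<oplus> y \<in> mloc"
proof -
  have x: "x \<in> carrier E" and y: "y \<in> carrier E" using assms loc_in by auto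
  have gen: "(s \<otimes> t) \<otimes> (x \<otimes> y) = (s \<otimes> x) \<otimes> (t \<otimes> y)" "(s \<otimes> t) \<otimes> (x \<oplus> y) = t \<otimes> (s \<otimes> x) \<oplus> s \<otimes> (t \<otimes> y)"
    if "s \<in> B" "t \<in> B" for s t
  proof -
    have "s \<in> carrier E" "t \<in> carrier E" using that B_in by auto
    then show "(s \<otimes> t) \<otimes> (x \<otimes> y) = (s \<otimes> x) \<otimes> (t \<otimes> y)"
      "(s \<otimes> t) \<otimes> (x \<oplus> y) = t \<otimes> (s \<otimes> x) \<oplus> s \<otimes> (t \<otimes> y)" using x y by algebra+
  qed
  obtain s where s: "s \<in> B" "s \<notin> Q" "s \<otimes> x \<in> B" using assms by (auto simp: loc_def)
  obtain t where t: "t \<in> B" "t \<notin> Q" "t \<otimes> y \<in> B" using assms by (auto simp: loc_def)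
  have st: "s \<otimes> t \<in> B" "s \<otimes> t \<notin> Q" using s t B_mult Q_prime by auto
  show "x \<otimes> y \<in> loc"
    using st x y gen[OF s(1) t(1)] B_mult[OF s(3) t(3)] unfolding loc_def by (auto intro!: bexI[of _ "s \<otimes> t"])
  show "x \<oplus> y \<in> loc"
    using st x y gen[OF s(1) t(1)] B_add[OF B_mult[OF t(1) s(3)] B_mult[OF s(1) t(3)]]
    unfolding loc_def by (auto intro!: bexI[of _ "s \<otimes> t"])
  show "x \<otimes> y \<in> mloc" if m: "y \<in> mloc"
  proof -
    obtain t where t: "t \<in> B" "t \<notin> Q" "t \<otimes> y \<in> Q" using m by (auto simp: mloc_def)
    have st: "s \<otimes> t \<in> B" "s \<otimes> t \<notin> Q" using s t B_mult Q_prime by auto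
    show ?thesis
      using st x y gen[OF s(1) t(1)] Q_mult[OF s(3) t(3)] unfolding mloc_def by (auto intro!: bexI[of _ "s \<otimes> t"])
  qed
  show "x \<oplus> y \<in> mloc" if m: "x \<in> mloc" "y \<in> mloc"
  proof -
    obtain t where t: "t \<in> B" "t \<notin> Q" "t \<otimes> y \<in> Q" using m by (auto simp: mloc_def)
    obtain s where s: "s \<in> B" "s \<notin> Q" "s \<otimes> x \<in> Q" using m by (auto simp: mloc_def)
    have st: "s \<otimes> t \<in> B" "s \<otimes> t \<notin> Q" using s t B_mult Q_prime by auto
    show ?thesis
      using st x y gen[OF s(1) t(1)] Q_add[OF Q_mult[OF t(1) s(3)] Q_mult[OF s(1) t(3)]]
      unfolding mloc_def by (auto intro!: bexI[of _ "s \<otimes> t"])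
  qed
qed

lemma A_loc: "a \<in> A \<Longrightarrow> a \<in> loc" using A_integral B_loc by blast
lemma one_loc: "\<one> \<in> loc" by (simp add: A_loc)
lemma zero_mloc: "\<zero> \<in> mloc" by (simp add: Q_mloc Q_zero)
lemma one_mloc: "\<one> \<notin> mloc" using mloc_B A_integral Q_one A_one by blast
lemma f_mloc: "f \<in> mloc" using Q f by (intro Q_mloc) (metis (mono_tags, lifting) A_one Int_iff f_in mem_Collect_eq r_one)

lemma loc_neg: "x \<in> loc \<Longrightarrow> \<ominus> x \<in> loc"
  using loc_ops(1)[of "\<ominus> \<one>" x] A_loc[of "\<ominus> \<one>"] loc_in[of x] by (simp add: l_minus)

lemma mloc_neg: "x \<in> mloc \<Longrightarrow> \<ominus> x \<in> mloc"
  using loc_ops(3)[of "\<ominus> \<one>" x] A_loc[of "\<ominus> \<one>"] mloc_loc[of x] loc_in[of x] by (simp add: l_minus)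

lemma subring_loc: "subring loc E"
  by (rule subringI) (use loc_in one_loc loc_neg loc_ops in auto)

lemma loc_pow: "x \<in> loc \<Longrightarrow> x [^] (k::nat) \<in> loc"
  by (induction k) (auto simp: one_loc loc_ops)

lemma loc_unit:
  assumes "x \<in> loc" "x \<notin> mloc" shows "x \<noteq> \<zero>" "inv x \<in> loc" "inv x \<notin> mloc" "x \<otimes> inv x = \<one>"
proof -
  show nz: "x \<noteq> \<zero>" using assms zero_mloc by auto
  have x: "x \<in> carrier E" using assms loc_in by auto
  with nz show i: "x \<otimes> inv x = \<one>" by (auto simp: field_Units)
  have ic: "inv x \<in> carrier E" using x nz by (auto simp: field_Units)
  obtain s where s: "s \<in> B" "s \<notin> Q" "s \<otimes> x \<in> B" using assms by (auto simp: loc_def)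
  then have n: "s \<otimes> x \<notin> Q" using assms x by (auto simp: mloc_def)
  have "(s \<otimes> x) \<otimes> inv x = s" using s(1) x ic i B_in[of s] by (simp add: m_assoc)
  then show il: "inv x \<in> loc" using s n ic unfolding loc_def by (auto intro!: bexI[of _ "s \<otimes> x"])
  show "inv x \<notin> mloc"
    using loc_ops(3)[OF assms(1) il] i one_mloc by auto
qed

text \<open>Divide by the largest power of \<open>f\<close> that divides every coefficient. There is
  one, because by \<open>separated\<close> some power of \<open>f\<close> does not divide a given
  nonzero coefficient.\<close>

lemma primitive_relation:
  assumes "set as \<subseteq> A" "\<not> set as \<subseteq> {\<zero>}"
  shows "\<exists>k bs. as = map (\<lambda>b. f [^] (k::nat) \<otimes> b) bs \<and> set bs \<subseteq> A \<and> \<not> set bs \<subseteq> P"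
proof -
  define D where "D k \<longleftrightarrow> (\<forall>a\<in>set as. \<exists>b\<in>A. a = f [^] (k::nat) \<otimes> b)" for k
  obtain a0 where a0: "a0 \<in> set as" "a0 \<noteq> \<zero>" using assms by auto
  then obtain k0 where k0: "\<not> D k0" using separated[of a0] assms unfolding D_def by blast
  have D0: "D 0" using assms unfolding D_def by fastforce
  have "\<exists>k. D k \<and> \<not> D (Suc k)"
    using k0 D0 by (metis nat_induct)
  then obtain k where k: "D k" "\<not> D (Suc k)" by auto
  obtain g where g: "\<And>a. a \<in> set as \<Longrightarrow> g a \<in> A \<and> a = f [^] k \<otimes> g a" using k(1) unfolding D_def by metis
  have "\<not> set (map g as) \<subseteq> P"
  proof
    assume sub: "set (map g as) \<subseteq> P"
    have "D (Suc k)" unfolding D_def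
    proof
      fix a assume a: "a \<in> set as"
      then obtain c where c: "c \<in> A" "g a = f \<otimes> c" using sub by auto
      then have "a = f [^] Suc k \<otimes> c" using g[OF a] f_in m_assoc[OF nat_pow_closed[OF f_in] f_in A_in[OF c(1)]] by simp
      with c show "\<exists>b\<in>A. a = f [^] Suc k \<otimes> b" by blast
    qed
    with k show False by simp
  qed
  moreover have "as = map (\<lambda>b. f [^] k \<otimes> b) (map g as)" unfolding map_map comp_def
    using g by (intro map_idI[symmetric]) auto
  moreover have "set (map g as) \<subseteq> A" using g by auto
  ultimately show ?thesis by blast
qed

lemma primitive_dependence:
  assumes "length ys = Suc n" "set ys \<subseteq> carrier E"
  shows "\<exists>bs. length bs = Suc n \<and> set bs \<subseteq> A \<and> \<not> set bs \<subseteq> P \<and> combine bs ys = \<zero>"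
proof -
  obtain as where as: "length as = Suc n" "set as \<subseteq> A" "\<not> set as \<subseteq> {\<zero>}" "combine as ys = \<zero>"
    using dependent[OF assms] by auto
  obtain k bs where bs: "as = map (\<lambda>b. f [^] (k::nat) \<otimes> b) bs" "set bs \<subseteq> A" "\<not> set bs \<subseteq> P"
    using primitive_relation[OF as(2,3)] by auto
  have bc: "set bs \<subseteq> carrier E" using bs A_carrier by auto
  have "f [^] k \<otimes> combine bs ys = \<zero>"
    using combine_r_distr[OF bc assms(2) nat_pow_closed[OF f_in], of k] as(4) bs(1) by simp
  moreover have "f [^] k \<noteq> \<zero>" using pow_nonzero[OF f_in f(2)] . 
  ultimately have "combine bs ys = \<zero>"
    using integral[of "f [^] k" "combine bs ys"] combine_in_carrier[OF bc assms(2)] f_in by auto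
  with bs as(1) show ?thesis by (intro exI[of _ bs]) auto
qed

text \<open>The \<open>n + 1\<close> powers of \<open>y\<close> from \<open>\<one>\<close> to
  \<open>y [^] n\<close> satisfy a relation with a coefficient outside \<open>P\<close>, hence
  outside \<open>Q\<close>. So \<open>integral_fraction\<close> yields
  \<open>a \<otimes> y = b\<close> with \<open>a\<close> and \<open>b\<close> in \<open>B\<close>
  not both in \<open>Q\<close>.\<close>

lemma valuation_dichotomy:
  assumes y: "y \<in> carrier E" shows "y \<in> loc \<or> (y \<noteq> \<zero> \<and> inv y \<in> loc)"
proof -
  let ?ys = "exp_base y (Suc n)"
  have len: "length ?ys = Suc n" by (simp add: exp_base_def)
  obtain bs where bs: "length bs = Suc n" "set bs \<subseteq> A" "\<not> set bs \<subseteq> P" "combine bs ?ys = \<zero>"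
    using primitive_dependence[OF len exp_base_closed[OF y]] by auto
  then have "eval bs y = \<zero>" using combine_eq_eval[of bs y] by simp
  moreover obtain c where "c \<in> set bs" "c \<notin> Q" using bs P_iff by blast
  ultimately obtain a b where ab: "a \<in> B" "b \<in> B" "a \<otimes> y = b" "a \<notin> Q \<or> b \<notin> Q"
    using integral_fraction[OF Q(1) y bs(2)] by blast
  show ?thesis
  proof (cases "a \<notin> Q")
    case True
    then show ?thesis using ab y by (auto simp: loc_def)
  next
    case False
    with ab have b: "b \<notin> Q" by auto
    have y0: "y \<noteq> \<zero>" using b Q_zero ab(3) B_in[OF ab(1)] by auto
    then have i: "inv y \<in> carrier E" "y \<otimes> inv y = \<one>" using y by (auto simp: field_Units)
    have "b \<otimes> inv y = a" using ab(3)[symmetric] i y B_in[OF ab(1)] by (simp add: m_assoc)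
    then show ?thesis using y0 b ab i unfolding loc_def by blast
  qed
qed

text \<open>Used for a relation between partial products, with \<open>j\<close> the first index
  whose coefficient is outside \<open>P\<close> and \<open>M\<close> the multiples of the
  \<open>j\<close>-th product by \<open>mloc\<close>.\<close>

lemma combine_split:
  assumes "length bs = length ys" "set bs \<subseteq> carrier E" "set ys \<subseteq> carrier E" "j < length ys"
    and M: "M \<subseteq> carrier E" "\<zero> \<in> M" "\<And>u v. \<lbrakk>u \<in> M; v \<in> M\<rbrakk> \<Longrightarrow> u \<oplus> v \<in> M"
    and "\<And>i. \<lbrakk>i < length ys; i \<noteq> j\<rbrakk> \<Longrightarrow> bs ! i \<otimes> ys ! i \<in> M"
  shows "\<exists>m\<in>M. combine bs ys = m \<oplus> bs ! j \<otimes> ys ! j"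
proof -
  have all: "combine bs ys \<in> M" if "length bs = length ys" "\<And>i. i < length ys \<Longrightarrow> bs ! i \<otimes> ys ! i \<in> M" for bs ys
    using that
  proof (induction bs ys rule: list_induct2)
    case (Cons b bs y ys)
    have "bs ! i \<otimes> ys ! i \<in> M" if "i < length ys" for i using Cons.prems[of "Suc i"] that by simp
    moreover have "b \<otimes> y \<in> M" using Cons.prems[of 0] by simp
    ultimately show ?case using Cons.IH M by simp
  qed (use M in simp)
  show ?thesis using assms(1-4,8)
  proof (induction bs ys arbitrary: j rule: list_induct2)
    case (Cons b bs y ys)
    have c: "b \<in> carrier E" "y \<in> carrier E" "combine bs ys \<in> carrier E"
      using Cons.prems by (auto intro!: combine_in_carrier)
    show ?case
    proof (cases j)
      case 0
      have "bs ! i \<otimes> ys ! i \<in> M" if "i < length ys" for i using Cons.prems(4)[of "Suc i"] that 0 by simp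
      then have "combine bs ys \<in> M" using all Cons.hyps by blast
      then show ?thesis using c 0 by (intro bexI[of _ "combine bs ys"]) (simp_all add: a_comm)
    next
      case (Suc j')
      have "bs ! i \<otimes> ys ! i \<in> M" if "i < length ys" "i \<noteq> j'" for i
        using Cons.prems(4)[of "Suc i"] that Suc by simp
      then obtain m where m: "m \<in> M" "combine bs ys = m \<oplus> bs ! j' \<otimes> ys ! j'"
        using Cons.IH[of j'] Cons.prems Suc by auto
      have "b \<otimes> y \<in> M" using Cons.prems(4)[of 0] Suc by simp
      moreover have "bs ! j' \<in> carrier E" "ys ! j' \<in> carrier E" "m \<in> carrier E"
        using Cons.prems Cons.hyps Suc m M(1) by auto
      ultimately show ?thesis using m c M Suc by (intro bexI[of _ "b \<otimes> y \<oplus> m"]) (auto simp: a_assoc)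
    qed
  qed simp
qed

primrec pp :: "(nat \<Rightarrow> 'a) \<Rightarrow> nat \<Rightarrow> 'a" where
  "pp z 0 = \<one>"
| "pp z (Suc k) = pp z k \<otimes> z k"

lemma pp_loc: "(\<And>i. i < k \<Longrightarrow> z i \<in> mloc) \<Longrightarrow> pp z k \<in> loc"
  by (induction k) (auto simp: one_loc intro!: loc_ops mloc_loc)

lemma pp_le: "(\<And>i. i < k \<Longrightarrow> z i \<in> mloc) \<Longrightarrow> j \<le> k \<Longrightarrow> \<exists>r\<in>loc. pp z k = pp z j \<otimes> r \<and> (j < k \<longrightarrow> r \<in> mloc)"
proof (induction k)
  case 0
  then show ?case using one_loc by (intro bexI[of _ \<one>]) auto
next
  case (Suc k)
  show ?case
  proof (cases "j = Suc k")
    case True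
    then show ?thesis using one_loc loc_in[OF pp_loc[of "Suc k" z]] Suc.prems(1) by (intro bexI[of _ \<one>]) (auto simp del: pp.simps)
  next
    case False
    then obtain r where r: "r \<in> loc" "pp z k = pp z j \<otimes> r" using Suc by auto
    have "z k \<in> mloc" using Suc.prems by auto
    moreover have "pp z j \<in> carrier E" using Suc.prems False by (intro loc_in pp_loc) auto
    ultimately have "r \<otimes> z k \<in> mloc" "pp z (Suc k) = pp z j \<otimes> (r \<otimes> z k)"
      using r mloc_loc loc_ops(3) loc_in mloc_in by (auto simp: m_assoc)
    then show ?thesis using mloc_loc by blast
  qed
qed

text \<open>A factorisation of \<open>f\<close> into more than \<open>n\<close> non-units would give \<open>n + 1\<close> linearly independent
  elements, the partial products.\<close>

lemma chain_bound:
  assumes z: "\<And>i. i < k \<Longrightarrow> z i \<in> mloc" and r: "r \<in> loc" "f = pp z k \<otimes> r"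
  shows "k \<le> n"
proof (rule ccontr)
  assume "\<not> k \<le> n"
  then have k: "Suc n \<le> k" by simp
  let ?ys = "map (pp z) [0..<Suc n]"
  have len: "length ?ys = Suc n" by (simp del: upt_Suc)
  have yl: "pp z j \<in> loc" if "j < Suc n" for j using that k z by (intro pp_loc) auto
  then have yc: "set ?ys \<subseteq> carrier E" using loc_in by (auto simp del: upt_Suc)
  have fj: "\<exists>q\<in>mloc. f = pp z j \<otimes> q" if jn: "j < Suc n" for j
  proof -
    obtain r' where r': "r' \<in> loc" "pp z k = pp z j \<otimes> r'" "r' \<in> mloc" using pp_le[of k z j] z jn k by auto
    then have "r' \<otimes> r \<in> mloc" using r loc_ops(3)[OF r(1) r'(1)] loc_in by (simp add: m_comm)
    moreover have "f = pp z j \<otimes> (r' \<otimes> r)"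
      unfolding r(2) r'(2) using yl[OF jn] r r' loc_in by (intro m_assoc) auto
    ultimately show ?thesis by blast
  qed
  have y0: "pp z j \<noteq> \<zero>" if "j < Suc n" for j using fj[OF that] f(2) mloc_in by auto
  obtain bs where bs: "length bs = Suc n" "set bs \<subseteq> A" "\<not> set bs \<subseteq> P" "combine bs ?ys = \<zero>"
    using primitive_dependence[OF len yc] by blast
  \<comment> \<open>The first coefficient outside \<open>P\<close> dominates: earlier coefficients
    are divisible by \<open>f\<close>, hence by a nonunit times \<open>pp z j\<close>, and later
    products contain at least one more nonunit factor than \<open>pp z j\<close>.\<close>
  define bad where "bad j \<longleftrightarrow> j < Suc n \<and> bs ! j \<notin> P" for j
  obtain b where b: "b \<in> set bs" "b \<notin> P" using bs(3) unfolding subset_eq by blast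
  obtain i where i: "i < length bs" "bs ! i = b" using b(1) unfolding in_set_conv_nth by (elim exE conjE)
  have "bad i" unfolding bad_def i(2) by (rule conjI[OF i(1)[unfolded bs(1)] b(2)])
  then have "\<exists>j. bad j" by (rule exI)
  then obtain j where j': "bad j" "\<And>i. i < j \<Longrightarrow> \<not> bad i"
    unfolding exists_least_iff[of bad] by blast
  have j: "j < Suc n" "bs ! j \<notin> P"
    using conjunct1[OF j'(1)[unfolded bad_def]] conjunct2[OF j'(1)[unfolded bad_def]] .
  have j3: "bs ! i \<in> P" if "i < j" for i
  proof (rule ccontr)
    assume "bs ! i \<notin> P"
    then have "bad i" unfolding bad_def by (rule conjI[OF less_trans[OF that j(1)]])
    with j'(2)[OF that] show False by contradiction
  qed
  let ?M = "{pp z j \<otimes> q | q. q \<in> mloc}"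
  have bA: "bs ! i \<in> A" if "i < Suc n" for i using bs that by (metis nth_mem subsetD)
  have pj: "pp z j \<in> carrier E" using yl[OF j(1)] loc_in by simp
  have "\<exists>m\<in>?M. combine bs ?ys = m \<oplus> bs ! j \<otimes> ?ys ! j"
  proof (rule combine_split)
    show "length bs = length ?ys" "j < length ?ys" using bs j by (simp_all del: upt_Suc)
    show "set bs \<subseteq> carrier E" using bs A_carrier by auto
    show "set ?ys \<subseteq> carrier E" by (rule yc)
    show "?M \<subseteq> carrier E" using pj mloc_in by auto
    show "\<zero> \<in> ?M" using zero_mloc pj by (auto intro!: exI[of _ \<zero>])
    show "u \<oplus> v \<in> ?M" if uv: "u \<in> ?M" "v \<in> ?M" for u v
    proof -
      obtain q q' where "u = pp z j \<otimes> q" "v = pp z j \<otimes> q'" "q \<in> mloc" "q' \<in> mloc" using uv by auto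
      then have "u \<oplus> v = pp z j \<otimes> (q \<oplus> q')" "q \<oplus> q' \<in> mloc"
        using pj mloc_in loc_ops(4) mloc_loc by (auto simp: r_distr)
      then show ?thesis by blast
    qed
    fix i assume i: "i < length ?ys" "i \<noteq> j"
    then have i': "i < Suc n" by (simp del: upt_Suc)
    have ysi: "?ys ! i = pp z i" using i' by (simp del: upt_Suc)
    have pi: "pp z i \<in> carrier E" using yl[OF i'] loc_in by simp
    show "bs ! i \<otimes> ?ys ! i \<in> ?M"
    proof (cases "i < j")
      case True
      then obtain a where a: "a \<in> A" "bs ! i = f \<otimes> a" using j3[OF True] unfolding mem_Collect_eq by blast
      obtain q where q: "q \<in> mloc" "f = pp z j \<otimes> q" using fj[OF j(1)] by auto
      have "(a \<otimes> pp z i) \<otimes> q \<in> mloc"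
        using loc_ops(3)[OF loc_ops(1)[OF A_loc[OF a(1)] yl[OF i']] mloc_loc[OF q(1)] q(1)] .
      moreover have "bs ! i \<otimes> ?ys ! i = pp z j \<otimes> ((a \<otimes> pp z i) \<otimes> q)"
      proof -
        have "a \<in> carrier E" "q \<in> carrier E" using a q mloc_in by auto
        then show ?thesis unfolding ysi a(2) q(2) using pi pj by algebra
      qed
      ultimately show ?thesis by blast
    next
      case False
      then have "j < i" using i by simp
      then obtain r' where r': "pp z i = pp z j \<otimes> r'" "r' \<in> mloc" using pp_le[of i z j] z i' k by auto
      have "bs ! i \<otimes> r' \<in> mloc" using loc_ops(3)[OF A_loc[OF bA[OF i']] mloc_loc[OF r'(2)] r'(2)] .
      moreover have "bs ! i \<otimes> ?ys ! i = pp z j \<otimes> (bs ! i \<otimes> r')"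
        unfolding ysi r'(1) using pj mloc_in[OF r'(2)] A_in[OF bA[OF i']] by (simp add: m_lcomm)
      ultimately show ?thesis by blast
    qed
  qed
  then obtain q where q: "q \<in> mloc" "pp z j \<otimes> q \<oplus> bs ! j \<otimes> pp z j = \<zero>"
    using bs(4) j(1) by (auto simp del: upt_Suc)
  have c: "q \<in> carrier E" "bs ! j \<in> carrier E" using q mloc_in A_in[OF bA[OF j(1)]] by auto
  \<comment> \<open>Cancelling \<open>pp z j\<close> puts \<open>bs ! j\<close> into
    \<open>mloc\<close>, and \<open>mloc\<close> meets \<open>A\<close> in \<open>P\<close>, against
    the choice of \<open>j\<close>.\<close>
  have "pp z j \<otimes> (q \<oplus> bs ! j) = \<zero>" using q(2) c pj by (simp add: r_distr m_comm)
  then have "q \<oplus> bs ! j = \<zero>" using integral[OF _ pj] c y0[OF j(1)] by auto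
  then have "bs ! j = \<ominus> q" using c by (metis minus_equality minus_minus)
  then have "bs ! j \<in> mloc" using mloc_neg[OF q(1)] by simp
  then have "bs ! j \<in> Q" using mloc_B A_integral bA[OF j(1)] by blast
  then have "bs ! j \<in> P" by (rule iffD2[OF P_iff[OF bA[OF j(1)]]])
  with j(2) show False by contradiction
qed

text \<open>Take a factorisation of \<open>f\<close> with the maximal number \<open>e\<close> of
  nonunits, which exists by \<open>chain_bound\<close>. Its first factor divides every nonunit
  \<open>q\<close>: otherwise, by \<open>valuation_dichotomy\<close>, it would be \<open>q\<close>
  times a nonunit, and the factorisation could be lengthened. The cofactor \<open>u\<close> is a
  unit for the same reason.\<close>

lemma uniformizer_exists:
  "\<exists>w e u. w \<in> mloc \<and> w \<noteq> \<zero> \<and> 1 \<le> e \<and> e \<le> n \<and> (\<forall>q\<in>mloc. \<exists>r\<in>loc. q = w \<otimes> r) \<and>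
     u \<in> loc \<and> u \<notin> mloc \<and> f = w [^] (e::nat) \<otimes> u"
proof -
  define S where "S = {k. \<exists>z r. (\<forall>i<k. z i \<in> mloc) \<and> r \<in> loc \<and> f = pp z k \<otimes> r}"
  have fin: "finite S" using chain_bound by (intro finite_subset[of S "{..n}"]) (auto simp: S_def)
  have one: "1 \<in> S" using f_mloc f_in one_loc unfolding S_def
    by (intro CollectI exI[of _ "\<lambda>_. f"] exI[of _ \<one>]) simp
  define e where "e = Max S"
  have eS: "e \<in> S" and eM: "\<And>k. k \<in> S \<Longrightarrow> k \<le> e" using fin one unfolding e_def by (auto intro: Max_in)
  have e1: "1 \<le> e" using eM one by simp
  obtain z r where z: "\<forall>i<e. z i \<in> mloc" and r: "r \<in> loc" "f = pp z e \<otimes> r" using eS unfolding S_def by auto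
  have en: "e \<le> n" using chain_bound[of e z r] z r by auto
  have ppS: "pp z' (Suc k) = z' 0 \<otimes> pp (\<lambda>i. z' (Suc i)) k" if "\<And>i. i < Suc k \<Longrightarrow> z' i \<in> carrier E" for z' k
    using that
  proof (induction k)
    case (Suc k)
    have "pp (\<lambda>i. z' (Suc i)) k \<in> carrier E"
    proof -
      have "m \<le> k \<Longrightarrow> pp (\<lambda>i. z' (Suc i)) m \<in> carrier E" for m
        using Suc.prems by (induction m) auto
      then show ?thesis by simp
    qed
    then show ?case using Suc.IH Suc.prems by (simp add: m_assoc)
  qed simp
  obtain e' where e': "e = Suc e'" using e1 by (cases e) auto
  let ?w = "z 0" let ?z' = "\<lambda>i. z (Suc i)"
  have wm: "?w \<in> mloc" using z e1 by auto
  have wc: "?w \<in> carrier E" using wm mloc_in by simp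
  have z'm: "?z' i \<in> mloc" if "i < e'" for i using z that e' by auto
  have "pp z e = ?w \<otimes> pp ?z' e'" unfolding e' by (rule ppS) (use mloc_in z e' in blast)
  then have fw: "f = ?w \<otimes> pp ?z' e' \<otimes> r" using r(2) by (simp only:)
  have ppl: "pp ?z' e' \<in> loc" by (rule pp_loc) (rule z'm)
  have w0: "?w \<noteq> \<zero>"
  proof
    assume "?w = \<zero>"
    then have "f = \<zero>" unfolding fw using loc_in[OF ppl] loc_in[OF r(1)] by simp
    with f(2) show False ..
  qed
  have div: "\<exists>s\<in>loc. q = ?w \<otimes> s" if q: "q \<in> mloc" for q
  proof (cases "q = \<zero>")
    case True
    then show ?thesis using wc zero_mloc mloc_loc by (intro bexI[of _ \<zero>]) auto
  next
    case False
    have qc: "q \<in> carrier E" using q mloc_in by simp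
    have iw: "inv ?w \<in> carrier E" "?w \<otimes> inv ?w = \<one>" using wc w0 by (auto simp: field_Units)
    have iq: "inv q \<in> carrier E" "q \<otimes> inv q = \<one>" using qc False by (auto simp: field_Units)
    let ?y = "q \<otimes> inv ?w"
    have qy: "q = ?w \<otimes> ?y" using qc wc iw by (simp add: m_lcomm)
    show ?thesis
    proof (cases "?y \<in> loc")
      case True
      then show ?thesis using qy by blast
    next
      case F: False
      have yc: "?y \<in> carrier E" using qc iw by simp
      then have y0: "?y \<noteq> \<zero>" and iy: "inv ?y \<in> loc" using valuation_dichotomy F by auto
      have yi: "?y \<otimes> inv ?y = \<one>" "inv ?y \<in> carrier E" using yc y0 by (auto simp: field_Units)
      let ?t = "inv ?y"
      have wq: "?w = q \<otimes> ?t"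
      proof -
        have "q \<otimes> ?t = (?w \<otimes> ?y) \<otimes> ?t" using qy by simp
        also have "\<dots> = ?w" using wc yc yi by (simp add: m_assoc)
        finally show ?thesis by simp
      qed
      have tm: "?t \<notin> mloc"
      proof
        assume tm: "?t \<in> mloc"
        \<comment> \<open>The first factor \<open>?w\<close> is replaced by the two nonunits
          \<open>q\<close> and \<open>?t\<close>; the other factors move up by one place.\<close>
        let ?x = "\<lambda>i. if i = 0 then q else if i = 1 then ?t else ?z' (i - 2)"
        have x: "?x i \<in> mloc" if "i < Suc e" for i
        proof -
          have "i - 2 < e'" if "i \<noteq> 0" "i \<noteq> 1" using that \<open>i < Suc e\<close> e' by simp
          then show ?thesis using q tm z'm by simp
        qed
        have "pp ?x (Suc e) = ?x 0 \<otimes> pp (\<lambda>i. ?x (Suc i)) e"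
          by (rule ppS) (rule mloc_in[OF x])
        also have "pp (\<lambda>i. ?x (Suc i)) e = ?x (Suc 0) \<otimes> pp (\<lambda>i. ?x (Suc (Suc i))) e'"
          unfolding e' by (rule ppS) (use mloc_in[OF x] e' in blast)
        also have "(\<lambda>i. ?x (Suc (Suc i))) = ?z'" by simp
        finally have "pp ?x (Suc e) = q \<otimes> (?t \<otimes> pp ?z' e')"
          by (simp only: if_True if_False refl Suc_not_Zero One_nat_def)
        moreover have "?w \<otimes> pp ?z' e' = q \<otimes> (?t \<otimes> pp ?z' e')"
          using m_assoc[OF qc yi(2) loc_in[OF ppl]] wq by metis
        ultimately have "f = pp ?x (Suc e) \<otimes> r" using fw by (simp only:)
        moreover have "\<forall>i<Suc e. ?x i \<in> mloc" by (intro allI impI) (rule x)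
        ultimately have "Suc e \<in> S" using r(1) unfolding S_def
          by (intro CollectI exI[of _ ?x] exI[of _ r] conjI)
        from eM[OF this] show False by simp
      qed
      then have "?y \<in> loc" using loc_unit[OF iy tm] yc y0 by (simp add: field_Units)
      then show ?thesis using F by simp
    qed
  qed
  have "\<exists>s\<in>loc. pp z k = ?w [^] k \<otimes> s" if "k \<le> e" for k
    using that
  proof (induction k)
    case 0
    then show ?case using one_loc by (intro bexI[of _ \<one>]) auto
  next
    case (Suc k)
    then obtain s where s: "s \<in> loc" "pp z k = ?w [^] k \<otimes> s" by auto
    obtain t where t: "t \<in> loc" "z k = ?w \<otimes> t" using div[of "z k"] z Suc.prems by auto
    have "pp z (Suc k) = ?w [^] Suc k \<otimes> (s \<otimes> t)"
    proof -
      have "?w [^] k \<in> carrier E" "s \<in> carrier E" "t \<in> carrier E" using wc s t loc_in by auto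
      then show ?thesis unfolding pp.simps s(2) t(2) nat_pow_Suc using wc by algebra
    qed
    then show ?case using loc_ops(1)[OF s(1) t(1)] by blast
  qed
  then obtain s where s: "s \<in> loc" "pp z e = ?w [^] e \<otimes> s" by auto
  let ?u = "s \<otimes> r"
  have ul: "?u \<in> loc" using loc_ops s r by simp
  have fu: "f = ?w [^] e \<otimes> ?u" using r(2) s wc loc_in[OF s(1)] loc_in[OF r(1)] by (simp add: m_assoc)
  have "?u \<notin> mloc"
  proof
    assume um: "?u \<in> mloc"
    let ?x = "\<lambda>i. if i < e then ?w else ?u"
    have "pp ?x k = ?w [^] k" if "k \<le> e" for k using that by (induction k) auto
    then have "f = pp ?x (Suc e) \<otimes> \<one>" using fu wc loc_in[OF ul] by simp
    moreover have "\<forall>i<Suc e. ?x i \<in> mloc" using wm um by simp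
    ultimately have "Suc e \<in> S" using one_loc unfolding S_def
      by (intro CollectI exI[of _ ?x] exI[of _ \<one>] conjI)
    from eM[OF this] show False by simp
  qed
  with wm w0 e1 en div ul fu show ?thesis by blast
qed

end

section \<open>Powers of principal ideals, valuations and the ramification index\<close>

lemma (in cring) nat_pow_carrier_update: "x [^]\<^bsub>R\<lparr>carrier := H\<rparr>\<^esub> (k::nat) = x [^] k"
  by (simp add: nat_pow_def)

lemma (in cring) ideals_set_cgenideal_pow:
  assumes w: "w \<in> carrier R"
  shows "(PIdl w) [^]\<^bsub>ideals_set R\<^esub> (k::nat) = PIdl (w [^] k)"
proof (induction k)
  case 0
  have "PIdl \<one> = carrier R" unfolding cgenideal_def by (auto, metis r_one)
  then show ?case by (simp add: ideals_set_def nat_pow_def)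
next
  case (Suc k)
  interpret I: comm_monoid "ideals_set R" by (rule ideals_set_is_comm_monoid)
  have "(PIdl w) [^]\<^bsub>ideals_set R\<^esub> Suc k = ideal_prod R (PIdl (w [^] k)) (PIdl w)"
    using Suc by (simp add: ideals_set_def nat_pow_def)
  also have "\<dots> = Idl (PIdl (w [^] k) <#> PIdl w)"
    using w by (intro ideal_prod_eq_genideal cgenideal_ideal) auto
  also have "\<dots> = Idl (PIdl (w [^] Suc k))"
    using w by (subst cgenideal_prod) auto
  also have "\<dots> = PIdl (w [^] Suc k)"
    using w cgenideal_ideal[of "w [^] Suc k"] genideal_minimal[of "PIdl (w [^] Suc k)" "PIdl (w [^] Suc k)"]
      genideal_self[of "PIdl (w [^] Suc k)"] additive_subgroup.a_subset[OF ideal.axioms(1)]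
    by (intro equalityI) auto
  finally show ?case .
qed

context prime_over_principal begin

text \<open>A uniformizer \<open>w\<close> of \<open>loc\<close> with \<open>f\<close> equal to
  \<open>w [^] e\<close> times the unit \<open>u\<close>; \<open>ramification_index_unif\<close>
  identifies \<open>e\<close>. The inequality \<open>e \<le> n\<close> is what makes the final
  estimate uniform.\<close>

definition unif where
  "unif w e u \<longleftrightarrow> w \<in> mloc \<and> w \<noteq> \<zero> \<and> 1 \<le> e \<and> e \<le> n \<and> (\<forall>q\<in>mloc. \<exists>r\<in>loc. q = w \<otimes> r) \<and>
     u \<in> loc \<and> u \<notin> mloc \<and> f = w [^] (e::nat) \<otimes> u"

lemma unif_exists: "\<exists>w e u. unif w e u"
  using uniformizer_exists unfolding unif_def by blast

lemma unit_mult: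
  assumes "x \<in> loc" "x \<notin> mloc" "y \<in> loc" "y \<notin> mloc" shows "x \<otimes> y \<notin> mloc"
proof
  assume "x \<otimes> y \<in> mloc"
  then have "inv x \<otimes> (x \<otimes> y) \<in> mloc"
    by (rule loc_ops(3)[OF loc_unit(2)[OF assms(1,2)] loc_ops(1)[OF assms(1,3)]])
  moreover have "inv x \<otimes> (x \<otimes> y) = y"
    using loc_unit[OF assms(1,2)] loc_in assms m_assoc[of "inv x" x y] m_comm[of "inv x" x] by simp
  ultimately show False using assms by simp
qed

lemma unit_pow: "x \<in> loc \<Longrightarrow> x \<notin> mloc \<Longrightarrow> x [^] (k::nat) \<notin> mloc"
proof (induction k)
  case (Suc k)
  then show ?case using unit_mult[OF loc_pow[of x k]] by simp
qed (simp add: one_mloc)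

text \<open>The left side has valuation exactly \<open>a\<close>, as \<open>r\<close> is a unit, and
  the right side at least \<open>b\<close>; otherwise \<open>r\<close> would be a multiple of
  \<open>w\<close>.\<close>

lemma unif_pow_neq:
  assumes "unif w e u" "r \<in> loc" "r \<notin> mloc" "s \<in> loc" "w [^] (a::nat) \<otimes> r = w [^] (b::nat) \<otimes> s"
  shows "b \<le> a"
proof (rule ccontr)
  assume "\<not> b \<le> a"
  then obtain d where d: "b = a + Suc d" using less_natE not_le by (metis add_Suc_right)
  have w: "w \<in> carrier E" "w \<noteq> \<zero>" "w \<in> mloc" using assms(1) mloc_in unfolding unif_def by auto
  have c: "r \<in> carrier E" "s \<in> carrier E" using assms loc_in by auto
  let ?t = "w [^] d \<otimes> s \<otimes> w"
  have t: "?t \<in> mloc" using loc_ops(3)[OF loc_ops(1)[OF loc_pow[OF mloc_loc[OF w(3)]] assms(4)] mloc_loc[OF w(3)] w(3)] .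
  have "w [^] b \<otimes> s = w [^] a \<otimes> ?t"
    unfolding d using w c by (simp add: nat_pow_mult[symmetric] m_ac)
  then have "w [^] a \<otimes> r = w [^] a \<otimes> ?t" using assms(5) by (simp only:)
  moreover have "w [^] a \<noteq> \<zero>" by (rule pow_nonzero[OF w(1,2)])
  ultimately have "r = ?t" using m_lcancel[of "w [^] a" r ?t] w c mloc_in[OF t] by simp
  with t assms(3) show False by simp
qed

lemma f_pow_unif:
  assumes "unif w e u" shows "f [^] (m::nat) = w [^] (e * m) \<otimes> u [^] m"
proof -
  have c: "w \<in> carrier E" "u \<in> carrier E" "f = w [^] e \<otimes> u"
    using assms mloc_in loc_in unfolding unif_def by auto
  show ?thesis unfolding c(3) using c(1,2) by (simp add: nat_pow_distrib nat_pow_pow)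
qed

text \<open>The left side has valuation exactly \<open>e * m\<close> with \<open>e \<le> n\<close>,
  the right side at least \<open>k\<close>.\<close>

lemma unif_pow_bound:
  assumes "unif w e u" "v \<in> loc" "v \<notin> mloc" "r \<in> loc" "f [^] (m::nat) \<otimes> v = w [^] (k::nat) \<otimes> r"
  shows "k \<le> n * m"
proof -
  have u: "u \<in> loc" "u \<notin> mloc" "e \<le> n" "w \<in> carrier E" using assms mloc_in unfolding unif_def by auto
  have um: "u [^] m \<in> loc" "u [^] m \<notin> mloc" using u loc_pow unit_pow by auto
  have "w [^] (e * m) \<otimes> (u [^] m \<otimes> v) = w [^] k \<otimes> r"
    using assms(5) f_pow_unif[OF assms(1), of m] u(4) loc_in[OF um(1)] loc_in[OF assms(2)] by (simp add: m_assoc)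
  from unif_pow_neq[OF assms(1) loc_ops(1)[OF um(1) assms(2)] unit_mult[OF um assms(2,3)] assms(4) this]
  have "k \<le> e * m" .
  also have "\<dots> \<le> n * m" using u by simp
  finally show ?thesis .
qed

text \<open>Elements of \<open>Q\<close> are multiples of \<open>w\<close> in \<open>loc\<close>,
  and the powers in \<open>ideals_set\<close> consist of sums of products. The inclusion turns the
  congruences that define ramification groups into divisibility by \<open>w [^] k\<close>.\<close>

lemma prime_power_subset:
  assumes "unif w e u" "x \<in> Q [^]\<^bsub>ideals_set (E\<lparr>carrier := B\<rparr>)\<^esub> (k::nat)"
  shows "\<exists>r\<in>loc. x = w [^] k \<otimes> r"
  using assms(2)
proof (induction k arbitrary: x)
  case 0
  then have "x \<in> B" by (simp add: ideals_set_def nat_pow_def)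
  then show ?case using B_in B_loc by (intro bexI[of _ x]) auto
next
  case (Suc k)
  have w: "w \<in> carrier E" "\<And>q. q \<in> mloc \<Longrightarrow> \<exists>r\<in>loc. q = w \<otimes> r"
    using assms(1) mloc_in unfolding unif_def by auto
  have "x \<in> ideal_prod (E\<lparr>carrier := B\<rparr>) (Q [^]\<^bsub>ideals_set (E\<lparr>carrier := B\<rparr>)\<^esub> k) Q"
    using Suc.prems by (simp add: ideals_set_def nat_pow_def)
  then show ?case
  proof (induction x rule: ideal_prod.induct)
    case (prod i j)
    obtain r where r: "r \<in> loc" "i = w [^] k \<otimes> r" using Suc.IH[OF prod(1)] by auto
    obtain s where s: "s \<in> loc" "j = w \<otimes> s" using w(2)[OF Q_mloc[OF prod(2)]] by auto
    have "w [^] k \<in> carrier E" "r \<in> carrier E" "s \<in> carrier E" using w r s loc_in by auto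
    then have "i \<otimes>\<^bsub>E\<lparr>carrier := B\<rparr>\<^esub> j = w [^] Suc k \<otimes> (r \<otimes> s)"
      unfolding r(2) s(2) using w(1) by (simp add: m_ac)
    then show ?case using loc_ops(1)[OF r(1) s(1)] by blast
  next
    case (sum s1 s2)
    then obtain r s where "r \<in> loc" "s1 = w [^] Suc k \<otimes> r" "s \<in> loc" "s2 = w [^] Suc k \<otimes> s" by blast
    then have "s1 \<oplus>\<^bsub>E\<lparr>carrier := B\<rparr>\<^esub> s2 = w [^] Suc k \<otimes> (r \<oplus> s)" "r \<oplus> s \<in> loc"
      using w(1) loc_in loc_ops(2) by (simp_all add: r_distr del: nat_pow_Suc)
    then show ?case by blast
  qed
qed

text \<open>In \<open>loc\<close>, \<open>P\<close> generates the ideal of \<open>f\<close> and of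
  \<open>w [^] e\<close>, and \<open>Q\<close> that of \<open>w\<close>. As the ramification index
  is a definite description, the exponent also has to be unique: equal ideals give divisibility both
  ways, and valuations are compared.\<close>

lemma ramification_index_unif:
  assumes "unif w e u" shows "ramification_index E A P Q = e"
proof -
  let ?R = "E\<lparr>carrier := loc\<rparr>"
  interpret R: cring ?R using subring_loc subcringI' subcring_iff subringE(1) by metis
  have w: "w \<in> mloc" "w \<in> loc" "w \<in> carrier E" "\<And>q. q \<in> mloc \<Longrightarrow> \<exists>r\<in>loc. q = w \<otimes> r"
    and u: "u \<in> loc" "u \<notin> mloc" "f = w [^] e \<otimes> u" "u \<in> carrier E"
    using assms mloc_in mloc_loc loc_in unfolding unif_def by auto
  have fl: "f \<in> loc" using f A_loc by simp
  have PI: "PIdl\<^bsub>?R\<^esub> a = {x \<otimes> a | x. x \<in> loc}" for a by (simp add: cgenideal_def)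
  have P: "genideal ?R P = PIdl\<^bsub>?R\<^esub> f"
  proof
    have "P \<subseteq> PIdl\<^bsub>?R\<^esub> f" unfolding PI using A_loc f_in m_comm by fastforce
    then show "genideal ?R P \<subseteq> PIdl\<^bsub>?R\<^esub> f"
      using R.cgenideal_ideal[of f] fl by (intro R.genideal_minimal) auto
    have Pl: "P \<subseteq> carrier ?R" using f A_loc A_mult by auto
    have "f \<in> P" using f_in by (auto intro!: exI[of _ \<one>])
    then show "PIdl\<^bsub>?R\<^esub> f \<subseteq> genideal ?R P"
      using R.genideal_ideal[OF Pl] R.genideal_self[OF Pl] by (intro R.cgenideal_minimal) auto
  qed
  have Q: "genideal ?R Q = PIdl\<^bsub>?R\<^esub> w"
  proof
    have "Q \<subseteq> PIdl\<^bsub>?R\<^esub> w" unfolding PI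
    proof
      fix q assume "q \<in> Q"
      then obtain r where "r \<in> loc" "q = w \<otimes> r" using w(4) Q_mloc by blast
      then show "q \<in> {x \<otimes> w |x. x \<in> loc}" using w(3) loc_in m_comm by auto
    qed
    then show "genideal ?R Q \<subseteq> PIdl\<^bsub>?R\<^esub> w"
      using R.cgenideal_ideal[of w] w(2) by (intro R.genideal_minimal) auto
    have Ql: "Q \<subseteq> carrier ?R" using Q_B B_loc by auto
    obtain s where s: "s \<in> B" "s \<notin> Q" "s \<otimes> w \<in> Q" using w(1) by (auto simp: mloc_def)
    have sm: "s \<in> loc" "s \<notin> mloc" using s B_loc mloc_B by auto
    interpret I: ideal "genideal ?R Q" ?R by (rule R.genideal_ideal[OF Ql])
    have "s \<otimes> w \<in> genideal ?R Q" using s(3) R.genideal_self[OF Ql] by auto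
    then have "inv s \<otimes> (s \<otimes> w) \<in> genideal ?R Q"
      using I.I_l_closed[of "s \<otimes> w" "inv s"] loc_unit[OF sm] by simp
    moreover have "inv s \<otimes> (s \<otimes> w) = w"
      using loc_unit[OF sm] loc_in sm w(3) m_assoc[of "inv s" s w] m_comm[of "inv s" s] by simp
    ultimately show "PIdl\<^bsub>?R\<^esub> w \<subseteq> genideal ?R Q"
      using R.genideal_ideal[OF Ql] by (intro R.cgenideal_minimal) auto
  qed
  have pow: "genideal ?R Q [^]\<^bsub>ideals_set ?R\<^esub> k = PIdl\<^bsub>?R\<^esub> (w [^] k)" for k :: nat
    unfolding Q using R.ideals_set_cgenideal_pow[of w k] w(2) by (simp add: nat_pow_carrier_update)
  have "(THE k::nat. genideal ?R P = genideal ?R Q [^]\<^bsub>ideals_set ?R\<^esub> k) = e"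
  proof (rule the_equality)
    show "genideal ?R P = genideal ?R Q [^]\<^bsub>ideals_set ?R\<^esub> e"
      unfolding P pow
    proof
      have wl: "w [^] e \<in> loc" using loc_pow w(2) by simp
      have "f = u \<otimes> w [^] e" using u w(3) by (simp add: m_comm)
      then have "f \<in> PIdl\<^bsub>?R\<^esub> (w [^] e)" unfolding PI using u(1) by blast
      then show "PIdl\<^bsub>?R\<^esub> f \<subseteq> PIdl\<^bsub>?R\<^esub> (w [^] e)"
        using R.cgenideal_ideal[of "w [^] e"] wl by (intro R.cgenideal_minimal) auto
      have i: "inv u \<in> loc" "u \<otimes> inv u = \<one>" "inv u \<in> carrier E" using loc_unit[OF u(1,2)] loc_in by auto
      have "inv u \<otimes> f = w [^] e" unfolding u(3) using i u(4) w(3) m_lcomm[of "inv u" "w [^] e" u] m_comm[of "inv u" u] by simp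
      then have "w [^] e \<in> PIdl\<^bsub>?R\<^esub> f"
        unfolding PI by (intro CollectI exI[of _ "inv u"] conjI i(1) sym[of "inv u \<otimes> f"])
      then show "PIdl\<^bsub>?R\<^esub> (w [^] e) \<subseteq> PIdl\<^bsub>?R\<^esub> f"
        using R.cgenideal_ideal[of f] fl by (intro R.cgenideal_minimal) auto
    qed
    fix k :: nat assume k: "genideal ?R P = genideal ?R Q [^]\<^bsub>ideals_set ?R\<^esub> k"
    have "w [^] k \<in> PIdl\<^bsub>?R\<^esub> f"
      using k R.cgenideal_self[of "w [^] k"] loc_pow[OF w(2)] unfolding P pow by simp
    then obtain x where x: "x \<in> loc" "w [^] k = x \<otimes> f" unfolding PI by auto
    have "f \<in> PIdl\<^bsub>?R\<^esub> (w [^] k)" using k R.cgenideal_self[of f] fl unfolding P pow by simp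
    then obtain y where y: "y \<in> loc" "f = y \<otimes> w [^] k" unfolding PI by auto
    have "w [^] k \<otimes> \<one> = w [^] e \<otimes> (x \<otimes> u)"
      using x u w(3) loc_in[OF x(1)] by (simp add: m_lcomm)
    then have "e \<le> k" using unif_pow_neq[OF assms one_loc one_mloc loc_ops(1)[OF x(1) u(1)]] by blast
    moreover have "w [^] e \<otimes> u = w [^] k \<otimes> y"
      using y u w(3) loc_in[OF y(1)] by (metis m_comm nat_pow_closed)
    then have "k \<le> e" using unif_pow_neq[OF assms u(1,2) y(1)] by blast
    ultimately show "k = e" by simp
  qed
  then show ?thesis unfolding ramification_index_def localization_eq Let_def .
qed

text \<open>Separatedness is transferred from \<open>A\<close>, where a nonzero \<open>y\<close> has
  a nonzero multiple. If \<open>f [^] k\<close> is the last power of \<open>f\<close> dividing that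
  multiple in \<open>A\<close>, divisibility by \<open>f [^] Suc k\<close> in \<open>loc\<close>
  puts the cofactor into \<open>mloc\<close>, hence into \<open>P\<close>, which yields one more
  factor \<open>f\<close> in \<open>A\<close>.\<close>

lemma f_adically_separated:
  assumes y: "y \<in> loc" and div: "\<And>k::nat. \<exists>r\<in>loc. y = f [^] k \<otimes> r"
  shows "y = \<zero>"
proof (rule ccontr)
  assume y0: "y \<noteq> \<zero>"
  have yc: "y \<in> carrier E" using y loc_in by simp
  obtain s where s: "s \<in> B" "s \<notin> Q" "s \<otimes> y \<in> B" using y by (auto simp: loc_def)
  have sc: "s \<in> carrier E" "s \<noteq> \<zero>" using s B_in nonQ by auto
  then have "s \<otimes> y \<noteq> \<zero>" using y0 yc integral by auto
  then obtain c where c: "c \<in> B" "s \<otimes> y \<otimes> c \<in> A" "s \<otimes> y \<otimes> c \<noteq> \<zero>"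
    using integral_nonzero_multiple[OF s(3)] by auto
  let ?a = "s \<otimes> y \<otimes> c"
  define D where "D k \<longleftrightarrow> (\<exists>b\<in>A. ?a = f [^] (k::nat) \<otimes> b)" for k
  have "D 0" unfolding D_def using c by (intro bexI[of _ ?a]) auto
  moreover have "\<not> (\<forall>k. D k)" using separated[OF c(2,3)] unfolding D_def by blast
  ultimately obtain k where k: "D k" "\<not> D (Suc k)" by (metis nat_induct)
  obtain b where b: "b \<in> A" "?a = f [^] k \<otimes> b" using k(1) unfolding D_def by auto
  obtain r where r: "r \<in> loc" "y = f [^] Suc k \<otimes> r" using div by blast
  let ?t = "s \<otimes> (r \<otimes> c)"
  have rc: "r \<in> carrier E" "c \<in> carrier E" using r loc_in c(1) B_in by auto
  have t: "?t \<in> loc" by (intro loc_ops B_loc s c r)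
  have "?a = f [^] k \<otimes> (f \<otimes> ?t)"
  proof -
    have "f [^] k \<in> carrier E" using f_in by simp
    then show ?thesis unfolding r(2) nat_pow_Suc using sc(1) rc f_in by algebra
  qed
  then have "f [^] k \<otimes> b = f [^] k \<otimes> (f \<otimes> ?t)" using b(2) by (simp only:)
  then have "b = f \<otimes> ?t"
    using m_lcancel[OF pow_nonzero[OF f_in f(2), of k] nat_pow_closed[OF f_in] A_in[OF b(1)] m_closed[OF f_in loc_in[OF t]]]
    by simp
  then have "b = ?t \<otimes> f" using m_comm[OF f_in loc_in[OF t]] by (simp only:)
  then have "b \<in> mloc" using loc_ops(3)[OF t mloc_loc[OF f_mloc] f_mloc] by (simp only:)
  then have "b \<in> P" using P_iff[OF b(1)] mloc_B A_integral b(1) by blast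
  then obtain b' where b': "b' \<in> A" "b = f \<otimes> b'" by auto
  have "?a = f [^] Suc k \<otimes> b'"
    using b(2) b'(2) m_assoc[OF nat_pow_closed[OF f_in] f_in A_in[OF b'(1)]] by simp
  then have "D (Suc k)" using b'(1) unfolding D_def by blast
  with k(2) show False by contradiction
qed

text \<open>Common powers of \<open>f\<close> are cancelled from numerator and denominator. If the
  denominator still lay in \<open>P\<close>, so would the numerator, because \<open>b\<close> lies
  in \<open>B\<close> and \<open>Q\<close> is an ideal of \<open>B\<close>; this contradicts the
  cancellation.\<close>

lemma integral_fraction_local:
  assumes b: "b \<in> B" and cd: "c \<in> A" "d \<in> A" "d \<noteq> \<zero>" "d \<otimes> b = c"
  shows "\<exists>s\<in>A. s \<notin> P \<and> s \<otimes> b \<in> A"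
proof -
  obtain k bs where bs: "[d, c] = map (\<lambda>b. f [^] (k::nat) \<otimes> b) bs" "set bs \<subseteq> A" "\<not> set bs \<subseteq> P"
  proof -
    have "set [d, c] \<subseteq> A" "\<not> set [d, c] \<subseteq> {\<zero>}" using cd(1-3) by simp_all
    from primitive_relation[OF this] show thesis by (elim exE conjE) (rule that)
  qed
  then obtain d' c' where dc: "bs = [d', c']" by (cases bs rule: list.exhaust) (auto simp: Cons_eq_map_conv)
  have A: "d' \<in> A" "c' \<in> A" "d = f [^] k \<otimes> d'" "c = f [^] k \<otimes> c'" using bs dc by auto
  have "f [^] k \<otimes> (d' \<otimes> b) = f [^] k \<otimes> c'"
    using cd(4) A B_in[OF b] f_in by (simp add: m_assoc)
  then have eq: "d' \<otimes> b = c'"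
    using m_lcancel[OF pow_nonzero[OF f_in f(2), of k] nat_pow_closed[OF f_in] m_closed[OF A_in[OF A(1)] B_in[OF b]] A_in[OF A(2)]]
    by simp
  have "d' \<notin> P"
  proof
    assume d': "d' \<in> P"
    then have "b \<otimes> d' \<in> Q" using P_iff[OF A(1)] Q_mult[OF b] by blast
    then have "c' \<in> Q" using eq m_comm[OF B_in[OF b] A_in[OF A(1)]] by (simp only:)
    then have "c' \<in> P" using P_iff[OF A(2)] by blast
    with d' have "set bs \<subseteq> P" unfolding dc by (simp only: list.set insert_subset empty_subsetI simp_thms)
    with bs(3) show False by contradiction
  qed
  with A eq show ?thesis by blast
qed

end

section \<open>Fraction fields and maximal ideals\<close>

text \<open>The operations of \<open>Frac\<close> are unions over all representatives; such a union
  collapses as soon as the result does not depend on the representative.\<close>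

lemma UN_pair_const:
  assumes "(a0, b0) \<in> S" "\<And>a b. (a, b) \<in> S \<Longrightarrow> G a b = c"
  shows "(\<Union>(a, b)\<in>S. G a b) = c"
proof -
  have "(\<lambda>(a, b). G a b) z = c" if "z \<in> S" for z using assms(2) that by (cases z) auto
  then have "(\<lambda>(a, b). G a b) ` S = {c}" using assms(1) by blast
  then show ?thesis by simp
qed

context domain begin

abbreviation fr where "fr a b \<equiv> frac_class R a b"

lemma fr_eq_iff:
  assumes "a \<in> carrier R" "b \<in> carrier R" "b \<noteq> \<zero>" "c \<in> carrier R" "d \<in> carrier R" "d \<noteq> \<zero>"
  shows "fr a b = fr c d \<longleftrightarrow> a \<otimes> d = c \<otimes> b"
proof
  assume "fr a b = fr c d"
  moreover have "(c, d) \<in> fr c d" using assms by (simp add: frac_class_def)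
  ultimately have "(c, d) \<in> fr a b" by simp
  then show "a \<otimes> d = c \<otimes> b" by (simp add: frac_class_def)
next
  assume eq: "a \<otimes> d = c \<otimes> b"
  have "a \<otimes> y = x \<otimes> b \<longleftrightarrow> c \<otimes> y = x \<otimes> d" if xy: "x \<in> carrier R" "y \<in> carrier R" for x y
  proof -
    have "a \<otimes> y = x \<otimes> b \<longleftrightarrow> d \<otimes> (a \<otimes> y) = d \<otimes> (x \<otimes> b)"
      using assms xy by (subst m_lcancel) auto
    also have "d \<otimes> (a \<otimes> y) = b \<otimes> (c \<otimes> y)"
    proof -
      have "d \<otimes> (a \<otimes> y) = (a \<otimes> d) \<otimes> y" using assms xy by (simp add: m_ac)
      then show ?thesis using assms xy unfolding eq by (simp add: m_ac)
    qed
    also have "d \<otimes> (x \<otimes> b) = b \<otimes> (x \<otimes> d)" using assms xy by (simp add: m_ac)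
    also have "b \<otimes> (c \<otimes> y) = b \<otimes> (x \<otimes> d) \<longleftrightarrow> c \<otimes> y = x \<otimes> d"
      using assms xy by (subst m_lcancel) auto
    finally show ?thesis .
  qed
  then show "fr a b = fr c d" unfolding frac_class_def by auto
qed

lemma fr_self: "a \<in> carrier R \<Longrightarrow> b \<in> carrier R \<Longrightarrow> b \<noteq> \<zero> \<Longrightarrow> (a, b) \<in> fr a b"
  by (simp add: frac_class_def)

lemma Frac_carrierE:
  assumes "x \<in> carrier (Frac R)"
  obtains a b where "a \<in> carrier R" "b \<in> carrier R" "b \<noteq> \<zero>" "x = fr a b"
  using assms by (auto simp: Frac_def)

lemma fr_closed: "a \<in> carrier R \<Longrightarrow> b \<in> carrier R \<Longrightarrow> b \<noteq> \<zero> \<Longrightarrow> fr a b \<in> carrier (Frac R)"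
  by (auto simp: Frac_def)

lemma Frac_ops:
  assumes ab: "a \<in> carrier R" "b \<in> carrier R" "b \<noteq> \<zero>" and cd: "c \<in> carrier R" "d \<in> carrier R" "d \<noteq> \<zero>"
  shows "fr a b \<otimes>\<^bsub>Frac R\<^esub> fr c d = fr (a \<otimes> c) (b \<otimes> d)"
    and "fr a b \<oplus>\<^bsub>Frac R\<^esub> fr c d = fr (a \<otimes> d \<oplus> c \<otimes> b) (b \<otimes> d)"
proof -
  have bd: "b \<otimes> d \<in> carrier R" "b \<otimes> d \<noteq> \<zero>" using assms integral by auto
  have 1: "fr (a' \<otimes> c') (b' \<otimes> d') = fr (a \<otimes> c) (b \<otimes> d)
    \<and> fr (a' \<otimes> d' \<oplus> c' \<otimes> b') (b' \<otimes> d') = fr (a \<otimes> d \<oplus> c \<otimes> b) (b \<otimes> d)"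
    if h: "(a', b') \<in> fr a b" "(c', d') \<in> fr c d" for a' b' c' d'
  proof -
    have 2: "a' \<in> carrier R" "b' \<in> carrier R" "b' \<noteq> \<zero>" "c' \<in> carrier R" "d' \<in> carrier R" "d' \<noteq> \<zero>"
      "a \<otimes> b' = a' \<otimes> b" "c \<otimes> d' = c' \<otimes> d"
      using h by (auto simp: frac_class_def)
    have bd': "b' \<otimes> d' \<in> carrier R" "b' \<otimes> d' \<noteq> \<zero>" using 2 integral by auto
    have "(a' \<otimes> c') \<otimes> (b \<otimes> d) = (a' \<otimes> b) \<otimes> (c' \<otimes> d)" using 2(1-6) assms by (simp add: m_ac)
    also have "\<dots> = (a \<otimes> c) \<otimes> (b' \<otimes> d')"
      unfolding 2(7,8)[symmetric] using 2(1-6) assms by (simp add: m_ac)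
    finally have A: "(a' \<otimes> c') \<otimes> (b \<otimes> d) = (a \<otimes> c) \<otimes> (b' \<otimes> d')" .
    have "(a' \<otimes> d' \<oplus> c' \<otimes> b') \<otimes> (b \<otimes> d) = (a' \<otimes> b) \<otimes> (d' \<otimes> d) \<oplus> (c' \<otimes> d) \<otimes> (b' \<otimes> b)"
      using 2(1-6) assms by algebra
    also have "\<dots> = (a \<otimes> d \<oplus> c \<otimes> b) \<otimes> (b' \<otimes> d')"
      unfolding 2(7,8)[symmetric] using 2(1-6) assms by algebra
    finally have "(a' \<otimes> d' \<oplus> c' \<otimes> b') \<otimes> (b \<otimes> d) = (a \<otimes> d \<oplus> c \<otimes> b) \<otimes> (b' \<otimes> d')" .
    with A show ?thesis using fr_eq_iff 2(1-6) assms bd bd' by simp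
  qed
  have ne: "(a, b) \<in> fr a b" "(c, d) \<in> fr c d" using assms by (auto intro: fr_self)
  show "fr a b \<otimes>\<^bsub>Frac R\<^esub> fr c d = fr (a \<otimes> c) (b \<otimes> d)"
    unfolding Frac_def by simp (intro UN_pair_const[OF ne(1)] UN_pair_const[OF ne(2)] conjunct1[OF 1])
  show "fr a b \<oplus>\<^bsub>Frac R\<^esub> fr c d = fr (a \<otimes> d \<oplus> c \<otimes> b) (b \<otimes> d)"
    unfolding Frac_def by simp (intro UN_pair_const[OF ne(1)] UN_pair_const[OF ne(2)] conjunct2[OF 1])
qed

lemma Frac_zero_one: "\<zero>\<^bsub>Frac R\<^esub> = fr \<zero> \<one>" "\<one>\<^bsub>Frac R\<^esub> = fr \<one> \<one>"
  by (simp_all add: Frac_def)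

lemma field_Frac: "field (Frac R)"
proof -
  have nz: "\<And>b d. \<lbrakk>b \<in> carrier R; d \<in> carrier R; b \<noteq> \<zero>; d \<noteq> \<zero>\<rbrakk> \<Longrightarrow> b \<otimes> d \<noteq> \<zero>" using integral by auto
  have ab: "abelian_group (Frac R)"
  proof (rule abelian_groupI)
    fix x y assume "x \<in> carrier (Frac R)" "y \<in> carrier (Frac R)"
    then obtain a b c d where *: "a \<in> carrier R" "b \<in> carrier R" "b \<noteq> \<zero>" "x = fr a b"
      "c \<in> carrier R" "d \<in> carrier R" "d \<noteq> \<zero>" "y = fr c d" by (metis Frac_carrierE)
    show "x \<oplus>\<^bsub>Frac R\<^esub> y \<in> carrier (Frac R)"
      unfolding *(4,8) Frac_ops(2)[OF *(1-3,5-7)] using * nz by (intro fr_closed) simp_all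
    show "x \<oplus>\<^bsub>Frac R\<^esub> y = y \<oplus>\<^bsub>Frac R\<^esub> x"
      unfolding *(4,8) Frac_ops(2)[OF *(1-3,5-7)] Frac_ops(2)[OF *(5-7,1-3)]
      using a_comm[OF m_closed[OF *(1,6)] m_closed[OF *(5,2)]] m_comm[OF *(2,6)] by (simp only:)
    fix z assume "z \<in> carrier (Frac R)"
    then obtain e f where **: "e \<in> carrier R" "f \<in> carrier R" "f \<noteq> \<zero>" "z = fr e f" by (metis Frac_carrierE)
    have "(a \<otimes> d \<oplus> c \<otimes> b) \<otimes> f \<oplus> e \<otimes> (b \<otimes> d) = a \<otimes> (d \<otimes> f) \<oplus> (c \<otimes> f \<oplus> e \<otimes> d) \<otimes> b"
      using *(1,2,5,6) **(1,2) by algebra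
    moreover have "x \<oplus>\<^bsub>Frac R\<^esub> y = fr (a \<otimes> d \<oplus> c \<otimes> b) (b \<otimes> d)"
      unfolding *(4,8) by (rule Frac_ops(2)[OF *(1-3,5-7)])
    moreover have "fr (a \<otimes> d \<oplus> c \<otimes> b) (b \<otimes> d) \<oplus>\<^bsub>Frac R\<^esub> z
        = fr ((a \<otimes> d \<oplus> c \<otimes> b) \<otimes> f \<oplus> e \<otimes> (b \<otimes> d)) (b \<otimes> d \<otimes> f)"
      unfolding **(4) using *(1-3,5-7) **(1-3) nz by (intro Frac_ops(2)) simp_all
    moreover have "y \<oplus>\<^bsub>Frac R\<^esub> z = fr (c \<otimes> f \<oplus> e \<otimes> d) (d \<otimes> f)"
      unfolding *(8) **(4) by (rule Frac_ops(2)[OF *(5-7) **(1-3)])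
    moreover have "x \<oplus>\<^bsub>Frac R\<^esub> fr (c \<otimes> f \<oplus> e \<otimes> d) (d \<otimes> f)
        = fr (a \<otimes> (d \<otimes> f) \<oplus> (c \<otimes> f \<oplus> e \<otimes> d) \<otimes> b) (b \<otimes> (d \<otimes> f))"
      unfolding *(4) using *(1-3,5-7) **(1-3) nz by (intro Frac_ops(2)) simp_all
    moreover have "b \<otimes> d \<otimes> f = b \<otimes> (d \<otimes> f)" by (rule m_assoc[OF *(2,6) **(2)])
    ultimately show "x \<oplus>\<^bsub>Frac R\<^esub> y \<oplus>\<^bsub>Frac R\<^esub> z = x \<oplus>\<^bsub>Frac R\<^esub> (y \<oplus>\<^bsub>Frac R\<^esub> z)"
      by (simp only:)
  next
    show "\<zero>\<^bsub>Frac R\<^esub> \<in> carrier (Frac R)" by (simp add: Frac_zero_one fr_closed)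
    fix x assume "x \<in> carrier (Frac R)"
    then obtain a b where *: "a \<in> carrier R" "b \<in> carrier R" "b \<noteq> \<zero>" "x = fr a b" by (metis Frac_carrierE)
    show "\<zero>\<^bsub>Frac R\<^esub> \<oplus>\<^bsub>Frac R\<^esub> x = x"
      using Frac_ops(2)[OF zero_closed one_closed one_not_zero *(1-3)] * by (simp add: Frac_zero_one)
    have "fr (\<ominus> a) b \<oplus>\<^bsub>Frac R\<^esub> x = fr (\<ominus> a \<otimes> b \<oplus> a \<otimes> b) (b \<otimes> b)"
      unfolding *(4) by (rule Frac_ops(2)[OF a_inv_closed[OF *(1)] *(2,3,1-3)])
    also have "\<dots> = fr \<zero> \<one>"
    proof (subst fr_eq_iff)
      show "(\<ominus> a \<otimes> b \<oplus> a \<otimes> b) \<otimes> \<one> = \<zero> \<otimes> (b \<otimes> b)"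
        using *(1,2) by (simp add: l_minus l_neg)
      show "b \<otimes> b \<noteq> \<zero>" by (rule nz[OF *(2,2,3,3)])
    qed (use *(1,2) in simp_all)
    finally show "\<exists>y\<in>carrier (Frac R). y \<oplus>\<^bsub>Frac R\<^esub> x = \<zero>\<^bsub>Frac R\<^esub>"
      unfolding Frac_zero_one by (rule bexI[OF _ fr_closed[OF a_inv_closed[OF *(1)] *(2,3)]])
  qed
  have cm: "comm_monoid (Frac R)"
  proof (rule comm_monoidI)
    fix x y assume "x \<in> carrier (Frac R)" "y \<in> carrier (Frac R)"
    then obtain a b c d where *: "a \<in> carrier R" "b \<in> carrier R" "b \<noteq> \<zero>" "x = fr a b"
      "c \<in> carrier R" "d \<in> carrier R" "d \<noteq> \<zero>" "y = fr c d" by (metis Frac_carrierE)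
    show "x \<otimes>\<^bsub>Frac R\<^esub> y \<in> carrier (Frac R)"
      unfolding *(4,8) Frac_ops(1)[OF *(1-3,5-7)] using * nz by (intro fr_closed) simp_all
    show "x \<otimes>\<^bsub>Frac R\<^esub> y = y \<otimes>\<^bsub>Frac R\<^esub> x"
      unfolding *(4,8) Frac_ops(1)[OF *(1-3,5-7)] Frac_ops(1)[OF *(5-7,1-3)]
      using m_comm[OF *(1,5)] m_comm[OF *(2,6)] by (simp only:)
    fix z assume "z \<in> carrier (Frac R)"
    then obtain e f where **: "e \<in> carrier R" "f \<in> carrier R" "f \<noteq> \<zero>" "z = fr e f" by (metis Frac_carrierE)
    show "x \<otimes>\<^bsub>Frac R\<^esub> y \<otimes>\<^bsub>Frac R\<^esub> z = x \<otimes>\<^bsub>Frac R\<^esub> (y \<otimes>\<^bsub>Frac R\<^esub> z)"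
      unfolding *(4,8) **(4) Frac_ops(1)[OF *(1-3,5-7)] Frac_ops(1)[OF *(5-7) **(1-3)]
      using Frac_ops(1)[OF m_closed[OF *(1,5)] m_closed[OF *(2,6)] nz[OF *(2,6,3,7)] **(1-3)]
        Frac_ops(1)[OF *(1-3) m_closed[OF *(5) **(1)] m_closed[OF *(6) **(2)] nz[OF *(6) **(2) *(7) **(3)]]
        m_assoc[OF *(1,5) **(1)] m_assoc[OF *(2,6) **(2)]
      by (simp only:)
  next
    show "\<one>\<^bsub>Frac R\<^esub> \<in> carrier (Frac R)" by (simp add: Frac_zero_one fr_closed)
    fix x assume "x \<in> carrier (Frac R)"
    then obtain a b where *: "a \<in> carrier R" "b \<in> carrier R" "b \<noteq> \<zero>" "x = fr a b" by (metis Frac_carrierE)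
    then show "\<one>\<^bsub>Frac R\<^esub> \<otimes>\<^bsub>Frac R\<^esub> x = x"
      using Frac_ops(1)[OF one_closed one_closed one_not_zero *(1-3)] by (simp add: Frac_zero_one)
  qed
  have cr: "cring (Frac R)"
  proof (rule cringI[OF ab cm])
    fix x y z assume xyz: "x \<in> carrier (Frac R)" "y \<in> carrier (Frac R)" "z \<in> carrier (Frac R)"
    obtain a b where x: "a \<in> carrier R" "b \<in> carrier R" "b \<noteq> \<zero>" "x = fr a b"
      using xyz(1) by (rule Frac_carrierE)
    obtain c d where y: "c \<in> carrier R" "d \<in> carrier R" "d \<noteq> \<zero>" "y = fr c d"
      using xyz(2) by (rule Frac_carrierE)
    obtain e f where z: "e \<in> carrier R" "f \<in> carrier R" "f \<noteq> \<zero>" "z = fr e f"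
      using xyz(3) by (rule Frac_carrierE)
    note * = x y z
    have "((a \<otimes> d \<oplus> c \<otimes> b) \<otimes> e) \<otimes> ((b \<otimes> f) \<otimes> (d \<otimes> f)) = ((a \<otimes> e) \<otimes> (d \<otimes> f) \<oplus> (c \<otimes> e) \<otimes> (b \<otimes> f)) \<otimes> ((b \<otimes> d) \<otimes> f)"
      using *(1,2,5,6,9,10) by algebra
    moreover have "x \<oplus>\<^bsub>Frac R\<^esub> y = fr (a \<otimes> d \<oplus> c \<otimes> b) (b \<otimes> d)"
      unfolding *(4,8) by (rule Frac_ops(2)[OF *(1-3,5-7)])
    moreover have "fr (a \<otimes> d \<oplus> c \<otimes> b) (b \<otimes> d) \<otimes>\<^bsub>Frac R\<^esub> z = fr ((a \<otimes> d \<oplus> c \<otimes> b) \<otimes> e) (b \<otimes> d \<otimes> f)"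
      unfolding *(12) using *(1-3,5-7,9-11) nz by (intro Frac_ops(1)) simp_all
    moreover have "x \<otimes>\<^bsub>Frac R\<^esub> z = fr (a \<otimes> e) (b \<otimes> f)" "y \<otimes>\<^bsub>Frac R\<^esub> z = fr (c \<otimes> e) (d \<otimes> f)"
      unfolding *(4,8,12) by (rule Frac_ops(1)[OF *(1-3,9-11)] Frac_ops(1)[OF *(5-7,9-11)])+
    moreover have "fr (a \<otimes> e) (b \<otimes> f) \<oplus>\<^bsub>Frac R\<^esub> fr (c \<otimes> e) (d \<otimes> f)
        = fr ((a \<otimes> e) \<otimes> (d \<otimes> f) \<oplus> (c \<otimes> e) \<otimes> (b \<otimes> f)) ((b \<otimes> f) \<otimes> (d \<otimes> f))"
      using *(1-3,5-7,9-11) nz by (intro Frac_ops(2)) simp_all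
    moreover have "fr ((a \<otimes> d \<oplus> c \<otimes> b) \<otimes> e) (b \<otimes> d \<otimes> f)
        = fr ((a \<otimes> e) \<otimes> (d \<otimes> f) \<oplus> (c \<otimes> e) \<otimes> (b \<otimes> f)) ((b \<otimes> f) \<otimes> (d \<otimes> f))
      \<longleftrightarrow> ((a \<otimes> d \<oplus> c \<otimes> b) \<otimes> e) \<otimes> ((b \<otimes> f) \<otimes> (d \<otimes> f))
        = ((a \<otimes> e) \<otimes> (d \<otimes> f) \<oplus> (c \<otimes> e) \<otimes> (b \<otimes> f)) \<otimes> ((b \<otimes> d) \<otimes> f)"
      using *(1-3,5-7,9-11) nz by (intro fr_eq_iff) simp_all
    ultimately show "(x \<oplus>\<^bsub>Frac R\<^esub> y) \<otimes>\<^bsub>Frac R\<^esub> z = x \<otimes>\<^bsub>Frac R\<^esub> z \<oplus>\<^bsub>Frac R\<^esub> y \<otimes>\<^bsub>Frac R\<^esub> z"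
      by (simp only:)
  qed
  show ?thesis
  proof (rule cring.cring_fieldI2[OF cr])
    show "\<zero>\<^bsub>Frac R\<^esub> \<noteq> \<one>\<^bsub>Frac R\<^esub>" by (simp add: Frac_zero_one fr_eq_iff)
    fix x assume x: "x \<in> carrier (Frac R)" "x \<noteq> \<zero>\<^bsub>Frac R\<^esub>"
    then obtain a b where *: "a \<in> carrier R" "b \<in> carrier R" "b \<noteq> \<zero>" "x = fr a b" by (metis Frac_carrierE)
    with x have a: "a \<noteq> \<zero>" by (auto simp: Frac_zero_one fr_eq_iff)
    have "x \<otimes>\<^bsub>Frac R\<^esub> fr b a = \<one>\<^bsub>Frac R\<^esub>"
      unfolding *(4) Frac_ops(1)[OF *(1-3,2,1) a] Frac_zero_one
      using *(1-3) a nz by (subst fr_eq_iff) (simp_all add: m_comm)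
    then show "\<exists>y\<in>carrier (Frac R). x \<otimes>\<^bsub>Frac R\<^esub> y = \<one>\<^bsub>Frac R\<^esub>" 
      by (rule bexI[OF _ fr_closed[OF *(2,1) a]])
  qed
qed

lemma Frac_embedding:
  shows "a \<in> carrier R \<Longrightarrow> fr a \<one> \<in> carrier (Frac R)"
    and "\<lbrakk>a \<in> carrier R; b \<in> carrier R\<rbrakk> \<Longrightarrow> fr (a \<otimes> b) \<one> = fr a \<one> \<otimes>\<^bsub>Frac R\<^esub> fr b \<one>"
    and "\<lbrakk>a \<in> carrier R; b \<in> carrier R\<rbrakk> \<Longrightarrow> fr (a \<oplus> b) \<one> = fr a \<one> \<oplus>\<^bsub>Frac R\<^esub> fr b \<one>"
    and "\<lbrakk>a \<in> carrier R; b \<in> carrier R\<rbrakk> \<Longrightarrow> fr a \<one> = fr b \<one> \<longleftrightarrow> a = b"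
    and "x \<in> carrier (Frac R) \<Longrightarrow> \<exists>a\<in>carrier R. \<exists>b\<in>carrier R. b \<noteq> \<zero> \<and> x \<otimes>\<^bsub>Frac R\<^esub> fr b \<one> = fr a \<one>"
proof -
  show "\<exists>a\<in>carrier R. \<exists>b\<in>carrier R. b \<noteq> \<zero> \<and> x \<otimes>\<^bsub>Frac R\<^esub> fr b \<one> = fr a \<one>" if "x \<in> carrier (Frac R)"
  proof -
    obtain a b where *: "a \<in> carrier R" "b \<in> carrier R" "b \<noteq> \<zero>" "x = fr a b"
      using \<open>x \<in> carrier (Frac R)\<close> by (rule Frac_carrierE)
    then have "x \<otimes>\<^bsub>Frac R\<^esub> fr b \<one> = fr a \<one>" by (simp add: Frac_ops fr_eq_iff)
    with * show ?thesis by blast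
  qed
qed (simp_all add: fr_closed Frac_ops fr_eq_iff)

end

text \<open>Zorn's lemma for the ideals above \<open>I\<close> that miss \<open>T\<close>; the empty
  chain is bounded by \<open>I\<close> itself. With \<open>T\<close> the powers of an element this
  leads to primes, with \<open>T = {\<one>}\<close> to maximal ideals.\<close>

lemma (in cring) exists_ideal_maximal_avoiding:
  assumes I: "ideal I R" "I \<inter> T = {}"
  shows "\<exists>Q. ideal Q R \<and> I \<subseteq> Q \<and> Q \<inter> T = {} \<and> (\<forall>J. ideal J R \<longrightarrow> Q \<subseteq> J \<longrightarrow> J \<inter> T = {} \<longrightarrow> J = Q)"
proof -
  define \<A> where "\<A> = {J. ideal J R \<and> I \<subseteq> J \<and> J \<inter> T = {}}"
  have "\<exists>M\<in>\<A>. \<forall>J\<in>\<A>. M \<subseteq> J \<longrightarrow> J = M"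
  proof (rule subset_Zorn)
    fix C assume C: "subset.chain \<A> C"
    show "\<exists>U\<in>\<A>. \<forall>J\<in>C. J \<subseteq> U"
    proof (cases "C = {}")
      case True
      then show ?thesis using I unfolding \<A>_def by auto
    next
      case False
      have "subset.chain {J. ideal J R} C" using C unfolding subset.chain_def \<A>_def by auto
      from chain_Union_is_ideal[OF this] have "ideal (\<Union>C) R" unfolding if_not_P[OF False] .
      moreover have "\<forall>J\<in>C. I \<subseteq> J \<and> J \<inter> T = {}" using C unfolding subset.chain_def \<A>_def by auto
      then have "I \<subseteq> \<Union>C" "\<Union>C \<inter> T = {}" using False by blast+
      ultimately have "\<Union>C \<in> \<A>" unfolding \<A>_def by (intro CollectI conjI)
      then show ?thesis by (rule bexI[rotated]) (intro ballI Union_upper)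
    qed
  qed
  then obtain M where "M \<in> \<A>" "\<And>J. J \<in> \<A> \<Longrightarrow> M \<subseteq> J \<Longrightarrow> J = M" by blast
  then show ?thesis unfolding \<A>_def by (intro exI[of _ M]) auto
qed

text \<open>An ideal \<open>Q\<close> maximal among those missing the powers of \<open>t\<close> is
  prime: if \<open>a\<close> and \<open>b\<close> lie outside, then \<open>Q + (a)\<close> and
  \<open>Q + (b)\<close> contain powers of \<open>t\<close>, and their product lies in
  \<open>Q + (a b)\<close>.\<close>

lemma (in cring) exists_prime_avoiding_powers:
  assumes I: "ideal I R" and t: "t \<in> carrier R" "\<And>k::nat. t [^] k \<notin> I"
  shows "\<exists>Q. primeideal Q R \<and> I \<subseteq> Q \<and> t \<notin> Q"
proof -
  let ?T = "{t [^] k | k::nat. True}"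
  have "I \<inter> ?T = {}" using t(2) by blast
  from exists_ideal_maximal_avoiding[OF I this] obtain Q where Q: "ideal Q R" "I \<subseteq> Q" "Q \<inter> ?T = {}"
    "\<And>J. \<lbrakk>ideal J R; Q \<subseteq> J; J \<inter> ?T = {}\<rbrakk> \<Longrightarrow> J = Q" by blast
  interpret Q: ideal Q R by (rule Q(1))
  have tQ: "t [^] k \<notin> Q" for k :: nat using Q(3) by blast
  have ex: "\<exists>k::nat. \<exists>q\<in>Q. \<exists>c\<in>carrier R. t [^] k = q \<oplus> c \<otimes> a" if a: "a \<in> carrier R" "a \<notin> Q" for a
  proof -
    let ?J = "Q <+>\<^bsub>R\<^esub> PIdl a"
    have J: "ideal ?J R" by (intro add_ideals Q(1) cgenideal_ideal a(1))
    have mem: "q \<oplus> c \<otimes> a \<in> ?J" if "q \<in> Q" "c \<in> carrier R" for q c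
      using that unfolding set_add_def' cgenideal_def by blast
    have "Q \<subseteq> ?J"
    proof
      fix q assume q: "q \<in> Q"
      then show "q \<in> ?J" using mem[OF q zero_closed] a(1) Q.Icarr[OF q] by simp
    qed
    moreover have "a \<in> ?J" using mem[of \<zero> \<one>] a(1) additive_subgroup.zero_closed[OF Q.additive_subgroup_axioms] by simp
    ultimately have "?J \<inter> ?T \<noteq> {}" using Q(4)[OF J] a(2) by blast
    then obtain k where "t [^] (k::nat) \<in> ?J" by blast
    then show ?thesis unfolding set_add_def' cgenideal_def by blast
  qed
  have "primeideal Q R"
  proof (rule primeidealI[OF Q(1) is_cring])
    show "carrier R \<noteq> Q" using tQ[of 0] by auto
    fix a b assume ab: "a \<in> carrier R" "b \<in> carrier R" "a \<otimes> b \<in> Q"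
    show "a \<in> Q \<or> b \<in> Q"
    proof (rule ccontr)
      assume "\<not> (a \<in> Q \<or> b \<in> Q)"
      then obtain k l :: nat and q q' c c' where *: "q \<in> Q" "c \<in> carrier R" "t [^] k = q \<oplus> c \<otimes> a"
        "q' \<in> Q" "c' \<in> carrier R" "t [^] l = q' \<oplus> c' \<otimes> b" using ex ab(1,2) by meson
      have car: "q \<in> carrier R" "q' \<in> carrier R" using * Q.Icarr by auto
      have "t [^] (k + l) = (q \<oplus> c \<otimes> a) \<otimes> (q' \<oplus> c' \<otimes> b)" using nat_pow_mult[OF t(1), of k l] *(3,6) by simp
      also have "\<dots> = (q' \<oplus> c' \<otimes> b) \<otimes> q \<oplus> ((c \<otimes> a) \<otimes> q' \<oplus> (c \<otimes> c') \<otimes> (a \<otimes> b))"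
        using *(2,5) car ab(1,2) by algebra
      also have "\<dots> \<in> Q"
        by (rule Q.a_closed[OF Q.I_l_closed[OF *(1)] Q.a_closed[OF Q.I_l_closed[OF *(4)] Q.I_l_closed[OF ab(3)]]])
        (use * car ab in simp_all)
      finally show False using tQ by blast
    qed
  qed
  with Q(2) tQ[of 1] t(1) show ?thesis by auto
qed

lemma (in cring) exists_maximalideal_above:
  assumes I: "ideal I R" "\<one> \<notin> I"
  shows "\<exists>Q. maximalideal Q R \<and> I \<subseteq> Q"
proof -
  from exists_ideal_maximal_avoiding[OF I(1), of "{\<one>}"] I(2) obtain Q where Q: "ideal Q R" "I \<subseteq> Q" "\<one> \<notin> Q"
    "\<And>J. \<lbrakk>ideal J R; Q \<subseteq> J; \<one> \<notin> J\<rbrakk> \<Longrightarrow> J = Q" by auto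
  have "maximalideal Q R"
  proof (rule maximalidealI[OF Q(1)])
    show "carrier R \<noteq> Q" using Q(3) by auto
    show "J = Q \<or> J = carrier R" if "ideal J R" "Q \<subseteq> J" "J \<subseteq> carrier R" for J
      using Q(4)[OF that(1,2)] ideal.one_imp_carrier[OF that(1)] by blast
  qed
  with Q show ?thesis by blast
qed

section \<open>Regular local rings of dimension two\<close>

definition ideal_of :: "('a, 'm) ring_scheme \<Rightarrow> 'a set \<Rightarrow> 'a set \<Rightarrow> bool" where
  "ideal_of E B I \<longleftrightarrow> I \<subseteq> B \<and> \<zero>\<^bsub>E\<^esub> \<in> I \<and> (\<forall>x\<in>I. \<forall>y\<in>I. x \<oplus>\<^bsub>E\<^esub> y \<in> I) \<and>
    (\<forall>b\<in>B. \<forall>x\<in>I. b \<otimes>\<^bsub>E\<^esub> x \<in> I)"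

lemma nat_last_true: "\<lbrakk>T 0; \<exists>k::nat. \<not> T k\<rbrakk> \<Longrightarrow> \<exists>k. T k \<and> \<not> T (Suc k)"
  by (metis nat_induct)

lemma ideal_ofI:
  assumes "I \<subseteq> B" "\<zero>\<^bsub>E\<^esub> \<in> I" "\<And>x y. \<lbrakk>x \<in> I; y \<in> I\<rbrakk> \<Longrightarrow> x \<oplus>\<^bsub>E\<^esub> y \<in> I"
    "\<And>b x. \<lbrakk>b \<in> B; x \<in> I\<rbrakk> \<Longrightarrow> b \<otimes>\<^bsub>E\<^esub> x \<in> I"
  shows "ideal_of E B I"
  using assms unfolding ideal_of_def by blast

lemma ideal_ofD:
  assumes "ideal_of E B I"
  shows "x \<in> I \<Longrightarrow> x \<in> B" "\<zero>\<^bsub>E\<^esub> \<in> I" "\<lbrakk>x \<in> I; y \<in> I\<rbrakk> \<Longrightarrow> x \<oplus>\<^bsub>E\<^esub> y \<in> I"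
    "\<lbrakk>b \<in> B; x \<in> I\<rbrakk> \<Longrightarrow> b \<otimes>\<^bsub>E\<^esub> x \<in> I"
  using assms unfolding ideal_of_def by blast+

lemma prime_ofD:
  assumes "prime_of E B Q"
  shows "ideal_of E B Q" "\<one>\<^bsub>E\<^esub> \<notin> Q" "\<lbrakk>a \<in> B; b \<in> B; a \<otimes>\<^bsub>E\<^esub> b \<in> Q\<rbrakk> \<Longrightarrow> a \<in> Q \<or> b \<in> Q"
  using assms unfolding prime_of_def ideal_of_def by blast+

lemma (in cring) ideal_iff_ideal_of:
  assumes B: "subring B R"
  shows "ideal I (R\<lparr>carrier := B\<rparr>) \<longleftrightarrow> ideal_of R B I"
proof
  assume "ideal I (R\<lparr>carrier := B\<rparr>)"
  then interpret I: ideal I "R\<lparr>carrier := B\<rparr>" .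
  show "ideal_of R B I"
  proof (rule ideal_ofI)
    show "I \<subseteq> B" using I.Icarr by auto
    show "\<zero> \<in> I" using additive_subgroup.zero_closed[OF I.additive_subgroup_axioms] by simp
    show "x \<oplus> y \<in> I" if "x \<in> I" "y \<in> I" for x y
      using additive_subgroup.a_closed[OF I.additive_subgroup_axioms that] by simp
    show "b \<otimes> x \<in> I" if "b \<in> B" "x \<in> I" for x b using I.I_l_closed[of x b] that by simp
  qed
next
  assume "ideal_of R B I"
  then show "ideal I (R\<lparr>carrier := B\<rparr>)"
    by (intro additive_subgroup_subringI[OF B]) (blast dest: ideal_ofD)+
qed

section \<open>Ideals of a subring as spans of finite lists\<close>

context field_subring begin

lemma ideal_of_minus: "\<lbrakk>ideal_of E A I; x \<in> I; y \<in> I\<rbrakk> \<Longrightarrow> x \<ominus> y \<in> I"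
proof -
  assume I: "ideal_of E A I" and xy: "x \<in> I" "y \<in> I"
  have "\<ominus> y = (\<ominus> \<one>) \<otimes> y" using ideal_ofD(1)[OF I xy(2)] by (simp add: l_minus)
  then have "\<ominus> y \<in> I" using ideal_ofD(4)[OF I _ xy(2), of "\<ominus> \<one>"] by simp
  then show ?thesis unfolding a_minus_def by (rule ideal_ofD(3)[OF I xy(1)])
qed

lemma ideal_of_lspan: "set gs \<subseteq> A \<Longrightarrow> ideal_of E A (lspan gs)"
proof (rule ideal_ofI)
  assume gs: "set gs \<subseteq> A"
  then have c: "set gs \<subseteq> carrier E" using A_carrier by blast
  show "lspan gs \<subseteq> A" using gs by (induction gs) auto
  show "\<zero> \<in> lspan gs" by (rule lspan_zero[OF c])
  show "x \<oplus> y \<in> lspan gs" if "x \<in> lspan gs" "y \<in> lspan gs" for x y by (rule lspan_add[OF that c])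
  show "b \<otimes> x \<in> lspan gs" if "b \<in> A" "x \<in> lspan gs" for b x by (rule lspan_smult[OF that c])
qed

lemma lspan_minimal: "\<lbrakk>ideal_of E A I; set gs \<subseteq> I\<rbrakk> \<Longrightarrow> lspan gs \<subseteq> I"
proof (induction gs)
  case (Cons g gs)
  then show ?case using ideal_ofD[OF Cons.prems(1)] by auto
qed (auto dest: ideal_ofD)

lemma genideal_eq_lspan:
  assumes "set gs \<subseteq> A" shows "genideal (E\<lparr>carrier := A\<rparr>) (set gs) = lspan gs"
proof
  interpret D: cring "E\<lparr>carrier := A\<rparr>" using subring_A subcringI' subcring_iff subringE(1) by metis
  have i: "ideal (lspan gs) (E\<lparr>carrier := A\<rparr>)"
    using ideal_iff_ideal_of[OF subring_A] ideal_of_lspan[OF assms] by simp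
  have "set gs \<subseteq> lspan gs"
    using lspan_mem[of _ gs] assms A_carrier by blast
  then show "genideal (E\<lparr>carrier := A\<rparr>) (set gs) \<subseteq> lspan gs" by (rule D.genideal_minimal[OF i])
  have "set gs \<subseteq> carrier (E\<lparr>carrier := A\<rparr>)" using assms by simp
  from D.genideal_ideal[OF this] D.genideal_self[OF this]
  show "lspan gs \<subseteq> genideal (E\<lparr>carrier := A\<rparr>) (set gs)"
    using lspan_minimal ideal_iff_ideal_of[OF subring_A] by simp
qed

end

locale local_subring = field_subring +
  fixes m
  assumes m_ideal: "ideal_of E A m" and m_one: "\<one> \<notin> m"
    and m_unit: "\<lbrakk>a \<in> A; a \<notin> m\<rbrakk> \<Longrightarrow> \<exists>b\<in>A. a \<otimes> b = \<one>"
    and noetherian: "ideal_of E A I \<Longrightarrow> \<exists>gs. set gs \<subseteq> A \<and> I = lspan gs"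
begin

lemma m_A: "a \<in> m \<Longrightarrow> a \<in> A" by (rule ideal_ofD(1)[OF m_ideal])

lemma proper_ideal_m: "ideal_of E A I \<Longrightarrow> \<one> \<notin> I \<Longrightarrow> a \<in> I \<Longrightarrow> a \<in> m"
proof (rule ccontr)
  assume I: "ideal_of E A I" "\<one> \<notin> I" "a \<in> I" "a \<notin> m"
  then have a: "a \<in> A" using ideal_ofD(1)[OF I(1)] by simp
  then obtain b where b: "b \<in> A" "a \<otimes> b = \<one>" using m_unit I by auto
  then have "b \<otimes> a = \<one>" using m_comm[of b a] a by simp
  then show False using ideal_ofD(4)[OF I(1) b(1) I(3)] I(2) by simp
qed

text \<open>Instead of a determinant, generators of \<open>I\<close> modulo \<open>J\<close> are
  discarded one at a time. Substituting \<open>g\<close> into its own expression produces the factor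
  \<open>\<one> \<ominus> w \<otimes> a\<close>, a unit because \<open>w\<close> lies in
  \<open>m\<close>; so \<open>g\<close> is generated by the others modulo \<open>J\<close>.\<close>

lemma nakayama:
  assumes I: "ideal_of E A I" and J: "ideal_of E A J" and w: "w \<in> m"
    and step: "\<And>x. x \<in> I \<Longrightarrow> \<exists>y\<in>I. \<exists>z\<in>J. x = w \<otimes> y \<oplus> z"
  shows "I \<subseteq> J"
proof -
  obtain gs0 where gs0: "set gs0 \<subseteq> A" "I = lspan gs0" using noetherian[OF I] by auto
  have wA: "w \<in> A" using w m_A by simp
  have main: "I \<subseteq> J" if "set gs \<subseteq> I" "\<forall>x\<in>I. \<exists>y\<in>lspan gs. \<exists>z\<in>J. x = y \<oplus> z" for gs
    using that
  proof (induction gs)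
    case Nil
    show ?case
    proof
      fix x assume "x \<in> I"
      then obtain z where "z \<in> J" "x = \<zero> \<oplus> z" using Nil.prems(2) by auto
      then show "x \<in> J" using ideal_ofD(1)[OF J] by simp
    qed
  next
    case (Cons g gs)
    have sub: "set gs \<subseteq> A" "g \<in> A" "g \<in> I" using Cons.prems(1) ideal_ofD(1)[OF I] by auto
    have L: "ideal_of E A (lspan gs)" by (rule ideal_of_lspan[OF sub(1)])
    obtain y z where yz: "y \<in> I" "z \<in> J" "g = w \<otimes> y \<oplus> z" using step[OF sub(3)] by auto
    obtain y' z' where y': "y' \<in> lspan (g # gs)" "z' \<in> J" "y = y' \<oplus> z'"
      using bspec[OF Cons.prems(2) yz(1)] by blast
    obtain a l where al: "a \<in> A" "l \<in> lspan gs" "y' = a \<otimes> g \<oplus> l" using y'(1) by auto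
    have zA: "z \<in> A" "z' \<in> A" "l \<in> A"
      by (rule ideal_ofD(1)[OF J yz(2)] ideal_ofD(1)[OF J y'(2)] ideal_ofD(1)[OF L al(2)])+
    have "\<one> \<ominus> w \<otimes> a \<notin> m"
    proof
      assume h: "\<one> \<ominus> w \<otimes> a \<in> m"
      have wa: "w \<otimes> a \<in> m" using ideal_ofD(4)[OF m_ideal al(1) w] m_comm[of a w] al(1) wA by simp
      have "(\<one> \<ominus> w \<otimes> a) \<oplus> w \<otimes> a = \<one>" using A_in[OF wA] A_in[OF al(1)] by algebra
      then show False using ideal_ofD(3)[OF m_ideal h wa] m_one by simp
    qed
    then obtain c where c: "c \<in> A" "(\<one> \<ominus> w \<otimes> a) \<otimes> c = \<one>" using m_unit[of "\<one> \<ominus> w \<otimes> a"] wA al(1) by auto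
    have in': "w \<in> carrier E" "a \<in> carrier E" "g \<in> carrier E" "l \<in> carrier E" "z \<in> carrier E" "z' \<in> carrier E" "c \<in> carrier E"
      using wA al(1) sub(2) zA c(1) by auto
    have g1: "(\<one> \<ominus> w \<otimes> a) \<otimes> g = w \<otimes> l \<oplus> (w \<otimes> z' \<oplus> z)"
    proof -
      have "g = w \<otimes> (a \<otimes> g \<oplus> l \<oplus> z') \<oplus> z" using yz(3) unfolding y'(3) al(3) .
      then have "g \<ominus> w \<otimes> a \<otimes> g = (w \<otimes> (a \<otimes> g \<oplus> l \<oplus> z') \<oplus> z) \<ominus> w \<otimes> a \<otimes> g"
        by (rule arg_cong[where f = "\<lambda>t. t \<ominus> w \<otimes> a \<otimes> g"])
      also have "\<dots> = w \<otimes> l \<oplus> (w \<otimes> z' \<oplus> z)" using in' by algebra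
      finally have "g \<ominus> w \<otimes> a \<otimes> g = w \<otimes> l \<oplus> (w \<otimes> z' \<oplus> z)" .
      moreover have "(\<one> \<ominus> w \<otimes> a) \<otimes> g = g \<ominus> w \<otimes> a \<otimes> g" using in' by algebra
      ultimately show ?thesis by simp
    qed
    have "g = ((\<one> \<ominus> w \<otimes> a) \<otimes> c) \<otimes> g" using c(2) in' by simp
    also have "\<dots> = c \<otimes> ((\<one> \<ominus> w \<otimes> a) \<otimes> g)" using in' by algebra
    also have "\<dots> = (c \<otimes> w) \<otimes> l \<oplus> (c \<otimes> (w \<otimes> z' \<oplus> z))" unfolding g1 using in' by algebra
    finally have g2: "g = (c \<otimes> w) \<otimes> l \<oplus> (c \<otimes> (w \<otimes> z' \<oplus> z))" .
    define l2 where "l2 = (c \<otimes> w) \<otimes> l"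
    define z2 where "z2 = c \<otimes> (w \<otimes> z' \<oplus> z)"
    have g3: "g = l2 \<oplus> z2" using g2 unfolding l2_def z2_def .
    have l2: "l2 \<in> lspan gs" unfolding l2_def using ideal_ofD(4)[OF L _ al(2)] c(1) wA by simp
    have z2: "z2 \<in> J" unfolding z2_def
      by (rule ideal_ofD(4)[OF J c(1) ideal_ofD(3)[OF J ideal_ofD(4)[OF J wA y'(2)] yz(2)]])
    show ?case
    proof (rule Cons.IH)
      show "set gs \<subseteq> I" using Cons.prems(1) by simp
      show "\<forall>x\<in>I. \<exists>y\<in>lspan gs. \<exists>z\<in>J. x = y \<oplus> z"
      proof
        fix x assume "x \<in> I"
        then obtain b k z3 where x: "b \<in> A" "k \<in> lspan gs" "z3 \<in> J" "x = b \<otimes> g \<oplus> k \<oplus> z3"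
          using bspec[OF Cons.prems(2) \<open>x \<in> I\<close>] by auto
        have "b \<in> carrier E" "k \<in> carrier E" "z3 \<in> carrier E" "l2 \<in> carrier E" "z2 \<in> carrier E"
          by (rule A_in[OF x(1)] A_in[OF ideal_ofD(1)[OF L x(2)]] A_in[OF ideal_ofD(1)[OF J x(3)]]
              A_in[OF ideal_ofD(1)[OF L l2]] A_in[OF ideal_ofD(1)[OF J z2]])+
        then have "b \<otimes> (l2 \<oplus> z2) \<oplus> k \<oplus> z3 = (b \<otimes> l2 \<oplus> k) \<oplus> (b \<otimes> z2 \<oplus> z3)" by algebra
        then have "x = (b \<otimes> l2 \<oplus> k) \<oplus> (b \<otimes> z2 \<oplus> z3)" using x(4) g3 by simp
        moreover have "b \<otimes> l2 \<oplus> k \<in> lspan gs" by (rule ideal_ofD(3)[OF L ideal_ofD(4)[OF L x(1) l2] x(2)])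
        moreover have "b \<otimes> z2 \<oplus> z3 \<in> J" by (rule ideal_ofD(3)[OF J ideal_ofD(4)[OF J x(1) z2] x(3)])
        ultimately show "\<exists>y\<in>lspan gs. \<exists>z\<in>J. x = y \<oplus> z" by blast
      qed
    qed
  qed
  show ?thesis
  proof (rule main[of gs0])
    have c: "set gs0 \<subseteq> carrier E" using gs0(1) A_carrier by blast
    show "set gs0 \<subseteq> I" using lspan_mem[OF _ c] gs0(2) by blast
    show "\<forall>x\<in>I. \<exists>y\<in>lspan gs0. \<exists>z\<in>J. x = y \<oplus> z"
    proof
      fix x assume x: "x \<in> I"
      then have "x = x \<oplus> \<zero>" using ideal_ofD(1)[OF I] by simp
      then show "\<exists>y\<in>lspan gs0. \<exists>z\<in>J. x = y \<oplus> z" using x gs0(2) ideal_ofD(2)[OF J] by blast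
    qed
  qed
qed

text \<open>For \<open>J = P\<close> this is the preimage in \<open>A\<close> of the ideal of
  \<open>A/P\<close> generated by \<open>w\<close>; statements about the ring \<open>A/P\<close> can
  thus be made in \<open>A\<close>.\<close>

definition mult_plus :: "'a \<Rightarrow> 'a set \<Rightarrow> 'a set" where
  "mult_plus w J = {w \<otimes> a \<oplus> z | a z. a \<in> A \<and> z \<in> J}"

lemma mult_plusI: "\<lbrakk>a \<in> A; z \<in> J\<rbrakk> \<Longrightarrow> w \<otimes> a \<oplus> z \<in> mult_plus w J"
  unfolding mult_plus_def by blast

lemma mult_plusE:
  assumes "x \<in> mult_plus w J" obtains a z where "a \<in> A" "z \<in> J" "x = w \<otimes> a \<oplus> z"
  using assms unfolding mult_plus_def by blast

lemma ideal_of_mult_plus: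
  assumes w: "w \<in> A" and J: "ideal_of E A J" shows "ideal_of E A (mult_plus w J)"
proof (rule ideal_ofI)
  show "mult_plus w J \<subseteq> A"
  proof
    fix x assume "x \<in> mult_plus w J"
    then obtain a z where "a \<in> A" "z \<in> J" "x = w \<otimes> a \<oplus> z" by (rule mult_plusE)
    then show "x \<in> A" using w ideal_ofD(1)[OF J] by simp
  qed
  show "\<zero> \<in> mult_plus w J"
    using mult_plusI[OF A_zero ideal_ofD(2)[OF J], of w] w by simp
  show "x \<oplus> y \<in> mult_plus w J" if xy: "x \<in> mult_plus w J" "y \<in> mult_plus w J" for x y
  proof -
    obtain a z where x: "a \<in> A" "z \<in> J" "x = w \<otimes> a \<oplus> z" using xy(1) by (rule mult_plusE)
    obtain b z' where y: "b \<in> A" "z' \<in> J" "y = w \<otimes> b \<oplus> z'" using xy(2) by (rule mult_plusE)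
    have "a \<in> carrier E" "b \<in> carrier E" "z \<in> carrier E" "z' \<in> carrier E" "w \<in> carrier E"
      using x y w ideal_ofD(1)[OF J] by auto
    then have "x \<oplus> y = w \<otimes> (a \<oplus> b) \<oplus> (z \<oplus> z')" unfolding x(3) y(3) by algebra
    then show ?thesis using mult_plusI[OF A_add[OF x(1) y(1)] ideal_ofD(3)[OF J x(2) y(2)]] by simp
  qed
  show "b \<otimes> x \<in> mult_plus w J" if b: "b \<in> A" and x: "x \<in> mult_plus w J" for b x
  proof -
    obtain a z where x: "a \<in> A" "z \<in> J" "x = w \<otimes> a \<oplus> z" using x by (rule mult_plusE)
    have "a \<in> carrier E" "b \<in> carrier E" "z \<in> carrier E" "w \<in> carrier E"
      using x b w ideal_ofD(1)[OF J] by auto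
    then have "b \<otimes> x = w \<otimes> (b \<otimes> a) \<oplus> b \<otimes> z" unfolding x(3) by algebra
    then show ?thesis using mult_plusI[OF A_mult[OF b x(1)] ideal_ofD(4)[OF J b x(2)]] by simp
  qed
qed

lemma ideal_of_zero: "ideal_of E A {\<zero>}"
  by (rule ideal_ofI) auto

lemma mult_plus_zero:
  assumes w: "w \<in> A" shows "mult_plus w {\<zero>} = {w \<otimes> a | a. a \<in> A}"
proof -
  have eq: "w \<otimes> a \<oplus> \<zero> = w \<otimes> a" if "a \<in> A" for a using that w by simp
  show ?thesis
  proof (intro equalityI subsetI)
    fix x assume "x \<in> mult_plus w {\<zero>}"
    then obtain a z where "a \<in> A" "z \<in> {\<zero>}" "x = w \<otimes> a \<oplus> z" by (rule mult_plusE)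
    then show "x \<in> {w \<otimes> a | a. a \<in> A}" using eq by auto
  next
    fix x assume "x \<in> {w \<otimes> a | a. a \<in> A}"
    then obtain a where a: "a \<in> A" "x = w \<otimes> a" by blast
    then show "x \<in> mult_plus w {\<zero>}" using mult_plusI[OF a(1), of \<zero> "{\<zero>}" w] eq[OF a(1)] by simp
  qed
qed

lemma ideal_chain_stable:
  fixes C :: "nat \<Rightarrow> 'a set"
  assumes C: "\<And>k. ideal_of E A (C k)" and mono: "\<And>k. C k \<subseteq> C (Suc k)"
  shows "\<exists>k. C (Suc k) \<subseteq> C k"
proof -
  have mono': "x \<in> C j" if "x \<in> C k" "k \<le> j" for x k j
    using that(2,1) by (induction j rule: dec_induct) (use mono in auto)
  have "ideal_of E A (\<Union>k. C k)"
  proof (rule ideal_ofI)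
    show "x \<oplus> y \<in> (\<Union>k. C k)" if xy: "x \<in> (\<Union>k. C k)" "y \<in> (\<Union>k. C k)" for x y
    proof -
      obtain i j where ij: "x \<in> C i" "y \<in> C j" using xy by auto
      then have "x \<in> C (max i j)" "y \<in> C (max i j)" using mono' by auto
      from ideal_ofD(3)[OF C this] show ?thesis by blast
    qed
    show "(\<Union>k. C k) \<subseteq> A"
    proof
      fix x assume "x \<in> (\<Union>k. C k)"
      then obtain k where "x \<in> C k" by blast
      then show "x \<in> A" by (rule ideal_ofD(1)[OF C])
    qed
    show "\<zero> \<in> (\<Union>k. C k)" using ideal_ofD(2)[OF C[of 0]] by blast
    show "b \<otimes> x \<in> (\<Union>k. C k)" if b: "b \<in> A" and x: "x \<in> (\<Union>k. C k)" for b x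
    proof -
      obtain k where "x \<in> C k" using x by blast
      from ideal_ofD(4)[OF C b this] show ?thesis by blast
    qed
  qed
  then obtain gs where gs: "set gs \<subseteq> A" "(\<Union>k. C k) = lspan gs" using noetherian by blast
  have "set gs \<subseteq> (\<Union>k. C k)" unfolding gs(2) using lspan_mem[of _ gs] gs(1) A_carrier by blast
  then have "\<exists>k. set gs \<subseteq> C k"
  proof (induction gs)
    case (Cons g gs)
    then obtain k j where "set gs \<subseteq> C k" "g \<in> C j" by auto
    then have "set gs \<subseteq> C (max k j)" "g \<in> C (max k j)" using mono' by (auto simp: subset_iff)
    then show ?case by (intro exI[of _ "max k j"]) auto
  qed auto
  then obtain k where "set gs \<subseteq> C k" by blast
  from lspan_minimal[OF C this] have "(\<Union>k. C k) \<subseteq> C k" using gs(2) by simp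
  then show ?thesis by blast
qed

text \<open>Modulo \<open>u\<close> the maximal ideal is generated by \<open>v\<close>, so the image
  of \<open>P\<close> is generated by a power \<open>v [^] k\<close>. An element \<open>x\<close> of
  \<open>P\<close> with image \<open>v [^] k\<close> times a unit generates \<open>P\<close> up to
  multiples of \<open>u\<close>; as \<open>u\<close> is not in the prime \<open>P\<close>, these
  multiples lie in \<open>u P\<close>, and Nakayama's lemma gives \<open>P = x A\<close>.\<close>

lemma prime_principal_aux:
  assumes uv: "u \<in> m" "v \<in> m" and gen: "\<And>x. x \<in> m \<Longrightarrow> \<exists>a\<in>A. \<exists>b\<in>A. x = u \<otimes> a \<oplus> v \<otimes> b"
    and P: "prime_of E A P" "P \<noteq> {\<zero>}" "u \<notin> P"
  shows "\<exists>f\<in>P. f \<noteq> \<zero> \<and> P = {f \<otimes> a | a. a \<in> A}"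
proof -
  have PI: "ideal_of E A P" and Pp: "\<And>a b. \<lbrakk>a \<in> A; b \<in> A; a \<otimes> b \<in> P\<rbrakk> \<Longrightarrow> a \<in> P \<or> b \<in> P"
    using prime_ofD[OF P(1)] by blast+
  have uA: "u \<in> A" and vA: "v \<in> A" using uv m_A by auto
  have uc: "u \<in> carrier E" and vc: "v \<in> carrier E" using uA vA by auto
  define J where "J = mult_plus u {\<zero>}"
  have J: "ideal_of E A J" unfolding J_def by (rule ideal_of_mult_plus[OF uA ideal_of_zero])
  have JI: "u \<otimes> a \<in> J" if "a \<in> A" for a unfolding J_def mult_plus_zero[OF uA] using that by blast
  have JE: "\<exists>a\<in>A. x = u \<otimes> a" if "x \<in> J" for x using that unfolding J_def mult_plus_zero[OF uA] by blast
  define V where "V k = mult_plus (v [^] k) J" for k :: nat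
  have V0: "P \<subseteq> V 0"
  proof
    fix x assume "x \<in> P"
    then have x: "x \<in> A" by (rule ideal_ofD(1)[OF PI])
    have "v [^] (0::nat) \<otimes> x \<oplus> \<zero> \<in> V 0" unfolding V_def by (rule mult_plusI[OF x ideal_ofD(2)[OF J]])
    then show "x \<in> V 0" using x by simp
  qed
  \<comment> \<open>If \<open>P\<close> were contained in every \<open>V k\<close>, stationarity of
    the chain \<open>C\<close> below would give \<open>I \<subseteq> v I + J\<close> for
    \<open>I = u A + P\<close>, so that \<open>P\<close> lies in \<open>J = u A\<close>. As
    \<open>u\<close> is not in \<open>P\<close>, then \<open>P = u P\<close>, and Nakayama's lemma
    makes \<open>P\<close> zero.\<close>
  have "\<exists>k. \<not> P \<subseteq> V k"
  proof (rule ccontr)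
    assume "\<not> (\<exists>k. \<not> P \<subseteq> V k)"
    then have all: "P \<subseteq> V k" for k by blast
    define I where "I = mult_plus u P"
    have I: "ideal_of E A I" unfolding I_def by (rule ideal_of_mult_plus[OF uA PI])
    have PsI: "x \<in> I" if "x \<in> P" for x
      using mult_plusI[OF A_zero that, of u] ideal_ofD(1)[OF PI that] uc unfolding I_def by simp
    have JsI: "x \<in> I" if x: "x \<in> J" for x
    proof -
      obtain a where "a \<in> A" "x = u \<otimes> a" using JE[OF x] by auto
      then show ?thesis using mult_plusI[OF _ ideal_ofD(2)[OF PI], of a u] uc unfolding I_def by simp
    qed
    define C where "C k = {y \<in> A. v [^] k \<otimes> y \<in> I}" for k :: nat
    have "ideal_of E A (C k)" for k
    proof (rule ideal_ofI)
      have vk: "v [^] k \<in> carrier E" using vc by simp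
      show "C k \<subseteq> A" by (auto simp: C_def)
      show "\<zero> \<in> C k" using vk ideal_ofD(2)[OF I] by (simp add: C_def)
      show "x \<oplus> y \<in> C k" if "x \<in> C k" "y \<in> C k" for x y
        using that vk ideal_ofD(3)[OF I] by (auto simp: C_def r_distr)
      show "b \<otimes> x \<in> C k" if "b \<in> A" "x \<in> C k" for b x
        using that vk ideal_ofD(4)[OF I that(1)] by (auto simp: C_def m_lcomm)
    qed
    moreover have "C k \<subseteq> C (Suc k)" for k
    proof
      fix y assume y: "y \<in> C k"
      have "v [^] Suc k \<otimes> y = v \<otimes> (v [^] k \<otimes> y)" using y vc by (simp add: C_def m_ac)
      then show "y \<in> C (Suc k)" using y ideal_ofD(4)[OF I vA] by (simp add: C_def)
    qed
    ultimately obtain k where k: "C (Suc k) \<subseteq> C k" using ideal_chain_stable by blast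
    have "I \<subseteq> J"
    proof (rule nakayama[OF I J uv(2)])
      fix x assume "x \<in> I"
      then obtain a q where xa: "a \<in> A" "q \<in> P" "x = u \<otimes> a \<oplus> q" unfolding I_def by (rule mult_plusE)
      have "q \<in> V (Suc k)" using all xa(2) by blast
      then obtain y z where yz: "y \<in> A" "z \<in> J" "q = v [^] Suc k \<otimes> y \<oplus> z" unfolding V_def by (rule mult_plusE)
      have c: "a \<in> carrier E" "y \<in> carrier E" "z \<in> carrier E" "v [^] k \<in> carrier E" "v [^] Suc k \<in> carrier E"
        using xa yz ideal_ofD(1)[OF J] vc by auto
      have "v [^] Suc k \<otimes> y = q \<ominus> z" unfolding yz(3) using c by algebra
      also have "\<dots> \<in> I" by (rule ideal_of_minus[OF I PsI[OF xa(2)] JsI[OF yz(2)]])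
      finally have "y \<in> C (Suc k)" using yz(1) by (simp add: C_def)
      then have "v [^] k \<otimes> y \<in> I" using k by (auto simp: C_def)
      moreover have "u \<otimes> a \<oplus> z \<in> J" by (rule ideal_ofD(3)[OF J JI[OF xa(1)] yz(2)])
      moreover have "x = v \<otimes> (v [^] k \<otimes> y) \<oplus> (u \<otimes> a \<oplus> z)"
        unfolding xa(3) yz(3) nat_pow_Suc using c(1-4) uc vc by algebra
      ultimately show "\<exists>y\<in>I. \<exists>z\<in>J. x = v \<otimes> y \<oplus> z" by blast
    qed
    have "P \<subseteq> {\<zero>}"
    proof (rule nakayama[OF PI ideal_of_zero uv(1)])
      fix x assume x: "x \<in> P"
      then obtain a where a: "a \<in> A" "x = u \<otimes> a" using JE PsI \<open>I \<subseteq> J\<close> by blast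
      then have "a \<in> P" using Pp[OF uA a(1)] x P(3) by blast
      moreover have "x = u \<otimes> a \<oplus> \<zero>" using a uc by simp
      ultimately show "\<exists>y\<in>P. \<exists>z\<in>{\<zero>}. x = u \<otimes> y \<oplus> z" by blast
    qed
    then show False using P(2) ideal_ofD(2)[OF PI] by blast
  qed
  then obtain k where k: "P \<subseteq> V k" "\<not> P \<subseteq> V (Suc k)"
    using nat_last_true[of "\<lambda>k. P \<subseteq> V k"] V0 by blast
  obtain x where x: "x \<in> P" "x \<notin> V (Suc k)" using k(2) by blast
  obtain y z where yz: "y \<in> A" "z \<in> J" "x = v [^] k \<otimes> y \<oplus> z" using x(1) k(1) unfolding V_def by (blast elim: mult_plusE)
  obtain z' where z': "z' \<in> A" "z = u \<otimes> z'" using JE[OF yz(2)] by auto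
  have vk: "v [^] k \<in> carrier E" using vc by simp
  have "y \<notin> m"
  proof
    assume "y \<in> m"
    then obtain a b where ab: "a \<in> A" "b \<in> A" "y = u \<otimes> a \<oplus> v \<otimes> b" using gen by blast
    have c: "a \<in> carrier E" "b \<in> carrier E" "z \<in> carrier E" using ab ideal_ofD(1)[OF J yz(2)] by auto
    have "x = v [^] Suc k \<otimes> b \<oplus> (u \<otimes> (v [^] k \<otimes> a) \<oplus> z)"
      unfolding yz(3) ab(3) nat_pow_Suc using c vk uc vc by algebra
    moreover have "u \<otimes> (v [^] k \<otimes> a) \<oplus> z \<in> J"
      using ideal_ofD(3)[OF J JI yz(2)] ab(1) vA by simp
    ultimately have "x \<in> V (Suc k)" unfolding V_def using mult_plusI[OF ab(2)] by simp
    with x(2) show False by contradiction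
  qed
  then obtain y' where y': "y' \<in> A" "y \<otimes> y' = \<one>" using m_unit[OF yz(1)] by auto
  have xA: "x \<in> A" using ideal_ofD(1)[OF PI x(1)] .
  define H where "H = mult_plus x {\<zero>}"
  have H: "ideal_of E A H" unfolding H_def by (rule ideal_of_mult_plus[OF xA ideal_of_zero])
  have HI: "x \<otimes> a \<in> H" if "a \<in> A" for a unfolding H_def mult_plus_zero[OF xA] using that by blast
  have "P \<subseteq> H"
  proof (rule nakayama[OF PI H uv(1)])
    fix q assume q: "q \<in> P"
    then obtain c d where cd: "c \<in> A" "d \<in> J" "q = v [^] k \<otimes> c \<oplus> d"
      using k(1) unfolding V_def by (blast elim: mult_plusE)
    obtain d' where d': "d' \<in> A" "d = u \<otimes> d'" using JE[OF cd(2)] by auto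
    have cc: "c \<in> carrier E" "d' \<in> carrier E" "y \<in> carrier E" "y' \<in> carrier E" "z' \<in> carrier E" "x \<in> carrier E"
      using cd d' yz y' z' xA by auto
    \<comment> \<open>A multiple of \<open>x\<close> cancels \<open>v [^] k \<otimes> c\<close>
      because \<open>y\<close> is a unit with inverse \<open>y'\<close>; \<open>?r\<close> is the
      remaining coefficient of \<open>u\<close>.\<close>
    let ?r = "d' \<ominus> z' \<otimes> y' \<otimes> c"
    have "v [^] k = v [^] k \<otimes> (y \<otimes> y')" using vk y'(2) by simp
    then have "q = (v [^] k \<otimes> (y \<otimes> y')) \<otimes> c \<oplus> u \<otimes> d'" using cd(3) d'(2) by simp
    also have "\<dots> = u \<otimes> ?r \<oplus> (v [^] k \<otimes> y \<oplus> u \<otimes> z') \<otimes> (y' \<otimes> c)" using cc vk uc by algebra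
    also have "v [^] k \<otimes> y \<oplus> u \<otimes> z' = x" using yz(3) z'(2) by simp
    finally have eq: "q = u \<otimes> ?r \<oplus> x \<otimes> (y' \<otimes> c)" .
    have rA: "?r \<in> A" using d' z' y' cd by simp
    have xP: "x \<otimes> (y' \<otimes> c) \<in> P"
      using ideal_ofD(4)[OF PI A_mult[OF y'(1) cd(1)] x(1)] m_comm[of x "y' \<otimes> c"] cc by simp
    have "u \<otimes> ?r = q \<ominus> x \<otimes> (y' \<otimes> c)"
    proof -
      have "?r \<in> carrier E" "x \<otimes> (y' \<otimes> c) \<in> carrier E" using cc by auto
      then have "(u \<otimes> ?r \<oplus> x \<otimes> (y' \<otimes> c)) \<ominus> x \<otimes> (y' \<otimes> c) = u \<otimes> ?r" using uc
        by (simp add: a_minus_def a_assoc r_neg)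
      then show ?thesis using eq by simp
    qed
    also have "\<dots> \<in> P" by (rule ideal_of_minus[OF PI q xP])
    finally have "?r \<in> P" using Pp[OF uA rA] P(3) by blast
    with eq show "\<exists>y\<in>P. \<exists>z\<in>H. q = u \<otimes> y \<oplus> z" using HI[OF A_mult[OF y'(1) cd(1)]] by blast
  qed
  moreover have "H \<subseteq> P"
  proof
    fix h assume "h \<in> H"
    then obtain a where a: "a \<in> A" "h = x \<otimes> a" unfolding H_def mult_plus_zero[OF xA] by blast
    then show "h \<in> P" using ideal_ofD(4)[OF PI a(1) x(1)] m_comm[of a x] xA by simp
  qed
  ultimately have PH: "P = {x \<otimes> a | a. a \<in> A}" using mult_plus_zero[OF xA] unfolding H_def by blast
  have "x \<noteq> \<zero>"
  proof
    assume "x = \<zero>"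
    then have "P \<subseteq> {\<zero>}" unfolding PH by auto
    then show False using P(2) ideal_ofD(2)[OF PI] by blast
  qed
  with x(1) PH show ?thesis by blast
qed

text \<open>Since \<open>P\<close> differs from \<open>m\<close>, one of the two generators lies
  outside \<open>P\<close>; the roles of \<open>u\<close> and \<open>v\<close> are exchanged if
  necessary.\<close>

lemma prime_principal:
  assumes uv: "u \<in> m" "v \<in> m" and gen: "\<And>x. x \<in> m \<Longrightarrow> \<exists>a\<in>A. \<exists>b\<in>A. x = u \<otimes> a \<oplus> v \<otimes> b"
    and P: "prime_of E A P" "P \<noteq> {\<zero>}" "P \<noteq> m"
  shows "\<exists>f\<in>P. f \<noteq> \<zero> \<and> P = {f \<otimes> a | a. a \<in> A}"
proof (cases "u \<in> P")
  case False
  then show ?thesis using prime_principal_aux[OF uv gen P(1,2)] by blast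
next
  case True
  have PI: "ideal_of E A P" "\<one> \<notin> P" using prime_ofD[OF P(1)] by blast+
  have "v \<notin> P"
  proof
    assume v: "v \<in> P"
    have "m \<subseteq> P"
    proof
      fix x assume "x \<in> m"
      then obtain a b where ab: "a \<in> A" "b \<in> A" "x = u \<otimes> a \<oplus> v \<otimes> b" using gen by blast
      have "a \<otimes> u \<oplus> b \<otimes> v \<in> P"
        by (rule ideal_ofD(3)[OF PI(1) ideal_ofD(4)[OF PI(1) ab(1) True] ideal_ofD(4)[OF PI(1) ab(2) v]])
      then show "x \<in> P" unfolding ab(3) using m_comm[of a u] m_comm[of b v] ab(1,2) uv m_A by auto
    qed
    moreover have "P \<subseteq> m" using proper_ideal_m[OF PI] by blast
    ultimately show False using P(3) by blast
  qed
  moreover have "\<exists>a\<in>A. \<exists>b\<in>A. x = v \<otimes> a \<oplus> u \<otimes> b" if x: "x \<in> m" for x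
  proof -
    obtain a b where ab: "a \<in> A" "b \<in> A" "x = u \<otimes> a \<oplus> v \<otimes> b" using gen[OF x] by blast
    then have "x = v \<otimes> b \<oplus> u \<otimes> a" using uv m_A by (simp add: a_comm)
    with ab show ?thesis by blast
  qed
  ultimately show ?thesis using prime_principal_aux[OF uv(2,1) _ P(1,2)] by blast
qed

text \<open>Krull's intersection theorem for \<open>A/P\<close>. With \<open>I\<close> the
  intersection of all \<open>mult_plus (w [^] k) P\<close>, primality of \<open>P\<close> and
  \<open>w \<notin> P\<close> allow one factor \<open>w\<close> to be cancelled, so \<open>I\<close>
  is contained in \<open>w I + P\<close> and Nakayama's lemma applies.\<close>

lemma separated_modulo:
  assumes P: "prime_of E A P" and w: "w \<in> m" "w \<notin> P" and a: "a \<in> A" "a \<notin> P"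
  shows "\<exists>k::nat. a \<notin> mult_plus (w [^] k) P"
proof -
  have PI: "ideal_of E A P" and Pp: "\<And>a b. \<lbrakk>a \<in> A; b \<in> A; a \<otimes> b \<in> P\<rbrakk> \<Longrightarrow> a \<in> P \<or> b \<in> P"
    using prime_ofD[OF P(1)] by blast+
  have wA: "w \<in> A" using w m_A by simp
  define I where "I = {a \<in> A. \<forall>k::nat. a \<in> mult_plus (w [^] k) P}"
  have M: "ideal_of E A (mult_plus (w [^] k) P)" for k :: nat
    using ideal_of_mult_plus[OF A_pow[OF wA] PI] .
  have I: "ideal_of E A I"
    by (rule ideal_ofI) (auto simp: I_def intro: ideal_ofD[OF M])
  have "I \<subseteq> P"
  proof (rule nakayama[OF I PI w(1)])
    fix x assume x: "x \<in> I"
    then have "x \<in> mult_plus (w [^] (1::nat)) P" unfolding I_def by blast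
    then obtain b c where bc: "b \<in> A" "c \<in> P" "x = w [^] (1::nat) \<otimes> b \<oplus> c" by (rule mult_plusE)
    then have xe: "x = w \<otimes> b \<oplus> c" using wA by simp
    have cA: "c \<in> A" using ideal_ofD(1)[OF PI bc(2)] .
    have "b \<in> I" unfolding I_def
    proof (intro CollectI conjI allI bc(1))
      fix k :: nat
      have "x \<in> mult_plus (w [^] Suc k) P" using x unfolding I_def by blast
      then obtain b' c' where b': "b' \<in> A" "c' \<in> P" "x = w [^] Suc k \<otimes> b' \<oplus> c'" by (rule mult_plusE)
      have c'A: "c' \<in> A" using ideal_ofD(1)[OF PI b'(2)] .
      have cc: "b \<in> carrier E" "b' \<in> carrier E" "c \<in> carrier E" "c' \<in> carrier E" "w \<in> carrier E" "w [^] k \<in> carrier E"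
        using bc b' cA c'A wA by auto
      have "w \<otimes> (b \<ominus> w [^] k \<otimes> b') = (w \<otimes> b \<oplus> c) \<ominus> (w [^] k \<otimes> w \<otimes> b' \<oplus> c') \<oplus> (c' \<ominus> c)"
        using cc by algebra
      also have "\<dots> = (x \<ominus> x) \<oplus> (c' \<ominus> c)" using b'(3) xe by simp
      also have "\<dots> = c' \<ominus> c" using cc xe by simp
      also have "\<dots> \<in> P" by (rule ideal_of_minus[OF PI b'(2) bc(2)])
      finally have "b \<ominus> w [^] k \<otimes> b' \<in> P" using Pp[OF wA, of "b \<ominus> w [^] k \<otimes> b'"] bc(1) b'(1) wA w(2) by simp
      from mult_plusI[OF b'(1) this, of "w [^] k"]
      show "b \<in> mult_plus (w [^] k) P"
      proof -
        have "w [^] k \<otimes> b' \<oplus> (b \<ominus> w [^] k \<otimes> b') = b" using cc by algebra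
        then show ?thesis using \<open>w [^] k \<otimes> b' \<oplus> (b \<ominus> w [^] k \<otimes> b') \<in> mult_plus (w [^] k) P\<close> by simp
      qed
    qed
    with bc(2) xe show "\<exists>y\<in>I. \<exists>z\<in>P. x = w \<otimes> y \<oplus> z" by blast
  qed
  then show ?thesis using a unfolding I_def by blast
qed

lemma separated_principal:
  assumes w: "w \<in> m" "w \<noteq> \<zero>" and a: "a \<in> A" "a \<noteq> \<zero>"
  shows "\<exists>k::nat. \<forall>b\<in>A. a \<noteq> w [^] k \<otimes> b"
proof -
  have "prime_of E A {\<zero>}"
    unfolding prime_of_def using integral by auto
  from separated_modulo[OF this w(1) _ a(1)] w(2) a(2)
  obtain k :: nat where k: "a \<notin> mult_plus (w [^] k) {\<zero>}" by blast
  have "w [^] k \<in> A" using w m_A by simp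
  then show ?thesis using k unfolding mult_plus_zero[OF \<open>w [^] k \<in> A\<close>] by blast
qed

text \<open>The exponent \<open>s\<close> is the last one with \<open>a\<close> in
  \<open>mult_plus (w [^] s) P\<close>; a cofactor \<open>y\<close> in \<open>m\<close> would allow
  one more.\<close>

lemma dvr_normal_form:
  assumes P: "prime_of E A P" and w: "w \<in> m" "w \<notin> P" and gen: "m = mult_plus w P" and a: "a \<in> A" "a \<notin> P"
  shows "\<exists>s y c. y \<in> A \<and> y \<notin> m \<and> c \<in> P \<and> a = w [^] (s::nat) \<otimes> y \<oplus> c"
proof -
  have PI: "ideal_of E A P" using prime_ofD[OF P(1)] by blast
  have wA: "w \<in> carrier E" using w m_A by simp
  have "w [^] (0::nat) \<otimes> a \<oplus> \<zero> \<in> mult_plus (w [^] (0::nat)) P"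
    by (rule mult_plusI[OF a(1) ideal_ofD(2)[OF PI]])
  then have "a \<in> mult_plus (w [^] (0::nat)) P" using a(1) by simp
  then obtain s :: nat where s: "a \<in> mult_plus (w [^] s) P" "a \<notin> mult_plus (w [^] Suc s) P"
    using nat_last_true[of "\<lambda>k. a \<in> mult_plus (w [^] k) P"] separated_modulo[OF P w a] by blast
  obtain y c where y: "y \<in> A" "c \<in> P" "a = w [^] s \<otimes> y \<oplus> c" using s(1) by (rule mult_plusE)
  have "y \<notin> m"
  proof
    assume "y \<in> m"
    then have "y \<in> mult_plus w P" using gen by simp
    then obtain b d where b: "b \<in> A" "d \<in> P" "y = w \<otimes> b \<oplus> d" by (rule mult_plusE)
    have cc: "b \<in> carrier E" "d \<in> carrier E" "c \<in> carrier E" "w [^] s \<in> carrier E"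
      using b y ideal_ofD(1)[OF PI] wA by auto
    have "a = w [^] Suc s \<otimes> b \<oplus> (w [^] s \<otimes> d \<oplus> c)"
      unfolding y(3) b(3) nat_pow_Suc using cc wA by algebra
    moreover have "w [^] s \<otimes> d \<oplus> c \<in> P"
      using ideal_ofD(3)[OF PI ideal_ofD(4)[OF PI A_pow[OF m_A[OF w(1)]] b(2)] y(2)] .
    ultimately have "a \<in> mult_plus (w [^] Suc s) P" using mult_plusI[OF b(1)] by simp
    with s(2) show False by contradiction
  qed
  with y show ?thesis by blast
qed

end

section \<open>Frobenius, coefficient fields\<close>

context cring begin

lemma binomial_expansion:
  assumes x: "x \<in> carrier R" and y: "y \<in> carrier R"
  shows "(x \<oplus> y) [^] (n::nat) = (\<Oplus>k\<in>{..n}. add_pow R (n choose k) (x [^] k \<otimes> y [^] (n - k)))"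
proof (induction n)
  case 0
  then show ?case using x y by (simp add: finsum_0)
next
  case (Suc n)
  let ?t = "\<lambda>c k l. add_pow R ((c::nat)) (x [^] (k::nat) \<otimes> y [^] (l::nat))"
  let ?S = "\<Oplus>k\<in>{..n}. ?t (n choose k) k (n - k)"
  have t: "?t c k l \<in> carrier R" for c k l using x y by simp
  have tx: "x \<otimes> ?t c k l = ?t c (Suc k) l" for c k l
    using x y by (subst add_pow_rdistr) (simp_all add: m_ac)
  have ty: "y \<otimes> ?t c k l = ?t c k (Suc l)" for c k l
    using x y by (subst add_pow_rdistr) (simp_all add: m_ac)
  have S: "?S \<in> carrier R" using t by (intro finsum_closed) auto
  have X: "x \<otimes> ?S = (\<Oplus>k\<in>{..n}. ?t (n choose k) (Suc k) (n - k))"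
    using t by (subst finsum_rdistr[OF _ x]) (auto simp: tx)
  have Y: "y \<otimes> ?S = (\<Oplus>k\<in>{..Suc n}. ?t (n choose k) k (Suc n - k))"
  proof -
    have "y \<otimes> ?S = (\<Oplus>k\<in>{..n}. ?t (n choose k) k (Suc (n - k)))"
      using t by (subst finsum_rdistr[OF _ y]) (auto simp: ty)
    also have "\<dots> = (\<Oplus>k\<in>{..n}. ?t (n choose k) k (Suc n - k))"
      using t by (intro finsum_cong') (auto simp: Suc_diff_le)
    \<comment> \<open>The added term for \<open>k = Suc n\<close> has coefficient zero. With it, the
      term for \<open>k = 0\<close> can be split off and the rest matched with the other sum by
      Pascal's rule.\<close>
    also have "\<dots> = (\<Oplus>k\<in>{..Suc n}. ?t (n choose k) k (Suc n - k))"
      using t by (subst finsum_Suc) (simp_all add: binomial_eq_0 Pi_def finsum_closed del: nat_pow_Suc)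
    finally show ?thesis .
  qed
  have "(\<Oplus>k\<in>{..Suc n}. ?t (Suc n choose k) k (Suc n - k))
      = (\<Oplus>k\<in>{..n}. ?t (Suc n choose Suc k) (Suc k) (n - k)) \<oplus> ?t 1 0 (Suc n)"
    using t by (subst finsum_Suc2) (auto simp del: binomial_Suc_Suc nat_pow_Suc)
  also have "(\<Oplus>k\<in>{..n}. ?t (Suc n choose Suc k) (Suc k) (n - k))
      = (\<Oplus>k\<in>{..n}. ?t (n choose k) (Suc k) (n - k) \<oplus> ?t (n choose Suc k) (Suc k) (n - k))"
    using t x y by (intro finsum_cong') (auto simp: add.nat_pow_mult simp del: nat_pow_Suc)
  also have "\<dots> = x \<otimes> ?S \<oplus> (\<Oplus>k\<in>{..n}. ?t (n choose Suc k) (Suc k) (n - k))"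
    unfolding X by (rule finsum_addf[OF Pi_I[OF t] Pi_I[OF t]])
  also have "\<dots> \<oplus> ?t 1 0 (Suc n)
      = x \<otimes> ?S \<oplus> ((\<Oplus>k\<in>{..n}. ?t (n choose Suc k) (Suc k) (n - k)) \<oplus> ?t 1 0 (Suc n))"
    by (rule a_assoc[OF m_closed[OF x S] finsum_closed[OF Pi_I[OF t]] t])
  also have "(\<Oplus>k\<in>{..n}. ?t (n choose Suc k) (Suc k) (n - k)) \<oplus> ?t 1 0 (Suc n) = y \<otimes> ?S"
    unfolding Y using t by (subst finsum_Suc2) (auto simp del: nat_pow_Suc)
  also have "x \<otimes> ?S \<oplus> y \<otimes> ?S = ?S \<otimes> (x \<oplus> y)"     by (simp only: m_comm[OF S a_closed[OF x y]] l_distr[OF x y S])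
  finally show ?case using Suc by simp
qed

text \<open>For \<open>0 < k < p\<close> one has
  \<open>k (p choose k) = p ((p - 1) choose (k - 1))\<close> and \<open>p\<close> does not divide
  \<open>k\<close>, so the middle terms of the binomial expansion vanish.\<close>

lemma frobenius_add:
  assumes p: "Factorial_Ring.prime (p::nat)" "add_pow R p \<one> = \<zero>" and x: "x \<in> carrier R" and y: "y \<in> carrier R"
  shows "(x \<oplus> y) [^] p = x [^] p \<oplus> y [^] p"
proof -
  have ann: "add_pow R c z = \<zero>" if pc: "p dvd c" and z: "z \<in> carrier R" for c z
  proof -
    obtain d where d: "c = p * d" using pc by (rule dvdE)
    have "add_pow R p z = \<zero>" using add_pow_ldistr[of \<one> z p] z p(2) by simp
    then have "add_pow R d (add_pow R p z) = \<zero>" by (simp add: add.nat_pow_one)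
    then show ?thesis unfolding d using add.nat_pow_pow[OF z, of d p] by (simp add: mult.commute)
  qed
  have dv: "p dvd (p choose k)" if "0 < k" "k < p" for k
  proof -
    have "k * (p choose k) = p * ((p - 1) choose (k - 1))" using that times_binomial_minus1_eq by simp
    then have "p dvd k * (p choose k)" by simp
    moreover have "\<not> p dvd k" using that by (auto dest: dvd_imp_le)
    ultimately show ?thesis using p(1) prime_dvd_mult_iff by blast
  qed
  obtain q where q: "p = Suc q" "0 < q" using p(1) prime_gt_1_nat by (metis Suc_lessE One_nat_def)
  let ?t = "\<lambda>k. add_pow R (p choose k) (x [^] k \<otimes> y [^] (p - k))"
  have t: "?t k \<in> carrier R" for k using x y by simp
  have "(x \<oplus> y) [^] p = (\<Oplus>k\<in>{..p}. ?t k)" by (rule binomial_expansion[OF x y])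
  also have "\<dots> = ?t p \<oplus> (\<Oplus>k\<in>{..q}. ?t k)" using t unfolding q by (subst finsum_Suc) auto
  also have "(\<Oplus>k\<in>{..q}. ?t k) = (\<Oplus>k\<in>{..q}. if 0 = k then y [^] p else \<zero>)"
    using dv q t x y by (intro finsum_cong') (auto intro!: ann)
  also have "\<dots> = y [^] p" using finsum_singleton[of 0 "{..q}" "\<lambda>_. y [^] p"] y by simp
  also have "?t p = x [^] p" using x by simp
  finally show ?thesis .
qed

lemma frobenius_pow_add:
  assumes p: "Factorial_Ring.prime (p::nat)" "add_pow R p \<one> = \<zero>" and x: "x \<in> carrier R" and y: "y \<in> carrier R"
  shows "(x \<oplus> y) [^] (p ^ n) = x [^] (p ^ n) \<oplus> y [^] (p ^ n)"
proof (induction n)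
  case (Suc n)
  have pw: "z [^] (p ^ Suc n) = (z [^] (p ^ n)) [^] p" if "z \<in> carrier R" for z
    using nat_pow_pow[OF that, of "p ^ n" p] by (simp add: mult.commute)
  show ?case using Suc frobenius_add[OF p, of "x [^] (p ^ n)" "y [^] (p ^ n)"] x y by (simp add: pw del: power_Suc)
qed (use x y in simp)

lemma frobenius_pow_minus:
  assumes p: "Factorial_Ring.prime (p::nat)" "add_pow R p \<one> = \<zero>" and x: "x \<in> carrier R" and y: "y \<in> carrier R"
  shows "(x \<ominus> y) [^] (p ^ n) = x [^] (p ^ n) \<ominus> y [^] (p ^ n)"
proof -
  have "x = (x \<ominus> y) \<oplus> y" using x y by algebra
  then have eq: "x [^] (p ^ n) = (x \<ominus> y) [^] (p ^ n) \<oplus> y [^] (p ^ n)"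
    using frobenius_pow_add[OF p minus_closed[OF x y] y, of n] by simp
  have c: "(x \<ominus> y) [^] (p ^ n) \<in> carrier R" "y [^] (p ^ n) \<in> carrier R" using x y by auto
  show ?thesis unfolding eq using c by algebra
qed

lemma frobenius_minus:
  assumes p: "Factorial_Ring.prime (p::nat)" "add_pow R p \<one> = \<zero>" and x: "x \<in> carrier R" and y: "y \<in> carrier R"
  shows "(x \<ominus> y) [^] p = x [^] p \<ominus> y [^] p"
  using frobenius_pow_minus[OF assms, of 1] by simp

section \<open>Local rings, coefficient fields and the dimension over them\<close>

lemma unit_outside_ideal:
  assumes "ideal M R" "\<And>a. \<lbrakk>a \<in> carrier R; a \<notin> M\<rbrakk> \<Longrightarrow> \<exists>b\<in>carrier R. a \<otimes> b = \<one>"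
    and J: "ideal J R" "a \<in> J" "a \<notin> M"
  shows "J = carrier R"
proof -
  interpret J: ideal J R by (rule J(1))
  obtain b where b: "b \<in> carrier R" "a \<otimes> b = \<one>" using assms(2)[OF J.Icarr[OF J(2)] J(3)] by auto
  then have "\<one> \<in> J" using J.I_r_closed[OF J(2) b(1)] by simp
  then show ?thesis by (rule J.one_imp_carrier)
qed

lemma local_cringI:
  assumes M: "ideal M R" "\<one> \<notin> M" and u: "\<And>a. \<lbrakk>a \<in> carrier R; a \<notin> M\<rbrakk> \<Longrightarrow> \<exists>b\<in>carrier R. a \<otimes> b = \<one>"
  shows "local_cring R" "max_ideal R = M" "maximalideal M R"
proof -
  have all: "J = carrier R" if "ideal J R" "a \<in> J" "a \<notin> M" for J a
    by (rule unit_outside_ideal[OF M(1) _ that]) (rule u)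
  show mx: "maximalideal M R"
  proof (rule maximalidealI[OF M(1)])
    show "carrier R \<noteq> M" using M(2) by auto
    show "J = M \<or> J = carrier R" if "ideal J R" "M \<subseteq> J" "J \<subseteq> carrier R" for J
      using all[OF that(1)] that(2) by blast
  qed
  have uniq: "M' = M" if "maximalideal M' R" for M'
  proof -
    interpret M': maximalideal M' R by (rule that)
    have "M' \<subseteq> M" using all[OF M'.ideal_axioms] M'.I_notcarr by blast
    then show ?thesis using M'.I_maximal[OF M(1)] M(2) ideal.Icarr[OF M(1)] one_closed by blast
  qed
  show "local_cring R" unfolding local_cring_def by (intro conjI is_cring ex1I[of _ M] mx uniq)
  show "max_ideal R = M" unfolding max_ideal_def using mx uniq by (intro the_equality)
qed

lemma local_cring_maximal:
  assumes "local_cring R"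
  shows "maximalideal (max_ideal R) R"
    and "\<lbrakk>a \<in> carrier R; a \<notin> max_ideal R\<rbrakk> \<Longrightarrow> \<exists>b\<in>carrier R. a \<otimes> b = \<one>"
proof -
  have ex: "\<exists>!M. maximalideal M R" using assms unfolding local_cring_def by blast
  show mx: "maximalideal (max_ideal R) R" unfolding max_ideal_def by (rule theI'[OF ex])
  assume a: "a \<in> carrier R" "a \<notin> max_ideal R"
  have "\<one> \<in> PIdl a"
  proof (rule ccontr)
    assume "\<one> \<notin> PIdl a"
    from exists_maximalideal_above[OF cgenideal_ideal[OF a(1)] this]
    obtain Q where "maximalideal Q R" "PIdl a \<subseteq> Q" by blast
    then have "a \<in> max_ideal R" using ex mx cgenideal_self[OF a(1)] by blast
    with a(2) show False by contradiction
  qed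
  then show "\<exists>b\<in>carrier R. a \<otimes> b = \<one>" unfolding cgenideal_def using m_comm[OF a(1)] by auto
qed

text \<open>For a principal artinian local ring with perfect residue field the \<open>p^n\<close>-th powers form a
  coefficient field as soon as the \<open>p^n\<close>-th power of the maximal ideal vanishes.\<close>

lemma residue_field_dim_eq:
  assumes loc: "local_cring R" and w: "w \<in> carrier R" "max_ideal R = PIdl w"
    and s: "w [^] Suc s = \<zero>" "w [^] s \<noteq> \<zero>"
    and p: "Factorial_Ring.prime (p::nat)" "add_pow R p \<one> = \<zero>"
    and perfect: "\<And>x. x \<in> carrier R \<Longrightarrow> \<exists>y\<in>carrier R. x \<ominus> y [^] p \<in> max_ideal R"
  shows "residue_field_dim R = Suc s"
proof -
  let ?M = "max_ideal R"
  interpret M: maximalideal ?M R by (rule local_cring_maximal(1)[OF loc])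
  interpret P: primeideal ?M R by (rule maximalideal_prime[OF M.maximalideal_axioms])
  note unit = local_cring_maximal(2)[OF loc]
  have M1: "\<one> \<notin> ?M" using M.one_imp_carrier M.I_notcarr by auto
  obtain n where n: "Suc s \<le> p ^ n"
  proof -
    have "Suc s \<le> 2 ^ Suc s" by (rule less_imp_le[OF less_exp])
    also have "(2::nat) ^ Suc s \<le> p ^ Suc s" using prime_ge_2_nat[OF p(1)] by (intro power_mono) auto
    finally show thesis by (rule that)
  qed
  let ?q = "p ^ n"
  have q0: "?q \<noteq> 0" using p(1) by (simp add: prime_gt_0_nat)
  have Mq: "x [^] ?q = \<zero>" if x: "x \<in> ?M" for x
  proof -
    obtain c where c: "c \<in> carrier R" "x = c \<otimes> w" using x[unfolded w(2) cgenideal_def] by blast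
    obtain d where d: "?q = d + Suc s" using n le_Suc_ex[of "Suc s" ?q] by (auto simp: add.commute simp del: add_Suc)
    have "w [^] ?q = w [^] d \<otimes> w [^] Suc s" unfolding d by (rule nat_pow_mult[OF w(1), symmetric])
    then have "w [^] ?q = \<zero>" unfolding s(1) using w(1) by simp
    then show ?thesis using c w(1) by (simp add: nat_pow_distrib)
  qed
  have powM: "x \<in> ?M" if "x \<in> carrier R" "x [^] (k::nat) \<in> ?M" for x k
    using that
  proof (induction k)
    case (Suc k)
    then show ?case using P.I_prime[of "x [^] k" x] by auto
  qed (use M1 in simp)
  define F where "F = (\<lambda>x. x [^] ?q) ` carrier R"
  have Fc: "F \<subseteq> carrier R" by (auto simp: F_def)
  have subr: "subring F R"
  proof (rule subringI)
    show "F \<subseteq> carrier R" by (rule Fc)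
    show "\<one> \<in> F" unfolding F_def by (rule image_eqI[of _ _ \<one>]) auto
    show "\<ominus> h \<in> F" if h: "h \<in> F" for h
    proof -
      obtain x where x: "x \<in> carrier R" "h = x [^] ?q" using h by (auto simp: F_def)
      have "(\<zero> \<ominus> x) [^] ?q = \<zero> [^] ?q \<ominus> x [^] ?q" by (rule frobenius_pow_minus[OF p zero_closed x(1)])
      then have "\<ominus> h = (\<zero> \<ominus> x) [^] ?q" using x q0 by (simp add: nat_pow_zero minus_eq)
      then show ?thesis using x unfolding F_def by auto
    qed
    show "h \<otimes> k \<in> F" "h \<oplus> k \<in> F" if h: "h \<in> F" "k \<in> F" for h k
    proof -
      obtain x y where x: "x \<in> carrier R" "h = x [^] ?q" "y \<in> carrier R" "k = y [^] ?q" using h by (auto simp: F_def)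
      have "h \<otimes> k = (x \<otimes> y) [^] ?q" "h \<oplus> k = (x \<oplus> y) [^] ?q"
        using x frobenius_pow_add[OF p x(1,3), of n] by (simp_all add: nat_pow_distrib)
      then show "h \<otimes> k \<in> F" "h \<oplus> k \<in> F" using x unfolding F_def by auto
    qed
  qed
  have "\<one> \<noteq> \<zero>" using M1 additive_subgroup.zero_closed[OF M.additive_subgroup_axioms] by auto
  have "subfield F R"
  proof (rule subfieldI[OF subcringI'[OF subr]])
    show "Units (R\<lparr>carrier := F\<rparr>) = F - {\<zero>}"
    proof
      show "Units (R\<lparr>carrier := F\<rparr>) \<subseteq> F - {\<zero>}"
        using \<open>\<one> \<noteq> \<zero>\<close> Fc unfolding Units_def by auto
      show "F - {\<zero>} \<subseteq> Units (R\<lparr>carrier := F\<rparr>)"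
      proof
        fix h assume h: "h \<in> F - {\<zero>}"
        then obtain x where x: "x \<in> carrier R" "h = x [^] ?q" by (auto simp: F_def)
        then have "x \<notin> ?M" using Mq h by auto
        then obtain y where y: "y \<in> carrier R" "x \<otimes> y = \<one>" using unit x by auto
        have "h \<otimes> y [^] ?q = (x \<otimes> y) [^] ?q" using x y(1) by (simp add: nat_pow_distrib)
        then have "h \<otimes> y [^] ?q = \<one>" unfolding y(2) by simp
        moreover from this have "y [^] ?q \<otimes> h = \<one>" using x y(1) m_comm[of "y [^] ?q" h] by simp
        moreover have "y [^] ?q \<in> F" using y(1) by (auto simp: F_def)
        ultimately show "h \<in> Units (R\<lparr>carrier := F\<rparr>)" using h unfolding Units_def by auto
      qed
    qed
  qed
  \<comment> \<open>Taking a \<open>p\<close>-th root modulo the maximal ideal \<open>k\<close>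
    times, with Frobenius additive, makes every element a \<open>p^k\<close>-th power modulo that
    ideal.\<close>
  have lift: "\<exists>y\<in>carrier R. x \<ominus> y [^] (p ^ k) \<in> ?M" if x: "x \<in> carrier R" for x k
  proof (induction k)
    case 0
    have "x \<ominus> x [^] (p ^ 0) = \<zero>" using x by (simp add: minus_eq r_neg)
    then have "x \<ominus> x [^] (p ^ 0) \<in> ?M"
      using additive_subgroup.zero_closed[OF M.additive_subgroup_axioms] by (simp only:)
    then show ?case using x by blast
  next
    case (Suc k)
    then obtain y where y: "y \<in> carrier R" "x \<ominus> y [^] (p ^ k) \<in> ?M" by auto
    obtain z where z: "z \<in> carrier R" "y \<ominus> z [^] p \<in> ?M" using perfect[OF y(1)] by auto
    have zz: "(z [^] p) [^] (p ^ k) = z [^] (p ^ Suc k)"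
      using nat_pow_pow[OF z(1), of p "p ^ k"] by simp
    have "(y \<ominus> z [^] p) [^] (p ^ k) \<in> ?M"
    proof -
      obtain l where "p ^ k = Suc l" using p(1) by (metis not0_implies_Suc power_eq_0_iff not_prime_0)
      then show ?thesis using M.I_l_closed[OF z(2), of "(y \<ominus> z [^] p) [^] l"] y z by simp
    qed
    then have m2: "y [^] (p ^ k) \<ominus> z [^] (p ^ Suc k) \<in> ?M"
      unfolding frobenius_pow_minus[OF p y(1) nat_pow_closed[OF z(1)]] zz .
    have "x \<ominus> z [^] (p ^ Suc k) = (x \<ominus> y [^] (p ^ k)) \<oplus> (y [^] (p ^ k) \<ominus> z [^] (p ^ Suc k))"
    proof -
      have "y [^] (p ^ k) \<in> carrier R" "z [^] (p ^ Suc k) \<in> carrier R" using y z by auto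
      then show ?thesis using x by algebra
    qed
    then have "x \<ominus> z [^] (p ^ Suc k) \<in> ?M"
      using additive_subgroup.a_closed[OF M.additive_subgroup_axioms y(2) m2] by simp
    then show ?case using z(1) by blast
  qed
  have coset: "?M +> a = ?M +> b \<longleftrightarrow> a \<ominus> b \<in> ?M" if "a \<in> carrier R" "b \<in> carrier R" for a b
    using quotient_eq_iff_same_a_r_cos[OF M.ideal_axioms that] by simp
  have "coefficient_field F R"
    unfolding coefficient_field_def bij_betw_def
  proof (intro conjI \<open>subfield F R\<close> inj_onI)
    fix h k assume hk: "h \<in> F" "k \<in> F" "?M +> h = ?M +> k"
    then obtain x y where x: "x \<in> carrier R" "h = x [^] ?q" "y \<in> carrier R" "k = y [^] ?q" by (auto simp: F_def)
    have "h \<ominus> k \<in> ?M" using coset hk Fc by blast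
    then have "(x \<ominus> y) [^] ?q \<in> ?M" using frobenius_pow_minus[OF p x(1,3), of n] x by simp
    then have "x \<ominus> y \<in> ?M" using powM x by blast
    then have "h \<ominus> k = \<zero>" using Mq frobenius_pow_minus[OF p x(1,3), of n] x by simp
    then show "h = k" using hk Fc by (metis r_right_minus_eq subsetD)
  next
    show "(+>) ?M ` F = carrier (R Quot ?M)"
    proof
      show "(+>) ?M ` F \<subseteq> carrier (R Quot ?M)"
        using Fc unfolding FactRing_def A_RCOSETS_def' by auto
      show "carrier (R Quot ?M) \<subseteq> (+>) ?M ` F"
      proof
        fix C assume "C \<in> carrier (R Quot ?M)"
        then obtain x where x: "x \<in> carrier R" "C = ?M +> x" unfolding FactRing_def A_RCOSETS_def' by auto
        obtain y where y: "y \<in> carrier R" "x \<ominus> y [^] ?q \<in> ?M" using lift[OF x(1)] by blast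
        then have "C = ?M +> y [^] ?q" using x coset by simp
        then show "C \<in> (+>) ?M ` F" using y(1) unfolding F_def by blast
      qed
    qed
  qed
  \<comment> \<open>The set \<open>F\<close> shows that a coefficient field exists. The dimension is
    computed for the field \<open>K\<close> picked by the choice operator, of which nothing is used
    except that it is a coefficient field.\<close>
  then have "coefficient_field (SOME F. coefficient_field F R) R" by (rule someI)
  then obtain K where K: "K = (SOME F. coefficient_field F R)" "subfield K R"
    "bij_betw ((+>) ?M) K (carrier (R Quot ?M))" unfolding coefficient_field_def by blast
  have Kc: "K \<subseteq> carrier R" by (rule subfieldE(3)[OF K(2)])
  have dec: "\<exists>a\<in>K. \<exists>d\<in>carrier R. c = a \<oplus> d \<otimes> w" if c: "c \<in> carrier R" for c
  proof -
    have "?M +> c \<in> carrier (R Quot ?M)" using c unfolding FactRing_def A_RCOSETS_def' by auto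
    then have "?M +> c \<in> (+>) ?M ` K" using K(3) unfolding bij_betw_def by simp
    then obtain a where a: "a \<in> K" "?M +> c = ?M +> a" by blast
    have ac: "a \<in> carrier R" using a(1) Kc by blast
    have "c \<ominus> a \<in> ?M" using a(2) coset[OF c ac] by simp
    then obtain d where d: "d \<in> carrier R" "c \<ominus> a = d \<otimes> w" unfolding w(2) cgenideal_def by auto
    have "c = a \<oplus> (c \<ominus> a)" using c ac by algebra
    then have "c = a \<oplus> d \<otimes> w" using d(2) by simp
    then show ?thesis using a(1) d(1) by blast
  qed
  \<comment> \<open>The powers of the maximal ideal form a filtration whose steps are lines over
    \<open>K\<close>, since every element is one of \<open>K\<close> modulo \<open>w\<close>;
    dimension \<open>j\<close> belongs to the exponent \<open>Suc s - j\<close>.\<close>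
  have "dimension j K (PIdl (w [^] (Suc s - j)))" if "j \<le> Suc s" for j
    using that
  proof (induction j)
    case 0
    have "PIdl (w [^] Suc s) = {\<zero>}" unfolding s(1) cgenideal_def by (auto intro!: exI[of _ \<one>])
    then show ?case by simp
  next
    case (Suc j)
    let ?v = "w [^] (Suc s - Suc j)"
    have e: "Suc s - j = Suc (Suc s - Suc j)" using Suc.prems by simp
    have v: "?v \<in> carrier R" using w(1) by simp
    have wv: "w [^] (Suc s - j) = ?v \<otimes> w" unfolding e by simp
    have v0: "?v \<noteq> \<zero>"
    proof
      assume v0: "?v = \<zero>"
      have "w [^] s = ?v \<otimes> w [^] j" using nat_pow_mult[OF w(1), of "Suc s - Suc j" j] Suc.prems by simp
      then show False using s(2) v0 w(1) by simp
    qed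
    have notin: "?v \<notin> PIdl (w [^] (Suc s - j))"
    proof
      assume "?v \<in> PIdl (w [^] (Suc s - j))"
      then obtain c where c: "c \<in> carrier R" "?v = c \<otimes> (?v \<otimes> w)" unfolding wv cgenideal_def by auto
      let ?u = "\<one> \<ominus> c \<otimes> w"
      have cw: "c \<otimes> w \<in> ?M" unfolding w(2) cgenideal_def using c(1) by auto
      have "?u \<notin> ?M"
      proof
        assume "?u \<in> ?M"
        then have "?u \<oplus> c \<otimes> w \<in> ?M" using cw by (rule additive_subgroup.a_closed[OF M.additive_subgroup_axioms])
        moreover have "?u \<oplus> c \<otimes> w = \<one>" using c(1) w(1) by algebra
        ultimately show False using M1 by simp
      qed
      then obtain b where b: "b \<in> carrier R" "?u \<otimes> b = \<one>" using unit[of ?u] c(1) w(1) by auto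
      have "?u \<otimes> ?v = ?v \<ominus> c \<otimes> (?v \<otimes> w)" using c(1) w(1) v by algebra
      also have "\<dots> = ?v \<ominus> ?v" using c(2) by simp
      also have "\<dots> = \<zero>" using v by algebra
      finally have z: "?u \<otimes> ?v = \<zero>" .
      have "?v = (?u \<otimes> b) \<otimes> ?v" using b(2) v by simp
      also have "\<dots> = b \<otimes> (?u \<otimes> ?v)" using c(1) w(1) v b(1) by algebra
      also have "\<dots> = \<zero>" using z b(1) by simp
      finally show False using v0 by contradiction
    qed
    have le: "line_extension K ?v (PIdl (w [^] (Suc s - j))) = PIdl ?v"
    proof
      show "line_extension K ?v (PIdl (w [^] (Suc s - j))) \<subseteq> PIdl ?v"
      proof
        fix x assume "x \<in> line_extension K ?v (PIdl (w [^] (Suc s - j)))"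
        then obtain k c where k: "k \<in> K" "c \<in> carrier R" "x = k \<otimes> ?v \<oplus> c \<otimes> (?v \<otimes> w)"
          unfolding line_extension_mem_iff wv cgenideal_def by auto
        have "k \<in> carrier R" using k(1) Kc by blast
        then have "x = (k \<oplus> c \<otimes> w) \<otimes> ?v" "k \<oplus> c \<otimes> w \<in> carrier R" unfolding k(3) using k(2) v w(1) by algebra+
        then show "x \<in> PIdl ?v" unfolding cgenideal_def by blast
      qed
      show "PIdl ?v \<subseteq> line_extension K ?v (PIdl (w [^] (Suc s - j)))"
      proof
        fix x assume "x \<in> PIdl ?v"
        then obtain c where c: "c \<in> carrier R" "x = c \<otimes> ?v" unfolding cgenideal_def by auto
        obtain a d where ad: "a \<in> K" "d \<in> carrier R" "c = a \<oplus> d \<otimes> w" using dec[OF c(1)] by blast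
        have "a \<in> carrier R" using ad(1) Kc by blast
        then have "x = a \<otimes> ?v \<oplus> d \<otimes> (?v \<otimes> w)" unfolding c(2) ad(3) using ad(2) v w(1) by algebra
        moreover have "d \<otimes> (?v \<otimes> w) \<in> PIdl (w [^] (Suc s - j))" unfolding wv cgenideal_def using ad(2) by blast
        ultimately show "x \<in> line_extension K ?v (PIdl (w [^] (Suc s - j)))"
          unfolding line_extension_mem_iff using ad(1) by blast
      qed
    qed
    have "dimension j K (PIdl (w [^] (Suc s - j)))" by (rule Suc.IH) (use Suc.prems in simp)
    from Suc_dim[OF v notin this] show ?case by (simp only: le)
  qed
  from this[of "Suc s"] have "dimension (Suc s) K (PIdl \<one>)" by simp
  moreover have "PIdl \<one> = carrier R" unfolding cgenideal_def by (auto, metis r_one)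
  ultimately have "dimension (Suc s) K (carrier R)" by simp
  from dimI[OF K(2) this] have "dim K (carrier R) = Suc s" by (simp add: over_def)
  then show ?thesis unfolding residue_field_dim_def K(1) .
qed

end

lemma (in cring) eval_binomial:
  assumes "0 < (p::nat)" "y \<in> carrier R" "c \<in> carrier R"
  shows "eval (\<one> # replicate (p - 1) \<zero> @ [c]) y = y [^] p \<oplus> c"
proof -
  have "\<one> # replicate (p - 1) \<zero> @ [c] = monom \<one> (p - 1) @ [c]" by (simp add: monom_def)
  then have "eval (\<one> # replicate (p - 1) \<zero> @ [c]) y = eval (monom \<one> (p - 1) @ [c]) y" by (simp only:)
  also have "\<dots> = eval (monom \<one> (p - 1)) y \<otimes> y \<oplus> c"
    by (rule eval_append_aux[OF monom_in_carrier[OF one_closed] assms(3,2)])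
  also have "eval (monom \<one> (p - 1)) y = y [^] (p - 1)" using eval_monom[of \<one> y] assms(2) by simp
  also have "y [^] (p - 1) \<otimes> y = y [^] p" using assms(1) nat_pow_Suc[of y "p - 1"] by simp
  finally show ?thesis .
qed

lemma (in field) algebraically_closed_root:
  assumes ac: "algebraically_closed R" and p: "0 < (p::nat)" and c: "c \<in> carrier R"
  shows "\<exists>y\<in>carrier R. y [^] p = c"
proof -
  let ?f = "\<one> # replicate (p - 1) \<zero> @ [\<ominus> c]"
  have f: "?f \<in> carrier (poly_ring R)" unfolding univ_poly_carrier[symmetric] polynomial_def using c by auto
  have len: "length ?f = Suc p" using p by simp
  have "splitted ?f" by (rule algebraically_closed.roots_over_carrier[OF ac f])
  then have "size (roots ?f) = p" unfolding splitted_def len by simp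
  then have "roots ?f \<noteq> {#}" using p by auto
  then obtain y where "y \<in># roots ?f" by blast
  then have y: "y \<in> carrier R" "eval ?f y = \<zero>" using roots_mem_iff_is_root[OF f] unfolding is_root_def by auto
  have "y [^] p \<oplus> \<ominus> c = \<zero>" using y eval_binomial[OF p y(1) a_inv_closed[OF c]] by simp
  then have "y [^] p = c" using y(1) c by (metis minus_eq nat_pow_closed r_right_minus_eq)
  with y(1) show ?thesis by blast
qed

section \<open>Krull dimension and regularity\<close>

definition prime_chain :: "('a, 'm) ring_scheme \<Rightarrow> nat \<Rightarrow> (nat \<Rightarrow> 'a set) \<Rightarrow> bool" where
  "prime_chain R n P \<longleftrightarrow> (\<forall>i\<le>n. primeideal (P i) R) \<and> (\<forall>i<n. P i \<subset> P (Suc i))"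

lemma krull_dim_ge: "prime_chain R n P \<Longrightarrow> enat n \<le> krull_dim R"
  unfolding krull_dim_def prime_chain_def by (intro SUP_upper) blast

lemma krull_dim_leI: "(\<And>n P. prime_chain R n P \<Longrightarrow> n \<le> N) \<Longrightarrow> krull_dim R \<le> enat N"
  unfolding krull_dim_def prime_chain_def by (intro SUP_least) (simp, blast)

text \<open>Only positive values are treated, since zero is also the supremum of an empty set of
  chain lengths.\<close>

lemma krull_dim_attained:
  assumes "krull_dim R = enat (Suc N)" shows "\<exists>P. prime_chain R (Suc N) P"
proof (rule ccontr)
  assume no: "\<not> ?thesis"
  have "krull_dim R \<le> enat N"
  proof (rule krull_dim_leI)
    fix n P assume c: "prime_chain R n P"
    have "n \<le> Suc N" using krull_dim_ge[OF c] assms by simp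
    moreover have "n \<noteq> Suc N" using c no by blast
    ultimately show "n \<le> N" by simp
  qed
  with assms show False by simp
qed

context cring begin

text \<open>The members of \<open>J\<close> are cosets of \<open>I\<close>, so
  \<open>\<Union>J\<close> is the preimage of \<open>J\<close> in \<open>R\<close>.\<close>

lemma quot_prime_vimage:
  assumes I: "ideal I R" and J: "primeideal J (R Quot I)"
  shows "primeideal (\<Union>J) R" "I \<subseteq> \<Union>J" "a \<in> carrier R \<Longrightarrow> a \<in> \<Union>J \<longleftrightarrow> I +> a \<in> J"
proof -
  interpret I: ideal I R by (rule I)
  interpret J: primeideal J "R Quot I" by (rule J)
  have Jc: "J \<subseteq> carrier (R Quot I)" using J.Icarr by blast
  have mem: "a \<in> \<Union>J \<longleftrightarrow> I +> a \<in> J" if "a \<in> carrier R" for a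
    by (rule canonical_proj_vimage_mem_iff[OF I Jc that])
  show "a \<in> carrier R \<Longrightarrow> a \<in> \<Union>J \<longleftrightarrow> I +> a \<in> J" by (rule mem)
  have id: "ideal (\<Union>J) R" by (rule quot_ideal_imp_ring_ideal[OF I J.ideal_axioms])
  show "primeideal (\<Union>J) R"
  proof (rule primeidealI[OF id is_cring])
    show "carrier R \<noteq> \<Union>J"
    proof
      assume "carrier R = \<Union>J"
      then have "I +> \<one> \<in> J" using mem[OF one_closed] one_closed by simp
      then have "\<one>\<^bsub>R Quot I\<^esub> \<in> J" by (simp add: FactRing_def)
      then show False using J.one_imp_carrier J.I_notcarr by blast
    qed
    fix a b assume ab: "a \<in> carrier R" "b \<in> carrier R" "a \<otimes> b \<in> \<Union>J"
    then have "I +> (a \<otimes> b) \<in> J" using mem[OF m_closed[OF ab(1,2)]] by blast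
    then have "(I +> a) \<otimes>\<^bsub>R Quot I\<^esub> (I +> b) \<in> J" using ring_hom_mult[OF I.rcos_ring_hom ab(1,2)] by simp
    then have "I +> a \<in> J \<or> I +> b \<in> J"
      using J.I_prime ring_hom_closed[OF I.rcos_ring_hom] ab(1,2) by blast
    then show "a \<in> \<Union>J \<or> b \<in> \<Union>J" using mem ab(1,2) by blast
  qed
  show "I \<subseteq> \<Union>J"
  proof
    fix a assume a: "a \<in> I"
    then have "I +> a = I" by (rule a_rcos_zero[OF I])
    also have "I = \<zero>\<^bsub>R Quot I\<^esub>" by (simp add: FactRing_def)
    also have "\<dots> \<in> J" by (rule additive_subgroup.zero_closed[OF J.additive_subgroup_axioms])
    finally show "a \<in> \<Union>J" using mem[OF I.Icarr[OF a]] by blast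
  qed
qed

lemma quot_prime_image:
  assumes I: "ideal I R" and P: "primeideal P R" "I \<subseteq> P"
  shows "primeideal ((+>) I ` P) (R Quot I)" "a \<in> carrier R \<Longrightarrow> I +> a \<in> (+>) I ` P \<longleftrightarrow> a \<in> P"
proof -
  interpret I: ideal I R by (rule I)
  interpret P: primeideal P R by (rule P)
  interpret Q: cring "R Quot I" by (rule I.quotient_is_cring[OF is_cring])
  have mem: "I +> a \<in> (+>) I ` P \<longleftrightarrow> a \<in> P" if a: "a \<in> carrier R" for a
  proof
    assume "I +> a \<in> (+>) I ` P"
    then obtain b where b: "b \<in> P" "I +> a = I +> b" by blast
    have bc: "b \<in> carrier R" using P.Icarr[OF b(1)] .
    have "a \<ominus> b \<in> P" using quotient_eq_iff_same_a_r_cos[OF I a bc] b(2) P(2) by blast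
    then have "(a \<ominus> b) \<oplus> b \<in> P" using b(1) by (rule additive_subgroup.a_closed[OF P.additive_subgroup_axioms])
    moreover have "(a \<ominus> b) \<oplus> b = a" using a bc by algebra
    ultimately show "a \<in> P" by simp
  qed blast
  show "a \<in> carrier R \<Longrightarrow> I +> a \<in> (+>) I ` P \<longleftrightarrow> a \<in> P" by (rule mem)
  have rep: "\<exists>a\<in>carrier R. C = I +> a" if "C \<in> carrier (R Quot I)" for C
    using that unfolding FactRing_def A_RCOSETS_def' by auto
  show "primeideal ((+>) I ` P) (R Quot I)"
  proof (rule primeidealI[OF ring_ideal_imp_quot_ideal[OF I P.ideal_axioms] Q.is_cring])
    have "I +> \<one> \<notin> (+>) I ` P" using mem[OF one_closed] P.one_imp_carrier P.I_notcarr by blast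
    then show "carrier (R Quot I) \<noteq> (+>) I ` P"
      using ring_hom_closed[OF I.rcos_ring_hom one_closed] by blast
    fix C D assume CD: "C \<in> carrier (R Quot I)" "D \<in> carrier (R Quot I)" "C \<otimes>\<^bsub>R Quot I\<^esub> D \<in> (+>) I ` P"
    obtain a b where ab: "a \<in> carrier R" "C = I +> a" "b \<in> carrier R" "D = I +> b" using rep CD(1,2) by blast
    have "I +> (a \<otimes> b) \<in> (+>) I ` P"
      using CD(3) unfolding ab(2,4) ring_hom_mult[OF I.rcos_ring_hom ab(1,3)] .
    then have "a \<otimes> b \<in> P" using mem[OF m_closed[OF ab(1,3)]] by blast
    then show "C \<in> (+>) I ` P \<or> D \<in> (+>) I ` P" using P.I_prime[OF ab(1,3)] ab(2,4) by blast
  qed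
qed

lemma quot_prime_vimage_strict:
  assumes I: "ideal I R" and J: "primeideal J (R Quot I)" "primeideal K (R Quot I)" "J \<subset> K"
  shows "\<Union>J \<subset> \<Union>K"
proof -
  obtain C where C: "C \<in> K" "C \<notin> J" using J(3) by blast
  have "C \<in> carrier (R Quot I)" by (rule ideal.Icarr[OF primeideal.axioms(1)[OF J(2)] C(1)])
  then obtain a where a: "a \<in> carrier R" "C = I +> a" unfolding FactRing_def A_RCOSETS_def' by auto
  then have "a \<in> \<Union>K" "a \<notin> \<Union>J"
    using quot_prime_vimage(3)[OF I J(1) a(1)] quot_prime_vimage(3)[OF I J(2) a(1)] C by simp_all
  moreover have "\<Union>J \<subseteq> \<Union>K" using J(3) by blast
  ultimately show ?thesis by blast
qed

lemma quot_prime_image_strict: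
  assumes I: "ideal I R" and P: "primeideal P R" "primeideal Q R" "I \<subseteq> P" "P \<subset> Q"
  shows "(+>) I ` P \<subset> (+>) I ` Q"
proof -
  obtain a where a: "a \<in> Q" "a \<notin> P" using P(4) by blast
  have ac: "a \<in> carrier R" by (rule ideal.Icarr[OF primeideal.axioms(1)[OF P(2)] a(1)])
  have "I +> a \<in> (+>) I ` Q" using a(1) by blast
  moreover have "I +> a \<notin> (+>) I ` P" using quot_prime_image(2)[OF I P(1,3) ac] a(2) by blast
  moreover have "(+>) I ` P \<subseteq> (+>) I ` Q" using P(4) by blast
  ultimately show ?thesis by blast
qed

lemma prime_not_subset_maximal: "\<lbrakk>maximalideal M R; primeideal P R; M \<subseteq> P\<rbrakk> \<Longrightarrow> P = M"
  by (metis ideal.Icarr maximalideal.I_maximal primeideal.I_notcarr primeideal.axioms(1) subsetI)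

text \<open>For \<open>P = {\<zero>}\<close> a chain of length two survives in the quotient, and for
  \<open>P = M\<close> only one prime is left there. Otherwise \<open>P\<close> and \<open>M\<close>
  give a chain of length one, and any longer chain, lifted to \<open>R\<close> and prolonged below
  by the zero ideal, would exceed dimension two.\<close>

lemma Spec1_iff_two_dim:
  assumes "domain R" and dim: "krull_dim R = 2" and M: "maximalideal M R" and P: "primeideal P R" "P \<subseteq> M"
  shows "P \<in> Spec1 R \<longleftrightarrow> P \<noteq> {\<zero>} \<and> P \<noteq> M"
proof -
  interpret domain R by (rule assms(1))
  have PI: "ideal P R" using P(1) by (rule primeideal.axioms(1))
  have Mp: "primeideal M R" by (rule maximalideal_prime[OF M])
  have two: "krull_dim R = enat (Suc (Suc 0))" using dim by (simp add: numeral_eq_enat)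
  show ?thesis
  proof
    assume "P \<in> Spec1 R"
    then have one: "krull_dim (R Quot P) = enat (Suc 0)" by (simp add: Spec1_def one_enat_def)
    show "P \<noteq> {\<zero>} \<and> P \<noteq> M"
    proof
      show "P \<noteq> {\<zero>}"
      proof
        assume P0: "P = {\<zero>}"
        obtain Q where Q: "prime_chain R (Suc (Suc 0)) Q" using krull_dim_attained[OF two] by blast
        have sub: "P \<subseteq> Q i" if "i \<le> Suc (Suc 0)" for i
        proof -
          have "ideal (Q i) R" using Q that unfolding prime_chain_def by (blast dest: primeideal.axioms(1))
          then show ?thesis unfolding P0 using additive_subgroup.zero_closed[OF ideal.axioms(1)] by blast
        qed
        have "prime_chain (R Quot P) (Suc (Suc 0)) (\<lambda>i. (+>) P ` Q i)"
          unfolding prime_chain_def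
        proof (intro conjI allI impI)
          show "primeideal ((+>) P ` Q i) (R Quot P)" if "i \<le> Suc (Suc 0)" for i
            using Q that unfolding prime_chain_def by (intro quot_prime_image(1)[OF PI _ sub]) auto
          show "(+>) P ` Q i \<subset> (+>) P ` Q (Suc i)" if "i < Suc (Suc 0)" for i
            using Q that unfolding prime_chain_def by (intro quot_prime_image_strict[OF PI _ _ sub]) auto
        qed
        from krull_dim_ge[OF this] show False unfolding one by simp
      qed
      show "P \<noteq> M"
      proof
        assume PM: "P = M"
        obtain Q where Q: "prime_chain (R Quot P) (Suc 0) Q" using krull_dim_attained[OF one] by blast
        then have q: "primeideal (Q 0) (R Quot P)" "primeideal (Q (Suc 0)) (R Quot P)" "Q 0 \<subset> Q (Suc 0)"
          unfolding prime_chain_def by auto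
        have "\<Union>(Q 0) = M" "\<Union>(Q (Suc 0)) = M"
          using prime_not_subset_maximal[OF M quot_prime_vimage(1)[OF PI q(1)]]
            prime_not_subset_maximal[OF M quot_prime_vimage(1)[OF PI q(2)]]
            quot_prime_vimage(2)[OF PI q(1)] quot_prime_vimage(2)[OF PI q(2)] PM by blast+
        then show False using quot_prime_vimage_strict[OF PI q] by simp
      qed
    qed
  next
    assume nt: "P \<noteq> {\<zero>} \<and> P \<noteq> M"
    then have PM: "P \<subset> M" using P(2) by blast
    have "prime_chain (R Quot P) 1 (\<lambda>i. if i = 0 then (+>) P ` P else (+>) P ` M)"
      unfolding prime_chain_def
      using quot_prime_image(1)[OF PI P(1)] quot_prime_image(1)[OF PI Mp P(2)]
        quot_prime_image_strict[OF PI P(1) Mp subset_refl PM] by auto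
    then have "enat 1 \<le> krull_dim (R Quot P)" by (rule krull_dim_ge)
    moreover have "krull_dim (R Quot P) \<le> enat 1"
    proof (rule krull_dim_leI)
      fix n J assume J: "prime_chain (R Quot P) n J"
      let ?Q = "\<lambda>i. case i of 0 \<Rightarrow> {\<zero>} | Suc j \<Rightarrow> \<Union>(J j)"
      have J': "primeideal (J i) (R Quot P)" if "i \<le> n" for i using J that unfolding prime_chain_def by blast
      have "prime_chain R (Suc n) ?Q"
        unfolding prime_chain_def
      proof (intro conjI allI impI)
        show "primeideal (?Q i) R" if "i \<le> Suc n" for i
          using that zeroprimeideal quot_prime_vimage(1)[OF PI J'] by (cases i) auto
        show "?Q i \<subset> ?Q (Suc i)" if i: "i < Suc n" for i
        proof (cases i)
          case 0
          have "P \<subseteq> \<Union>(J 0)" using quot_prime_vimage(2)[OF PI J'] by simp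
          moreover have "\<zero> \<in> P" by (rule additive_subgroup.zero_closed[OF ideal.axioms(1)[OF PI]])
          ultimately show ?thesis using nt 0 by auto
        next
          case (Suc j)
          have "J j \<subset> J (Suc j)" using J i Suc unfolding prime_chain_def by auto
          then have "\<Union>(J j) \<subset> \<Union>(J (Suc j))" using i Suc by (intro quot_prime_vimage_strict[OF PI J' J']) auto
          then show ?thesis using Suc by simp
        qed
      qed
      from krull_dim_ge[OF this] show "n \<le> 1" using dim by (simp add: numeral_eq_enat)
    qed
    ultimately have "krull_dim (R Quot P) = 1" by (simp add: one_enat_def)
    then show "P \<in> Spec1 R" using P(1) by (simp add: Spec1_def)
  qed
qed

text \<open>The embedding dimension is a least number; the noetherian property provides some finite
  generating set, so the minimum is attained.\<close>

lemma regular_local_ring_generators: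
  assumes reg: "regular_local_ring R" and dim: "krull_dim R = enat n"
  shows "\<exists>S\<subseteq>carrier R. finite S \<and> card S = n \<and> genideal R S = max_ideal R"
proof -
  let ?T = "\<lambda>n. \<exists>S\<subseteq>carrier R. finite S \<and> card S = n \<and> genideal R S = max_ideal R"
  have loc: "local_cring R" and "noetherian_ring R" and e: "embedding_dim R = n"
    using reg dim unfolding regular_local_ring_def by auto
  interpret N: noetherian_ring R by fact
  have "ideal (max_ideal R) R" using local_cring_maximal(1)[OF loc] by (rule maximalideal.axioms(1))
  then obtain S where "S \<subseteq> carrier R" "finite S" "max_ideal R = Idl S" using N.finetely_gen by blast
  then have "?T (card S)" by blast
  then have "?T (embedding_dim R)" unfolding embedding_dim_def by (rule LeastI)
  then show ?thesis unfolding e .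
qed

end

lemma ring_hom_add_pow:
  assumes "ring R" "ring S" "h \<in> ring_hom R S" "x \<in> carrier R"
  shows "h (add_pow R (n::nat) x) = add_pow S n (h x)"
proof -
  interpret R: ring R by fact
  interpret S: ring S by fact
  interpret h: ring_hom_ring R S h by (intro ring_hom_ringI2 assms)
  show ?thesis using assms(4) by (induction n) (simp_all add: R.add.nat_pow_Suc S.add.nat_pow_Suc)
qed

section \<open>Regularity expressed in the ambient field\<close>

context field_subring begin

abbreviation "D \<equiv> E\<lparr>carrier := A\<rparr>"

lemma D_domain: "domain D" by (rule subring_is_domain[OF subring_A])

lemma D_cring: "cring D" using D_domain by (rule domain.axioms(1))

lemma D_neg: "b \<in> A \<Longrightarrow> \<ominus>\<^bsub>D\<^esub> b = \<ominus> b"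
proof -
  interpret D: cring D by (rule D_cring)
  assume "b \<in> A"
  then show ?thesis by (intro D.minus_equality) (auto simp: l_neg)
qed

lemma D_minus: "\<lbrakk>a \<in> A; b \<in> A\<rbrakk> \<Longrightarrow> a \<ominus>\<^bsub>D\<^esub> b = a \<ominus> b"
  by (simp add: a_minus_def D_neg)

lemma D_coset: "I +>\<^bsub>D\<^esub> a = I +> a"
  by (simp add: a_r_coset_def')

lemma D_coset_eq_iff:
  assumes "ideal_of E A I" "a \<in> A" "b \<in> A"
  shows "I +>\<^bsub>D\<^esub> a = I +>\<^bsub>D\<^esub> b \<longleftrightarrow> a \<ominus> b \<in> I"
proof -
  interpret D: cring D by (rule D_cring)
  have "ideal I D" using assms(1) ideal_iff_ideal_of[OF subring_A] by simp
  from D.quotient_eq_iff_same_a_r_cos[OF this, of a b] show ?thesis using assms(2,3) by (simp add: D_minus)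
qed

lemma local_subring_of_regular:
  assumes "regular_local_ring D"
  shows "local_subring E A (max_ideal D)"
proof -
  interpret D: cring D by (rule D_cring)
  have loc: "local_cring D" and nr: "noetherian_ring D" using assms unfolding regular_local_ring_def by auto
  interpret N: noetherian_ring D by (rule nr)
  interpret M: maximalideal "max_ideal D" D by (rule D.local_cring_maximal(1)[OF loc])
  show ?thesis
  proof (intro local_subring.intro local_subring_axioms.intro field_subring_axioms)
    show "ideal_of E A (max_ideal D)" using ideal_iff_ideal_of[OF subring_A] M.ideal_axioms by simp
    show "\<one> \<notin> max_ideal D" using M.one_imp_carrier M.I_notcarr by auto
    show "\<exists>b\<in>A. a \<otimes> b = \<one>" if "a \<in> A" "a \<notin> max_ideal D" for a
      using D.local_cring_maximal(2)[OF loc, of a] that by simp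
    show "\<exists>gs. set gs \<subseteq> A \<and> I = lspan gs" if "ideal_of E A I" for I
    proof -
      have "ideal I D" using \<open>ideal_of E A I\<close> ideal_iff_ideal_of[OF subring_A] by simp
      then obtain S where S: "S \<subseteq> A" "finite S" "I = genideal D S" using N.finetely_gen by auto
      obtain gs where "set gs = S" using finite_list[OF S(2)] by blast
      then show ?thesis using S genideal_eq_lspan[of gs] by blast
    qed
  qed
qed

lemma two_generators:
  assumes "regular_local_ring D" "krull_dim D = 2"
  shows "\<exists>u\<in>max_ideal D. \<exists>v\<in>max_ideal D. \<forall>x\<in>max_ideal D. \<exists>a\<in>A. \<exists>b\<in>A. x = u \<otimes> a \<oplus> v \<otimes> b"
proof -
  interpret D: cring D by (rule D_cring)
  have "krull_dim D = enat 2" using assms(2) by (simp add: numeral_eq_enat)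
  from D.regular_local_ring_generators[OF assms(1) this]
  obtain S where S: "S \<subseteq> A" "card S = 2" "genideal D S = max_ideal D" by auto
  then obtain u v where uv: "S = {u, v}" by (auto simp: card_2_iff)
  have "u \<in> A" "v \<in> A" using S uv by auto
  moreover from this have m: "max_ideal D = lspan [u, v]" using S(3) uv genideal_eq_lspan[of "[u, v]"] by simp
  moreover have "u \<in> lspan [u, v]" "v \<in> lspan [u, v]"
    using lspan_mem[of _ "[u, v]"] calculation(1,2) by auto
  moreover have "\<exists>a\<in>A. \<exists>b\<in>A. x = u \<otimes> a \<oplus> v \<otimes> b" if x: "x \<in> lspan [u, v]" for x
  proof -
    obtain a b where "a \<in> A" "b \<in> A" "x = a \<otimes> u \<oplus> (b \<otimes> v \<oplus> \<zero>)" using x by auto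
    then show ?thesis using calculation(1,2) by (intro bexI[of _ a] bexI[of _ b]) (auto simp: m_comm)
  qed
  ultimately show ?thesis by blast
qed

end

section \<open>Quotients of the local ring and intersection numbers\<close>

context local_subring begin

lemma max_ideal_D: "max_ideal D = m" "local_cring D" "maximalideal m D"
proof -
  interpret D: cring D by (rule D_cring)
  have "ideal m D" using m_ideal ideal_iff_ideal_of[OF subring_A] by simp
  from D.local_cringI[OF this] show "max_ideal D = m" "local_cring D" "maximalideal m D"
    using m_one m_unit by auto
qed

lemma prime_subset_m: "prime_of E A P \<Longrightarrow> a \<in> P \<Longrightarrow> a \<in> m"
  using proper_ideal_m prime_ofD(1,2) by blast

text \<open>By regularity the maximal ideal of the one-dimensional ring \<open>A/P\<close> is
  generated by a single class, and \<open>w\<close> represents it. It is not in \<open>P\<close>, as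
  otherwise \<open>m\<close> would equal \<open>P\<close>.\<close>

lemma regular_quotient_uniformizer:
  assumes P: "prime_of E A P" "P \<noteq> m" and reg: "regular_local_ring (D Quot P)" and dim: "krull_dim (D Quot P) = 1"
  shows "\<exists>w\<in>m. w \<notin> P \<and> m = mult_plus w P"
proof -
  interpret D: cring D by (rule D_cring)
  have PI: "ideal_of E A P" by (rule prime_ofD(1)[OF P(1)])
  then have PI': "ideal P D" using ideal_iff_ideal_of[OF subring_A] by simp
  interpret P: ideal P D by (rule PI')
  interpret Q: cring "D Quot P" by (rule P.quotient_is_cring[OF D_cring])
  have "krull_dim (D Quot P) = enat 1" using dim by (simp add: one_enat_def)
  from Q.regular_local_ring_generators[OF reg this]
  obtain S where S: "S \<subseteq> carrier (D Quot P)" "card S = 1" "genideal (D Quot P) S = max_ideal (D Quot P)" by auto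
  then obtain C where C: "S = {C}" by (auto simp: card_1_singleton_iff)
  have rep: "\<exists>a\<in>A. C' = P +>\<^bsub>D\<^esub> a" if "C' \<in> carrier (D Quot P)" for C'
    using that unfolding FactRing_def A_RCOSETS_def' by auto
  obtain w where w: "w \<in> A" "C = P +>\<^bsub>D\<^esub> w" using rep S(1) C by auto
  let ?M = "max_ideal (D Quot P)"
  have loc: "local_cring (D Quot P)" using reg unfolding regular_local_ring_def by simp
  interpret M: maximalideal ?M "D Quot P" by (rule Q.local_cring_maximal(1)[OF loc])
  have MP: "?M = PIdl\<^bsub>D Quot P\<^esub> C" using S C Q.cgenideal_eq_genideal[of C] by simp
  have one: "\<one>\<^bsub>D Quot P\<^esub> = P +>\<^bsub>D\<^esub> \<one>" by (simp add: FactRing_def)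
  have hm: "P +>\<^bsub>D\<^esub> (a \<otimes> b) = (P +>\<^bsub>D\<^esub> a) \<otimes>\<^bsub>D Quot P\<^esub> (P +>\<^bsub>D\<^esub> b)" if "a \<in> A" "b \<in> A" for a b
    using ring_hom_mult[OF P.rcos_ring_hom, of a b] that by simp
  have hc: "P +>\<^bsub>D\<^esub> a \<in> carrier (D Quot P)" if "a \<in> A" for a
    using ring_hom_closed[OF P.rcos_ring_hom, of a] that by simp
  have iff: "a \<in> m \<longleftrightarrow> P +>\<^bsub>D\<^esub> a \<in> ?M" if a: "a \<in> A" for a
  proof
    assume am: "a \<in> m"
    show "P +>\<^bsub>D\<^esub> a \<in> ?M"
    proof (rule ccontr)
      assume "P +>\<^bsub>D\<^esub> a \<notin> ?M"
      then obtain C' where C': "C' \<in> carrier (D Quot P)" "(P +>\<^bsub>D\<^esub> a) \<otimes>\<^bsub>D Quot P\<^esub> C' = \<one>\<^bsub>D Quot P\<^esub>"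
        using Q.local_cring_maximal(2)[OF loc hc[OF a]] by blast
      then obtain b where b: "b \<in> A" "C' = P +>\<^bsub>D\<^esub> b" using rep by blast
      have "P +>\<^bsub>D\<^esub> (a \<otimes> b) = P +>\<^bsub>D\<^esub> \<one>" using C'(2) unfolding b(2) hm[OF a b(1)] one .
      then have "\<one> \<ominus> a \<otimes> b \<in> P" using D_coset_eq_iff[OF PI A_one A_mult[OF a b(1)]] by simp
      then have "\<one> \<ominus> a \<otimes> b \<in> m" by (rule prime_subset_m[OF P(1)])
      moreover have "a \<otimes> b \<in> m" using ideal_ofD(4)[OF m_ideal b(1) am] m_comm[of a b] a b(1) by simp
      ultimately have "(\<one> \<ominus> a \<otimes> b) \<oplus> a \<otimes> b \<in> m" by (rule ideal_ofD(3)[OF m_ideal])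
      moreover have "(\<one> \<ominus> a \<otimes> b) \<oplus> a \<otimes> b = \<one>" using A_in[OF a] A_in[OF b(1)] by algebra
      ultimately show False using m_one by simp
    qed
  next
    assume aM: "P +>\<^bsub>D\<^esub> a \<in> ?M"
    show "a \<in> m"
    proof (rule ccontr)
      assume "a \<notin> m"
      then obtain b where b: "b \<in> A" "a \<otimes> b = \<one>" using m_unit[OF a] by blast
      have "(P +>\<^bsub>D\<^esub> a) \<otimes>\<^bsub>D Quot P\<^esub> (P +>\<^bsub>D\<^esub> b) \<in> ?M" by (rule M.I_r_closed[OF aM hc[OF b(1)]])
      then have "\<one>\<^bsub>D Quot P\<^esub> \<in> ?M" unfolding hm[OF a b(1), symmetric] b(2) one .
      then show False using M.one_imp_carrier M.I_notcarr by blast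
    qed
  qed
  have wm: "w \<in> m" using iff[OF w(1)] Q.cgenideal_self[OF hc[OF w(1)]] unfolding MP w(2) by blast
  have eq: "m = mult_plus w P"
  proof
    show "m \<subseteq> mult_plus w P"
    proof
      fix a assume a: "a \<in> m"
      have aA: "a \<in> A" by (rule m_A[OF a])
      have "P +>\<^bsub>D\<^esub> a \<in> PIdl\<^bsub>D Quot P\<^esub> C" using iff[OF aA] a unfolding MP by blast
      then obtain C' where C': "C' \<in> carrier (D Quot P)" "P +>\<^bsub>D\<^esub> a = C' \<otimes>\<^bsub>D Quot P\<^esub> C"
        unfolding cgenideal_def by blast
      obtain c where c: "c \<in> A" "C' = P +>\<^bsub>D\<^esub> c" using rep[OF C'(1)] by blast
      have "P +>\<^bsub>D\<^esub> a = P +>\<^bsub>D\<^esub> (c \<otimes> w)" unfolding hm[OF c(1) w(1)] using C'(2) c(2) w(2) by simp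
      then have d: "a \<ominus> c \<otimes> w \<in> P" using D_coset_eq_iff[OF PI aA A_mult[OF c(1) w(1)]] by simp
      have "a = w \<otimes> c \<oplus> (a \<ominus> c \<otimes> w)" using A_in[OF aA] A_in[OF c(1)] A_in[OF w(1)] by algebra
      then show "a \<in> mult_plus w P" using mult_plusI[OF c(1) d, of w] by simp
    qed
    show "mult_plus w P \<subseteq> m"
    proof
      fix a assume "a \<in> mult_plus w P"
      then obtain b z where bz: "b \<in> A" "z \<in> P" "a = w \<otimes> b \<oplus> z" by (rule mult_plusE)
      have "w \<otimes> b \<in> m" using ideal_ofD(4)[OF m_ideal bz(1) wm] m_comm[of w b] w(1) bz(1) by simp
      then show "a \<in> m" unfolding bz(3) by (rule ideal_ofD(3)[OF m_ideal _ prime_subset_m[OF P(1) bz(2)]])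
    qed
  qed
  have "w \<notin> P"
  proof
    assume wP: "w \<in> P"
    have "m \<subseteq> P"
    proof
      fix a assume "a \<in> m"
      then obtain b z where bz: "b \<in> A" "z \<in> P" "a = w \<otimes> b \<oplus> z" unfolding eq by (rule mult_plusE)
      have "w \<otimes> b \<in> P" using ideal_ofD(4)[OF PI bz(1) wP] m_comm[of w b] w(1) bz(1) by simp
      then show "a \<in> P" unfolding bz(3) by (rule ideal_ofD(3)[OF PI _ bz(2)])
    qed
    then show False using P(2) prime_subset_m[OF P(1)] by blast
  qed
  with wm eq show ?thesis by blast
qed

text \<open>As \<open>y\<close> is a unit, the sum of \<open>P\<close> and the ideal of
  \<open>g\<close> is \<open>mult_plus (w [^] Suc s) P\<close>. The quotient by it is a local ring
  whose maximal ideal is generated by the class of \<open>w\<close>, and \<open>Suc s\<close> is the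
  first exponent for which the power of this class vanishes; so \<open>residue_field_dim_eq\<close>
  applies.\<close>

lemma intersection_number_principal:
  assumes P: "prime_of E A P" and w: "w \<in> m" "w \<notin> P" "m = mult_plus w P"
    and g: "g = w [^] Suc s \<otimes> y \<oplus> c" "y \<in> A" "y \<notin> m" "c \<in> P"
    and p: "Factorial_Ring.prime (p::nat)" "add_pow D p \<one> = \<zero>" and ac: "algebraically_closed (D Quot m)"
  shows "intersection_number D P {g \<otimes> a | a. a \<in> A} = Suc s"
proof -
  interpret D: cring D by (rule D_cring)
  have PI: "ideal_of E A P" by (rule prime_ofD(1)[OF P])
  have wA: "w \<in> A" by (rule m_A[OF w(1)])
  have wc: "w \<in> carrier E" and yc: "y \<in> carrier E" using wA g(2) by auto
  have cA: "c \<in> A" by (rule ideal_ofD(1)[OF PI g(4)])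
  have gA: "g \<in> A" unfolding g(1) using wA g(2) cA by simp
  let ?I = "mult_plus (w [^] Suc s) P"
  have I: "ideal_of E A ?I" by (rule ideal_of_mult_plus[OF A_pow[OF wA] PI])
  have PsI: "z \<in> ?I" if "z \<in> P" for z
    using mult_plusI[OF A_zero that, of "w [^] Suc s"] ideal_ofD(1)[OF PI that] wc by simp
  have Im: "a \<in> m" if a: "a \<in> ?I" for a
  proof -
    obtain b z where bz: "b \<in> A" "z \<in> P" "a = w [^] Suc s \<otimes> b \<oplus> z" using a by (rule mult_plusE)
    have "w [^] Suc s \<otimes> b = (w [^] s \<otimes> b) \<otimes> w" using wc bz(1) by (simp add: m_ac)
    then have "w [^] Suc s \<otimes> b \<in> m" using ideal_ofD(4)[OF m_ideal A_mult[OF A_pow[OF wA] bz(1)] w(1)] by simp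
    then show ?thesis unfolding bz(3) by (rule ideal_ofD(3)[OF m_ideal _ prime_subset_m[OF P bz(2)]])
  qed
  have sum: "P <+>\<^bsub>D\<^esub> {g \<otimes> a | a. a \<in> A} = ?I"
  proof
    show "P <+>\<^bsub>D\<^esub> {g \<otimes> a | a. a \<in> A} \<subseteq> ?I"
    proof
      fix x assume "x \<in> P <+>\<^bsub>D\<^esub> {g \<otimes> a | a. a \<in> A}"
      then obtain q a where q: "q \<in> P" "a \<in> A" "x = q \<oplus> g \<otimes> a" unfolding set_add_def' by auto
      have "q \<in> carrier E" "c \<in> carrier E" "a \<in> carrier E" "w [^] Suc s \<in> carrier E"
        using q cA ideal_ofD(1)[OF PI] wc by auto
      then have "x = w [^] Suc s \<otimes> (y \<otimes> a) \<oplus> (q \<oplus> a \<otimes> c)" unfolding q(3) g(1) using yc by algebra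
      moreover have "q \<oplus> a \<otimes> c \<in> P" by (rule ideal_ofD(3)[OF PI q(1) ideal_ofD(4)[OF PI q(2) g(4)]])
      ultimately show "x \<in> ?I" using mult_plusI[OF A_mult[OF g(2) q(2)]] by simp
    qed
    show "?I \<subseteq> P <+>\<^bsub>D\<^esub> {g \<otimes> a | a. a \<in> A}"
    proof
      fix x assume "x \<in> ?I"
      then obtain b z where bz: "b \<in> A" "z \<in> P" "x = w [^] Suc s \<otimes> b \<oplus> z" by (rule mult_plusE)
      obtain y' where y': "y' \<in> A" "y \<otimes> y' = \<one>" using m_unit[OF g(2,3)] by blast
      have cc: "z \<in> carrier E" "c \<in> carrier E" "b \<in> carrier E" "y' \<in> carrier E" "w [^] Suc s \<in> carrier E"
        using bz cA y' ideal_ofD(1)[OF PI] wc by auto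
      have "x = w [^] Suc s \<otimes> (y \<otimes> y') \<otimes> b \<oplus> z" unfolding bz(3) y'(2) using cc by simp
      also have "\<dots> = (z \<ominus> (y' \<otimes> b) \<otimes> c) \<oplus> (w [^] Suc s \<otimes> y \<oplus> c) \<otimes> (y' \<otimes> b)" using cc yc by algebra
      finally have x: "x = (z \<ominus> (y' \<otimes> b) \<otimes> c) \<oplus> g \<otimes> (y' \<otimes> b)" unfolding g(1) .
      have "z \<ominus> (y' \<otimes> b) \<otimes> c \<in> P"
        by (rule ideal_of_minus[OF PI bz(2) ideal_ofD(4)[OF PI A_mult[OF y'(1) bz(1)] g(4)]])
      with x A_mult[OF y'(1) bz(1)] show "x \<in> P <+>\<^bsub>D\<^esub> {g \<otimes> a | a. a \<in> A}"
        unfolding set_add_def' by auto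
    qed
  qed
  let ?R = "D Quot ?I"
  have I': "ideal ?I D" using I ideal_iff_ideal_of[OF subring_A] by simp
  interpret I: ideal ?I D by (rule I')
  interpret Q: cring ?R by (rule I.quotient_is_cring[OF D_cring])
  let ?h = "\<lambda>a. ?I +>\<^bsub>D\<^esub> a"
  note hom = I.rcos_ring_hom
  interpret h: ring_hom_ring D ?R ?h by (rule I.rcos_ring_hom_ring)
  have rep: "\<exists>a\<in>A. C = ?h a" if "C \<in> carrier ?R" for C
    using that unfolding FactRing_def A_RCOSETS_def' by auto
  have one: "\<one>\<^bsub>?R\<^esub> = ?h \<one>" by (simp add: FactRing_def)
  have hm: "?h (a \<otimes> b) = ?h a \<otimes>\<^bsub>?R\<^esub> ?h b" if "a \<in> A" "b \<in> A" for a b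
    using ring_hom_mult[OF hom, of a b] that by simp
  have hc: "?h a \<in> carrier ?R" if "a \<in> A" for a using ring_hom_closed[OF hom, of a] that by simp
  have heq: "?h a = ?h b \<longleftrightarrow> a \<ominus> b \<in> ?I" if "a \<in> A" "b \<in> A" for a b by (rule D_coset_eq_iff[OF I that])
  have hz: "?h a = \<zero>\<^bsub>?R\<^esub> \<longleftrightarrow> a \<in> ?I" if a: "a \<in> A" for a
  proof -
    have "\<zero>\<^bsub>?R\<^esub> = ?h \<zero>" using h.hom_zero by simp
    moreover have "a \<ominus> \<zero> = a" using a by (simp add: minus_eq)
    ultimately show ?thesis using heq[OF a A_zero] by simp
  qed
  have hpow: "?h a [^]\<^bsub>?R\<^esub> (k::nat) = ?h (a [^] k)" if "a \<in> A" for a k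
    using h.hom_nat_pow[of a k] that by (simp add: nat_pow_carrier_update)
  let ?M = "?h ` m"
  have mI: "ideal m D" using m_ideal ideal_iff_ideal_of[OF subring_A] by simp
  have M: "ideal ?M ?R" by (rule D.ring_ideal_imp_quot_ideal[OF I' mI])
  have hM: "?h a \<in> ?M \<longleftrightarrow> a \<in> m" if a: "a \<in> A" for a
  proof
    assume "?h a \<in> ?M"
    then obtain b where b: "b \<in> m" "?h a = ?h b" by blast
    have "a \<ominus> b \<in> m" using heq[OF a m_A[OF b(1)]] b(2) Im by blast
    then have "(a \<ominus> b) \<oplus> b \<in> m" using b(1) by (rule ideal_ofD(3)[OF m_ideal])
    moreover have "(a \<ominus> b) \<oplus> b = a" using A_in[OF a] A_in[OF m_A[OF b(1)]] by algebra
    ultimately show "a \<in> m" by simp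
  qed blast
  have M1: "\<one>\<^bsub>?R\<^esub> \<notin> ?M" unfolding one using hM[OF A_one] m_one by blast
  have unit: "\<exists>b\<in>carrier ?R. C \<otimes>\<^bsub>?R\<^esub> b = \<one>\<^bsub>?R\<^esub>" if C: "C \<in> carrier ?R" "C \<notin> ?M" for C
  proof -
    obtain a where a: "a \<in> A" "C = ?h a" using rep[OF C(1)] by blast
    then have "a \<notin> m" using C(2) hM by blast
    then obtain b where b: "b \<in> A" "a \<otimes> b = \<one>" using m_unit[OF a(1)] by blast
    have "C \<otimes>\<^bsub>?R\<^esub> ?h b = \<one>\<^bsub>?R\<^esub>" unfolding a(2) hm[OF a(1) b(1), symmetric] b(2) one ..
    then show ?thesis using hc[OF b(1)] by blast
  qed
  have loc: "local_cring ?R" "max_ideal ?R = ?M"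
    by (rule Q.local_cringI[OF M M1], rule unit, assumption+)+
  have MP: "?M = PIdl\<^bsub>?R\<^esub> (?h w)"
  proof
    show "?M \<subseteq> PIdl\<^bsub>?R\<^esub> (?h w)"
    proof
      fix C assume "C \<in> ?M"
      then obtain a where a: "a \<in> m" "C = ?h a" by blast
      obtain b z where bz: "b \<in> A" "z \<in> P" "a = w \<otimes> b \<oplus> z" using a(1) unfolding w(3) by (rule mult_plusE)
      have zA: "z \<in> A" by (rule ideal_ofD(1)[OF PI bz(2)])
      have "a \<ominus> b \<otimes> w = z" unfolding bz(3) using A_in[OF bz(1)] wc A_in[OF zA] by algebra
      then have "C = ?h (b \<otimes> w)" unfolding a(2) using heq[OF m_A[OF a(1)] A_mult[OF bz(1) wA]] PsI[OF bz(2)] by simp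
      then have "C = ?h b \<otimes>\<^bsub>?R\<^esub> ?h w" unfolding hm[OF bz(1) wA] .
      then show "C \<in> PIdl\<^bsub>?R\<^esub> (?h w)" unfolding cgenideal_def using hc[OF bz(1)] by blast
    qed
    show "PIdl\<^bsub>?R\<^esub> (?h w) \<subseteq> ?M" by (rule Q.cgenideal_minimal[OF M]) (use w(1) in blast)
  qed
  have "residue_field_dim ?R = Suc s"
  proof (rule Q.residue_field_dim_eq[OF _ hc[OF wA] _ _ _ p(1)])
    show "local_cring ?R" by (rule loc(1))
    show "max_ideal ?R = PIdl\<^bsub>?R\<^esub> (?h w)" unfolding loc(2) MP ..
    have "w [^] Suc s \<otimes> \<one> \<oplus> \<zero> \<in> ?I" by (rule mult_plusI[OF A_one ideal_ofD(2)[OF PI]])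
    then have "w [^] Suc s \<in> ?I" using wc by simp
    then show "?h w [^]\<^bsub>?R\<^esub> Suc s = \<zero>\<^bsub>?R\<^esub>" unfolding hpow[OF wA] using hz[OF A_pow[OF wA]] by blast
    \<comment> \<open>If this power vanished,
      \<open>w [^] s \<otimes> (\<one> \<ominus> w \<otimes> b)\<close> would lie in the prime
      \<open>P\<close>; but powers of \<open>w\<close> are outside \<open>P\<close>, and the second
      factor is outside \<open>m\<close>.\<close>
    show "?h w [^]\<^bsub>?R\<^esub> s \<noteq> \<zero>\<^bsub>?R\<^esub>"
    proof
      assume "?h w [^]\<^bsub>?R\<^esub> s = \<zero>\<^bsub>?R\<^esub>"
      then have "w [^] s \<in> ?I" unfolding hpow[OF wA] using hz[OF A_pow[OF wA]] by blast
      then obtain b z where bz: "b \<in> A" "z \<in> P" "w [^] s = w [^] Suc s \<otimes> b \<oplus> z" by (rule mult_plusE)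
      have cc: "z \<in> carrier E" "b \<in> carrier E" "w [^] s \<in> carrier E" using bz ideal_ofD(1)[OF PI] wc by auto
      have "w [^] s \<otimes> (\<one> \<ominus> w \<otimes> b) = w [^] s \<ominus> w [^] Suc s \<otimes> b" unfolding nat_pow_Suc using cc wc by algebra
      also have "\<dots> = (w [^] Suc s \<otimes> b \<oplus> z) \<ominus> w [^] Suc s \<otimes> b" using bz(3) by simp
      also have "\<dots> = z" unfolding nat_pow_Suc using cc wc by algebra
      finally have "w [^] s \<otimes> (\<one> \<ominus> w \<otimes> b) \<in> P" using bz(2) by simp
      then have "w [^] s \<in> P \<or> \<one> \<ominus> w \<otimes> b \<in> P" using prime_ofD(3)[OF P A_pow[OF wA]] wA bz(1) by simp
      moreover have "w [^] k \<notin> P" for k :: nat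
      proof (induction k)
        case 0
        then show ?case using prime_ofD(2)[OF P] by simp
      next
        case (Suc k)
        then show ?case using prime_ofD(3)[OF P A_pow[OF wA] wA] w(2) by auto
      qed
      ultimately have "\<one> \<ominus> w \<otimes> b \<in> m" using prime_subset_m[OF P] by blast
      moreover have "w \<otimes> b \<in> m" using ideal_ofD(4)[OF m_ideal bz(1) w(1)] m_comm[OF cc(2) wc] by simp
      ultimately have "(\<one> \<ominus> w \<otimes> b) \<oplus> w \<otimes> b \<in> m" by (rule ideal_ofD(3)[OF m_ideal])
      moreover have "(\<one> \<ominus> w \<otimes> b) \<oplus> w \<otimes> b = \<one>" using cc(2) wc by algebra
      ultimately show False using m_one by simp
    qed
    have "add_pow ?R p \<one>\<^bsub>?R\<^esub> = ?h (add_pow D p \<one>)"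
      using ring_hom_add_pow[OF D.ring_axioms Q.ring_axioms hom, of \<one> p] one by simp
    then show "add_pow ?R p \<one>\<^bsub>?R\<^esub> = \<zero>\<^bsub>?R\<^esub>" unfolding p(2) using hz[OF A_zero] ideal_ofD(2)[OF I] by simp
    fix C assume "C \<in> carrier ?R"
    then obtain a where a: "a \<in> A" "C = ?h a" using rep by blast
    interpret m: maximalideal m D by (rule max_ideal_D(3))
    interpret k: field "D Quot m" by (rule m.quotient_is_field[OF D_cring])
    interpret hk: ring_hom_ring D "D Quot m" "(+>\<^bsub>D\<^esub>) m" by (rule m.rcos_ring_hom_ring)
    have "m +>\<^bsub>D\<^esub> a \<in> carrier (D Quot m)" using ring_hom_closed[OF m.rcos_ring_hom, of a] a(1) by simp
    \<comment> \<open>A \<open>p\<close>-th root of the class of \<open>a\<close> exists in the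
      algebraically closed residue field \<open>A/m\<close>; a lift of it to \<open>A\<close> is
      what \<open>perfect\<close> asks for in the quotient.\<close>
    then obtain B where B: "B \<in> carrier (D Quot m)" "B [^]\<^bsub>D Quot m\<^esub> p = m +>\<^bsub>D\<^esub> a"
      using k.algebraically_closed_root[OF ac prime_gt_0_nat[OF p(1)]] by blast
    obtain b where b: "b \<in> A" "B = m +>\<^bsub>D\<^esub> b" using B(1) unfolding FactRing_def A_RCOSETS_def' by auto
    have "m +>\<^bsub>D\<^esub> (b [^] p) = m +>\<^bsub>D\<^esub> a"
      using B(2) hk.hom_nat_pow[of b p] b by (simp add: nat_pow_carrier_update)
    then have ab: "a \<ominus> b [^] p \<in> m" using D_coset_eq_iff[OF m_ideal a(1) A_pow[OF b(1)], of p] by metis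
    have "?h (a \<ominus> b [^] p) = ?h a \<ominus>\<^bsub>?R\<^esub> ?h (b [^] p)"
    proof -
      have "a \<ominus>\<^bsub>D\<^esub> b [^] p = a \<ominus> b [^] p" by (rule D_minus[OF a(1) A_pow[OF b(1)]])
      moreover have "?h (a \<ominus>\<^bsub>D\<^esub> b [^] p) = ?h a \<ominus>\<^bsub>?R\<^esub> ?h (b [^] p)"
      proof -
        interpret h: ring_hom_ring D ?R ?h by (rule ring_hom_ringI2[OF D.ring_axioms Q.ring_axioms hom])
        have c: "a \<in> carrier D" "b [^] p \<in> carrier D" using a(1) b(1) by simp_all
        show ?thesis unfolding a_minus_def h.hom_add[OF c(1) D.a_inv_closed[OF c(2)]] h.hom_a_inv[OF c(2)] ..
      qed
      ultimately show ?thesis by simp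
    qed
    then have "C \<ominus>\<^bsub>?R\<^esub> ?h b [^]\<^bsub>?R\<^esub> p \<in> ?M" unfolding a(2) hpow[OF b(1)] using ab by (metis imageI)
    then show "\<exists>y\<in>carrier ?R. C \<ominus>\<^bsub>?R\<^esub> y [^]\<^bsub>?R\<^esub> p \<in> max_ideal ?R"
      unfolding loc(2) using hc[OF b(1)] by blast
  qed
  then show ?thesis unfolding intersection_number_def sum .
qed

end

section \<open>Residue fields\<close>

text \<open>The reduction from \<open>B\<close> to the fraction field of \<open>B/Q\<close>, given
  by its properties: a homomorphism on \<open>B\<close> with kernel \<open>Q\<close>, of whose
  values all elements of \<open>F\<close> are quotients. Arguments in this locale do not unfold
  cosets or fraction classes.\<close>

locale residue_map = prime_over_principal E A f Q n + F: field F
    for E (structure) and A f Q n and F +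
  fixes \<phi> :: "'a \<Rightarrow> 'c"
  assumes res_closed: "b \<in> B \<Longrightarrow> \<phi> b \<in> carrier F"
    and res_mult: "\<lbrakk>b \<in> B; c \<in> B\<rbrakk> \<Longrightarrow> \<phi> (b \<otimes> c) = \<phi> b \<otimes>\<^bsub>F\<^esub> \<phi> c"
    and res_add: "\<lbrakk>b \<in> B; c \<in> B\<rbrakk> \<Longrightarrow> \<phi> (b \<oplus> c) = \<phi> b \<oplus>\<^bsub>F\<^esub> \<phi> c"
    and res_one: "\<phi> \<one> = \<one>\<^bsub>F\<^esub>"
    and res_zero_iff: "b \<in> B \<Longrightarrow> \<phi> b = \<zero>\<^bsub>F\<^esub> \<longleftrightarrow> b \<in> Q"
    and res_fraction: "y \<in> carrier F \<Longrightarrow> \<exists>c\<in>B. c \<notin> Q \<and> (\<exists>b\<in>B. y \<otimes>\<^bsub>F\<^esub> \<phi> c = \<phi> b)"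

section \<open>The residue field of a prime above, and existence of such primes\<close>

context field_subring begin

definition residue where
  "residue Q b = frac_class (E\<lparr>carrier := integral_closure E A\<rparr> Quot Q) (Q +> b)
     \<one>\<^bsub>E\<lparr>carrier := integral_closure E A\<rparr> Quot Q\<^esub>"

lemma residue_subring_eq: "residue_subring E A Q = residue Q ` A"
  unfolding residue_subring_def residue_def Let_def ..

lemma residue_props:
  fixes Q
  defines "B \<equiv> integral_closure E A" and "F \<equiv> residue_field E A Q"
  assumes Q: "prime_of E B Q"
  shows "field F" and "b \<in> B \<Longrightarrow> residue Q b \<in> carrier F"
    and "\<lbrakk>b \<in> B; c \<in> B\<rbrakk> \<Longrightarrow> residue Q (b \<otimes> c) = residue Q b \<otimes>\<^bsub>F\<^esub> residue Q c"
    and "\<lbrakk>b \<in> B; c \<in> B\<rbrakk> \<Longrightarrow> residue Q (b \<oplus> c) = residue Q b \<oplus>\<^bsub>F\<^esub> residue Q c"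
    and "residue Q \<one> = \<one>\<^bsub>F\<^esub>"
    and "b \<in> B \<Longrightarrow> residue Q b = \<zero>\<^bsub>F\<^esub> \<longleftrightarrow> b \<in> Q"
    and "y \<in> carrier F \<Longrightarrow> \<exists>c\<in>B. c \<notin> Q \<and> (\<exists>b\<in>B. y \<otimes>\<^bsub>F\<^esub> residue Q c = residue Q b)"
proof -
  let ?R = "E\<lparr>carrier := B\<rparr>"
  have sB: "subring B E" unfolding B_def by (rule subring_integral_closure)
  have fsB: "field_subring E B" by (rule field_subring.intro[OF field_axioms field_subring_axioms.intro[OF sB]])
  have cosR: "Q +> b = Q +>\<^bsub>?R\<^esub> b" for b by (rule field_subring.D_coset[OF fsB, symmetric])
  have PR: "primeideal Q ?R" using primeideal_iff_prime_of[OF sB] Q by blast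
  have QI: "ideal_of E B Q" by (rule prime_ofD(1)[OF Q])
  interpret PR: primeideal Q ?R by (rule PR)
  interpret QD: domain "?R Quot Q" by (rule PR.quotient_is_domain)
  have hom: "(\<lambda>b. Q +> b) \<in> ring_hom ?R (?R Quot Q)"
    using PR.rcos_ring_hom unfolding cosR[abs_def] by (metis (no_types, lifting) ext)
  have hc: "Q +> b \<in> carrier (?R Quot Q)" if "b \<in> B" for b using ring_hom_closed[OF hom] that by simp
  have hm: "Q +> (b \<otimes> c) = (Q +> b) \<otimes>\<^bsub>?R Quot Q\<^esub> (Q +> c)" if "b \<in> B" "c \<in> B" for b c
    using ring_hom_mult[OF hom] that by simp
  have ha: "Q +> (b \<oplus> c) = (Q +> b) \<oplus>\<^bsub>?R Quot Q\<^esub> (Q +> c)" if "b \<in> B" "c \<in> B" for b c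
    using ring_hom_add[OF hom] that by simp
  have h1: "Q +> \<one> = \<one>\<^bsub>?R Quot Q\<^esub>" using ring_hom_one[OF hom] by simp
  have zB: "\<zero> \<in> B" by (rule subringE(2)[OF sB])
  have zero: "Q +> \<zero> = \<zero>\<^bsub>?R Quot Q\<^esub>"
    using ha[OF zB zB] QD.add.l_cancel_one[OF hc[OF zB] hc[OF zB]] by simp
  have hz: "Q +> b = \<zero>\<^bsub>?R Quot Q\<^esub> \<longleftrightarrow> b \<in> Q" if b: "b \<in> B" for b
  proof -
    have bc: "b \<in> carrier E" using b sB subringE(1) by blast
    have "Q +>\<^bsub>?R\<^esub> b = Q +>\<^bsub>?R\<^esub> \<zero> \<longleftrightarrow> b \<ominus> \<zero> \<in> Q"
      by (rule field_subring.D_coset_eq_iff[OF fsB QI b zB])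
    then show ?thesis unfolding zero[symmetric] cosR using bc by (simp add: a_minus_def)
  qed
  have rep: "\<exists>b\<in>B. C = Q +> b" if "C \<in> carrier (?R Quot Q)" for C
    using that unfolding FactRing_def A_RCOSETS_def' cosR by auto
  show "field F" unfolding F_def residue_field_def B_def[symmetric] by (rule QD.field_Frac)
  show "residue Q b \<in> carrier F" if "b \<in> B"
    unfolding F_def residue_field_def residue_def B_def[symmetric] by (rule QD.Frac_embedding(1)[OF hc[OF that]])
  show "residue Q (b \<otimes> c) = residue Q b \<otimes>\<^bsub>F\<^esub> residue Q c" if "b \<in> B" "c \<in> B"
    unfolding F_def residue_field_def residue_def B_def[symmetric] hm[OF that]
    by (rule QD.Frac_embedding(2)[OF hc[OF that(1)] hc[OF that(2)]])
  show "residue Q (b \<oplus> c) = residue Q b \<oplus>\<^bsub>F\<^esub> residue Q c" if "b \<in> B" "c \<in> B"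
    unfolding F_def residue_field_def residue_def B_def[symmetric] ha[OF that]
    by (rule QD.Frac_embedding(3)[OF hc[OF that(1)] hc[OF that(2)]])
  show "residue Q \<one> = \<one>\<^bsub>F\<^esub>"
    unfolding F_def residue_field_def residue_def B_def[symmetric] h1 QD.Frac_zero_one ..
  show "residue Q b = \<zero>\<^bsub>F\<^esub> \<longleftrightarrow> b \<in> Q" if b: "b \<in> B"
    unfolding F_def residue_field_def residue_def B_def[symmetric] QD.Frac_zero_one
      QD.Frac_embedding(4)[OF hc[OF b] QD.zero_closed] hz[OF b] ..
  show "\<exists>c\<in>B. c \<notin> Q \<and> (\<exists>b\<in>B. y \<otimes>\<^bsub>F\<^esub> residue Q c = residue Q b)" if y: "y \<in> carrier F"
  proof -
    obtain U V where UV: "U \<in> carrier (?R Quot Q)" "V \<in> carrier (?R Quot Q)" "V \<noteq> \<zero>\<^bsub>?R Quot Q\<^esub>"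
      "y \<otimes>\<^bsub>Frac (?R Quot Q)\<^esub> QD.fr V \<one>\<^bsub>?R Quot Q\<^esub> = QD.fr U \<one>\<^bsub>?R Quot Q\<^esub>"
      using QD.Frac_embedding(5)[of y] y unfolding F_def residue_field_def B_def[symmetric] by blast
    obtain b c where bc: "b \<in> B" "U = Q +> b" "c \<in> B" "V = Q +> c" using rep[OF UV(1)] rep[OF UV(2)] by blast
    have "c \<notin> Q" using UV(3) hz[OF bc(3)] bc(4) by blast
    moreover have "y \<otimes>\<^bsub>F\<^esub> residue Q c = residue Q b"
      unfolding F_def residue_field_def residue_def B_def[symmetric] using UV(4) unfolding bc(2,4) .
    ultimately show ?thesis using bc by blast
  qed
qed

text \<open>An integral inverse \<open>c\<close> of \<open>\<pi>\<close> would lie in \<open>A\<close>: multiply an integral equation by a power of \<open>\<pi>\<close>.\<close>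
lemma primes_over_nonempty:
  assumes I: "ideal_of E A M" "\<one> \<notin> M" and unit: "\<And>a. \<lbrakk>a \<in> A; a \<notin> M\<rbrakk> \<Longrightarrow> \<exists>b\<in>A. a \<otimes> b = \<one>"
    and \<pi>: "\<pi> \<in> M" "M = {\<pi> \<otimes> a | a. a \<in> A}"
  shows "\<exists>N. N \<in> primes_over E A M"
proof -
  let ?C = "integral_closure E A"
  let ?R = "E\<lparr>carrier := ?C\<rparr>"
  have sC: "subring ?C E" by (rule subring_integral_closure)
  interpret R: domain ?R by (rule subring_is_domain[OF sC])
  have \<pi>A: "\<pi> \<in> A" by (rule ideal_ofD(1)[OF I(1) \<pi>(1)])
  have \<pi>c: "\<pi> \<in> carrier E" using \<pi>A by simp
  have no: "\<pi> \<otimes> c \<noteq> \<one>" if c: "c \<in> ?C" for c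
  proof
    assume inv: "\<pi> \<otimes> c = \<one>"
    have cc: "c \<in> carrier E" using c by (rule integral_carrier)
    have low: "\<pi> [^] k \<otimes> v \<in> A" if "v \<in> lowdeg c (Suc k)" for v k
      using that
    proof (induction k arbitrary: v)
      case 0
      then show ?case using cc by auto
    next
      case (Suc k)
      obtain a u where au: "a \<in> A" "u \<in> lowdeg c (Suc k)" "v = a \<oplus> c \<otimes> u"
        using Suc.prems unfolding lowdeg.simps(2)[of c "Suc k"] by blast
      have uc: "u \<in> carrier E" using au(2) cc by (rule lowdeg_in[rotated])
      have "\<pi> [^] Suc k \<otimes> v = \<pi> [^] Suc k \<otimes> a \<oplus> (\<pi> \<otimes> c) \<otimes> (\<pi> [^] k \<otimes> u)"
        unfolding au(3) nat_pow_Suc using uc cc \<pi>c A_in[OF au(1)] nat_pow_closed[OF \<pi>c, of k] by algebra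
      also have "\<dots> = \<pi> [^] Suc k \<otimes> a \<oplus> \<pi> [^] k \<otimes> u" unfolding inv using uc \<pi>c by simp
      finally show ?case using Suc.IH[OF au(2)] au(1) \<pi>A by simp
    qed
    obtain d where d: "d > 0" "c [^] d \<in> lowdeg c d" using integral_lowdeg[OF c] .
    then obtain k where k: "d = Suc k" using gr0_conv_Suc by blast
    have "\<pi> [^] k \<otimes> c [^] Suc k \<in> A" by (rule low) (use d k in simp)
    moreover have "\<pi> [^] k \<otimes> c [^] Suc k = c"
    proof -
      have "\<pi> [^] k \<otimes> c [^] Suc k = (\<pi> \<otimes> c) [^] k \<otimes> c"
        using nat_pow_distrib[OF \<pi>c cc] \<pi>c cc by (simp add: m_assoc)
      then show ?thesis unfolding inv using cc by (simp add: nat_pow_one)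
    qed
    ultimately have "c \<in> A" by simp
    then have "\<one> \<in> M" unfolding \<pi>(2) inv[symmetric] by blast
    then show False using I(2) by simp
  qed
  have "ideal (PIdl\<^bsub>?R\<^esub> \<pi>) ?R" by (rule R.cgenideal_ideal) (simp add: A_integral[OF \<pi>A])
  moreover have "\<one>\<^bsub>?R\<^esub> \<notin> PIdl\<^bsub>?R\<^esub> \<pi>"
  proof
    assume "\<one>\<^bsub>?R\<^esub> \<in> PIdl\<^bsub>?R\<^esub> \<pi>"
    then obtain c where c: "c \<in> ?C" "\<one> = c \<otimes> \<pi>" unfolding cgenideal_def by auto
    then have "\<pi> \<otimes> c = \<one>" using m_comm[OF \<pi>c integral_carrier[OF c(1)]] by simp
    then show False using no[OF c(1)] by blast
  qed
  \<comment> \<open>A maximal ideal above \<open>\<pi>\<close> contracts to \<open>M\<close>: it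
    contains \<open>M\<close>, and elements of \<open>A\<close> outside \<open>M\<close> are
    units.\<close>
  ultimately obtain N where N: "maximalideal N ?R" "PIdl\<^bsub>?R\<^esub> \<pi> \<subseteq> N"
    using R.exists_maximalideal_above by blast
  have NP: "primeideal N ?R" by (rule R.maximalideal_prime[OF N(1)])
  have NP': "prime_of E ?C N" using primeideal_iff_prime_of[OF sC] NP by blast
  have "\<pi> \<in> N" using N(2) R.cgenideal_self[of \<pi>] A_integral[OF \<pi>A] by auto
  then have "M \<subseteq> N" unfolding \<pi>(2)
    using ideal_ofD(4)[OF prime_ofD(1)[OF NP'] A_integral] m_comm[OF \<pi>c] by auto
  moreover have "a \<in> M" if a: "a \<in> N" "a \<in> A" for a
  proof (rule ccontr)
    assume "a \<notin> M"
    then obtain b where b: "b \<in> A" "a \<otimes> b = \<one>" using unit a by blast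
    have "b \<otimes> a \<in> N" by (rule ideal_ofD(4)[OF prime_ofD(1)[OF NP'] A_integral[OF b(1)] a(1)])
    then show False using b m_comm[of a b] a(2) prime_ofD(2)[OF NP'] by simp
  qed
  moreover have "M \<subseteq> A" using ideal_ofD(1)[OF I(1)] by blast
  ultimately have "N \<inter> A = M" by blast
  then show ?thesis using NP unfolding primes_over_def by blast
qed

end

context prime_over_principal begin

lemma residue_map: "residue_map E A f Q n (residue_field E A Q) (residue Q)"
  by (intro residue_map.intro residue_map_axioms.intro prime_over_principal_axioms
      residue_props[OF Q(1)]) assumption+

end

section \<open>Reduction of linear relations modulo a prime of the integral closure\<close>

context residue_map begin

lemma res_zero: "\<phi> \<zero> = \<zero>\<^bsub>F\<^esub>"
  using res_zero_iff[OF A_integral[OF A_zero]] Q_zero by blast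

lemma B_neg: "b \<in> B \<Longrightarrow> \<ominus> b \<in> B"
  by (rule subringE(5)[OF subring_integral_closure])

lemma B_minus: "\<lbrakk>b \<in> B; c \<in> B\<rbrakk> \<Longrightarrow> b \<ominus> c \<in> B"
  unfolding a_minus_def by (intro B_add B_neg)

lemma res_neg: assumes b: "b \<in> B" shows "\<phi> (\<ominus> b) = \<ominus>\<^bsub>F\<^esub> \<phi> b"
proof -
  have "\<phi> (\<ominus> b) \<oplus>\<^bsub>F\<^esub> \<phi> b = \<zero>\<^bsub>F\<^esub>"
    unfolding res_add[OF B_neg[OF b] b, symmetric] using B_in[OF b] res_zero by (simp add: l_neg)
  then show ?thesis using F.minus_equality res_closed[OF b] res_closed[OF B_neg[OF b]] by metis
qed

lemma res_minus: "\<lbrakk>b \<in> B; c \<in> B\<rbrakk> \<Longrightarrow> \<phi> (b \<ominus> c) = \<phi> b \<ominus>\<^bsub>F\<^esub> \<phi> c"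
  unfolding a_minus_def by (simp add: res_add B_neg res_neg)

lemma res_eq_iff: assumes "b \<in> B" "c \<in> B" shows "\<phi> b = \<phi> c \<longleftrightarrow> b \<ominus> c \<in> Q"
  using res_zero_iff[OF B_minus[OF assms]] res_minus[OF assms] F.r_right_minus_eq res_closed assms by metis

lemma B_pow: "b \<in> B \<Longrightarrow> b [^] (k::nat) \<in> B"
  by (induction k) (auto intro: B_mult A_integral)

lemma res_pow: "b \<in> B \<Longrightarrow> \<phi> (b [^] (k::nat)) = \<phi> b [^]\<^bsub>F\<^esub> k"
  by (induction k) (auto simp: res_one res_mult B_pow)

lemma res_subring: "subring (\<phi> ` A) F"
proof (rule F.subringI)
  show "\<phi> ` A \<subseteq> carrier F" using res_closed A_integral by blast
  show "\<one>\<^bsub>F\<^esub> \<in> \<phi> ` A" using res_one A_one by (metis imageI)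
  fix x y assume "x \<in> \<phi> ` A" "y \<in> \<phi> ` A"
  then obtain a b where ab: "a \<in> A" "x = \<phi> a" "b \<in> A" "y = \<phi> b" by blast
  have B: "a \<in> B" "b \<in> B" using ab A_integral by auto
  show "x \<otimes>\<^bsub>F\<^esub> y \<in> \<phi> ` A" unfolding ab(2,4) res_mult[OF B, symmetric] using ab by blast
  show "x \<oplus>\<^bsub>F\<^esub> y \<in> \<phi> ` A" unfolding ab(2,4) res_add[OF B, symmetric] using ab by blast
next
  fix x assume "x \<in> \<phi> ` A"
  then obtain a where a: "a \<in> A" "x = \<phi> a" by blast
  show "\<ominus>\<^bsub>F\<^esub> x \<in> \<phi> ` A" unfolding a(2) res_neg[OF A_integral[OF a(1)], symmetric] using a by blast
qed

lemma field_subring_residue: "field_subring F (\<phi> ` A)"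
  by (intro field_subring.intro F.field_axioms field_subring_axioms.intro res_subring)

lemma res_combine:
  "\<lbrakk>set as \<subseteq> B; set bs \<subseteq> B\<rbrakk> \<Longrightarrow> combine as bs \<in> B \<and> \<phi> (combine as bs) = F.combine (map \<phi> as) (map \<phi> bs)"
  by (induction as bs rule: combine.induct)
    (auto simp: res_zero A_integral res_add res_mult B_mult B_add)

lemma common_denominator:
  "set ys \<subseteq> carrier F \<Longrightarrow> \<exists>c\<in>B. c \<notin> Q \<and> (\<forall>y\<in>set ys. \<exists>b\<in>B. y \<otimes>\<^bsub>F\<^esub> \<phi> c = \<phi> b)"
proof (induction ys)
  case Nil
  then show ?case using Q_one A_integral[OF A_one] by auto
next
  case (Cons y ys)
  obtain c where c: "c \<in> B" "c \<notin> Q" "\<forall>y\<in>set ys. \<exists>b\<in>B. y \<otimes>\<^bsub>F\<^esub> \<phi> c = \<phi> b" using Cons by auto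
  obtain d b where d: "d \<in> B" "d \<notin> Q" "b \<in> B" "y \<otimes>\<^bsub>F\<^esub> \<phi> d = \<phi> b" using res_fraction[of y] Cons.prems by auto
  have cl: "\<phi> c \<in> carrier F" "\<phi> d \<in> carrier F" "y \<in> carrier F" using c d res_closed Cons.prems by auto
  have "\<exists>b\<in>B. z \<otimes>\<^bsub>F\<^esub> \<phi> (c \<otimes> d) = \<phi> b" if z: "z \<in> set (y # ys)" for z
  proof (cases "z = y")
    case True
    have "z \<otimes>\<^bsub>F\<^esub> \<phi> (c \<otimes> d) = \<phi> c \<otimes>\<^bsub>F\<^esub> (y \<otimes>\<^bsub>F\<^esub> \<phi> d)"
      unfolding True res_mult[OF c(1) d(1)] using cl F.m_lcomm F.m_comm F.m_assoc by (metis F.m_closed)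
    then show ?thesis unfolding d(4) using res_mult[OF c(1) d(3)] B_mult[OF c(1) d(3)] by metis
  next
    case False
    then obtain b' where b': "b' \<in> B" "z \<otimes>\<^bsub>F\<^esub> \<phi> c = \<phi> b'" using z c(3) by auto
    have zc: "z \<in> carrier F" using z Cons.prems by auto
    have "z \<otimes>\<^bsub>F\<^esub> \<phi> (c \<otimes> d) = (z \<otimes>\<^bsub>F\<^esub> \<phi> c) \<otimes>\<^bsub>F\<^esub> \<phi> d"
      unfolding res_mult[OF c(1) d(1)] using cl zc by (simp add: F.m_assoc)
    then show ?thesis unfolding b'(2) using res_mult[OF b'(1) d(1)] B_mult[OF b'(1) d(1)] by metis
  qed
  moreover have "c \<otimes> d \<notin> Q" using Q_prime c d by blast
  ultimately show ?case using B_mult[OF c(1) d(1)] by blast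
qed

text \<open>Clear denominators, lift the elements to \<open>B\<close> and take a relation over
  \<open>A\<close> with a coefficient outside \<open>P\<close>: it stays nontrivial modulo
  \<open>Q\<close>. The residue extension thus inherits the degree bound \<open>n\<close>.\<close>

lemma residue_dependence:
  assumes ys: "length ys = Suc n" "set ys \<subseteq> carrier F"
  shows "\<exists>as. length as = Suc n \<and> set as \<subseteq> \<phi> ` A \<and> \<not> set as \<subseteq> {\<zero>\<^bsub>F\<^esub>} \<and> F.combine as ys = \<zero>\<^bsub>F\<^esub>"
proof -
  obtain c where c: "c \<in> B" "c \<notin> Q" "\<forall>y\<in>set ys. \<exists>b\<in>B. y \<otimes>\<^bsub>F\<^esub> \<phi> c = \<phi> b"
    using common_denominator[OF ys(2)] by blast
  then obtain g where g: "\<And>y. y \<in> set ys \<Longrightarrow> g y \<in> B \<and> y \<otimes>\<^bsub>F\<^esub> \<phi> c = \<phi> (g y)" by metis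
  have gB: "set (map g ys) \<subseteq> B" using g by auto
  then have gE: "set (map g ys) \<subseteq> carrier E" using B_in by blast
  obtain as where as: "length as = Suc n" "set as \<subseteq> A" "\<not> set as \<subseteq> P" "combine as (map g ys) = \<zero>"
    using primitive_dependence[of "map g ys"] ys(1) gE by auto
  have asB: "set as \<subseteq> B" using as(2) A_integral by blast
  have asF: "set (map \<phi> as) \<subseteq> carrier F" using asB res_closed by auto
  have cF: "\<phi> c \<in> carrier F" by (rule res_closed[OF c(1)])
  have mg: "map (\<lambda>u. u \<otimes>\<^bsub>F\<^esub> \<phi> c) ys = map \<phi> (map g ys)" using g by simp
  have "F.combine (map \<phi> as) ys \<otimes>\<^bsub>F\<^esub> \<phi> c = F.combine (map \<phi> as) (map \<phi> (map g ys))"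
    unfolding F.combine_l_distr[OF asF ys(2) cF] mg ..
  also have "\<dots> = \<zero>\<^bsub>F\<^esub>" using res_combine[OF asB gB] as(4) res_zero by simp
  finally have "F.combine (map \<phi> as) ys = \<zero>\<^bsub>F\<^esub>"
    using F.integral[OF _ F.combine_in_carrier[OF asF ys(2)] cF] res_zero_iff[OF c(1)] c(2) by blast
  moreover have "\<not> set (map \<phi> as) \<subseteq> {\<zero>\<^bsub>F\<^esub>}"
  proof
    assume *: "set (map \<phi> as) \<subseteq> {\<zero>\<^bsub>F\<^esub>}"
    have "a \<in> P" if "a \<in> set as" for a
    proof -
      have "\<phi> a = \<zero>\<^bsub>F\<^esub>" using * that by auto
      then have "a \<in> Q" using res_zero_iff that asB by blast
      then show ?thesis using P_iff that as(2) by blast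
    qed
    then show False using as(3) by blast
  qed
  moreover have "set (map \<phi> as) \<subseteq> \<phi> ` A" using as(2) by auto
  ultimately show ?thesis using as(1) by (metis length_map)
qed

end

text \<open>The image of \<open>A\<close> under \<open>\<phi>\<close> is \<open>A/P\<close>, and
  \<open>m = mult_plus w P\<close> makes it a discrete valuation ring with uniformizer
  \<open>\<phi> w\<close>.\<close>

locale residue_dvr = residue_map E A f Q n F \<phi> + local_subring E A m
    for E (structure) and A f Q n F \<phi> m +
  fixes w
  assumes f_m: "f \<in> m" and w: "w \<in> m" "w \<notin> P" "m = mult_plus w P"
begin

lemma w_A: "w \<in> A" using m_A w by blast

lemma P_m: "a \<in> P \<Longrightarrow> a \<in> m"
  using ideal_ofD(4)[OF m_ideal _ f_m] m_comm[OF f_in] by auto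

lemma P_ideal: "ideal_of E A P" by (rule prime_ofD(1)[OF prime_f])

lemma res_A_eq_iff: "\<lbrakk>a \<in> A; b \<in> A\<rbrakk> \<Longrightarrow> \<phi> a = \<phi> b \<longleftrightarrow> a \<ominus> b \<in> P"
  using res_eq_iff[OF A_integral A_integral] P_iff[OF A_minus] by blast

lemma res_m_iff: assumes a: "a \<in> A" shows "\<phi> a \<in> \<phi> ` m \<longleftrightarrow> a \<in> m"
proof
  assume "\<phi> a \<in> \<phi> ` m"
  then obtain b where b: "b \<in> m" "\<phi> a = \<phi> b" by blast
  then have "a \<ominus> b \<in> m" using P_m res_A_eq_iff[OF a m_A[OF b(1)]] by blast
  then have "(a \<ominus> b) \<oplus> b \<in> m" using b(1) by (rule ideal_ofD(3)[OF m_ideal])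
  moreover have "(a \<ominus> b) \<oplus> b = a" using A_in[OF a] A_in[OF m_A[OF b(1)]] by algebra
  ultimately show "a \<in> m" by simp
qed blast

lemma res_m_ideal: "ideal_of F (\<phi> ` A) (\<phi> ` m)"
proof (rule ideal_ofI)
  show "\<phi> ` m \<subseteq> \<phi> ` A" using m_A by blast
  show "\<zero>\<^bsub>F\<^esub> \<in> \<phi> ` m" using res_zero ideal_ofD(2)[OF m_ideal] by (metis imageI)
  fix x y assume "x \<in> \<phi> ` m" "y \<in> \<phi> ` m"
  then obtain a b where ab: "a \<in> m" "x = \<phi> a" "b \<in> m" "y = \<phi> b" by blast
  show "x \<oplus>\<^bsub>F\<^esub> y \<in> \<phi> ` m"
    unfolding ab(2,4) using res_add[OF A_integral[OF m_A[OF ab(1)]] A_integral[OF m_A[OF ab(3)]]]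
      ideal_ofD(3)[OF m_ideal ab(1,3)] by (metis imageI)
next
  fix x y assume "x \<in> \<phi> ` A" "y \<in> \<phi> ` m"
  then obtain a b where ab: "a \<in> A" "x = \<phi> a" "b \<in> m" "y = \<phi> b" by blast
  show "x \<otimes>\<^bsub>F\<^esub> y \<in> \<phi> ` m"
    unfolding ab(2,4) using res_mult[OF A_integral[OF ab(1)] A_integral[OF m_A[OF ab(3)]]]
      ideal_ofD(4)[OF m_ideal ab(1,3)] by (metis imageI)
qed

lemma res_m_one: "\<one>\<^bsub>F\<^esub> \<notin> \<phi> ` m"
  using res_m_iff[OF A_one] res_one m_one by simp

lemma res_m_unit: assumes "x \<in> \<phi> ` A" "x \<notin> \<phi> ` m" shows "\<exists>y\<in>\<phi> ` A. x \<otimes>\<^bsub>F\<^esub> y = \<one>\<^bsub>F\<^esub>"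
proof -
  obtain a where a: "a \<in> A" "x = \<phi> a" using assms by blast
  then obtain b where b: "b \<in> A" "a \<otimes> b = \<one>" using m_unit assms(2) by blast
  have "\<phi> a \<otimes>\<^bsub>F\<^esub> \<phi> b = \<one>\<^bsub>F\<^esub>" using res_mult[OF A_integral[OF a(1)] A_integral[OF b(1)]] b(2) res_one by simp
  then show ?thesis using a b by blast
qed

lemma res_m_eq: "\<phi> ` m = {\<phi> w \<otimes>\<^bsub>F\<^esub> s | s. s \<in> \<phi> ` A}"
proof (intro equalityI subsetI)
  fix x assume "x \<in> \<phi> ` m"
  then obtain c where c: "c \<in> m" "x = \<phi> c" by blast
  have "c \<in> mult_plus w P" using c(1) by (subst w(3)[symmetric])
  then obtain a z where az: "a \<in> A" "z \<in> P" "c = w \<otimes> a \<oplus> z" by (rule mult_plusE)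
  have zA: "z \<in> A" by (rule ideal_ofD(1)[OF P_ideal az(2)])
  have "c \<ominus> w \<otimes> a = z" unfolding az(3) using A_in[OF zA] A_in[OF az(1)] A_in[OF w_A] by algebra
  then have "\<phi> c = \<phi> (w \<otimes> a)" using res_A_eq_iff[OF m_A[OF c(1)] A_mult[OF w_A az(1)]] az(2) by blast
  then show "x \<in> {\<phi> w \<otimes>\<^bsub>F\<^esub> s | s. s \<in> \<phi> ` A}"
    unfolding c(2) using res_mult[OF A_integral[OF w_A] A_integral[OF az(1)]] az(1) by auto
next
  fix x assume "x \<in> {\<phi> w \<otimes>\<^bsub>F\<^esub> s | s. s \<in> \<phi> ` A}"
  then obtain a where a: "a \<in> A" "x = \<phi> w \<otimes>\<^bsub>F\<^esub> \<phi> a" by blast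
  have "\<phi> a \<otimes>\<^bsub>F\<^esub> \<phi> w \<in> \<phi> ` m" by (rule ideal_ofD(4)[OF res_m_ideal]) (use a w in auto)
  then show "x \<in> \<phi> ` m" unfolding a(2) using F.m_comm res_closed A_integral a(1) w_A by metis
qed

lemma res_max_ideal: "max_ideal (F\<lparr>carrier := \<phi> ` A\<rparr>) = \<phi> ` m"
proof -
  interpret S: domain "F\<lparr>carrier := \<phi> ` A\<rparr>" by (rule F.subring_is_domain[OF res_subring])
  show ?thesis
  proof (rule S.local_cringI(2))
    show "ideal (\<phi> ` m) (F\<lparr>carrier := \<phi> ` A\<rparr>)" using F.ideal_iff_ideal_of[OF res_subring] res_m_ideal by blast
  qed (use res_m_one res_m_unit in auto)
qed

lemma w_ne: "\<phi> w \<noteq> \<zero>\<^bsub>F\<^esub>"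
  using res_zero_iff[OF A_integral[OF w_A]] P_iff[OF w_A] w(2) by blast

lemma res_prime: "prime_of F (\<phi> ` A) (\<phi> ` m)"
proof -
  have "x \<in> \<phi> ` m \<or> y \<in> \<phi> ` m" if xy: "x \<in> \<phi> ` A" "y \<in> \<phi> ` A" "x \<otimes>\<^bsub>F\<^esub> y \<in> \<phi> ` m" for x y
  proof (rule ccontr)
    assume "\<not> ?thesis"
    then obtain u where u: "u \<in> \<phi> ` A" "x \<otimes>\<^bsub>F\<^esub> u = \<one>\<^bsub>F\<^esub>" and n: "y \<notin> \<phi> ` m" using res_m_unit xy(1) by blast
    have cl: "x \<in> carrier F" "y \<in> carrier F" "u \<in> carrier F" using xy u subringE(1)[OF res_subring] by blast+
    have "u \<otimes>\<^bsub>F\<^esub> (x \<otimes>\<^bsub>F\<^esub> y) \<in> \<phi> ` m" by (rule ideal_ofD(4)[OF res_m_ideal u(1) xy(3)])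
    moreover have "u \<otimes>\<^bsub>F\<^esub> (x \<otimes>\<^bsub>F\<^esub> y) = (x \<otimes>\<^bsub>F\<^esub> u) \<otimes>\<^bsub>F\<^esub> y" using cl F.m_assoc F.m_comm by metis
    ultimately show False using n u(2) cl by simp
  qed
  then show ?thesis using res_m_ideal res_m_one unfolding ideal_of_def prime_of_def by blast
qed

text \<open>The same situation one dimension lower: \<open>A/P\<close> in the residue field, with
  \<open>\<phi> w\<close> in place of \<open>f\<close> and \<open>N\<close> in place of
  \<open>Q\<close>. The ramification index of \<open>N\<close> is thereby bounded by the same
  \<open>n\<close>.\<close>

lemma residue_prime_over_principal:
  assumes N: "N \<in> primes_over F (\<phi> ` A) (max_ideal (F\<lparr>carrier := \<phi> ` A\<rparr>))"
  shows "prime_over_principal F (\<phi> ` A) (\<phi> w) N n"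
proof (intro prime_over_principal.intro field_subring_residue prime_over_principal_axioms.intro)
  show "\<phi> w \<in> \<phi> ` A" using w_A by blast
  show "\<phi> w \<noteq> \<zero>\<^bsub>F\<^esub>" by (rule w_ne)
  show "prime_of F (\<phi> ` A) {\<phi> w \<otimes>\<^bsub>F\<^esub> s | s. s \<in> \<phi> ` A}" using res_prime unfolding res_m_eq .
  show "\<exists>k. \<forall>b\<in>\<phi> ` A. s \<noteq> \<phi> w [^]\<^bsub>F\<^esub> (k::nat) \<otimes>\<^bsub>F\<^esub> b" if s: "s \<in> \<phi> ` A" "s \<noteq> \<zero>\<^bsub>F\<^esub>" for s
  proof -
    obtain a where a: "a \<in> A" "s = \<phi> a" using s by blast
    then have "a \<notin> P" using s(2) res_zero_iff[OF A_integral] P_iff by blast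
    then obtain k where k: "a \<notin> mult_plus (w [^] (k::nat)) P" using separated_modulo[OF prime_f w(1,2) a(1)] by blast
    have "s \<noteq> \<phi> w [^]\<^bsub>F\<^esub> k \<otimes>\<^bsub>F\<^esub> \<phi> b" if b: "b \<in> A" for b
    proof
      assume "s = \<phi> w [^]\<^bsub>F\<^esub> k \<otimes>\<^bsub>F\<^esub> \<phi> b"
      then have "\<phi> a = \<phi> (w [^] k \<otimes> b)"
        using a(2) res_pow[OF A_integral[OF w_A]] res_mult[OF B_pow[OF A_integral[OF w_A]] A_integral[OF b]] by simp
      then have z: "a \<ominus> w [^] k \<otimes> b \<in> P" using res_A_eq_iff[OF a(1) A_mult[OF A_pow[OF w_A] b]] by blast
      have "w [^] k \<otimes> b \<oplus> (a \<ominus> w [^] k \<otimes> b) \<in> mult_plus (w [^] k) P" by (rule mult_plusI[OF b z])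
      moreover have "w [^] k \<otimes> b \<oplus> (a \<ominus> w [^] k \<otimes> b) = a"
        using A_in[OF a(1)] A_in[OF b] A_in[OF A_pow[OF w_A, of k]] by algebra
      ultimately show False using k by simp
    qed
    then show ?thesis by blast
  qed
  show "\<exists>as. length as = Suc n \<and> set as \<subseteq> \<phi> ` A \<and> \<not> set as \<subseteq> {\<zero>\<^bsub>F\<^esub>} \<and> F.combine as ys = \<zero>\<^bsub>F\<^esub>"
    if "length ys = Suc n" "set ys \<subseteq> carrier F" for ys by (rule residue_dependence[OF that])
  show "prime_of F (integral_closure F (\<phi> ` A)) N"
    using N F.primeideal_iff_prime_of[OF field_subring.subring_integral_closure[OF field_subring_residue]]
    unfolding primes_over_def by blast
  show "N \<inter> \<phi> ` A = {\<phi> w \<otimes>\<^bsub>F\<^esub> s | s. s \<in> \<phi> ` A}"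
    using N unfolding primes_over_def res_max_ideal res_m_eq by blast
qed

lemma residue_primes_over_nonempty:
  "\<exists>N. N \<in> primes_over F (\<phi> ` A) (max_ideal (F\<lparr>carrier := \<phi> ` A\<rparr>))"
  unfolding res_max_ideal
proof (rule field_subring.primes_over_nonempty[OF field_subring_residue res_m_ideal res_m_one res_m_unit _ res_m_eq])
  show "\<phi> w \<in> \<phi> ` m" using w(1) by blast
qed

end

section \<open>Orbit polynomials and the inertia argument\<close>

text \<open>A homomorphism that need only be defined on a subring \<open>H\<close>. Instances are
  automorphisms of \<open>E\<close> and of \<open>F\<close>, with \<open>H\<close> the whole field,
  and the reduction \<open>\<phi>\<close> on \<open>B\<close>.\<close>

locale subring_hom = R: cring R + S: cring S
    for R (structure) and H and S and h +
  assumes subring_H: "subring H R"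
    and hom_closed: "x \<in> H \<Longrightarrow> h x \<in> carrier S"
    and hom_mult: "\<lbrakk>x \<in> H; y \<in> H\<rbrakk> \<Longrightarrow> h (x \<otimes> y) = h x \<otimes>\<^bsub>S\<^esub> h y"
    and hom_add: "\<lbrakk>x \<in> H; y \<in> H\<rbrakk> \<Longrightarrow> h (x \<oplus> y) = h x \<oplus>\<^bsub>S\<^esub> h y"
    and hom_one: "h \<one> = \<one>\<^bsub>S\<^esub>"

section \<open>Polynomials given by a list of roots\<close>

context cring begin

text \<open>\<open>pcoef as j\<close> is the coefficient of \<open>X^j\<close> in the product of the \<open>X - a\<close> over \<open>a\<close> in \<open>as\<close>.\<close>

primrec pcoef :: "'a list \<Rightarrow> nat \<Rightarrow> 'a" where
  "pcoef [] j = (if j = 0 then \<one> else \<zero>)"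
| "pcoef (a # as) j = (case j of 0 \<Rightarrow> \<zero> | Suc i \<Rightarrow> pcoef as i) \<ominus> a \<otimes> pcoef as j"

primrec ev :: "(nat \<Rightarrow> 'a) \<Rightarrow> nat \<Rightarrow> 'a \<Rightarrow> 'a" where
  "ev c 0 x = \<zero>"
| "ev c (Suc n) x = c n \<otimes> x [^] n \<oplus> ev c n x"

lemma pcoef_in_subring:
  assumes H: "subring H R" shows "set as \<subseteq> H \<Longrightarrow> pcoef as j \<in> H"
proof (induction as arbitrary: j)
  case Nil
  then show ?case using subringE[OF H] by simp
next
  case (Cons a as)
  have "x \<ominus> y \<in> H" if "x \<in> H" "y \<in> H" for x y using that subringE(5,7)[OF H] unfolding a_minus_def by blast
  then show ?case using Cons subringE(2,6)[OF H] by (cases j) auto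
qed

lemma pcoef_closed: "set as \<subseteq> carrier R \<Longrightarrow> pcoef as j \<in> carrier R"
  by (rule pcoef_in_subring[OF carrier_is_subring])

lemma ev_closed: "(\<And>i. c i \<in> carrier R) \<Longrightarrow> x \<in> carrier R \<Longrightarrow> ev c n x \<in> carrier R"
  by (induction n) auto

lemma pcoef_swap:
  assumes "a \<in> carrier R" "b \<in> carrier R" "set as \<subseteq> carrier R"
  shows "pcoef (a # b # as) j = pcoef (b # a # as) j"
proof -
  have c: "pcoef as i \<in> carrier R" for i using pcoef_closed assms(3) .
  consider "j = 0" | "j = Suc 0" | i where "j = Suc (Suc i)" by (metis not0_implies_Suc)
  then show ?thesis
  proof cases
    case 1
    then show ?thesis using c[of 0] assms by simp algebra
  next
    case 2
    then show ?thesis using c[of 0] c[of 1] assms by simp algebra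
  next
    case 3
    then show ?thesis using c[of i] c[of "Suc i"] c[of "Suc (Suc i)"] assms by simp algebra
  qed
qed

text \<open>Invariance under moving the first root to the end, which is how an automorphism acts on
  the list of iterates of an element.\<close>

lemma pcoef_snoc: "\<lbrakk>a \<in> carrier R; set as \<subseteq> carrier R\<rbrakk> \<Longrightarrow> pcoef (as @ [a]) j = pcoef (a # as) j"
proof (induction as arbitrary: j)
  case (Cons b as)
  have eq: "pcoef (as @ [a]) = pcoef (a # as)" using Cons by auto
  have "pcoef ((b # as) @ [a]) j = pcoef (b # a # as) j" unfolding append_Cons pcoef.simps(2)[of b] eq ..
  then show ?case using pcoef_swap[of b a as] Cons.prems by auto
qed simp

lemma pcoef_high: "\<lbrakk>set as \<subseteq> carrier R; length as < j\<rbrakk> \<Longrightarrow> pcoef as j = \<zero>"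
  by (induction as arbitrary: j) (auto simp: a_minus_def split: nat.split)

lemma pcoef_top: "set as \<subseteq> carrier R \<Longrightarrow> pcoef as (length as) = \<one>"
  by (induction as) (auto simp: pcoef_high a_minus_def)

lemma ev_pcoef_Cons:
  assumes "a \<in> carrier R" "set as \<subseteq> carrier R" "x \<in> carrier R"
  shows "ev (pcoef (a # as)) (Suc k) x = x \<otimes> ev (pcoef as) k x \<ominus> a \<otimes> ev (pcoef as) (Suc k) x"
proof (induction k)
  case 0
  then show ?case using assms pcoef_closed[OF assms(2), of 0] by simp algebra
next
  case (Suc k)
  have c: "pcoef as k \<in> carrier R" "pcoef as (Suc k) \<in> carrier R" "ev (pcoef as) k x \<in> carrier R" "x [^] k \<in> carrier R"
    using assms pcoef_closed ev_closed by auto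
  have "ev (pcoef (a # as)) (Suc (Suc k)) x = (pcoef as k \<ominus> a \<otimes> pcoef as (Suc k)) \<otimes> x [^] Suc k \<oplus>
      (x \<otimes> ev (pcoef as) k x \<ominus> a \<otimes> ev (pcoef as) (Suc k) x)"
    unfolding ev.simps(2)[of _ "Suc k"] Suc by simp
  also have "\<dots> = x \<otimes> ev (pcoef as) (Suc k) x \<ominus> a \<otimes> ev (pcoef as) (Suc (Suc k)) x"
    unfolding ev.simps(2) nat_pow_Suc using c assms(1,3) by algebra
  finally show ?case .
qed

text \<open>The polynomial has degree \<open>length as\<close>, so \<open>Suc (length as)\<close>
  coefficients are summed.\<close>

lemma ev_pcoef:
  assumes "x \<in> carrier R"
  shows "set as \<subseteq> carrier R \<Longrightarrow> ev (pcoef as) (Suc (length as)) x = foldr (\<lambda>a r. (x \<ominus> a) \<otimes> r) as \<one>"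
proof (induction as)
  case Nil
  then show ?case using assms by simp
next
  case (Cons a as)
  have c: "a \<in> carrier R" "set as \<subseteq> carrier R" using Cons.prems by auto
  have e: "ev (pcoef as) k x \<in> carrier R" for k using c assms by (intro ev_closed pcoef_closed)
  have "ev (pcoef as) (Suc (Suc (length as))) x = ev (pcoef as) (Suc (length as)) x"
    unfolding ev.simps(2)[of _ "Suc (length as)"] using pcoef_high[OF c(2), of "Suc (length as)"] e assms
    by (simp del: ev.simps)
  then have "ev (pcoef (a # as)) (Suc (length (a # as))) x = (x \<ominus> a) \<otimes> ev (pcoef as) (Suc (length as)) x"
    unfolding list.size(4) Suc_eq_plus1[symmetric] add_Suc_right add_0_right
    using ev_pcoef_Cons[OF c assms, of "Suc (length as)"] e[of "Suc (length as)"] assms c(1)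
    by (simp del: ev.simps) algebra
  then show ?case unfolding Cons.IH[OF c(2)] by (simp only: foldr.simps o_apply)
qed

lemma eval_ev: "eval (map c (rev [0..<n])) x = ev c n x"
  by (induction n) auto

lemma linear_product_root: "\<lbrakk>x \<in> set as; set as \<subseteq> carrier R\<rbrakk> \<Longrightarrow> foldr (\<lambda>a r. (x \<ominus> a) \<otimes> r) as \<one> = \<zero>"
proof (induction as)
  case (Cons a as)
  have "foldr (\<lambda>a r. (x \<ominus> a) \<otimes> r) as \<one> \<in> carrier R" if "set as \<subseteq> carrier R" for as
    using that Cons.prems by (induction as) auto
  then show ?case using Cons by (cases "x = a") (auto simp: a_minus_def r_neg)
qed simp

lemma pcoef_replicate: "x \<in> carrier R \<Longrightarrow> pcoef (replicate k x) 0 = (\<ominus> x) [^] k"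
proof (induction k)
  case (Suc k)
  have c: "(\<ominus> x) [^] k \<in> carrier R" using Suc.prems by simp
  have "\<zero> \<ominus> x \<otimes> y = y \<otimes> (\<ominus> x)" if "y \<in> carrier R" for y using that Suc.prems by algebra
  then show ?case using Suc c by simp
qed simp

end

lemma (in domain) linear_product_zero:
  "\<lbrakk>x \<in> carrier R; set as \<subseteq> carrier R; foldr (\<lambda>a r. (x \<ominus> a) \<otimes> r) as \<one> = \<zero>\<rbrakk> \<Longrightarrow> x \<in> set as"
proof (induction as)
  case (Cons a as)
  have cl: "foldr (\<lambda>a r. (x \<ominus> a) \<otimes> r) as \<one> \<in> carrier R" if "set as \<subseteq> carrier R" for as
    using that Cons.prems(1) by (induction as) auto
  have "x \<ominus> a = \<zero> \<or> foldr (\<lambda>a r. (x \<ominus> a) \<otimes> r) as \<one> = \<zero>"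
    using integral[of "x \<ominus> a" "foldr (\<lambda>a r. (x \<ominus> a) \<otimes> r) as \<one>"] cl[of as] Cons.prems by auto
  then show ?case using Cons by (auto simp: r_right_minus_eq)
qed simp

context subring_hom begin

lemma H_carrier: "x \<in> H \<Longrightarrow> x \<in> carrier R" using subringE(1)[OF subring_H] by blast

lemma hom_zero: "h \<zero> = \<zero>\<^bsub>S\<^esub>"
proof -
  have z: "\<zero> \<in> H" by (rule subringE(2)[OF subring_H])
  show ?thesis using hom_add[OF z z] S.add.l_cancel_one[OF hom_closed[OF z] hom_closed[OF z]] by simp
qed

lemma hom_neg: assumes x: "x \<in> H" shows "h (\<ominus> x) = \<ominus>\<^bsub>S\<^esub> h x"
proof -
  have nx: "\<ominus> x \<in> H" by (rule subringE(5)[OF subring_H x])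
  have "h (\<ominus> x) \<oplus>\<^bsub>S\<^esub> h x = \<zero>\<^bsub>S\<^esub>"
    unfolding hom_add[OF nx x, symmetric] using H_carrier[OF x] hom_zero by (simp add: R.l_neg)
  then show ?thesis using S.minus_equality hom_closed[OF x] hom_closed[OF nx] by metis
qed

lemma hom_minus: "\<lbrakk>x \<in> H; y \<in> H\<rbrakk> \<Longrightarrow> h (x \<ominus> y) = h x \<ominus>\<^bsub>S\<^esub> h y"
  unfolding a_minus_def by (simp add: hom_add hom_neg subringE(5)[OF subring_H])

lemma pow_H: "x \<in> H \<Longrightarrow> x [^] (k::nat) \<in> H"
  by (induction k) (auto simp: subringE[OF subring_H])

lemma hom_pow: "x \<in> H \<Longrightarrow> h (x [^] (k::nat)) = h x [^]\<^bsub>S\<^esub> k"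
  by (induction k) (auto simp: hom_one hom_mult pow_H)

lemma hom_pcoef: "set as \<subseteq> H \<Longrightarrow> h (R.pcoef as j) = S.pcoef (map h as) j"
proof (induction as arbitrary: j)
  case Nil
  then show ?case by (simp add: hom_one hom_zero)
next
  case (Cons a as)
  have H: "R.pcoef as i \<in> H" for i using Cons.prems by (intro R.pcoef_in_subring[OF subring_H]) auto
  have aH: "a \<in> H" using Cons.prems by simp
  have IH: "h (R.pcoef as i) = S.pcoef (map h as) i" for i using Cons by simp
  have m: "a \<otimes> R.pcoef as i \<in> H" for i by (rule subringE(6)[OF subring_H aH H])
  have z: "\<zero> \<in> H" by (rule subringE(2)[OF subring_H])
  show ?case
    by (cases j) (simp_all add: hom_minus[OF z m] hom_minus[OF H m] hom_zero hom_mult[OF aH H] IH)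
qed

lemma eval_H: "\<lbrakk>set q \<subseteq> H; x \<in> H\<rbrakk> \<Longrightarrow> R.eval q x \<in> H \<and> h (R.eval q x) = S.eval (map h q) (h x)"
proof (induction q)
  case Nil
  then show ?case by (simp add: hom_zero subringE(2)[OF subring_H])
next
  case (Cons a q)
  have m: "a \<otimes> x [^] k \<in> H" for k :: nat using Cons.prems pow_H subringE(6)[OF subring_H] by auto
  show ?case using Cons m[of "length q"] hom_add[OF m] pow_H[OF Cons.prems(2)]
    by (simp add: subringE(7)[OF subring_H] hom_mult hom_pow)
qed

end

section \<open>Orbits under an automorphism and their symmetric functions\<close>

lemma (in cring) funpow_closed:
  assumes hom: "subring_hom R (carrier R) R g" and x: "x \<in> carrier R"
  shows "(g ^^ j) x \<in> carrier R"
  by (induction j) (use x subring_hom.hom_closed[OF hom] in auto)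

text \<open>Since \<open>n\<close> is a period, applying \<open>g\<close> to the list of iterates
  rotates it by one place, and the coefficients are invariant under this rotation.\<close>

lemma (in cring) orbit_pcoef_fixed:
  assumes hom: "subring_hom R (carrier R) R g" and x: "x \<in> carrier R" and per: "(g ^^ n) x = x" "0 < n"
  defines "as \<equiv> map (\<lambda>j. (g ^^ j) x) [0..<n]"
  shows "g (pcoef as j) = pcoef as j"
proof -
  obtain k where k: "n = Suc k" using per(2) gr0_conv_Suc by blast
  let ?os = "map (\<lambda>j. (g ^^ Suc j) x) [0..<k]"
  have up: "[0..<n] = 0 # map Suc [0..<k]" by (simp add: k upt_conv_Cons map_Suc_upt del: upt_Suc)
  have up': "[0..<n] = [0..<k] @ [k]" by (simp add: k)
  have as: "as = x # ?os" unfolding as_def up by simp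
  have cl: "set as \<subseteq> carrier R" unfolding as_def using funpow_closed[OF hom x] by auto
  have "map g as = ?os @ [(g ^^ n) x]" unfolding as_def up' by (simp add: k)
  then have "pcoef (map g as) j = pcoef as j"
    unfolding per(1) as using pcoef_snoc[OF x, of ?os] cl unfolding as by auto
  then show ?thesis using subring_hom.hom_pcoef[OF hom cl, of j] by simp
qed

text \<open>Of the Galois group a generator is kept: its \<open>p\<close>-th iterate is the
  identity, and the elements it fixes are fractions over \<open>A\<close>.\<close>

locale field_automorphism = field_subring E A for E (structure) and A +
  fixes \<sigma> :: "'a \<Rightarrow> 'a" and p :: nat
  assumes p: "Factorial_Ring.prime p" "add_pow E p \<one> = \<zero>"
    and sig_closed: "x \<in> carrier E \<Longrightarrow> \<sigma> x \<in> carrier E"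
    and sig_mult: "\<lbrakk>x \<in> carrier E; y \<in> carrier E\<rbrakk> \<Longrightarrow> \<sigma> (x \<otimes> y) = \<sigma> x \<otimes> \<sigma> y"
    and sig_add: "\<lbrakk>x \<in> carrier E; y \<in> carrier E\<rbrakk> \<Longrightarrow> \<sigma> (x \<oplus> y) = \<sigma> x \<oplus> \<sigma> y"
    and sig_A: "a \<in> A \<Longrightarrow> \<sigma> a = a"
    and sig_order: "x \<in> carrier E \<Longrightarrow> (\<sigma> ^^ p) x = x"
    and sig_fixed: "\<lbrakk>x \<in> carrier E; \<sigma> x = x\<rbrakk> \<Longrightarrow> \<exists>a\<in>A. \<exists>d\<in>A. d \<noteq> \<zero> \<and> d \<otimes> x = a"
    and sig_nontriv: "\<exists>x\<in>carrier E. \<sigma> x \<noteq> x"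
begin

lemma sig_hom: "subring_hom E (carrier E) E \<sigma>"
  by (intro subring_hom.intro is_cring subring_hom_axioms.intro carrier_is_subring
      sig_closed sig_mult sig_add sig_A A_one) assumption+

lemma sig_pow_hom: "subring_hom E (carrier E) E (\<sigma> ^^ j)"
proof (intro subring_hom.intro is_cring subring_hom_axioms.intro carrier_is_subring)
  show cl: "(\<sigma> ^^ j) x \<in> carrier E" if "x \<in> carrier E" for x
    using that by (induction j) (auto simp: sig_closed)
  have cl: "(\<sigma> ^^ i) x \<in> carrier E" if "x \<in> carrier E" for x i
    using that by (induction i) (auto simp: sig_closed)
  show "(\<sigma> ^^ j) (x \<otimes> y) = (\<sigma> ^^ j) x \<otimes> (\<sigma> ^^ j) y" if "x \<in> carrier E" "y \<in> carrier E" for x y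
    using that by (induction j) (auto simp: sig_mult cl)
  show "(\<sigma> ^^ j) (x \<oplus> y) = (\<sigma> ^^ j) x \<oplus> (\<sigma> ^^ j) y" if "x \<in> carrier E" "y \<in> carrier E" for x y
    using that by (induction j) (auto simp: sig_add cl)
  show "(\<sigma> ^^ j) \<one> = \<one>" by (induction j) (auto simp: sig_A)
qed

lemma sig_pow_A: "a \<in> A \<Longrightarrow> (\<sigma> ^^ j) a = a"
  by (induction j) (auto simp: sig_A)

lemma sig_B: assumes b: "b \<in> integral_closure E A" shows "\<sigma> b \<in> integral_closure E A"
proof -
  obtain q where q: "set q \<subseteq> A" "eval (\<one> # q) b = \<zero>" using b unfolding integral_closure_iff[OF integral_carrier[OF b]] by blast
  have bc: "b \<in> carrier E" by (rule integral_carrier[OF b])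
  have mq: "map \<sigma> (\<one> # q) = \<one> # q" using q(1) sig_A by (auto intro!: map_idI)
  have "eval (\<one> # q) (\<sigma> b) = \<sigma> (eval (\<one> # q) b)"
    using subring_hom.eval_H[OF sig_hom, of "\<one> # q" b] q(1) bc A_carrier unfolding mq by auto
  also have "\<dots> = \<zero>" unfolding q(2) by (rule sig_A[OF A_zero])
  finally show ?thesis using integral_closure_iff[OF sig_closed[OF bc]] q(1) by blast
qed

lemma sig_pow_B: "b \<in> integral_closure E A \<Longrightarrow> (\<sigma> ^^ j) b \<in> integral_closure E A"
  by (induction j) (auto simp: sig_B)

definition sig_orbit :: "'a \<Rightarrow> 'a list" where
  "sig_orbit x = map (\<lambda>j. (\<sigma> ^^ j) x) [0..<p]"

lemma orbit_coefficient_fixed: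
  assumes x: "x \<in> carrier E" shows "\<sigma> (pcoef (sig_orbit x) j) = pcoef (sig_orbit x) j"
  unfolding sig_orbit_def
  by (rule orbit_pcoef_fixed[OF sig_hom x sig_order[OF x] prime_gt_0_nat[OF p(1)]])

lemma orbit_coefficient_B:
  assumes x: "x \<in> integral_closure E A" shows "pcoef (sig_orbit x) j \<in> integral_closure E A"
  by (rule pcoef_in_subring[OF subring_integral_closure]) (auto simp: sig_orbit_def sig_pow_B[OF x])

end

lemma (in field_subring) fractions_in_iff:
  "x \<in> fractions_in E A \<longleftrightarrow> x \<in> carrier E \<and> (\<exists>a\<in>A. \<exists>s\<in>A. s \<noteq> \<zero> \<and> s \<otimes> x = a)"
proof
  assume "x \<in> fractions_in E A"
  then obtain a s where as: "a \<in> A" "s \<in> A" "s \<noteq> \<zero>" "x = a \<otimes> inv s"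
    unfolding fractions_in_def localization_def by blast
  have i: "inv s \<in> carrier E" "s \<otimes> inv s = \<one>" using as field_Units by auto
  have "s \<otimes> x = (s \<otimes> inv s) \<otimes> a" unfolding as(4) using i(1) A_in[OF as(1)] A_in[OF as(2)] by algebra
  then have "s \<otimes> x = a" unfolding i(2) using as(1) by simp
  moreover have "x \<in> carrier E" unfolding as(4) using i(1) as(1) by simp
  ultimately show "x \<in> carrier E \<and> (\<exists>a\<in>A. \<exists>s\<in>A. s \<noteq> \<zero> \<and> s \<otimes> x = a)" using as by blast
next
  assume "x \<in> carrier E \<and> (\<exists>a\<in>A. \<exists>s\<in>A. s \<noteq> \<zero> \<and> s \<otimes> x = a)"
  then obtain a s where as: "x \<in> carrier E" "a \<in> A" "s \<in> A" "s \<noteq> \<zero>" "s \<otimes> x = a" by blast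
  have i: "inv s \<in> carrier E" "s \<otimes> inv s = \<one>" using as field_Units by auto
  have "a \<otimes> inv s = (s \<otimes> inv s) \<otimes> x" unfolding as(5)[symmetric] using i(1) as(1) A_in[OF as(3)] by algebra
  then have "x = a \<otimes> inv s" unfolding i(2) using as(1) by simp
  then show "x \<in> fractions_in E A" unfolding fractions_in_def localization_def using as by blast
qed

locale automorphism_residue = field_automorphism E A \<sigma> p + residue_map E A f Q p F \<phi>
  for E (structure) and A \<sigma> p f Q F \<phi>
begin

lemma res_hom: "subring_hom E B F \<phi>"
  by (intro subring_hom.intro is_cring F.is_cring subring_hom_axioms.intro subring_integral_closure
      res_closed res_mult res_add res_one) assumption+

lemma res_fractions_iff:
  "y \<in> fractions_in F (\<phi> ` A) \<longleftrightarrow> y \<in> carrier F \<and> (\<exists>a\<in>A. \<exists>s\<in>A. s \<notin> P \<and> \<phi> s \<otimes>\<^bsub>F\<^esub> y = \<phi> a)"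
proof -
  have "\<phi> s \<noteq> \<zero>\<^bsub>F\<^esub> \<longleftrightarrow> s \<notin> P" if "s \<in> A" for s
    using res_zero_iff[OF A_integral[OF that]] P_iff[OF that] by blast
  then show ?thesis unfolding field_subring.fractions_in_iff[OF field_subring_residue] by blast
qed

text \<open>Such a coefficient lies in \<open>B\<close> and is fixed by \<open>\<sigma>\<close>, so
  it is a fraction over \<open>A\<close>, and \<open>integral_fraction_local\<close> provides a
  denominator outside \<open>P\<close>.\<close>

lemma orbit_coefficient_local:
  assumes x: "x \<in> B" shows "\<exists>s\<in>A. s \<notin> P \<and> s \<otimes> pcoef (sig_orbit x) j \<in> A"
proof -
  let ?c = "pcoef (sig_orbit x) j"
  have cB: "?c \<in> B" by (rule orbit_coefficient_B[OF x])
  obtain a d where "a \<in> A" "d \<in> A" "d \<noteq> \<zero>" "d \<otimes> ?c = a"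
    using sig_fixed[OF B_in[OF cB] orbit_coefficient_fixed[OF B_in[OF x]]] by blast
  then show ?thesis by (rule integral_fraction_local[OF cB])
qed

lemma orbit_coefficient_residue:
  assumes x: "x \<in> B"
  shows "F.pcoef (map \<phi> (sig_orbit x)) j \<in> fractions_in F (\<phi> ` A)"
proof -
  let ?c = "pcoef (sig_orbit x) j"
  obtain s where s: "s \<in> A" "s \<notin> P" "s \<otimes> ?c \<in> A" using orbit_coefficient_local[OF x] by blast
  have cB: "?c \<in> B" by (rule orbit_coefficient_B[OF x])
  have oB: "set (sig_orbit x) \<subseteq> B" unfolding sig_orbit_def using sig_pow_B[OF x] by auto
  have eq: "F.pcoef (map \<phi> (sig_orbit x)) j = \<phi> ?c"
    by (rule subring_hom.hom_pcoef[OF res_hom oB, symmetric])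
  show ?thesis unfolding eq res_fractions_iff
    using s res_closed[OF cB] res_mult[OF A_integral[OF s(1)] cB, symmetric] by blast
qed

text \<open>The orbit of \<open>\<ominus> x\<close> reduces to \<open>p\<close> equal elements, so
  the constant coefficient of its orbit polynomial reduces to the \<open>p\<close>-th power of
  \<open>\<phi> x\<close>; starting from \<open>\<ominus> x\<close> avoids a sign. This power lies
  in the residue field of \<open>P\<close>, and by \<open>sep\<close> so does
  \<open>\<phi> x\<close>.\<close>

lemma inertia_residue:
  assumes triv: "\<And>b. b \<in> B \<Longrightarrow> \<sigma> b \<ominus> b \<in> Q"
    and sep: "\<And>y. \<lbrakk>y \<in> carrier F; y [^]\<^bsub>F\<^esub> p \<in> fractions_in F (\<phi> ` A)\<rbrakk> \<Longrightarrow> y \<in> fractions_in F (\<phi> ` A)"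
    and x: "x \<in> B"
  shows "\<exists>s\<in>A. s \<notin> P \<and> (\<exists>a\<in>A. s \<otimes> x \<ominus> a \<in> Q)"
proof -
  have nx: "\<ominus> x \<in> B" by (rule B_neg[OF x])
  have j: "\<phi> ((\<sigma> ^^ j) (\<ominus> x)) = \<phi> (\<ominus> x)" for j
  proof (induction j)
    case (Suc j)
    have jB: "(\<sigma> ^^ j) (\<ominus> x) \<in> B" by (rule sig_pow_B[OF nx])
    have "\<phi> (\<sigma> ((\<sigma> ^^ j) (\<ominus> x))) = \<phi> ((\<sigma> ^^ j) (\<ominus> x))"
      using res_eq_iff[OF sig_B[OF jB] jB] triv[OF jB] by blast
    then show ?case using Suc by simp
  qed simp
  have "map \<phi> (sig_orbit (\<ominus> x)) = replicate p (\<phi> (\<ominus> x))"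
    unfolding sig_orbit_def using j by (intro nth_equalityI) auto
  then have "F.pcoef (replicate p (\<phi> (\<ominus> x))) 0 \<in> fractions_in F (\<phi> ` A)"
    using orbit_coefficient_residue[OF nx, of 0] by simp
  moreover have "\<ominus>\<^bsub>F\<^esub> \<phi> (\<ominus> x) = \<phi> x" unfolding res_neg[OF x] using res_closed[OF x] by simp
  ultimately have "\<phi> x [^]\<^bsub>F\<^esub> p \<in> fractions_in F (\<phi> ` A)"
    using F.pcoef_replicate[OF res_closed[OF nx], of p] by simp
  then have "\<phi> x \<in> fractions_in F (\<phi> ` A)" by (rule sep[OF res_closed[OF x]])
  then obtain a s where as: "a \<in> A" "s \<in> A" "s \<notin> P" "\<phi> s \<otimes>\<^bsub>F\<^esub> \<phi> x = \<phi> a" unfolding res_fractions_iff by blast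
  have "\<phi> (s \<otimes> x) = \<phi> a" using as(4) res_mult[OF A_integral[OF as(2)] x] by simp
  then have "s \<otimes> x \<ominus> a \<in> Q" using res_eq_iff[OF B_mult[OF A_integral[OF as(2)] x] A_integral[OF as(1)]] by blast
  then show ?thesis using as by blast
qed

text \<open>If \<open>\<sigma>\<close> acts trivially modulo \<open>Q\<close>, then unramifiedness gives \<open>B_Q = A_P + f B_Q\<close>, so
  \<open>\<sigma> - 1\<close> maps \<open>B_Q\<close> into \<open>f^k B_Q\<close> for every \<open>k\<close>.\<close>
lemma inertia_trivial:
  assumes triv: "\<And>b. b \<in> B \<Longrightarrow> \<sigma> b \<ominus> b \<in> Q"
    and sep: "\<And>y. \<lbrakk>y \<in> carrier F; y [^]\<^bsub>F\<^esub> p \<in> fractions_in F (\<phi> ` A)\<rbrakk> \<Longrightarrow> y \<in> fractions_in F (\<phi> ` A)"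
    and ram: "ramification_index E A P Q = 1"
  shows False
proof -
  obtain w e u where weu: "unif w e u" using unif_exists by blast
  have e: "e = 1" using ramification_index_unif[OF weu] ram by simp
  have w: "w \<in> carrier E" "u \<in> loc" "u \<notin> mloc" "f = w \<otimes> u" "\<forall>q\<in>mloc. \<exists>r\<in>loc. q = w \<otimes> r"
    using weu mloc_in unfolding unif_def e by auto
  have uc: "u \<in> carrier E" by (rule loc_in[OF w(2)])
  note ui = loc_unit[OF w(2,3)]
  have uic: "inv u \<in> carrier E" by (rule loc_in[OF ui(2)])
  have mf: "\<exists>z\<in>loc. q = f \<otimes> z" if q: "q \<in> mloc" for q
  proof -
    obtain r where r: "r \<in> loc" "q = w \<otimes> r" using w(5) q by blast
    have rc: "r \<in> carrier E" by (rule loc_in[OF r(1)])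
    have "f \<otimes> (inv u \<otimes> r) = w \<otimes> (u \<otimes> inv u) \<otimes> r" unfolding w(4) using w(1) uc uic rc by algebra
    then have "q = f \<otimes> (inv u \<otimes> r)" unfolding ui(4) r(2) using w(1) rc by simp
    then show ?thesis using loc_ops(1)[OF ui(2) r(1)] by blast
  qed
  \<comment> \<open>With \<open>t\<close> a denominator of \<open>y\<close>, both \<open>t\<close>
    and \<open>t \<otimes> y\<close> agree modulo \<open>Q\<close>, up to denominators outside
    \<open>P\<close>, with fractions \<open>a1/s1\<close> and \<open>a2/s2\<close> over
    \<open>A\<close>; the quotient of these approximates \<open>y\<close>.\<close>
  have dec: "\<exists>s\<in>A. s \<notin> P \<and> (\<exists>a\<in>A. \<exists>z\<in>loc. s \<otimes> y = a \<oplus> f \<otimes> z)" if y: "y \<in> loc" for y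
  proof -
    obtain t where t: "t \<in> B" "t \<notin> Q" "t \<otimes> y \<in> B" using y unfolding loc_def by blast
    obtain s1 a1 where 1: "s1 \<in> A" "s1 \<notin> P" "a1 \<in> A" "s1 \<otimes> t \<ominus> a1 \<in> Q"
      using inertia_residue[OF triv sep t(1)] by blast
    obtain s2 a2 where 2: "s2 \<in> A" "s2 \<notin> P" "a2 \<in> A" "s2 \<otimes> (t \<otimes> y) \<ominus> a2 \<in> Q"
      using inertia_residue[OF triv sep t(3)] by blast
    have c: "y \<in> carrier E" "t \<in> carrier E" "s1 \<in> carrier E" "s2 \<in> carrier E" "a1 \<in> carrier E" "a2 \<in> carrier E"
      using loc_in[OF y] B_in[OF t(1)] 1 2 by auto
    have "a1 \<notin> P"
    proof
      assume "a1 \<in> P"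
      then have "a1 \<in> Q" using P_iff[OF 1(3)] by blast
      then have "(s1 \<otimes> t \<ominus> a1) \<oplus> a1 \<in> Q" using 1(4) Q_add by blast
      moreover have "(s1 \<otimes> t \<ominus> a1) \<oplus> a1 = s1 \<otimes> t" using c by algebra
      ultimately have "s1 \<in> Q \<or> t \<in> Q" using Q_prime[OF A_integral[OF 1(1)] t(1)] by simp
      then show False using t(2) P_iff[OF 1(1)] 1(2) by blast
    qed
    then have nP: "s2 \<otimes> a1 \<notin> P" using prime_ofD(3)[OF prime_f 2(1) 1(3)] 2(2) by blast
    have "a1 \<otimes> (s2 \<otimes> (t \<otimes> y) \<ominus> a2) \<oplus> (\<ominus> a2) \<otimes> (s1 \<otimes> t \<ominus> a1) \<in> Q"
      by (intro Q_add Q_mult A_integral 1 2 A_neg)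
    moreover have "a1 \<otimes> (s2 \<otimes> (t \<otimes> y) \<ominus> a2) \<oplus> (\<ominus> a2) \<otimes> (s1 \<otimes> t \<ominus> a1) = t \<otimes> ((s2 \<otimes> a1) \<otimes> y \<ominus> a2 \<otimes> s1)"
      using c by algebra
    ultimately have "(s2 \<otimes> a1) \<otimes> y \<ominus> a2 \<otimes> s1 \<in> mloc" unfolding mloc_def using t c by auto
    then obtain z where z: "z \<in> loc" "(s2 \<otimes> a1) \<otimes> y \<ominus> a2 \<otimes> s1 = f \<otimes> z" using mf by blast
    have "(s2 \<otimes> a1) \<otimes> y = a2 \<otimes> s1 \<oplus> ((s2 \<otimes> a1) \<otimes> y \<ominus> a2 \<otimes> s1)" using c by algebra
    then have "(s2 \<otimes> a1) \<otimes> y = a2 \<otimes> s1 \<oplus> f \<otimes> z" unfolding z(2) .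
    then show ?thesis using nP z(1) A_mult[OF 2(1) 1(3)] A_mult[OF 2(3) 1(1)] by blast
  qed
  \<comment> \<open>The elements \<open>\<sigma> t\<close> and \<open>t\<close> are congruent modulo
    \<open>Q\<close>, so \<open>\<sigma>\<close> maps denominators to denominators.\<close>
  have sloc: "\<sigma> y \<in> loc" if y: "y \<in> loc" for y
  proof -
    obtain t where t: "t \<in> B" "t \<notin> Q" "t \<otimes> y \<in> B" using y unfolding loc_def by blast
    have c: "y \<in> carrier E" "t \<in> carrier E" using loc_in[OF y] B_in[OF t(1)] by auto
    have "\<sigma> t \<notin> Q"
    proof
      assume "\<sigma> t \<in> Q"
      then have "\<sigma> t \<oplus> (\<ominus> \<one>) \<otimes> (\<sigma> t \<ominus> t) \<in> Q"
        by (intro Q_add Q_mult A_integral A_neg A_one triv t)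
      moreover have "\<sigma> t \<oplus> (\<ominus> \<one>) \<otimes> (\<sigma> t \<ominus> t) = t" using c sig_closed[OF c(2)] by algebra
      ultimately show False using t(2) by simp
    qed
    moreover have "\<sigma> t \<otimes> \<sigma> y \<in> B" using sig_B[OF t(3)] sig_mult[OF c(2,1)] by simp
    ultimately show ?thesis unfolding loc_def using sig_B[OF t(1)] sig_closed[OF c(1)] by blast
  qed
  \<comment> \<open>As \<open>\<sigma>\<close> fixes \<open>s\<close>, \<open>a\<close> and
    \<open>f\<close>, the equation \<open>s \<otimes> y = a \<oplus> f \<otimes> z\<close> turns
    \<open>\<sigma> y \<ominus> y\<close> into \<open>f\<close> times
    \<open>\<sigma> z \<ominus> z\<close>, up to the unit \<open>s\<close>.\<close>
  have div: "\<exists>r\<in>loc. \<sigma> y \<ominus> y = f [^] k \<otimes> r" if "y \<in> loc" for y and k :: nat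
    using that
  proof (induction k arbitrary: y)
    case 0
    have "\<sigma> y \<ominus> y \<in> loc" unfolding a_minus_def using 0 by (intro loc_ops(2) loc_neg sloc)
    moreover have "f [^] (0::nat) \<otimes> (\<sigma> y \<ominus> y) = \<sigma> y \<ominus> y" using loc_in[OF calculation] by simp
    ultimately show ?case by metis
  next
    case (Suc k)
    obtain s a z where saz: "s \<in> A" "s \<notin> P" "a \<in> A" "z \<in> loc" "s \<otimes> y = a \<oplus> f \<otimes> z" using dec[OF Suc.prems] by blast
    obtain r where r: "r \<in> loc" "\<sigma> z \<ominus> z = f [^] k \<otimes> r" using Suc.IH[OF saz(4)] by blast
    have c: "y \<in> carrier E" "s \<in> carrier E" "a \<in> carrier E" "z \<in> carrier E" "r \<in> carrier E" "f \<in> carrier E"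
      "f [^] k \<in> carrier E" "\<sigma> y \<in> carrier E" "\<sigma> z \<in> carrier E"
      using loc_in[OF Suc.prems] saz loc_in[OF saz(4)] loc_in[OF r(1)] f_in sig_closed by auto
    have sl: "s \<in> loc" "s \<notin> mloc" using A_loc[OF saz(1)] mloc_B[OF _ A_integral[OF saz(1)]] P_iff[OF saz(1)] saz(2) by auto
    note si = loc_unit[OF sl]
    have sic: "inv s \<in> carrier E" by (rule loc_in[OF si(2)])
    have "\<sigma> (s \<otimes> y) = s \<otimes> \<sigma> y" using sig_mult[OF c(2,1)] sig_A[OF saz(1)] by simp
    moreover have "\<sigma> (s \<otimes> y) = a \<oplus> f \<otimes> \<sigma> z" unfolding saz(5)
      using sig_add[OF c(3) m_closed[OF c(6,4)]] sig_mult[OF c(6,4)] sig_A[OF saz(3)] sig_A[OF f(1)] by simp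
    ultimately have e1: "s \<otimes> \<sigma> y = a \<oplus> f \<otimes> \<sigma> z" by simp
    have "s \<otimes> (\<sigma> y \<ominus> y) = s \<otimes> \<sigma> y \<ominus> s \<otimes> y" using c by algebra
    also have "\<dots> = f \<otimes> (\<sigma> z \<ominus> z)" unfolding e1 saz(5) using c(3,4,6,9) by algebra
    also have "\<dots> = f [^] Suc k \<otimes> r" unfolding r(2) nat_pow_Suc using c(5,6,7) by algebra
    finally have e2: "s \<otimes> (\<sigma> y \<ominus> y) = f [^] Suc k \<otimes> r" .
    have "\<sigma> y \<ominus> y = (s \<otimes> inv s) \<otimes> (\<sigma> y \<ominus> y)" unfolding si(4) using c by simp
    also have "\<dots> = inv s \<otimes> (s \<otimes> (\<sigma> y \<ominus> y))" using sic c(1,2,8) by algebra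
    also have "\<dots> = f [^] Suc k \<otimes> (inv s \<otimes> r)" unfolding e2 nat_pow_Suc using sic c(5,6,7) by algebra
    finally show ?case using loc_ops(1)[OF si(2) r(1)] by blast
  qed
  have fix_loc: "\<sigma> y = y" if y: "y \<in> loc" for y
  proof -
    have "\<sigma> y \<ominus> y \<in> loc" unfolding a_minus_def using y by (intro loc_ops(2) loc_neg sloc)
    then have "\<sigma> y \<ominus> y = \<zero>" by (rule f_adically_separated) (rule div[OF y])
    then show ?thesis using r_right_minus_eq[OF sig_closed[OF loc_in[OF y]] loc_in[OF y]] by blast
  qed
  \<comment> \<open>An element moved by \<open>\<sigma>\<close> lies outside \<open>loc\<close>; but
    then its inverse lies in \<open>loc\<close> and is fixed.\<close>
  obtain x where x: "x \<in> carrier E" "\<sigma> x \<noteq> x" using sig_nontriv by blast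
  then have nl: "x \<noteq> \<zero>" "inv x \<in> loc" using valuation_dichotomy fix_loc by blast+
  have ic: "inv x \<in> carrier E" "x \<otimes> inv x = \<one>" using x nl field_Units by auto
  have "\<sigma> x \<otimes> \<sigma> (inv x) = \<sigma> \<one>" using sig_mult[OF x(1) ic(1)] ic(2) by simp
  then have e: "\<sigma> x \<otimes> inv x = \<one>" unfolding fix_loc[OF nl(2)] sig_A[OF A_one] .
  have "\<sigma> x = (\<sigma> x \<otimes> inv x) \<otimes> x"
  proof -
    have "(\<sigma> x \<otimes> inv x) \<otimes> x = \<sigma> x \<otimes> (x \<otimes> inv x)" using ic(1) x(1) sig_closed[OF x(1)] by algebra
    then show ?thesis unfolding ic(2) using sig_closed[OF x(1)] by simp
  qed
  then have "\<sigma> x = x" unfolding e using x(1) by simp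
  then show False using x(2) by blast
qed

end

section \<open>Lower ramification groups along a transversal prime\<close>

context residue_dvr begin

text \<open>If \<open>x\<close> avoids the earlier sets, then each of them contains \<open>y + w^k x\<close> for at most one \<open>k\<close>.\<close>
lemma avoid_submodules:
  assumes fin: "finite J" and V: "\<And>j x y. \<lbrakk>x \<in> V j; y \<in> V j\<rbrakk> \<Longrightarrow> x \<ominus> y \<in> V j"
    and sat: "\<And>j a x. \<lbrakk>a \<in> A; x \<in> B\<rbrakk> \<Longrightarrow> x \<in> V j \<Longrightarrow> a \<otimes> x \<in> V j"
      "\<And>j a x. \<lbrakk>a \<in> A; a \<notin> P; x \<in> B; a \<otimes> x \<in> V j\<rbrakk> \<Longrightarrow> x \<in> V j"
    and ne: "\<And>j. j \<in> J \<Longrightarrow> \<exists>x\<in>B. x \<notin> V j"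
  shows "\<exists>x\<in>B. \<forall>j\<in>J. x \<notin> V j"
  using fin ne
proof (induction J)
  case empty
  then show ?case using A_integral[OF A_zero] by blast
next
  case (insert j J)
  obtain x where x: "x \<in> B" "\<forall>i\<in>J. x \<notin> V i" using insert by blast
  obtain y where y: "y \<in> B" "y \<notin> V j" using insert.prems by blast
  show ?case
  proof (cases "x \<in> V j")
    case False
    then show ?thesis using x by blast
  next
    case True
    define z where "z k = y \<oplus> w [^] k \<otimes> x" for k :: nat
    have c: "x \<in> carrier E" "y \<in> carrier E" "w \<in> carrier E" using x y B_in w_A by auto
    have wA: "w [^] k \<in> A" for k :: nat using w_A by simp
    have zB: "z k \<in> B" for k unfolding z_def by (intro B_add B_mult y x A_integral wA)
    have zj: "z k \<notin> V j" for k
    proof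
      assume "z k \<in> V j"
      then have "z k \<ominus> w [^] k \<otimes> x \<in> V j" using V sat(1)[OF wA x(1) True] by blast
      moreover have "z k \<ominus> w [^] k \<otimes> x = y" unfolding z_def using c A_in[OF wA[of k]] by algebra
      ultimately show False using y(2) by simp
    qed
    have uniq: "k = l" if kl: "z k \<in> V i" "z l \<in> V i" and i: "i \<in> J" for k l i
    proof -
      have main: "\<not> k < l" if kl: "z k \<in> V i" "z l \<in> V i" for k l
      proof
        assume "k < l"
        then obtain d where d: "l = k + Suc d" using less_imp_Suc_add by auto
        have cc: "w [^] k \<in> carrier E" "w [^] d \<in> carrier E" using wA A_in by blast+
        have "w [^] l = w [^] k \<otimes> (w [^] d \<otimes> w)" unfolding d using c(3) by (simp add: nat_pow_mult[symmetric] m_assoc)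
        \<comment> \<open>The difference is \<open>x\<close> times an element of \<open>A\<close>
          outside \<open>P\<close>, as \<open>\<one> \<ominus> w [^] d \<otimes> w\<close> is
          outside \<open>m\<close>; saturation would put \<open>x\<close> into
          \<open>V i\<close>.\<close>
        then have "z k \<ominus> z l = (w [^] k \<otimes> (\<one> \<ominus> w [^] d \<otimes> w)) \<otimes> x" unfolding z_def using c cc by algebra
        then have a1: "w [^] k \<otimes> (\<one> \<ominus> w [^] d \<otimes> w) \<otimes> x \<in> V i" using V[OF kl] by simp
        have a2: "w [^] k \<otimes> (\<one> \<ominus> w [^] d \<otimes> w) \<in> A" using wA w_A by (intro A_mult A_minus A_one) auto
        have a3: "w [^] k \<otimes> (\<one> \<ominus> w [^] d \<otimes> w) \<notin> P"
        proof
          assume "w [^] k \<otimes> (\<one> \<ominus> w [^] d \<otimes> w) \<in> P"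
          then consider "w [^] k \<in> P" | "\<one> \<ominus> w [^] d \<otimes> w \<in> P"
            using prime_ofD(3)[OF prime_f wA A_minus[OF A_one A_mult[OF wA w_A]]] by blast
          then show False
          proof cases
            case 1
            have "w [^] k \<notin> P" for k :: nat
            proof (induction k)
              case 0
              then show ?case using prime_ofD(2)[OF prime_f] by simp
            next
              case (Suc k)
              then show ?case using prime_ofD(3)[OF prime_f wA w_A] w(2) by auto
            qed
            then show False using 1 by blast
          next
            case 2
            have "w [^] d \<otimes> w \<in> m" by (rule ideal_ofD(4)[OF m_ideal wA w(1)])
            with P_m[OF 2] have "(\<one> \<ominus> w [^] d \<otimes> w) \<oplus> w [^] d \<otimes> w \<in> m" by (rule ideal_ofD(3)[OF m_ideal])
            moreover have "(\<one> \<ominus> w [^] d \<otimes> w) \<oplus> w [^] d \<otimes> w = \<one>" using c cc by algebra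
            ultimately show False using m_one by simp
          qed
        qed
        have "x \<in> V i" by (rule sat(2)[OF a2 a3 x(1) a1])
        then show False using x(2) i by blast
      qed
      show ?thesis using main[OF kl] main[OF kl(2,1)] by simp
    qed
    have "\<exists>k. \<forall>i\<in>J. z k \<notin> V i"
    proof (rule ccontr)
      assume "\<not> ?thesis"
      then obtain g where g: "\<And>k. g k \<in> J \<and> z k \<in> V (g k)" by metis
      have "inj g" by (rule injI) (use g uniq in metis)
      moreover have "finite (range g)" by (rule finite_subset[OF _ insert.hyps(1)]) (use g in blast)
      ultimately show False using finite_imageD infinite_UNIV_nat by blast
    qed
    then show ?thesis using zj zB by blast
  qed
qed

end

locale automorphism_dvr = automorphism_residue E A \<sigma> p f Q F \<phi> + residue_dvr E A f Q p F \<phi> m w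
  for E (structure) and A \<sigma> p f Q F \<phi> m w
begin

text \<open>Both \<open>\<tau>\<close> and the powers of \<open>\<sigma>\<close> permute the roots of the orbit polynomial modulo \<open>Q\<close>.\<close>
lemma residue_automorphism_root:
  assumes \<tau>: "subring_hom F (carrier F) F \<tau>" and fixes_K: "\<And>y. y \<in> fractions_in F (\<phi> ` A) \<Longrightarrow> \<tau> y = y"
    and x: "x \<in> B"
  shows "\<exists>j<p. \<tau> (\<phi> x) = \<phi> ((\<sigma> ^^ j) x)"
proof -
  let ?o = "map \<phi> (sig_orbit x)"
  have oB: "set (sig_orbit x) \<subseteq> B" unfolding sig_orbit_def using sig_pow_B[OF x] by auto
  then have oF: "set ?o \<subseteq> carrier F" using res_closed by auto
  then have oF': "set (map \<tau> ?o) \<subseteq> carrier F" using subring_hom.hom_closed[OF \<tau>] by auto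
  have "F.pcoef (map \<tau> ?o) j = F.pcoef ?o j" for j
    using subring_hom.hom_pcoef[OF \<tau> oF, of j] fixes_K[OF orbit_coefficient_residue[OF x]] by simp
  then have eq: "F.pcoef (map \<tau> ?o) = F.pcoef ?o" by auto
  have xF: "\<phi> x \<in> carrier F" by (rule res_closed[OF x])
  have t: "\<tau> (\<phi> x) \<in> carrier F" by (rule subring_hom.hom_closed[OF \<tau> xF])
  have "x \<in> set (sig_orbit x)" unfolding sig_orbit_def using prime_gt_0_nat[OF p(1)] by (force simp: image_iff)
  then have "\<tau> (\<phi> x) \<in> set (map \<tau> ?o)" by auto
  then have "F.ev (F.pcoef (map \<tau> ?o)) (Suc (length (map \<tau> ?o))) (\<tau> (\<phi> x)) = \<zero>\<^bsub>F\<^esub>"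
    unfolding F.ev_pcoef[OF t oF'] by (rule F.linear_product_root[OF _ oF'])
  then have "F.ev (F.pcoef ?o) (Suc (length ?o)) (\<tau> (\<phi> x)) = \<zero>\<^bsub>F\<^esub>"
    unfolding eq by (simp only: length_map)
  then have "\<tau> (\<phi> x) \<in> set ?o"
    unfolding F.ev_pcoef[OF t oF] by (rule F.linear_product_zero[OF t oF])
  then show ?thesis unfolding sig_orbit_def by auto
qed

text \<open>The sets of elements of \<open>B\<close> on which \<open>\<tau>\<close> agrees with a
  fixed power of \<open>\<sigma>\<close> are \<open>A\<close>-submodules from which factors in
  \<open>A\<close> outside \<open>P\<close> can be cancelled. If none of them were all of
  \<open>B\<close>, \<open>avoid_submodules\<close> would give an element matched by no power,
  against \<open>residue_automorphism_root\<close>.\<close>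

lemma residue_automorphism_power:
  assumes \<tau>: "subring_hom F (carrier F) F \<tau>" and fixes_K: "\<And>y. y \<in> fractions_in F (\<phi> ` A) \<Longrightarrow> \<tau> y = y"
  shows "\<exists>j<p. \<forall>x\<in>B. \<tau> (\<phi> x) = \<phi> ((\<sigma> ^^ j) x)"
proof (rule ccontr)
  assume no: "\<not> ?thesis"
  define V where "V j = {x \<in> B. \<tau> (\<phi> x) = \<phi> ((\<sigma> ^^ j) x)}" for j
  note th = subring_hom.hom_mult[OF \<tau>] subring_hom.hom_minus[OF \<tau>] subring_hom.hom_closed[OF \<tau>]
  have tA: "\<tau> (\<phi> a) = \<phi> a" if a: "a \<in> A" for a
  proof -
    have 1: "\<one> \<notin> P" by (rule prime_ofD(2)[OF prime_f])
    have "\<phi> \<one> \<otimes>\<^bsub>F\<^esub> \<phi> a = \<phi> a" unfolding res_one using res_closed[OF A_integral[OF a]] by simp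
    then show ?thesis using fixes_K res_fractions_iff 1 a res_closed[OF A_integral[OF a]] A_one by blast
  qed
  have mul: "\<tau> (\<phi> (a \<otimes> x)) = \<phi> a \<otimes>\<^bsub>F\<^esub> \<tau> (\<phi> x)" "\<phi> ((\<sigma> ^^ j) (a \<otimes> x)) = \<phi> a \<otimes>\<^bsub>F\<^esub> \<phi> ((\<sigma> ^^ j) x)"
    if a: "a \<in> A" and x: "x \<in> B" for a x j
  proof -
    have aB: "a \<in> B" by (rule A_integral[OF a])
    show "\<tau> (\<phi> (a \<otimes> x)) = \<phi> a \<otimes>\<^bsub>F\<^esub> \<tau> (\<phi> x)"
      unfolding res_mult[OF aB x] th(1)[OF res_closed[OF aB] res_closed[OF x]] tA[OF a] ..
    show "\<phi> ((\<sigma> ^^ j) (a \<otimes> x)) = \<phi> a \<otimes>\<^bsub>F\<^esub> \<phi> ((\<sigma> ^^ j) x)"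
      unfolding subring_hom.hom_mult[OF sig_pow_hom A_in[OF a] B_in[OF x]] sig_pow_A[OF a]
      by (rule res_mult[OF aB sig_pow_B[OF x]])
  qed
  have "\<exists>x\<in>B. \<forall>j\<in>{..<p}. x \<notin> V j"
  proof (rule avoid_submodules)
    fix j x y assume "x \<in> V j" "y \<in> V j"
    then have xy: "x \<in> B" "y \<in> B" "\<tau> (\<phi> x) = \<phi> ((\<sigma> ^^ j) x)" "\<tau> (\<phi> y) = \<phi> ((\<sigma> ^^ j) y)" unfolding V_def by auto
    have "\<tau> (\<phi> (x \<ominus> y)) = \<phi> ((\<sigma> ^^ j) (x \<ominus> y))"
      unfolding res_minus[OF xy(1,2)] th(2)[OF res_closed[OF xy(1)] res_closed[OF xy(2)]]
        subring_hom.hom_minus[OF sig_pow_hom B_in[OF xy(1)] B_in[OF xy(2)]]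
        res_minus[OF sig_pow_B[OF xy(1)] sig_pow_B[OF xy(2)]] xy(3,4) ..
    then show "x \<ominus> y \<in> V j" unfolding V_def using B_minus[OF xy(1,2)] by blast
  next
    fix j a x assume "a \<in> A" "x \<in> B" "x \<in> V j"
    then show "a \<otimes> x \<in> V j" unfolding V_def using mul B_mult A_integral by auto
  next
    fix j a x assume a: "a \<in> A" "a \<notin> P" "x \<in> B" "a \<otimes> x \<in> V j"
    then have "\<phi> a \<otimes>\<^bsub>F\<^esub> \<tau> (\<phi> x) = \<phi> a \<otimes>\<^bsub>F\<^esub> \<phi> ((\<sigma> ^^ j) x)" unfolding V_def using mul[OF a(1,3)] by auto
    moreover have "\<phi> a \<noteq> \<zero>\<^bsub>F\<^esub>" using res_zero_iff[OF A_integral[OF a(1)]] P_iff[OF a(1)] a(2) by blast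
    ultimately have "\<tau> (\<phi> x) = \<phi> ((\<sigma> ^^ j) x)"
      using F.m_lcancel res_closed[OF A_integral[OF a(1)]] th(3)[OF res_closed[OF a(3)]] res_closed[OF sig_pow_B[OF a(3)]] by metis
    then show "x \<in> V j" unfolding V_def using a(3) by blast
  next
    fix j assume "j \<in> {..<p}"
    then show "\<exists>x\<in>B. x \<notin> V j" unfolding V_def using no by blast
  qed (auto simp: V_def)
  then show False using residue_automorphism_root[OF \<tau> fixes_K] unfolding V_def by blast
qed

text \<open>A nontrivial element of the group is induced by the \<open>j\<close>-th iterate of
  \<open>\<sigma>\<close> with \<open>0 < j < p\<close>. As \<open>j\<close> is invertible modulo
  \<open>p\<close>, \<open>\<sigma>\<close> is in turn an iterate of that map, so every
  \<open>\<sigma> b \<ominus> b\<close> reduces to a multiple of the given power of a uniformizer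
  \<open>v\<close> at \<open>N\<close>. The same then holds for \<open>t [^] n\<close>, whose
  valuation is \<open>M * n\<close> times a ramification index that is at most
  \<open>p\<close>.\<close>

lemma lower_ramification_bound:
  assumes N: "N \<in> primes_over F (\<phi> ` A) (max_ideal (F\<lparr>carrier := \<phi> ` A\<rparr>))"
    and card: "card (lower_ramification_group F (\<phi> ` A) N i) = p"
    and t: "t \<in> A" "\<phi> t = \<phi> w [^]\<^bsub>F\<^esub> (M::nat) \<otimes>\<^bsub>F\<^esub> \<phi> y" "y \<in> A" "y \<notin> m"
    and tn: "t [^] (n::nat) \<in> genideal (E\<lparr>carrier := B\<rparr>) {\<sigma> b \<ominus> b | b. b \<in> B}"
  shows "nat (i + 1) \<le> p * (M * n)"
proof -
  define C where "C = integral_closure F (\<phi> ` A)"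
  let ?G = "lower_ramification_group F (\<phi> ` A) N i"
  note W = residue_prime_over_principal[OF N]
  note WS = field_subring_residue
  have GI: "g \<in> ring_hom F F" "g \<in> extensional (carrier F)" "y \<in> fractions_in F (\<phi> ` A) \<Longrightarrow> g y = y"
    "x \<in> C \<Longrightarrow> g x \<ominus>\<^bsub>F\<^esub> x \<in> N [^]\<^bsub>ideals_set (F\<lparr>carrier := C\<rparr>)\<^esub> nat (i + 1)"
    if "g \<in> ?G" for g x y
    using that unfolding lower_ramification_group_def Gal_def ring_iso_def C_def Let_def by auto
  have "\<exists>\<tau>\<in>?G. \<exists>y\<in>carrier F. \<tau> y \<noteq> y"
  proof (rule ccontr)
    assume *: "\<not> ?thesis"
    \<comment> \<open>Elements of the group are extensional, so those that fix all of
      \<open>carrier F\<close> are one and the same function, against cardinality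
      \<open>p > 1\<close>.\<close>
    have "?G \<subseteq> {restrict (\<lambda>y. y) (carrier F)}"
    proof
      fix g assume g: "g \<in> ?G"
      have "g = restrict (\<lambda>y. y) (carrier F)"
        by (rule extensionalityI[OF GI(2)[OF g] restrict_extensional]) (use * g in auto)
      then show "g \<in> {restrict (\<lambda>y. y) (carrier F)}" by blast
    qed
    then have "card ?G \<le> 1" using card_mono[of "{restrict (\<lambda>y. y) (carrier F)}"] by simp
    then show False using card prime_gt_1_nat[OF p(1)] by simp
  qed
  then obtain \<tau> y0 where \<tau>: "\<tau> \<in> ?G" "y0 \<in> carrier F" "\<tau> y0 \<noteq> y0" by blast
  note th = GI(1)[OF \<tau>(1)]
  have T: "subring_hom F (carrier F) F \<tau>"
    using th by (intro subring_hom.intro F.is_cring subring_hom_axioms.intro F.carrier_is_subring)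
      (auto simp: ring_hom_def)
  obtain j where j: "j < p" "\<And>x. x \<in> B \<Longrightarrow> \<tau> (\<phi> x) = \<phi> ((\<sigma> ^^ j) x)"
    using residue_automorphism_power[OF T GI(3)[OF \<tau>(1)]] by blast
  have "j \<noteq> 0"
  proof
    assume "j = 0"
    then have fixB: "\<tau> (\<phi> x) = \<phi> x" if "x \<in> B" for x using j(2)[OF that] by simp
    obtain c b where cb: "c \<in> B" "c \<notin> Q" "b \<in> B" "y0 \<otimes>\<^bsub>F\<^esub> \<phi> c = \<phi> b" using res_fraction[OF \<tau>(2)] by blast
    have cF: "\<phi> c \<in> carrier F" "\<phi> c \<noteq> \<zero>\<^bsub>F\<^esub>" using res_closed[OF cb(1)] res_zero_iff[OF cb(1)] cb(2) by auto
    have "\<tau> y0 \<otimes>\<^bsub>F\<^esub> \<phi> c = y0 \<otimes>\<^bsub>F\<^esub> \<phi> c"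
      using subring_hom.hom_mult[OF T \<tau>(2) cF(1)] unfolding cb(4) fixB[OF cb(1)] fixB[OF cb(3)] by simp
    then have "\<tau> y0 = y0" using F.m_rcancel[OF cF(2,1) subring_hom.hom_closed[OF T \<tau>(2)] \<tau>(2)] by simp
    then show False using \<tau>(3) by blast
  qed
  then have "gcd j p = 1"
    using j(1) p(1) by (metis coprime_commute coprime_iff_gcd_eq_1 dvd_imp_le gr0I not_le prime_imp_coprime_nat)
  then obtain l q where jl: "j * l = p * q + 1" using bezout_nat[OF \<open>j \<noteq> 0\<close>, of p] by metis
  obtain v e u where vw: "prime_over_principal.unif F (\<phi> ` A) (\<phi> w) N p v e u"
    using prime_over_principal.unif_exists[OF W] by blast
  let ?L = "prime_over_principal.loc F (\<phi> ` A) N"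
  have vF: "v \<in> carrier F"
    using vw prime_over_principal.mloc_in[OF W] unfolding prime_over_principal.unif_def[OF W] by blast
  let ?k = "nat (i + 1)"
  \<comment> \<open>The ideal generated by \<open>v [^] nat (i + 1)\<close> in the localization at
    \<open>N\<close>.\<close>
  define Wk where "Wk = {x \<in> carrier F. \<exists>r\<in>?L. x = v [^]\<^bsub>F\<^esub> ?k \<otimes>\<^bsub>F\<^esub> r}"
  have vk: "v [^]\<^bsub>F\<^esub> ?k \<in> carrier F" using vF by simp
  have LF: "r \<in> carrier F" if "r \<in> ?L" for r using prime_over_principal.loc_in[OF W that] .
  have resC: "\<phi> b \<in> C" if b: "b \<in> B" for b
  proof -
    obtain q where q: "set q \<subseteq> A" "eval (\<one> # q) b = \<zero>" using b unfolding integral_closure_iff[OF B_in[OF b]] by blast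
    have qB: "set (\<one> # q) \<subseteq> B" using q(1) A_integral by auto
    have "F.eval (map \<phi> (\<one> # q)) (\<phi> b) = \<phi> (eval (\<one> # q) b)" using subring_hom.eval_H[OF res_hom qB b] by simp
    also have "\<dots> = \<zero>\<^bsub>F\<^esub>" unfolding q(2) by (rule res_zero)
    finally have "F.eval (\<one>\<^bsub>F\<^esub> # map \<phi> q) (\<phi> b) = \<zero>\<^bsub>F\<^esub>" using res_one by simp
    then show ?thesis unfolding C_def field_subring.integral_closure_iff[OF WS res_closed[OF b]] using q(1) by (metis image_mono set_map)
  qed
  have Wadd: "x \<oplus>\<^bsub>F\<^esub> y \<in> Wk" if "x \<in> Wk" "y \<in> Wk" for x y
  proof -
    obtain r s where rs: "r \<in> ?L" "x = v [^]\<^bsub>F\<^esub> ?k \<otimes>\<^bsub>F\<^esub> r" "s \<in> ?L" "y = v [^]\<^bsub>F\<^esub> ?k \<otimes>\<^bsub>F\<^esub> s" using \<open>x \<in> Wk\<close> \<open>y \<in> Wk\<close> unfolding Wk_def by blast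
    have "x \<oplus>\<^bsub>F\<^esub> y = v [^]\<^bsub>F\<^esub> ?k \<otimes>\<^bsub>F\<^esub> (r \<oplus>\<^bsub>F\<^esub> s)" unfolding rs(2,4) using F.r_distr[OF LF[OF rs(1)] LF[OF rs(3)] vk] by simp
    then show ?thesis unfolding Wk_def using prime_over_principal.loc_ops(2)[OF W rs(1,3)] vk LF[OF rs(1)] LF[OF rs(3)] by auto
  qed
  have Wmul: "\<phi> b \<otimes>\<^bsub>F\<^esub> x \<in> Wk" if b: "b \<in> B" and x: "x \<in> Wk" for b x
  proof -
    obtain r where r: "r \<in> ?L" "x = v [^]\<^bsub>F\<^esub> ?k \<otimes>\<^bsub>F\<^esub> r" using x unfolding Wk_def by blast
    have bl: "\<phi> b \<in> ?L" by (rule prime_over_principal.B_loc[OF W]) (use resC[OF b] C_def in simp)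
    have "\<phi> b \<otimes>\<^bsub>F\<^esub> x = v [^]\<^bsub>F\<^esub> ?k \<otimes>\<^bsub>F\<^esub> (\<phi> b \<otimes>\<^bsub>F\<^esub> r)"
      unfolding r(2) by (rule F.m_lcomm[OF LF[OF bl] vk LF[OF r(1)]])
    then show ?thesis unfolding Wk_def using prime_over_principal.loc_ops(1)[OF W bl r(1)] vk LF[OF bl] LF[OF r(1)] by auto
  qed
  have Wzero: "\<zero>\<^bsub>F\<^esub> \<in> Wk"
  proof -
    have "\<zero>\<^bsub>F\<^esub> \<in> ?L" by (rule prime_over_principal.A_loc[OF W]) (use res_zero A_zero in \<open>metis imageI\<close>)
    then show ?thesis unfolding Wk_def using vk by force
  qed
  have step: "\<phi> ((\<sigma> ^^ j) b) \<ominus>\<^bsub>F\<^esub> \<phi> b \<in> Wk" if b: "b \<in> B" for b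
  proof -
    have "\<tau> (\<phi> b) \<ominus>\<^bsub>F\<^esub> \<phi> b \<in> N [^]\<^bsub>ideals_set (F\<lparr>carrier := C\<rparr>)\<^esub> ?k" by (rule GI(4)[OF \<tau>(1) resC[OF b]])
    then have "\<exists>r\<in>?L. \<tau> (\<phi> b) \<ominus>\<^bsub>F\<^esub> \<phi> b = v [^]\<^bsub>F\<^esub> ?k \<otimes>\<^bsub>F\<^esub> r"
      unfolding C_def by (rule prime_over_principal.prime_power_subset[OF W vw])
    then show ?thesis unfolding Wk_def j(2)[OF b]
      using F.minus_closed[OF res_closed[OF sig_pow_B[OF b]] res_closed[OF b]] by blast
  qed
  \<comment> \<open>Telescoping: the difference for the iterate \<open>j * l'\<close> is a sum of
    differences for the iterate \<open>j\<close>, taken at elements of \<open>B\<close>.\<close>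
  have iter: "\<phi> ((\<sigma> ^^ (j * l')) b) \<ominus>\<^bsub>F\<^esub> \<phi> b \<in> Wk" if b: "b \<in> B" for b l'
  proof (induction l')
    case 0
    then show ?case using Wzero res_closed[OF b] by (simp add: F.r_right_minus_eq a_minus_def F.r_neg)
  next
    case (Suc l')
    let ?c = "(\<sigma> ^^ (j * l')) b"
    have cB: "?c \<in> B" by (rule sig_pow_B[OF b])
    have cl: "\<phi> ((\<sigma> ^^ j) ?c) \<in> carrier F" "\<phi> ?c \<in> carrier F" "\<phi> b \<in> carrier F"
      using res_closed sig_pow_B cB b by auto
    have "(\<sigma> ^^ (j * Suc l')) b = (\<sigma> ^^ j) ?c" by (simp add: funpow_add)
    moreover have "\<phi> ((\<sigma> ^^ j) ?c) \<ominus>\<^bsub>F\<^esub> \<phi> b = (\<phi> ((\<sigma> ^^ j) ?c) \<ominus>\<^bsub>F\<^esub> \<phi> ?c) \<oplus>\<^bsub>F\<^esub> (\<phi> ?c \<ominus>\<^bsub>F\<^esub> \<phi> b)"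
      using cl by algebra
    ultimately show ?case using Wadd[OF step[OF cB] Suc] by simp
  qed
  have fin: "\<phi> (\<sigma> b \<ominus> b) \<in> Wk" if b: "b \<in> B" for b
  proof -
    have per: "(\<sigma> ^^ (p * q)) b = b" for q
      by (induction q) (use sig_order[OF B_in[OF b]] in \<open>simp_all add: funpow_add\<close>)
    have "(\<sigma> ^^ (1 + p * q)) b = \<sigma> b" unfolding funpow_add o_apply per by simp
    then have "(\<sigma> ^^ (j * l)) b = \<sigma> b" unfolding jl by (simp only: add.commute)
    then show ?thesis using iter[OF b, of l] unfolding res_minus[OF sig_B[OF b] b] by simp
  qed
  interpret R: domain "E\<lparr>carrier := B\<rparr>" by (rule subring_is_domain[OF subring_integral_closure])
  \<comment> \<open>The elements of \<open>B\<close> that reduce into \<open>Wk\<close> form an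
    ideal, which therefore contains the ideal generated by all
    \<open>\<sigma> b \<ominus> b\<close>.\<close>
  define J where "J = {b \<in> B. \<phi> b \<in> Wk}"
  have "ideal_of E B J"
  proof (rule ideal_ofI)
    show "J \<subseteq> B" unfolding J_def by blast
    show "\<zero> \<in> J" unfolding J_def using Wzero res_zero A_integral[OF A_zero] by simp
    show "x \<oplus> y \<in> J" if "x \<in> J" "y \<in> J" for x y using that Wadd B_add res_add unfolding J_def by auto
    show "b \<otimes> x \<in> J" if "b \<in> B" "x \<in> J" for b x using that Wmul B_mult res_mult unfolding J_def by auto
  qed
  then have "ideal J (E\<lparr>carrier := B\<rparr>)" using ideal_iff_ideal_of[OF subring_integral_closure] by blast
  moreover have "{\<sigma> b \<ominus> b | b. b \<in> B} \<subseteq> J" unfolding J_def using fin B_minus sig_B by blast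
  ultimately have "t [^] n \<in> J" using R.genideal_minimal tn by blast
  then obtain r where r: "r \<in> ?L" "\<phi> (t [^] n) = v [^]\<^bsub>F\<^esub> ?k \<otimes>\<^bsub>F\<^esub> r" unfolding J_def Wk_def by blast
  have wF: "\<phi> w \<in> carrier F" "\<phi> y \<in> carrier F" using res_closed A_integral w_A t(3) by auto
  have "\<phi> (t [^] n) = (\<phi> w [^]\<^bsub>F\<^esub> M \<otimes>\<^bsub>F\<^esub> \<phi> y) [^]\<^bsub>F\<^esub> n"
    using res_pow[OF A_integral[OF t(1)]] t(2) by simp
  also have "\<dots> = \<phi> w [^]\<^bsub>F\<^esub> (M * n) \<otimes>\<^bsub>F\<^esub> \<phi> y [^]\<^bsub>F\<^esub> n"
    using wF by (simp add: F.nat_pow_distrib F.nat_pow_pow)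
  finally have eq: "\<phi> w [^]\<^bsub>F\<^esub> (M * n) \<otimes>\<^bsub>F\<^esub> \<phi> y [^]\<^bsub>F\<^esub> n = v [^]\<^bsub>F\<^esub> ?k \<otimes>\<^bsub>F\<^esub> r" using r(2) by simp
  have yl: "\<phi> y \<in> ?L" by (rule prime_over_principal.A_loc[OF W]) (use t(3) in blast)
  have ym: "\<phi> y \<notin> prime_over_principal.mloc F (\<phi> ` A) N"
  proof
    assume *: "\<phi> y \<in> prime_over_principal.mloc F (\<phi> ` A) N"
    have "\<phi> y \<in> N" by (rule prime_over_principal.mloc_B[OF W *]) (use resC[OF A_integral[OF t(3)]] C_def in simp)
    then have "\<phi> y \<in> \<phi> ` m" using N t(3) unfolding primes_over_def res_max_ideal by blast
    then show False using res_m_iff[OF t(3)] t(4) by blast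
  qed
  show ?thesis
    by (rule prime_over_principal.unif_pow_bound[OF W vw _ _ r(1) eq])
      (rule prime_over_principal.loc_pow[OF W yl], rule prime_over_principal.unit_pow[OF W yl ym])
qed

end

section \<open>Separable and cyclic extensions\<close>

context field begin

lemma Irr_degree_one:
  assumes K: "subfield K R" and x: "x \<in> carrier R" "(algebraic over K) x" and deg: "degree (Irr K x) = 1"
  shows "x \<in> K"
proof -
  note I = IrrE[OF K x]
  have IK: "set (Irr K x) \<subseteq> K" using I(1) unfolding univ_poly_carrier[symmetric] polynomial_def by auto
  obtain b where b: "Irr K x = [\<one>, b]" using deg I(3)
    by (cases "Irr K x" rule: remdups_adj.cases) auto
  have bK: "b \<in> K" using IK b by simp
  then have bR: "b \<in> carrier R" using subfieldE(3)[OF K] by blast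
  have "x \<oplus> b = \<zero>" using I(4) x(1) bR unfolding b by auto
  then have "x = \<ominus> b" using minus_equality x(1) bR by metis
  then show ?thesis using subringE(5)[OF subfieldE(1)[OF K] bK] by simp
qed

text \<open>All roots of the minimal polynomial of \<open>x\<close> are \<open>p\<close>-th roots of the same element, hence equal;
  as they are simple by separability, the degree is \<open>1\<close>.\<close>
lemma separable_pth_root:
  assumes K: "subfield K R" and sep: "separable_extension R K"
    and p: "Factorial_Ring.prime (p::nat)" "add_pow R p \<one> = \<zero>"
    and x: "x \<in> carrier R" "x [^] p \<in> K"
  shows "x \<in> K"
proof -
  let ?F = "R\<lparr>carrier := K\<rparr>"
  let ?c = "x [^] p"
  define \<mu> where "\<mu> = Irr K x"
  have alg: "(algebraic over K) x" and sp: "separable_poly ?F \<mu>"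
    using sep x(1) unfolding separable_extension_def \<mu>_def over_def by auto
  note Kr = subfieldE(1)[OF K]
  note KE = subringE[OF Kr]
  note I = IrrE[OF K x(1) alg, folded \<mu>_def]
  interpret F: field ?F by (rule subfield_iff(2)[OF K])
  let ?\<Omega> = "F.alg_closure"
  interpret W: algebraic_closure ?\<Omega> "F.indexed_const ` K" using F.alg_closureE(1) by simp
  define h :: "'a \<Rightarrow> ('a list \<times> nat) multiset \<Rightarrow> 'a" where "h = F.indexed_const"
  interpret h: ring_hom_ring ?F ?\<Omega> h
    unfolding h_def by (rule ring_hom_ringI2[OF F.ring_axioms W.ring_axioms F.alg_closureE(2)])
  have \<mu>K: "set \<mu> \<subseteq> K" using I(1) unfolding univ_poly_carrier[symmetric] polynomial_def by auto
  have \<mu>F: "\<mu> \<in> carrier (univ_poly ?F (carrier ?F))" using I(1) univ_poly_consistent[OF Kr] by simp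
  have h\<mu>: "map h \<mu> \<in> carrier (poly_ring ?\<Omega>)"
    by (rule polynomial_hom[OF h.homh F.field_axioms W.field_axioms]) (rule \<mu>F)
  have "map h \<mu> \<in> carrier (univ_poly ?\<Omega> (h ` carrier ?F))"
    by (rule h.subfield_polynomial_hom[OF F.carrier_is_subfield W.one_not_zero \<mu>F])
  then have "W.splitted (map h \<mu>)" using W.roots_over_subfield unfolding h_def by simp
  then have size: "size (W.roots (map h \<mu>)) = length \<mu> - 1" unfolding W.splitted_def by simp
  let ?f = "\<one> # replicate (p - 1) \<zero> @ [\<ominus> ?c]"
  have p0: "0 < p" using prime_gt_0_nat[OF p(1)] .
  have fK: "set ?f \<subseteq> K" using KE x by auto
  have f: "?f \<in> carrier (univ_poly R K)" unfolding univ_poly_carrier[symmetric] polynomial_def using fK by auto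
  have cc: "?c \<in> carrier R" using x(1) by simp
  have "eval ?f x = \<zero>" using eval_binomial[OF p0 x(1), of "\<ominus> ?c"] cc by (simp add: r_neg)
  \<comment> \<open>Divisibility of \<open>X^p - x^p\<close> by the minimal polynomial is carried
    over to the algebraic closure, where it makes every root of \<open>\<mu>\<close> a
    \<open>p\<close>-th root of the image of \<open>?c\<close>.\<close>
  then have "\<mu> pdivides ?f" unfolding \<mu>_def by (rule Irr_minimal[OF K x(1) alg f])
  then have "\<mu> divides\<^bsub>univ_poly R K\<^esub> ?f" using pdivides_iff_shell[OF K I(1) f] by blast
  then obtain q where q: "q \<in> carrier (univ_poly R K)" "?f = poly_mult \<mu> q"
    unfolding factor_def univ_poly_mult by blast
  have qK: "set q \<subseteq> K" using q(1) unfolding univ_poly_carrier[symmetric] polynomial_def by auto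
  have qF: "?f = F.poly_mult \<mu> q" using q(2) poly_mult_consistent[OF Kr] by simp
  have root: "z [^]\<^bsub>?\<Omega>\<^esub> p = h ?c" if z: "z \<in> carrier ?\<Omega>" "W.eval (map h \<mu>) z = \<zero>\<^bsub>?\<Omega>\<^esub>" for z
  proof -
    have hK: "set (map h r) \<subseteq> carrier ?\<Omega>" if "set r \<subseteq> K" for r using that h.hom_closed by auto
    have "W.eval (map h ?f) z = W.eval (W.normalize (map h (F.poly_mult \<mu> q))) z"
      unfolding qF[symmetric] by (rule W.eval_normalize[OF hK[OF fK] z(1), symmetric])
    also have "\<dots> = W.eval (W.poly_mult (map h \<mu>) (map h q)) z"
      using h.poly_mult_hom'[of \<mu> q] \<mu>K qK by simp
    also have "\<dots> = W.eval (map h \<mu>) z \<otimes>\<^bsub>?\<Omega>\<^esub> W.eval (map h q) z"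
      by (rule W.eval_poly_mult[OF hK[OF \<mu>K] hK[OF qK] z(1)])
    also have "\<dots> = \<zero>\<^bsub>?\<Omega>\<^esub>" using z(2) W.eval_in_carrier[OF hK[OF qK] z(1)] by simp
    finally have 0: "W.eval (map h ?f) z = \<zero>\<^bsub>?\<Omega>\<^esub>" .
    have h1: "h \<one> = \<one>\<^bsub>?\<Omega>\<^esub>" "h \<zero> = \<zero>\<^bsub>?\<Omega>\<^esub>" using h.hom_one h.hom_zero by simp_all
    have hc: "h (\<ominus> ?c) = \<ominus>\<^bsub>?\<Omega>\<^esub> h ?c"
      using h.hom_a_inv[of ?c] x(2) field_subring.D_neg[OF field_subring.intro[OF field_axioms field_subring_axioms.intro[OF Kr]]] by simp
    have mf: "map h ?f = \<one>\<^bsub>?\<Omega>\<^esub> # replicate (p - 1) \<zero>\<^bsub>?\<Omega>\<^esub> @ [\<ominus>\<^bsub>?\<Omega>\<^esub> h ?c]" using h1 hc by simp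
    have hcc: "h ?c \<in> carrier ?\<Omega>" using h.hom_closed[of ?c] x(2) by simp
    have "z [^]\<^bsub>?\<Omega>\<^esub> p \<oplus>\<^bsub>?\<Omega>\<^esub> \<ominus>\<^bsub>?\<Omega>\<^esub> h ?c = \<zero>\<^bsub>?\<Omega>\<^esub>"
      using 0 unfolding mf W.eval_binomial[OF p0 z(1) W.a_inv_closed[OF hcc]] .
    then show ?thesis using z(1) hcc by (metis W.minus_eq W.nat_pow_closed W.r_right_minus_eq)
  qed
  have "add_pow ?F p \<one> = \<zero>"
  proof -
    have "add_pow ?F k \<one> = add_pow R k \<one>" for k :: nat by (induction k) (auto simp: add_pow_def nat_pow_def)
    then show ?thesis using p(2) by simp
  qed
  then have p\<Omega>: "add_pow ?\<Omega> p \<one>\<^bsub>?\<Omega>\<^esub> = \<zero>\<^bsub>?\<Omega>\<^esub>"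
    using ring_hom_add_pow[OF F.ring_axioms W.ring_axioms h.homh, of \<one> p] KE(3) h.hom_one h.hom_zero by simp
  have uniq: "z = y" if "z \<in> carrier ?\<Omega>" "y \<in> carrier ?\<Omega>" "z [^]\<^bsub>?\<Omega>\<^esub> p = y [^]\<^bsub>?\<Omega>\<^esub> p" for z y
  proof -
    have "(z \<ominus>\<^bsub>?\<Omega>\<^esub> y) [^]\<^bsub>?\<Omega>\<^esub> p = \<zero>\<^bsub>?\<Omega>\<^esub>"
      unfolding W.frobenius_minus[OF p(1) p\<Omega> that(1,2)] that(3) using that(2) by (simp add: a_minus_def W.r_neg)
    then have "z \<ominus>\<^bsub>?\<Omega>\<^esub> y = \<zero>\<^bsub>?\<Omega>\<^esub>" using W.pow_nonzero[of "z \<ominus>\<^bsub>?\<Omega>\<^esub> y" p] that by auto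
    then show ?thesis using W.r_right_minus_eq[OF that(1,2)] by blast
  qed
  have deg: "length \<mu> - 1 \<le> 1"
  proof (rule ccontr)
    assume *: "\<not> ?thesis"
    let ?M = "W.roots (map h \<mu>)"
    have "?M \<noteq> {#}" using * size by auto
    then obtain z where z: "z \<in># ?M" by blast
    have mem: "y \<in> carrier ?\<Omega> \<and> W.eval (map h \<mu>) y = \<zero>\<^bsub>?\<Omega>\<^esub>" if "y \<in># ?M" for y
      using that W.roots_mem_iff_is_root[OF h\<mu>] unfolding W.is_root_def by blast
    have "y = z" if y: "y \<in># ?M" for y
      using uniq[of y z] root mem[OF y] mem[OF z] by simp
    then have "?M = replicate_mset (size ?M) z" by (intro set_mset_subset_singletonD) blast
    then have "count ?M z = size ?M" by (metis count_replicate_mset)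
    moreover have "count ?M z \<le> 1"
      using sp mem[OF z] W.alg_mult_eq_count_roots[OF h\<mu>] unfolding separable_poly_def h_def by metis
    ultimately show False using * size by simp
  qed
  have "degree (Irr K x) = 1" using deg pirreducible_degree[OF K I(1,2)] unfolding \<mu>_def by simp
  then show ?thesis by (rule Irr_degree_one[OF K x(1) alg])
qed

end

lemma (in domain) characteristic_prime:
  assumes "has_characteristic R p" "0 < p" shows "Factorial_Ring.prime p"
proof -
  have char: "add_pow R n \<one> = \<zero> \<longleftrightarrow> p dvd n" for n :: nat using assms(1) unfolding has_characteristic_def by blast
  have p1: "p \<noteq> 1" using char[of 1] one_not_zero by auto
  have dv: "p dvd a \<or> p dvd b" if "p dvd a * b" for a b
  proof -
    have "add_pow R (a * b) \<one> = add_pow R a \<one> \<otimes> add_pow R b \<one>"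
      using add_pow_ldistr[of \<one> "add_pow R b \<one>" a] add.nat_pow_pow[of \<one> a b] add.nat_pow_pow[of \<one> b a] by (simp add: mult.commute[of b a])
    then have "add_pow R a \<one> \<otimes> add_pow R b \<one> = \<zero>" using char[of "a * b"] that by simp
    then show ?thesis using integral[of "add_pow R a \<one>" "add_pow R b \<one>"] char by auto
  qed
  have "Factorial_Ring.prime_elem p"
    unfolding Factorial_Ring.prime_elem_def
  proof (intro conjI allI impI)
    show "\<not> p dvd 1" using p1 by (simp only: nat_dvd_1_iff_1 not_False_eq_True)
  qed (use assms(2) dv in blast)+
  then show ?thesis unfolding Factorial_Ring.prime_def by simp
qed

section \<open>Galois groups: generators, periods and degrees\<close>

context field begin

lemma Gal_iff:
  "g \<in> carrier (Gal R K) \<longleftrightarrow> g \<in> ring_iso R R \<and> g \<in> extensional (carrier R) \<and> (\<forall>x\<in>K. g x = x)"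
  unfolding Gal_def by auto

lemma Gal_Bij: assumes "g \<in> carrier (Gal R K)" shows "g \<in> Bij (carrier R)" "g \<in> ring_hom R R"
  using assms unfolding Gal_iff ring_iso_def Bij_def by auto

lemma Gal_mult:
  assumes "g \<in> carrier (Gal R K)" "h \<in> carrier (Gal R K)" "x \<in> carrier R"
  shows "(g \<otimes>\<^bsub>Gal R K\<^esub> h) x = g (h x)"
  using assms(3) Gal_Bij(1)[OF assms(1)] Gal_Bij(1)[OF assms(2)] unfolding Gal_def BijGroup_def compose_def by simp

lemma Gal_one: "x \<in> carrier R \<Longrightarrow> \<one>\<^bsub>Gal R K\<^esub> x = x"
  unfolding Gal_def BijGroup_def by simp

text \<open>Inversion in \<open>Gal R K\<close> is a definite description, so the restricted inverse
  map is shown to be its only solution in order to evaluate it.\<close>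

lemma Gal_m_inv:
  assumes K: "K \<subseteq> carrier R" and g: "g \<in> carrier (Gal R K)" and x: "x \<in> carrier R" "g x = x"
  shows "(m_inv (Gal R K) g) x = x"
proof -
  let ?G = "Gal R K"
  define h where "h = restrict (inv_into (carrier R) g) (carrier R)"
  have giso: "g \<in> ring_iso R R" and gB: "bij_betw g (carrier R) (carrier R)" and gK: "\<forall>x\<in>K. g x = x"
    using g unfolding Gal_iff ring_iso_def by auto
  have inv: "h (g y) = y" "g (h y) = y" "h y \<in> carrier R" "g y \<in> carrier R" if "y \<in> carrier R" for y
    using that gB unfolding h_def
    by (auto simp: bij_betw_def inv_into_f_f f_inv_into_f inv_into_into image_iff)
  have "inv_into (carrier R) g \<in> ring_iso R R" by (rule ring_iso_set_sym[OF ring_axioms giso])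
  then have hiso: "h \<in> ring_iso R R"
    by (rule ring_iso_restrict) (auto simp: h_def ring_axioms)
  have hG: "h \<in> carrier ?G"
    unfolding Gal_iff using hiso inv(1) gK K by (auto simp: h_def) (metis h_def restrict_apply subsetD)
  have ext: "a = b" if "a \<in> carrier ?G" "b \<in> carrier ?G" "\<And>y. y \<in> carrier R \<Longrightarrow> a y = b y" for a b
    using that extensionalityI[of a "carrier R" b] unfolding Gal_iff by blast
  have oneB: "\<one>\<^bsub>?G\<^esub> \<in> extensional (carrier R)" unfolding Gal_def BijGroup_def by simp
  have mulB: "a \<otimes>\<^bsub>?G\<^esub> b \<in> extensional (carrier R)" if "a \<in> carrier ?G" "b \<in> carrier ?G" for a b
    using Gal_Bij(1)[OF that(1)] Gal_Bij(1)[OF that(2)] unfolding Gal_def BijGroup_def by simp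
  have "\<exists>!y. y \<in> carrier ?G \<and> g \<otimes>\<^bsub>?G\<^esub> y = \<one>\<^bsub>?G\<^esub> \<and> y \<otimes>\<^bsub>?G\<^esub> g = \<one>\<^bsub>?G\<^esub>"
  proof (rule ex1I[of _ h])
    have "g \<otimes>\<^bsub>?G\<^esub> h = \<one>\<^bsub>?G\<^esub>"
      by (rule extensionalityI[OF mulB[OF g hG] oneB]) (simp add: Gal_mult[OF g hG] Gal_one inv)
    moreover have "h \<otimes>\<^bsub>?G\<^esub> g = \<one>\<^bsub>?G\<^esub>"
      by (rule extensionalityI[OF mulB[OF hG g] oneB]) (simp add: Gal_mult[OF hG g] Gal_one inv)
    ultimately show "h \<in> carrier ?G \<and> g \<otimes>\<^bsub>?G\<^esub> h = \<one>\<^bsub>?G\<^esub> \<and> h \<otimes>\<^bsub>?G\<^esub> g = \<one>\<^bsub>?G\<^esub>" using hG by blast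
    fix b assume b: "b \<in> carrier ?G \<and> g \<otimes>\<^bsub>?G\<^esub> b = \<one>\<^bsub>?G\<^esub> \<and> b \<otimes>\<^bsub>?G\<^esub> g = \<one>\<^bsub>?G\<^esub>"
    show "b = h"
    proof (rule ext)
      fix y assume y: "y \<in> carrier R"
      have "b (g (h y)) = h y" using b Gal_mult[of b K g "h y"] g inv(3)[OF y] Gal_one[of "h y" K] by metis
      then show "b y = h y" using inv(2)[OF y] by simp
    qed (use b hG in auto)
  qed
  from theI'[OF this] have m: "m_inv ?G g \<in> carrier ?G" "m_inv ?G g \<otimes>\<^bsub>?G\<^esub> g = \<one>\<^bsub>?G\<^esub>"
    unfolding m_inv_def by auto
  have "(m_inv ?G g) (g x) = x" using Gal_mult[OF m(1) g x(1)] unfolding m(2) Gal_one[OF x(1)] by simp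
  then show ?thesis unfolding x(2) .
qed

text \<open>What a generator fixes is fixed by everything it generates, that is by all of
  \<open>Gal R K\<close>, and the extension is Galois.\<close>

lemma cyclic_extension_generator:
  assumes c: "cyclic_extension R K n"
  shows "\<exists>s\<in>carrier (Gal R K). \<forall>x\<in>carrier R. s x = x \<longrightarrow> x \<in> K"
proof -
  let ?G = "Gal R K"
  have gal: "galois_extension R K" and cyc: "cyclic_group ?G" using c unfolding cyclic_extension_def by auto
  have K: "K \<subseteq> carrier R" using gal subfieldE(3) unfolding galois_extension_def by blast
  obtain s where s: "s \<in> carrier ?G" "subgroup_generated ?G {s} = ?G" using cyc unfolding cyclic_group_def by blast
  have car: "carrier ?G = generate ?G {s}"
    using carrier_subgroup_generated[of ?G "{s}"] s by simp
  have "x \<in> K" if x: "x \<in> carrier R" "s x = x" for x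
  proof -
    have "h x = x" if "h \<in> generate ?G {s}" for h
      using that
    proof (induction h rule: generate.induct)
      case one
      then show ?case by (rule Gal_one[OF x(1)])
    next
      case (incl h)
      then show ?case using x(2) by simp
    next
      case (inv h)
      then show ?case using Gal_m_inv[OF K s(1) x] by simp
    next
      case (eng a b)
      then have "a \<in> carrier ?G" "b \<in> carrier ?G" using car by auto
      then show ?case using Gal_mult[of a K b x] x(1) eng by simp
    qed
    then show ?thesis using gal x(1) unfolding galois_extension_def car by blast
  qed
  then show ?thesis using s(1) by blast
qed

lemma Gal_subring_hom: "s \<in> carrier (Gal R K) \<Longrightarrow> subring_hom R (carrier R) R s"
  using Gal_Bij(2)[of s K]
  by (intro subring_hom.intro is_cring subring_hom_axioms.intro carrier_is_subring) (auto simp: ring_hom_def)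

text \<open>The first \<open>k\<close> iterates of \<open>x\<close> are the roots of a polynomial
  whose coefficients are fixed by \<open>s\<close>, hence lie in \<open>K\<close>; the minimal
  polynomial of \<open>x\<close> divides it.\<close>

lemma Irr_degree_le_period:
  assumes K: "subfield K R" and x: "x \<in> carrier R" and alg: "(algebraic over K) x"
    and s: "subring_hom R (carrier R) R s" and fixed: "\<And>y. \<lbrakk>y \<in> carrier R; s y = y\<rbrakk> \<Longrightarrow> y \<in> K"
    and per: "(s ^^ k) x = x" "0 < k"
  shows "degree (Irr K x) \<le> k"
proof -
  let ?as = "map (\<lambda>j. (s ^^ j) x) [0..<k]"
  let ?f = "map (pcoef ?as) (rev [0..<Suc k])"
  have as: "set ?as \<subseteq> carrier R" using funpow_closed[OF s x] by auto
  have cK: "pcoef ?as j \<in> K" for j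
    by (rule fixed[OF pcoef_closed[OF as] orbit_pcoef_fixed[OF s x per]])
  have top: "pcoef ?as k = \<one>" using pcoef_top[OF as] by simp
  have f: "?f \<in> carrier (univ_poly R K)"
    unfolding univ_poly_carrier[symmetric] polynomial_def using cK top subringE(3)[OF subfieldE(1)[OF K]] by auto
  have mem: "x \<in> set ?as" using per(2) by (force simp: image_iff)
  have "eval ?f x = ev (pcoef ?as) (Suc (length ?as)) x" unfolding eval_ev by simp
  also have "\<dots> = \<zero>" unfolding ev_pcoef[OF x as] by (rule linear_product_root[OF mem as])
  finally have "(Irr K x) pdivides ?f" by (rule Irr_minimal[OF K x alg f])
  moreover have "?f \<noteq> []" by simp
  ultimately have "degree (Irr K x) \<le> degree ?f"
    using pdivides_imp_degree_le[OF subfieldE(1)[OF K] IrrE(1)[OF K x alg] f] by blast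
  then show ?thesis by simp
qed

text \<open>All iterates are roots of the minimal polynomial, and there are at most as many roots as
  its degree. So two iterates among one more than that coincide, and injectivity of \<open>s\<close>
  shifts the coincidence back to \<open>x\<close>.\<close>

lemma exists_period:
  assumes K: "subfield K R" and x: "x \<in> carrier R" and alg: "(algebraic over K) x"
    and s: "s \<in> carrier (Gal R K)"
  shows "\<exists>k. 0 < k \<and> k \<le> degree (Irr K x) \<and> (s ^^ k) x = x"
proof -
  let ?d = "degree (Irr K x)"
  let ?M = "roots (Irr K x)"
  note sh = Gal_subring_hom[OF s]
  note I = IrrE[OF K x alg]
  have IK: "set (Irr K x) \<subseteq> K" using I(1) unfolding univ_poly_carrier[symmetric] polynomial_def by auto
  have KR: "K \<subseteq> carrier R" by (rule subfieldE(3)[OF K])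
  have IR: "Irr K x \<in> carrier (poly_ring R)" using carrier_polynomial_shell[OF subfieldE(1)[OF K] I(1)] .
  have Ine: "Irr K x \<noteq> []" using I(2) pirreducible_degree[OF K I(1,2)] by auto
  have sc: "(s ^^ j) x \<in> carrier R" for j by (rule funpow_closed[OF sh x])
  have sK: "map s (Irr K x) = Irr K x" using IK s unfolding Gal_iff by (intro map_idI) blast
  have root: "eval (Irr K x) ((s ^^ j) x) = \<zero>" for j
  proof (induction j)
    case 0
    then show ?case using I(4) by simp
  next
    case (Suc j)
    have "s (eval (Irr K x) ((s ^^ j) x)) = eval (map s (Irr K x)) (s ((s ^^ j) x))"
      using subring_hom.eval_H[OF sh, of "Irr K x" "(s ^^ j) x"] IK KR sc by auto
    then show ?case unfolding Suc sK subring_hom.hom_zero[OF sh] by simp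
  qed
  have in_M: "(s ^^ j) x \<in># ?M" for j
    unfolding roots_mem_iff_is_root[OF IR] is_root_def using root sc Ine by simp
  have "\<not> inj_on (\<lambda>j. (s ^^ j) x) {..?d}"
  proof
    assume "inj_on (\<lambda>j. (s ^^ j) x) {..?d}"
    then have "card ((\<lambda>j. (s ^^ j) x) ` {..?d}) = Suc ?d" using card_image by fastforce
    moreover have "card ((\<lambda>j. (s ^^ j) x) ` {..?d}) \<le> card (set_mset ?M)"
      by (rule card_mono) (use in_M in auto)
    moreover have "card (set_mset M) \<le> size M" for M :: "'a multiset"
      by (induction M) (auto simp: card_insert_if)
    moreover have "size ?M \<le> ?d" by (rule size_roots_le_degree[OF IR])
    ultimately have "Suc ?d \<le> ?d" by (metis le_trans)
    then show False by simp
  qed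
  then obtain i j where ij: "i < j" "j \<le> ?d" "(s ^^ i) x = (s ^^ j) x"
    unfolding inj_on_def by (metis atMost_iff linorder_neqE_nat)
  have inj: "inj_on s (carrier R)" using Gal_Bij(1)[OF s] unfolding Bij_def bij_betw_def by blast
  have "(s ^^ (j - i)) x = x"
    using ij(1,3)
  proof (induction i arbitrary: j)
    case (Suc i)
    then obtain l where l: "j = Suc l" using less_imp_Suc_add by blast
    have "s ((s ^^ i) x) = s ((s ^^ l) x)" using Suc.prems(2) l by simp
    then have "(s ^^ i) x = (s ^^ l) x" using inj sc unfolding inj_on_def by blast
    then show ?case using Suc.IH[of l] Suc.prems(1) l by simp
  qed simp
  then show ?thesis using ij by (intro exI[of _ "j - i"]) auto
qed

text \<open>Multiplicativity of the dimension in the tower from \<open>K\<close> over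
  \<open>K(x)\<close> to the whole field.\<close>

lemma Irr_degree_dvd:
  assumes K: "subfield K R" and dim: "dimension n K (carrier R)" and x: "x \<in> carrier R"
  shows "(algebraic over K) x" "degree (Irr K x) dvd n"
proof -
  show alg: "(algebraic over K) x"
    by (rule finite_dimension_imp_algebraic[OF K carrier_is_subring finite_dimensionI[OF dim] x])
  let ?K = "simple_extension K x"
  have sK: "subfield ?K R" using simple_extension_is_subfield[OF K x] alg by blast
  have KK: "K \<subseteq> ?K" by (rule simple_extension_incl[OF subfieldE(3)[OF K] x])
  obtain Us where Us: "set Us \<subseteq> carrier R" "Span K Us = carrier R" using exists_base[OF K dim] by blast
  have "carrier R \<subseteq> Span ?K Us"
    unfolding Us(2)[symmetric] using Span_eq_combine_set[OF K Us(1)] Span_eq_combine_set[OF sK Us(1)] KK by blast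
  then have "Span ?K Us = carrier R" using Span_in_carrier[OF subfieldE(3)[OF sK] Us(1)] by blast
  then obtain m where m: "dimension m ?K (carrier R)"
    using Span_finite_dimension[OF sK Us(1)] by (metis finite_dimensionE')
  have "dimension (degree (Irr K x) * m) K (carrier R)"
    by (rule telescopic_base[OF K sK dimension_simple_extension[OF K x alg] m])
  then show "degree (Irr K x) dvd n" using dimension_is_inj[OF K dim] by (metis dvd_triv_left)
qed

end

text \<open>That the \<open>p\<close>-th iterate is the identity is read off from degrees. Each
  \<open>x\<close> has degree \<open>1\<close> or \<open>p\<close> over the fractions of
  \<open>A\<close>; in the second case some period is at most the degree by
  \<open>exists_period\<close>, and at least the degree by \<open>Irr_degree_le_period\<close>, so
  it is \<open>p\<close>.\<close>

lemma (in field_subring) cyclic_extension_automorphism: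
  assumes char: "has_characteristic (E\<lparr>carrier := A\<rparr>) p" "0 < p"
    and cyc: "cyclic_extension E (fractions_in E A) p"
  shows "\<exists>\<sigma>. field_automorphism E A \<sigma> p"
proof -
  let ?K = "fractions_in E A"
  have pr: "Factorial_Ring.prime p" by (rule domain.characteristic_prime[OF D_domain char])
  have K: "subfield ?K E" and dim: "dimension p ?K (carrier E)"
    using cyc unfolding cyclic_extension_def galois_extension_def by auto
  obtain s where s: "s \<in> carrier (Gal E ?K)" and fixed: "\<And>x. \<lbrakk>x \<in> carrier E; s x = x\<rbrakk> \<Longrightarrow> x \<in> ?K"
    using cyclic_extension_generator[OF cyc] by blast
  note sh = Gal_subring_hom[OF s]
  have AK: "A \<subseteq> ?K"
  proof
    fix a assume a: "a \<in> A"
    then show "a \<in> ?K" unfolding fractions_in_iff using A_in[OF a] A_one one_not_zero l_one[OF A_in[OF a]] by metis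
  qed
  have order: "(s ^^ p) x = x" if x: "x \<in> carrier E" for x
  proof -
    note alg = Irr_degree_dvd[OF K dim x]
    consider "degree (Irr ?K x) = 1" | "degree (Irr ?K x) = p" using alg(2) pr unfolding prime_nat_iff by blast
    then show ?thesis
    proof cases
      case 1
      then have "s x = x" using Irr_degree_one[OF K x alg(1)] s unfolding Gal_iff by blast
      then have "(s ^^ j) x = x" for j by (induction j) auto
      then show ?thesis .
    next
      case 2
      obtain k where k: "0 < k" "k \<le> p" "(s ^^ k) x = x" using exists_period[OF K x alg(1) s] 2 by auto
      then have "p \<le> k" using Irr_degree_le_period[OF K x alg(1) sh fixed k(3,1)] 2 by simp
      then show ?thesis using k by simp
    qed
  qed
  have "add_pow E k \<one> = add_pow D k \<one>" for k :: nat by (induction k) (auto simp: add_pow_def nat_pow_def)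
  then have cp: "add_pow E p \<one> = \<zero>" using char(1) unfolding has_characteristic_def by simp
  have nontriv: "\<exists>x\<in>carrier E. s x \<noteq> x"
  proof (rule ccontr)
    assume "\<not> ?thesis"
    then have "carrier E = ?K" using fixed subfieldE(3)[OF K] by blast
    then have "dimension p ?K ?K" using dim by simp
    then have "p = 1" using dimension_is_inj[OF K _ dimension_one[OF K]] by blast
    then show False using pr by simp
  qed
  have "field_automorphism E A s p"
  proof (intro field_automorphism.intro field_subring_axioms field_automorphism_axioms.intro)
    show "s a = a" if "a \<in> A" for a using s AK that unfolding Gal_iff by blast
    show "\<exists>a\<in>A. \<exists>d\<in>A. d \<noteq> \<zero> \<and> d \<otimes> x = a" if "x \<in> carrier E" "s x = x" for x
      using fixed[OF that] unfolding fractions_in_iff by blast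
  qed (fact pr cp order nontriv subring_hom.hom_closed[OF sh] subring_hom.hom_mult[OF sh] subring_hom.hom_add[OF sh])+
  then show ?thesis by blast
qed

lemma (in field_subring) common_denominator_fractions:
  "set xs \<subseteq> fractions_in E A \<Longrightarrow> \<exists>s\<in>A. s \<noteq> \<zero> \<and> (\<forall>x\<in>set xs. s \<otimes> x \<in> A)"
proof (induction xs)
  case Nil
  then show ?case using A_one one_not_zero by (auto intro!: bexI[of _ \<one>])
next
  case (Cons x xs)
  obtain s where s: "s \<in> A" "s \<noteq> \<zero>" "\<forall>x\<in>set xs. s \<otimes> x \<in> A" using Cons by auto
  obtain t where t: "t \<in> A" "t \<noteq> \<zero>" "t \<otimes> x \<in> A" and xc: "x \<in> carrier E" using Cons.prems fractions_in_iff by auto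
  have "(s \<otimes> t) \<otimes> y \<in> A" if y: "y \<in> set (x # xs)" for y
  proof (cases "y = x")
    case True
    then show ?thesis using m_assoc[OF A_in[OF s(1)] A_in[OF t(1)] xc] A_mult[OF s(1) t(3)] by simp
  next
    case False
    then have ys: "y \<in> set xs" using y by simp
    then have yc: "y \<in> carrier E" using Cons.prems fractions_in_iff by auto
    have "(s \<otimes> t) \<otimes> y = t \<otimes> (s \<otimes> y)" using A_in[OF s(1)] A_in[OF t(1)] yc by algebra
    then show ?thesis using A_mult[OF t(1)] s(3) ys by simp
  qed
  moreover have "s \<otimes> t \<noteq> \<zero>" using s t integral_iff A_in by blast
  ultimately show ?case using A_mult[OF s(1) t(1)] by blast
qed

lemma (in field_subring) dimension_dependence:
  assumes K: "subfield (fractions_in E A) E" and dim: "dimension n (fractions_in E A) (carrier E)"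
    and ys: "length ys = Suc n" "set ys \<subseteq> carrier E"
  shows "\<exists>as. length as = Suc n \<and> set as \<subseteq> A \<and> \<not> set as \<subseteq> {\<zero>} \<and> combine as ys = \<zero>"
proof -
  let ?K = "fractions_in E A"
  have "dependent ?K ys" using independent_length_le_dimension[OF K dim _ ys(2)] ys(1) by auto
  then obtain Ks where Ks: "length Ks = length ys" "combine Ks ys = \<zero>" "set Ks \<subseteq> ?K" "set Ks \<noteq> {\<zero>}"
    using dependent_imp_non_trivial_combine[OF K ys(2)] by blast
  obtain s where s: "s \<in> A" "s \<noteq> \<zero>" "\<forall>x\<in>set Ks. s \<otimes> x \<in> A" using common_denominator_fractions[OF Ks(3)] by blast
  let ?as = "map ((\<otimes>) s) Ks"
  have KE: "set Ks \<subseteq> carrier E" using Ks(3) fractions_in_iff by blast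
  have "combine ?as ys = s \<otimes> combine Ks ys" by (rule combine_r_distr[OF KE ys(2) A_in[OF s(1)], symmetric])
  then have "combine ?as ys = \<zero>" unfolding Ks(2) using s(1) by simp
  moreover have "\<not> set ?as \<subseteq> {\<zero>}"
  proof
    assume *: "set ?as \<subseteq> {\<zero>}"
    have "k = \<zero>" if "k \<in> set Ks" for k
      using integral[of s k] * that s KE by auto
    then have "set Ks \<subseteq> {\<zero>}" by blast
    moreover have "set Ks \<noteq> {}" using Ks(1) ys(1) by auto
    ultimately show False using Ks(4) by (metis subset_singletonD)
  qed
  moreover have "set ?as \<subseteq> A" using s(3) by auto
  ultimately show ?thesis using Ks(1) ys(1) by (metis length_map)
qed

section \<open>The uniform bound\<close>

lemma (in field_subring) subfield_fractions: "subfield (fractions_in E A) E"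
proof (rule subfieldI')
  let ?K = "fractions_in E A"
  have memI: "x \<in> ?K" if "x \<in> carrier E" "s \<in> A" "s \<noteq> \<zero>" "s \<otimes> x \<in> A" for x s
    using that unfolding fractions_in_iff by blast
  have dest: "\<exists>s\<in>A. s \<noteq> \<zero> \<and> s \<otimes> x \<in> A \<and> s \<otimes> y \<in> A" if "x \<in> ?K" "y \<in> ?K" for x y
    using common_denominator_fractions[of "[x, y]"] that by auto
  have car: "x \<in> carrier E" if "x \<in> ?K" for x using that unfolding fractions_in_iff by blast
  show "subring ?K E"
  proof (rule subringI)
    show "?K \<subseteq> carrier E" using car by blast
    show "\<one> \<in> ?K" by (rule memI[of _ \<one>]) auto
    fix x assume x: "x \<in> ?K"
    obtain s where s: "s \<in> A" "s \<noteq> \<zero>" "s \<otimes> x \<in> A" using dest[OF x x] by blast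
    have "s \<otimes> (\<ominus> x) = \<ominus> (s \<otimes> x)" using A_in[OF s(1)] car[OF x] by algebra
    then show "\<ominus> x \<in> ?K" using memI[OF _ s(1,2)] car[OF x] A_neg[OF s(3)] by simp
  next
    fix x y assume xy: "x \<in> ?K" "y \<in> ?K"
    obtain s where s: "s \<in> A" "s \<noteq> \<zero>" "s \<otimes> x \<in> A" "s \<otimes> y \<in> A" using dest[OF xy] by blast
    note c = A_in[OF s(1)] car[OF xy(1)] car[OF xy(2)]
    have "(s \<otimes> s) \<otimes> (x \<otimes> y) = (s \<otimes> x) \<otimes> (s \<otimes> y)" using c by algebra
    moreover have "s \<otimes> s \<noteq> \<zero>" using integral[of s s] s(2) c by blast
    ultimately show "x \<otimes> y \<in> ?K" using memI[OF _ A_mult[OF s(1,1)]] c A_mult[OF s(3,4)] by simp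
    have "s \<otimes> (x \<oplus> y) = s \<otimes> x \<oplus> s \<otimes> y" using c by algebra
    then show "x \<oplus> y \<in> ?K" using memI[OF _ s(1,2)] c A_add[OF s(3,4)] by simp
  qed
  fix x assume x: "x \<in> ?K - {\<zero>}"
  then have xK: "x \<in> ?K" "x \<noteq> \<zero>" by auto
  obtain s where s: "s \<in> A" "s \<noteq> \<zero>" "s \<otimes> x \<in> A" using dest[OF xK(1) xK(1)] by blast
  have i: "inv x \<in> carrier E" "x \<otimes> inv x = \<one>" using xK car field_Units by auto
  have "(s \<otimes> x) \<otimes> inv x = s" using m_assoc[OF A_in[OF s(1)] car[OF xK(1)] i(1)] i(2) s(1) by simp
  moreover have "s \<otimes> x \<noteq> \<zero>" using integral[of s x] s(2) xK car A_in[OF s(1)] by blast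
  ultimately show "inv x \<in> ?K" using memI[OF i(1) s(3)] s(1) by simp
qed

text \<open>If nothing lies over \<open>P\<close>, the prime \<open>Q\<close> is chosen from the
  empty set and no longer depends on \<open>P\<close>; the value is unspecified, but one and the
  same for all such \<open>P\<close>.\<close>

lemma h_prime_no_primes_over:
  "\<exists>C. \<forall>P. primes_over L A P = {} \<longrightarrow> h_prime L A p P = C"
proof -
  have "h_prime L A p P = h_prime L A p P'" if "primes_over L A P = {}" "primes_over L A P' = {}" for P P'
    unfolding h_prime_def that ..
  then show ?thesis by metis
qed

section \<open>The cyclic cover of the two-dimensional regular ring\<close>

locale cyclic_cover = local_subring E A m + field_automorphism E A \<sigma> p
  for E (structure) and A m \<sigma> p +
  assumes regular: "regular_local_ring D" "krull_dim D = 2"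
    and char_p: "add_pow D p \<one> = \<zero>"
    and residue_closed: "algebraically_closed (D Quot m)"
    and dependent: "\<And>ys. \<lbrakk>length ys = Suc p; set ys \<subseteq> carrier E\<rbrakk> \<Longrightarrow>
      \<exists>as. length as = Suc p \<and> set as \<subseteq> A \<and> \<not> set as \<subseteq> {\<zero>} \<and> combine as ys = \<zero>"
begin

abbreviation (input) "BB \<equiv> integral_closure E A"

lemma Spec1_iff: "P \<in> Spec1 D \<longleftrightarrow> prime_of E A P \<and> P \<noteq> {\<zero>} \<and> P \<noteq> m"
proof -
  have "P \<in> Spec1 D \<longleftrightarrow> P \<noteq> {\<zero>} \<and> P \<noteq> m" if "prime_of E A P"
  proof -
    have "primeideal P D" using primeideal_iff_prime_of[OF subring_A] that by blast
    moreover have "P \<subseteq> m" using prime_subset_m[OF that] by blast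
    ultimately show ?thesis
      using cring.Spec1_iff_two_dim[OF D_cring D_domain regular(2) max_ideal_D(3)] by simp
  qed
  moreover have "prime_of E A P" if "P \<in> Spec1 D"
    using that primeideal_iff_prime_of[OF subring_A] unfolding Spec1_def by blast
  ultimately show ?thesis by blast
qed

lemma Spec1_principal:
  assumes "P \<in> Spec1 D"
  shows "\<exists>f\<in>m. f \<noteq> \<zero> \<and> f \<in> P \<and> P = {f \<otimes> a | a. a \<in> A}"
proof -
  have P: "prime_of E A P" "P \<noteq> {\<zero>}" "P \<noteq> m" using assms unfolding Spec1_iff by auto
  obtain u v where uv: "u \<in> m" "v \<in> m" "\<And>x. x \<in> m \<Longrightarrow> \<exists>a\<in>A. \<exists>b\<in>A. x = u \<otimes> a \<oplus> v \<otimes> b"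
    using two_generators[OF regular] unfolding max_ideal_D(1) by blast
  obtain f where f: "f \<in> P" "f \<noteq> \<zero>" "P = {f \<otimes> a | a. a \<in> A}" using prime_principal[OF uv P] by blast
  have "f \<in> m" by (rule prime_subset_m[OF P(1) f(1)])
  then show ?thesis using f by blast
qed

lemma Spec1_prime_over:
  assumes P: "P \<in> Spec1 D" and Q: "Q \<in> primes_over E A P"
    and f: "f \<in> m" "f \<noteq> \<zero>" "P = {f \<otimes> a | a. a \<in> A}"
  shows "prime_over_principal E A f Q p"
proof (intro prime_over_principal.intro field_subring_axioms prime_over_principal_axioms.intro)
  show "f \<in> A" "f \<noteq> \<zero>" by (rule m_A[OF f(1)], rule f(2))
  show "prime_of E A {f \<otimes> a | a. a \<in> A}" using P unfolding Spec1_iff f(3)[symmetric] by blast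
  show "\<exists>k. \<forall>b\<in>A. a \<noteq> f [^] (k::nat) \<otimes> b" if "a \<in> A" "a \<noteq> \<zero>" for a by (rule separated_principal[OF f(1,2) that])
  show "prime_of E BB Q"
    using Q primeideal_iff_prime_of[OF subring_integral_closure] unfolding primes_over_def by blast
  show "Q \<inter> A = {f \<otimes> a | a. a \<in> A}" using Q unfolding primes_over_def f(3)[symmetric] by blast
qed (rule dependent)

lemma automorphism_residue:
  assumes "prime_over_principal E A f Q p"
  shows "automorphism_residue E A \<sigma> p f Q (residue_field E A Q) (residue Q)"
  by (intro automorphism_residue.intro field_automorphism_axioms prime_over_principal.residue_map assms)

text \<open>If \<open>\<sigma>\<close> fixed \<open>B\<close>, it would fix the localization at
  \<open>Q\<close> and, by \<open>valuation_dichotomy\<close>, the inverses of all elements outside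
  it, hence all of \<open>E\<close>.\<close>

lemma sig_nontrivial_integral:
  assumes W: "prime_over_principal E A f Q p"
  shows "\<exists>b\<in>BB. \<sigma> b \<noteq> b"
proof (rule ccontr)
  assume "\<not> ?thesis"
  then have fixB: "\<sigma> b = b" if "b \<in> BB" for b using that by blast
  have fix_loc: "\<sigma> y = y" if yl: "y \<in> prime_over_principal.loc E A Q" for y
  proof -
    obtain s where s: "s \<in> BB" "s \<notin> Q" "s \<otimes> y \<in> BB" and y: "y \<in> carrier E"
      using yl unfolding prime_over_principal.loc_def[OF W] by blast
    have sc: "s \<in> carrier E" "s \<noteq> \<zero>" using integral_carrier[OF s(1)] prime_over_principal.nonQ[OF W s(1,2)] by auto
    have "s \<otimes> \<sigma> y = s \<otimes> y" using sig_mult[OF sc(1) y] fixB[OF s(3)] fixB[OF s(1)] by simp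
    then show ?thesis using m_lcancel[OF sc(2,1) sig_closed[OF y] y] by simp
  qed
  obtain x where x: "x \<in> carrier E" "\<sigma> x \<noteq> x" using sig_nontriv by blast
  then have nl: "x \<noteq> \<zero>" "inv x \<in> prime_over_principal.loc E A Q"
    using prime_over_principal.valuation_dichotomy[OF W] fix_loc by blast+
  have ic: "inv x \<in> carrier E" "x \<otimes> inv x = \<one>" using x nl field_Units by auto
  have "\<sigma> x \<otimes> \<sigma> (inv x) = \<sigma> \<one>" using sig_mult[OF x(1) ic(1)] ic(2) by simp
  then have e: "\<sigma> x \<otimes> inv x = x \<otimes> inv x" unfolding fix_loc[OF nl(2)] sig_A[OF A_one] ic(2) .
  have "inv x \<noteq> \<zero>" using ic(2) x(1) by auto
  then have "\<sigma> x = x" using e m_rcancel[OF _ ic(1) sig_closed[OF x(1)] x(1)] by blast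
  then show False using x(2) by blast
qed

text \<open>By separability the residue field of \<open>P\<close> contains every element of the
  larger residue field whose \<open>p\<close>-th power lies in it; together with ramification index
  one this is the input of \<open>inertia_trivial\<close>.\<close>

lemma unramified_inertia:
  assumes P: "P \<in> Spec1 D" and un: "unramified_at E A P" and Q: "Q \<in> primes_over E A P"
  shows "\<exists>b\<in>BB. \<sigma> b \<ominus> b \<notin> Q"
proof (rule ccontr)
  assume "\<not> ?thesis"
  then have triv: "\<sigma> b \<ominus> b \<in> Q" if "b \<in> BB" for b using that by blast
  obtain f where f: "f \<in> m" "f \<noteq> \<zero>" "P = {f \<otimes> a | a. a \<in> A}" using Spec1_principal[OF P] by blast
  note W = Spec1_prime_over[OF P Q f]
  let ?F = "residue_field E A Q"
  interpret R: automorphism_residue E A \<sigma> p f Q ?F "residue Q" by (rule automorphism_residue[OF W])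
  have "ramification_index E A P Q = 1" and sep: "separable_extension ?F (fractions_in ?F (residue Q ` A))"
    using un Q unfolding unramified_at_def residue_subfield_def residue_subring_eq by auto
  then have ram: "ramification_index E A {f \<otimes> a | a. a \<in> A} Q = 1" using f(3) by simp
  have "add_pow ?F k \<one>\<^bsub>?F\<^esub> = residue Q (add_pow E k \<one>) \<and> add_pow E k \<one> \<in> BB" for k :: nat
  proof (induction k)
    case 0
    then show ?case using R.res_zero A_integral[OF A_zero] by simp
  next
    case (Suc k)
    then show ?case using R.res_add[of "add_pow E k \<one>" \<one>] R.res_one A_integral[OF A_one] R.B_add by simp
  qed
  then have "add_pow ?F p \<one>\<^bsub>?F\<^esub> = \<zero>\<^bsub>?F\<^esub>" using p(2) R.res_zero by simp
  then show False
    using R.F.separable_pth_root[OF field_subring.subfield_fractions[OF R.field_subring_residue] sep p(1)]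
    by (intro R.inertia_trivial[OF triv _ ram])
qed

text \<open>Otherwise a prime \<open>Q\<close> contains all \<open>\<sigma> b \<ominus> b\<close>
  but not \<open>t\<close>. Its contraction to \<open>A\<close> is not \<open>m\<close>, as
  \<open>t\<close> lies in \<open>m\<close>, and it is nonzero, as some nonzero
  \<open>\<sigma> b \<ominus> b\<close> has a nonzero multiple in \<open>A\<close>. So it is of
  height one, and unramified because it misses \<open>t\<close>.\<close>

lemma ramification_ideal_power:
  assumes t: "t \<in> m" and ram: "\<And>P. P \<in> ramified_primes E A \<Longrightarrow> t \<in> P" and ne: "ramified_primes E A \<noteq> {}"
  shows "\<exists>n::nat. t [^] n \<in> genideal (E\<lparr>carrier := BB\<rparr>) {\<sigma> b \<ominus> b | b. b \<in> BB}"
proof (rule ccontr)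
  assume no: "\<not> ?thesis"
  let ?R = "E\<lparr>carrier := BB\<rparr>"
  let ?I = "genideal ?R {\<sigma> b \<ominus> b | b. b \<in> BB}"
  note sB = subring_integral_closure
  interpret R: domain ?R by (rule subring_is_domain[OF sB])
  have Bm: "\<sigma> b \<ominus> b \<in> BB" if "b \<in> BB" for b
    unfolding a_minus_def using sig_B[OF that] subringE(5,7)[OF sB] that by blast
  then have sub: "{\<sigma> b \<ominus> b | b. b \<in> BB} \<subseteq> carrier ?R" by auto
  have tA: "t \<in> A" by (rule m_A[OF t])
  have "t [^] k \<notin> ?I" for k :: nat using no by blast
  then have tk: "t [^]\<^bsub>?R\<^esub> k \<notin> ?I" for k :: nat by (simp only: nat_pow_carrier_update not_False_eq_True)
  have tc: "t \<in> carrier ?R" using A_integral[OF tA] by simp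
  obtain Q where Q: "primeideal Q ?R" "?I \<subseteq> Q" "t \<notin> Q"
    using R.exists_prime_avoiding_powers[OF R.genideal_ideal[OF sub] tc tk] by blast
  have Qp: "prime_of E BB Q" using primeideal_iff_prime_of[OF sB] Q(1) by blast
  have triv: "\<sigma> b \<ominus> b \<in> Q" if "b \<in> BB" for b using Q(2) R.genideal_self[OF sub] that by blast
  define P where "P = Q \<inter> A"
  have Pp: "prime_of E A P" using Qp A_integral unfolding prime_of_def P_def by auto
  obtain P0 where P0: "P0 \<in> ramified_primes E A" using ne by blast
  then have P0S: "P0 \<in> Spec1 D" and "\<not> unramified_at E A P0" unfolding ramified_primes_def by auto
  \<comment> \<open>With no prime over \<open>P0\<close> the condition of being unramified would
    hold vacuously, so a ramified prime comes with a prime above it. The latter serves to find an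
    element of \<open>B\<close> moved by \<open>\<sigma>\<close>.\<close>
  then obtain Q0 where Q0: "Q0 \<in> primes_over E A P0" unfolding unramified_at_def by blast
  obtain f0 where f0: "f0 \<in> m" "f0 \<noteq> \<zero>" "P0 = {f0 \<otimes> a | a. a \<in> A}" using Spec1_principal[OF P0S] by blast
  obtain b where b: "b \<in> BB" "\<sigma> b \<noteq> b" using sig_nontrivial_integral[OF Spec1_prime_over[OF P0S Q0 f0]] by blast
  have bc: "b \<in> carrier E" by (rule integral_carrier[OF b(1)])
  have "\<sigma> b \<ominus> b \<noteq> \<zero>" using r_right_minus_eq[OF sig_closed[OF bc] bc] b(2) by blast
  then obtain c where c: "c \<in> BB" "(\<sigma> b \<ominus> b) \<otimes> c \<in> A" "(\<sigma> b \<ominus> b) \<otimes> c \<noteq> \<zero>"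
    using integral_nonzero_multiple[OF Bm[OF b(1)]] by blast
  have "c \<otimes> (\<sigma> b \<ominus> b) \<in> Q" by (rule ideal_ofD(4)[OF prime_ofD(1)[OF Qp] c(1) triv[OF b(1)]])
  then have "(\<sigma> b \<ominus> b) \<otimes> c \<in> P"
    unfolding P_def using c(2) m_comm[OF integral_carrier[OF c(1)] integral_carrier[OF Bm[OF b(1)]]] by simp
  then have "P \<noteq> {\<zero>}" using c(3) by blast
  moreover have "P \<noteq> m" using t Q(3) unfolding P_def by blast
  ultimately have PS: "P \<in> Spec1 D" using Pp Spec1_iff by blast
  have "P \<notin> ramified_primes E A" using ram[of P] Q(3) unfolding P_def by blast
  then have "unramified_at E A P" using PS unfolding ramified_primes_def by blast
  moreover have "Q \<in> primes_over E A P" using Q(1) unfolding primes_over_def P_def by blast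
  ultimately show False using unramified_inertia[OF PS] triv by blast
qed

text \<open>Writing \<open>f = g \<otimes> a\<close> with \<open>g\<close> a generator of
  \<open>P\<close>, primality of \<open>P'\<close> puts \<open>g\<close> or \<open>a\<close> into
  \<open>P'\<close>. The first makes \<open>P\<close> and \<open>P'\<close> equal, the second makes
  \<open>g\<close> a unit.\<close>

lemma Spec1_incomparable:
  assumes P: "P \<in> Spec1 D" and P': "P' \<in> Spec1 D" "P \<noteq> P'" and f: "P' = {f \<otimes> a | a. a \<in> A}" "f \<in> A" "f \<noteq> \<zero>"
  shows "f \<notin> P"
proof
  assume fP: "f \<in> P"
  obtain g where g: "g \<in> m" "g \<noteq> \<zero>" "g \<in> P" "P = {g \<otimes> a | a. a \<in> A}" using Spec1_principal[OF P] by blast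
  have gA: "g \<in> A" by (rule m_A[OF g(1)])
  have Pp: "prime_of E A P" and P'p: "prime_of E A P'" using P P'(1) unfolding Spec1_iff by auto
  obtain a where a: "a \<in> A" "f = g \<otimes> a" using fP unfolding g(4) by blast
  have "f \<in> P'" unfolding f(1) using A_in[OF f(2)] by force
  then consider "g \<in> P'" | "a \<in> P'" using prime_ofD(3)[OF P'p gA a(1)] a(2) by blast
  then show False
  proof cases
    case 1
    have "P \<subseteq> P'"
      unfolding g(4) using ideal_ofD(4)[OF prime_ofD(1)[OF P'p] _ 1] m_comm[OF A_in[OF gA]] by auto
    moreover have "P' \<subseteq> P"
      unfolding f(1) using ideal_ofD(4)[OF prime_ofD(1)[OF Pp] _ fP] m_comm[OF A_in[OF f(2)]] by auto
    ultimately show False using P'(2) by blast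
  next
    case 2
    then obtain b where b: "b \<in> A" "a = f \<otimes> b" unfolding f(1) by blast
    have "f \<otimes> (\<one> \<ominus> g \<otimes> b) = f \<ominus> g \<otimes> (f \<otimes> b)" using A_in[OF f(2)] A_in[OF gA] A_in[OF b(1)] by algebra
    also have "\<dots> = \<zero>" using a b A_in[OF f(2)] by (metis r_right_minus_eq)
    finally have "\<one> \<ominus> g \<otimes> b = \<zero>" using integral[of f "\<one> \<ominus> g \<otimes> b"] f(2,3) gA b(1) by auto
    then have "\<one> = g \<otimes> b" using r_right_minus_eq[of \<one> "g \<otimes> b"] gA b(1) by auto
    then have "\<one> \<in> P" unfolding g(4) using b(1) by blast
    then show False using prime_ofD(2)[OF Pp] by blast
  qed
qed

text \<open>The exponent in \<open>dvr_normal_form\<close> is positive, as \<open>f\<close> lies in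
  \<open>m\<close>, and \<open>intersection_number_principal\<close> identifies it with the
  intersection number.\<close>

lemma transversal_normal_form:
  assumes P: "P \<in> Spec1 D" and P': "P' \<in> Spec1 D" "P \<noteq> P'" and f: "P' = {f \<otimes> a | a. a \<in> A}" "f \<in> m" "f \<noteq> \<zero>"
    and w: "w \<in> m" "w \<notin> P" "m = mult_plus w P"
  shows "\<exists>y c. y \<in> A \<and> y \<notin> m \<and> c \<in> P \<and> f = w [^] (intersection_number D P P') \<otimes> y \<oplus> c"
proof -
  have Pp: "prime_of E A P" using P unfolding Spec1_iff by auto
  have fP: "f \<notin> P" by (rule Spec1_incomparable[OF P P' f(1) m_A[OF f(2)] f(3)])
  obtain s y c where s: "y \<in> A" "y \<notin> m" "c \<in> P" "f = w [^] (s::nat) \<otimes> y \<oplus> c"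
    using dvr_normal_form[OF Pp w m_A[OF f(2)] fP] by blast
  have cm: "c \<in> m" by (rule prime_subset_m[OF Pp s(3)])
  have "s \<noteq> 0"
  proof
    assume "s = 0"
    then have "f = y \<oplus> c" using s(4) A_in[OF s(1)] by simp
    then have "y = f \<ominus> c" using A_in[OF s(1)] A_in[OF m_A[OF cm]] by algebra
    then have "y \<in> m" using ideal_of_minus[OF m_ideal f(2) cm] by simp
    then show False using s(2) by blast
  qed
  then obtain s' where s': "s = Suc s'" using not0_implies_Suc by blast
  have "intersection_number D P P' = Suc s'"
    unfolding f(1) by (rule intersection_number_principal[OF Pp w s(4)[unfolded s'] s(1-3) p(1) char_p residue_closed])
  then show ?thesis using s s' by metis
qed

text \<open>The index set of the maximum in \<open>h_prime\<close> might be empty;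
  \<open>nat (Max {})\<close> is then an unspecified number that does not depend on
  \<open>P\<close>, so it may enter the bound. The estimate of its members makes the index set
  finite, so that otherwise the maximum belongs to it.\<close>

lemma h_prime_bound:
  assumes P: "P \<in> U_set E A" and t: "t \<in> A"
    and nf: "\<And>w. \<lbrakk>w \<in> m; w \<notin> P; m = mult_plus w P\<rbrakk> \<Longrightarrow>
      \<exists>y c. y \<in> A \<and> y \<notin> m \<and> c \<in> P \<and> t = w [^] (M::nat) \<otimes> y \<oplus> c"
    and tn: "t [^] (n::nat) \<in> genideal (E\<lparr>carrier := BB\<rparr>) {\<sigma> b \<ominus> b | b. b \<in> BB}"
    and ne: "primes_over E A P \<noteq> {}"
  shows "h_prime E A p P \<le> max (nat (Max {})) (p * (M * n))"
proof -
  have PS: "P \<in> Spec1 D" and reg: "regular_local_ring (D Quot P)" and dim: "krull_dim (D Quot P) = 1"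
    using P unfolding U_set_def Spec1_def by auto
  have Pp: "prime_of E A P" "P \<noteq> m" using PS unfolding Spec1_iff by auto
  obtain w where w: "w \<in> m" "w \<notin> P" "m = mult_plus w P" using regular_quotient_uniformizer[OF Pp reg dim] by blast
  define Q where "Q = (SOME Q. Q \<in> primes_over E A P)"
  have Q: "Q \<in> primes_over E A P" unfolding Q_def using ne by (metis ex_in_conv someI_ex)
  obtain f where f: "f \<in> m" "f \<noteq> \<zero>" "P = {f \<otimes> a | a. a \<in> A}" using Spec1_principal[OF PS] by blast
  note W = Spec1_prime_over[OF PS Q f]
  let ?F = "residue_field E A Q"
  let ?S = "residue Q ` A"
  let ?M = "max_ideal (?F\<lparr>carrier := ?S\<rparr>)"
  have dvr: "residue_dvr E A f Q p ?F (residue Q) m w"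
    by (intro residue_dvr.intro residue_dvr_axioms.intro local_subring_axioms
        prime_over_principal.residue_map[OF W] f(1) w(1) w(2)[unfolded f(3)] w(3)[unfolded f(3)])
  interpret R: automorphism_dvr E A \<sigma> p f Q ?F "residue Q" m w
    by (intro automorphism_dvr.intro automorphism_residue[OF W] dvr)
  define N where "N = (SOME N. N \<in> primes_over ?F ?S ?M)"
  have N: "N \<in> primes_over ?F ?S ?M" unfolding N_def using R.residue_primes_over_nonempty by (rule someI_ex)
  obtain y c where yc: "y \<in> A" "y \<notin> m" "c \<in> P" "t = w [^] M \<otimes> y \<oplus> c" using nf[OF w] by blast
  have wA: "w \<in> A" by (rule m_A[OF w(1)])
  have wy: "w [^] M \<otimes> y \<in> A" using wA yc(1) by simp
  have cc: "c \<in> A" by (rule ideal_ofD(1)[OF prime_ofD(1)[OF Pp(1)] yc(3)])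
  have "t \<ominus> w [^] M \<otimes> y = c" unfolding yc(4) using A_in[OF wy] A_in[OF cc] by algebra
  then have "residue Q t = residue Q (w [^] M \<otimes> y)" using R.res_A_eq_iff[OF t wy] yc(3) f(3) by simp
  also have "\<dots> = residue Q w [^]\<^bsub>?F\<^esub> M \<otimes>\<^bsub>?F\<^esub> residue Q y"
    using R.res_mult[OF A_integral[OF A_pow[OF wA]] A_integral[OF yc(1)]] R.res_pow[OF A_integral[OF wA]] by simp
  finally have rt: "residue Q t = residue Q w [^]\<^bsub>?F\<^esub> M \<otimes>\<^bsub>?F\<^esub> residue Q y" .
  let ?I = "{i::int. -1 \<le> i \<and> card (lower_ramification_group ?F ?S N i) = p}"
  have bd: "nat (i + 1) \<le> p * (M * n)" if "i \<in> ?I" for i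
    by (rule R.lower_ramification_bound[OF N _ t rt yc(1,2) tn]) (use that in blast)
  have sub: "?I \<subseteq> {-1..int (p * (M * n))}" 
  proof
    fix i assume i: "i \<in> ?I"
    then have "-1 \<le> i" by blast
    moreover have "i \<le> int (p * (M * n))" using bd[OF i] by linarith
    ultimately show "i \<in> {-1..int (p * (M * n))}" by (simp only: atLeastAtMost_iff)
  qed
  then have fin: "finite ?I" by (rule finite_subset) simp
  have "nat (Max ?I) \<le> max (nat (Max {})) (p * (M * n))"
  proof (cases "?I = {}")
    case True
    then show ?thesis by (simp only: max.cobounded1)
  next
    case False
    have "Max ?I \<in> ?I" by (rule Max_in[OF fin False])
    then have "nat (Max ?I) \<le> p * (M * n)" using sub unfolding nat_le_iff by (meson atLeastAtMost_iff subsetD)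
    then show ?thesis by linarith
  qed
  moreover have "h_prime E A p P = (if ramification_index ?F ?S ?M N = p then nat (Max ?I) else 0)"
    unfolding h_prime_def Let_def Q_def[symmetric] residue_subring_eq N_def[symmetric] ..
  ultimately show ?thesis by simp
qed

text \<open>The element \<open>t\<close>, its order \<open>M\<close> along the primes of
  \<open>T_set\<close> and the exponent \<open>n\<close> are all fixed before a prime
  \<open>P\<close> is taken. For two ramified primes, \<open>t\<close> is a product of generators
  and orders add up; the summand one in \<open>M = r + 1\<close> is the intersection number with the
  second prime.\<close>

lemma h_sup_finite:
  assumes nc: "normal_crossing_branch E A ps"
  shows "h_sup E A p ps r < \<infinity>"
proof -
  have ram: "set ps = ramified_primes E A" and len: "length ps = 1 \<or> length ps = 2"
    using nc unfolding normal_crossing_branch_def by auto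
  have psS: "P \<in> Spec1 D" if "P \<in> set ps" for P using that unfolding ram ramified_primes_def by blast
  have ne: "ramified_primes E A \<noteq> {}" using len ram by auto
  have T: "P \<in> Spec1 D" "P \<in> U_set E A" "P \<notin> set ps" if "P \<in> T_set E A ps r" for P
    using that unfolding T_set_def U_set_def ram by auto
  have "\<exists>t\<in>m. \<exists>M. (\<forall>P\<in>set ps. t \<in> P) \<and> (\<forall>P\<in>T_set E A ps r. \<forall>w. w \<in> m \<longrightarrow> w \<notin> P \<longrightarrow> m = mult_plus w P \<longrightarrow>
      (\<exists>y c. y \<in> A \<and> y \<notin> m \<and> c \<in> P \<and> t = w [^] (M::nat) \<otimes> y \<oplus> c))"
    using len
  proof
    assume "length ps = 1"
    then obtain P1 where ps: "ps = [P1]" by (auto simp: length_Suc_conv)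
    have P1: "P1 \<in> Spec1 D" using psS ps by simp
    obtain f where f: "f \<in> m" "f \<noteq> \<zero>" "f \<in> P1" "P1 = {f \<otimes> a | a. a \<in> A}" using Spec1_principal[OF P1] by blast
    have "\<exists>y c. y \<in> A \<and> y \<notin> m \<and> c \<in> P \<and> f = w [^] r \<otimes> y \<oplus> c"
      if P: "P \<in> T_set E A ps r" and w: "w \<in> m" "w \<notin> P" "m = mult_plus w P" for P w
    proof -
      have "intersection_number D P P1 = r" using P unfolding T_set_def ps by simp
      moreover have "P \<noteq> P1" using T(3)[OF P] ps by auto
      ultimately show ?thesis using transversal_normal_form[OF T(1)[OF P] P1 _ f(4,1,2) w] by simp
    qed
    then show ?thesis using f(1,3) ps by (intro bexI[of _ f] exI[of _ r]) auto
  next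
    assume "length ps = 2"
    then obtain P1 P2 where ps: "ps = [P1, P2]" by (auto simp: length_Suc_conv numeral_2_eq_2)
    have P1: "P1 \<in> Spec1 D" and P2: "P2 \<in> Spec1 D" using psS ps by simp_all
    obtain f where f: "f \<in> m" "f \<noteq> \<zero>" "f \<in> P1" "P1 = {f \<otimes> a | a. a \<in> A}" using Spec1_principal[OF P1] by blast
    obtain g where g: "g \<in> m" "g \<noteq> \<zero>" "g \<in> P2" "P2 = {g \<otimes> a | a. a \<in> A}" using Spec1_principal[OF P2] by blast
    note fg = A_in[OF m_A[OF f(1)]] A_in[OF m_A[OF g(1)]]
    have P12: "ideal_of E A P1" "ideal_of E A P2" using P1 P2 prime_ofD(1) unfolding Spec1_iff by auto
    have "f \<otimes> g \<in> P2" by (rule ideal_ofD(4)[OF P12(2) m_A[OF f(1)] g(3)])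
    moreover have "g \<otimes> f \<in> P1" by (rule ideal_ofD(4)[OF P12(1) m_A[OF g(1)] f(3)])
    moreover have "\<exists>y c. y \<in> A \<and> y \<notin> m \<and> c \<in> P \<and> f \<otimes> g = w [^] (r + 1) \<otimes> y \<oplus> c"
      if P: "P \<in> T_set E A ps r" and w: "w \<in> m" "w \<notin> P" "m = mult_plus w P" for P w
    proof -
      have int: "intersection_number D P P1 = r" "intersection_number D P P2 = 1"
        using P unfolding T_set_def ps by simp_all
      have dist: "P \<noteq> P1" "P \<noteq> P2" using T(3)[OF P] ps by auto
      have Pi: "ideal_of E A P" using T(1)[OF P] prime_ofD(1) unfolding Spec1_iff by blast
      obtain y c where y: "y \<in> A" "y \<notin> m" "c \<in> P" "f = w [^] r \<otimes> y \<oplus> c"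
        using transversal_normal_form[OF T(1)[OF P] P1 dist(1) f(4,1,2) w] unfolding int by blast
      obtain z d where z: "z \<in> A" "z \<notin> m" "d \<in> P" "g = w [^] (1::nat) \<otimes> z \<oplus> d"
        using transversal_normal_form[OF T(1)[OF P] P2 dist(2) g(4,1,2) w] unfolding int by blast
      have wA: "w \<in> A" by (rule m_A[OF w(1)])
      have cd: "c \<in> A" "d \<in> A" using ideal_ofD(1)[OF Pi] y(3) z(3) by auto
      note cl = A_in[OF wA] A_in[OF y(1)] A_in[OF z(1)] A_in[OF cd(1)] A_in[OF cd(2)] A_in[OF A_pow[OF wA, of r]]
      have gw: "g = w \<otimes> z \<oplus> d" using z(4) cl(1) by simp
      have "f \<otimes> g = (w [^] r \<otimes> w) \<otimes> (y \<otimes> z) \<oplus> (g \<otimes> c \<oplus> (w [^] r \<otimes> y) \<otimes> d)"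
        unfolding y(4) gw using cl by algebra
      then have "f \<otimes> g = w [^] (r + 1) \<otimes> (y \<otimes> z) \<oplus> (g \<otimes> c \<oplus> (w [^] r \<otimes> y) \<otimes> d)" by simp
      moreover have "g \<otimes> c \<oplus> (w [^] r \<otimes> y) \<otimes> d \<in> P"
        by (intro ideal_ofD(3)[OF Pi] ideal_ofD(4)[OF Pi] m_A[OF g(1)] y z A_mult A_pow wA)
      moreover have "y \<otimes> z \<notin> m"
      proof
        assume yz: "y \<otimes> z \<in> m"
        obtain y' where y': "y' \<in> A" "y \<otimes> y' = \<one>" using m_unit[OF y(1,2)] by blast
        have "y' \<otimes> (y \<otimes> z) = (y \<otimes> y') \<otimes> z" using cl A_in[OF y'(1)] by algebra
        then have "z \<in> m" using ideal_ofD(4)[OF m_ideal y'(1) yz] y'(2) cl(3) by simp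
        then show False using z(2) by blast
      qed
      ultimately show ?thesis using A_mult[OF y(1) z(1)] by blast
    qed
    moreover have "f \<otimes> g \<in> m" by (rule ideal_ofD(4)[OF m_ideal m_A[OF f(1)] g(1)])
    ultimately show ?thesis using m_comm[OF fg] ps by (intro bexI[of _ "f \<otimes> g"] exI[of _ "r + 1"]) auto
  qed
  then obtain t M where t: "t \<in> m" "\<And>P. P \<in> set ps \<Longrightarrow> t \<in> P"
    and nf: "\<And>P w. \<lbrakk>P \<in> T_set E A ps r; w \<in> m; w \<notin> P; m = mult_plus w P\<rbrakk> \<Longrightarrow>
      \<exists>y c. y \<in> A \<and> y \<notin> m \<and> c \<in> P \<and> t = w [^] (M::nat) \<otimes> y \<oplus> c" by blast
  obtain n :: nat where n: "t [^] n \<in> genideal (E\<lparr>carrier := BB\<rparr>) {\<sigma> b \<ominus> b | b. b \<in> BB}"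
    using ramification_ideal_power[OF t(1) t(2)[unfolded ram] ne] by blast
  obtain C where C: "\<And>P. primes_over E A P = {} \<Longrightarrow> h_prime E A p P = C"
    using h_prime_no_primes_over[of E A p] by blast
  \<comment> \<open>Primes with nothing above them contribute the constant \<open>C\<close>, an
    empty set of indices the constant \<open>nat (Max {})\<close>.\<close>
  have "h_prime E A p P \<le> max C (max (nat (Max {})) (p * (M * n)))" if P: "P \<in> T_set E A ps r" for P
  proof (cases "primes_over E A P = {}")
    case True
    then show ?thesis using C by simp
  next
    case False
    have "h_prime E A p P \<le> max (nat (Max {})) (p * (M * n))"
      by (rule h_prime_bound[OF T(2)[OF P] m_A[OF t(1)] nf[OF P] n False])
    then show ?thesis by linarith
  qed
  then have "h_sup E A p ps r \<le> enat (max C (max (nat (Max {})) (p * (M * n))))"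
    unfolding h_sup_def by (intro SUP_least) simp
  then show ?thesis by (metis enat_ord_code(4) order.strict_trans1)
qed

end

theorem theorem2p3:
  fixes L :: "('a, 'm) ring_scheme" and A :: "'a set" and ps :: "'a set list" and p r :: nat
  assumes "field L" and "subring A L"
    and "regular_local_ring (L\<lparr>carrier := A\<rparr>)"
    and "krull_dim (L\<lparr>carrier := A\<rparr>) = 2"
    and "0 < p" and "has_characteristic (L\<lparr>carrier := A\<rparr>) p"
    and "algebraically_closed (L\<lparr>carrier := A\<rparr> Quot max_ideal (L\<lparr>carrier := A\<rparr>))"
    and "cyclic_extension L (fractions_in L A) p"
    and "normal_crossing_branch L A ps"
    and "1 \<le> r"
  shows "h_sup L A p ps r < \<infinity>"
proof -
  let ?D = "L\<lparr>carrier := A\<rparr>"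
  have fs: "field_subring L A" by (intro field_subring.intro field_subring_axioms.intro assms(1,2))
  obtain \<sigma> where \<sigma>: "field_automorphism L A \<sigma> p"
    using field_subring.cyclic_extension_automorphism[OF fs assms(6,5,8)] by blast
  have dim: "ring.dimension L p (fractions_in L A) (carrier L)" and K: "subfield (fractions_in L A) L"
    using assms(8) unfolding cyclic_extension_def galois_extension_def by auto
  have char: "add_pow ?D p \<one>\<^bsub>L\<^esub> = \<zero>\<^bsub>L\<^esub>"
    using assms(6) unfolding has_characteristic_def by auto
  have "cyclic_cover L A (max_ideal ?D) \<sigma> p"
    by (intro cyclic_cover.intro cyclic_cover_axioms.intro field_subring.local_subring_of_regular[OF fs assms(3)]
        \<sigma> assms(3,4,7) char field_subring.dimension_dependence[OF fs K dim])
  then show ?thesis by (rule cyclic_cover.h_sup_finite[OF _ assms(9)])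
qed

end
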